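(* Let $\Gamma$ be a discrete abelian group and let $\mathbb T\times G^{(0)}\xrightarrow{\iota}\Sigma\xrightarrow{q}G$ be a $\Gamma$-graded twist with grading homomorphisms $c_\Sigma,c_G$, where $G$ is étale and Hausdorff and $c_G^{-1}(0)$ is effective. Then the pair $(C^*_r(\Sigma;G),C_0(G^{(0)}))$ is a $\Gamma$-Cartan pair.
   Context: Groupoids and twists. All groupoids are locally compact Hausdorff topological groupoids, with $s(\gamma)=\gamma^{-1}\gamma$, $r(\gamma)=\gamma\gamma^{-1}$ and unit space $G^{(0)}$. An open set $B\subseteq G$ is a bisection if $r(B),s(B)$ are open and $r|_B,s|_B$ are homeomorphisms onto their images; $G$ is étale if its topology has a basis of bisections; a groupoid is effective if the interior of $\{\gamma:r(\gamma)=s(\gamma)\}$ is its unit space. A twist $\Sigma\to G$ consists of topological groupoids $\Sigma$, $G$ with $G$ étale and a sequence $\mathbb T\times G^{(0)}\xrightarrow{\iota}\Sigma\xrightarrow{q}G$ (where $\mathbb T\times G^{(0)}$ has product topology and $(z_1,x)(z_2,x)=(z_1z_2,x)$) such that: (1) $\iota,q$ are continuous groupoid homomorphisms, $\iota$ injective and $q$ surjective; (2) $\iota|_{\{1\}\times G^{(0)}}$ and $q|_{\Sigma^{(0)}}$ are homeomorphisms onto $\Sigma^{(0)}$ and $G^{(0)}$ (and $\Sigma^{(0)}$ is identified with $G^{(0)}$ via $q$); (3) $q^{-1}(G^{(0)})=\iota(\mathbb T\times G^{(0)})$; (4) $\iota(z,r(\gamma))\gamma=\gamma\iota(z,s(\gamma))$;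 (5) every $g\in G$ lies in an open bisection $U$ admitting a continuous $\phi_U:U\to\Sigma$ with $q\circ\phi_U=\mathrm{id}_U$ such that $(z,h)\mapsto\iota(z,r(h))\phi_U(h)$ is a homeomorphism of $\mathbb T\times U$ onto $q^{-1}(U)$. Write $z\cdot\gamma=\iota(z,r(\gamma))\gamma$ and $\dot\gamma=q(\gamma)$. A $\Gamma$-graded twist is a twist with continuous groupoid homomorphisms $c_\Sigma:\Sigma\to\Gamma$, $c_G:G\to\Gamma$ with $c_\Sigma=c_G\circ q$. The reduced $C^*$-algebra. $C_c(\Sigma;G)$ is the $*$-algebra of $f\in C_c(\Sigma)$ with $f(z\cdot\gamma)=\overline z f(\gamma)$, with $(f*g)(\gamma)=\sum_{\dot\eta\in G,\,r(\dot\eta)=r(\dot\gamma)}f(\eta)g(\eta^{-1}\gamma)$ (one representative $\eta$ of each $\dot\eta$) and $f^*(\gamma)=\overline{f(\gamma^{-1})}$. For $x\in G^{(0)}$, $\mathcal H_x$ is the Hilbert space of functions $\xi$ on $\Sigma x=s^{-1}(x)$ with $\xi(z\cdot\gamma)=\overline z\xi(\gamma)$ and $\sum_{\dot\gamma\in Gx}|\xi(\gamma)|^2<\infty$, and $(\pi_x(f)\xi)(\gamma)=\sum_{r(\dot\eta)=r(\dot\gamma)}f(\eta)\xi(\eta^{-1}\gamma)$. $C^*_r(\Sigma;G)$ is the completion of $C_c(\Sigma;G)$ in the norm $\|f\|_r=\sup_x\|\pi_x(f)\|$. $C_0(G^{(0)})$ is regarded as a subalgebra by sending $\phi\in C_c(G^{(0)})$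 to the function vanishing off $q^{-1}(G^{(0)})$ with $\iota(z,x)\mapsto\overline z\phi(x)$, and extending by continuity. The dual group $\hat\Gamma$ acts strongly continuously on $C^*_r(\Sigma;G)$ by the extension of $(\omega\cdot f)(\gamma)=\langle\omega,c_\Sigma(\gamma)\rangle f(\gamma)$, where $\langle\omega,t\rangle=\omega(t)$; the $\Gamma$-grading of $A=C^*_r(\Sigma;G)$ is by $A_t=\{a\in A:\omega\cdot a=\langle\omega,t\rangle a\ \forall\omega\in\hat\Gamma\}$. $\Gamma$-Cartan pairs. For an abelian $C^*$-subalgebra $D$ of a $C^*$-algebra $A$, $N(A,D)=\{n\in A: nDn^*\subseteq D,\ n^*Dn\subseteq D\}$. A maximal abelian $C^*$-subalgebra $D\subseteq A$ is Cartan in $A$ if there is a faithful conditional expectation $A\to D$, $D$ contains an approximate unit for $A$, and $N(A,D)$ generates $A$ as a $C^*$-algebra. If $A$ is graded by $\Gamma$ via a strongly continuous action of $\hat\Gamma$ on $A$, with graded subspaces $A_t=\{a\in A:\omega\cdot a=\langle\omega,t\rangle a\ \forall\omega\in\hat\Gamma\}$ for $t\in\Gamma$, and $D\subseteq A_0$ is an abelian $C^*$-subalgebra, then $(A,D)$ is a $\Gamma$-Cartan pair if $D$ is Cartan in $A_0$ and $N(A,D)$ spans a dense subset of $A$. *)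

theory Defs
  imports "HOL-Analysis.Analysis"
begin

section \<open>Topological groupoids\<close>

record 'g groupoid_data =
  gtop :: "'g topology"
  gmult :: "'g \<Rightarrow> 'g \<Rightarrow> 'g"
  ginv :: "'g \<Rightarrow> 'g"

definition arrows :: "('g, 'z) groupoid_data_scheme \<Rightarrow> 'g set" where
  "arrows G = topspace (gtop G)"

definition src :: "('g, 'z) groupoid_data_scheme \<Rightarrow> 'g \<Rightarrow> 'g" where
  "src G g = gmult G (ginv G g) g"

definition rng :: "('g, 'z) groupoid_data_scheme \<Rightarrow> 'g \<Rightarrow> 'g" where
  "rng G g = gmult G g (ginv G g)"

definition units :: "('g, 'z) groupoid_data_scheme \<Rightarrow> 'g set" where
  "units G = src G ` arrows G"

definition composable :: "('g, 'z) groupoid_data_scheme \<Rightarrow> ('g \<times> 'g) set" where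
  "composable G = {(g, h). g \<in> arrows G \<and> h \<in> arrows G \<and> src G g = rng G h}"

locale topological_groupoid =
  fixes G :: "'g groupoid_data"
  assumes inv_closed: "g \<in> arrows G \<Longrightarrow> ginv G g \<in> arrows G"
    and inv_inv: "g \<in> arrows G \<Longrightarrow> ginv G (ginv G g) = g"
    and mult_closed: "(g, h) \<in> composable G \<Longrightarrow> gmult G g h \<in> arrows G"
    and src_mult: "(g, h) \<in> composable G \<Longrightarrow> src G (gmult G g h) = src G h"
    and rng_mult: "(g, h) \<in> composable G \<Longrightarrow> rng G (gmult G g h) = rng G g"
    and mult_assoc: "\<lbrakk>(g, h) \<in> composable G; (h, k) \<in> composable G\<rbrakk>
          \<Longrightarrow> gmult G (gmult G g h) k = gmult G g (gmult G h k)"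
    and mult_src: "g \<in> arrows G \<Longrightarrow> gmult G g (src G g) = g"
    and rng_mult_self: "g \<in> arrows G \<Longrightarrow> gmult G (rng G g) g = g"
    and continuous_inv: "continuous_map (gtop G) (gtop G) (ginv G)"
    and continuous_mult:
      "continuous_map (subtopology (prod_topology (gtop G) (gtop G)) (composable G)) (gtop G)
         (\<lambda>(g, h). gmult G g h)"
    and Hausdorff: "Hausdorff_space (gtop G)"
    and locally_compact: "locally_compact_space (gtop G)"

definition open_bisection :: "'g groupoid_data \<Rightarrow> 'g set \<Rightarrow> bool" where
  "open_bisection G B \<longleftrightarrow>
     openin (gtop G) B \<and> openin (gtop G) (rng G ` B) \<and> openin (gtop G) (src G ` B) \<and>
     homeomorphic_map (subtopology (gtop G) B) (subtopology (gtop G) (rng G ` B)) (rng G) \<and>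
     homeomorphic_map (subtopology (gtop G) B) (subtopology (gtop G) (src G ` B)) (src G)"

definition etale :: "'g groupoid_data \<Rightarrow> bool" where
  "etale G \<longleftrightarrow>
     (\<forall>U g. openin (gtop G) U \<and> g \<in> U \<longrightarrow> (\<exists>B. open_bisection G B \<and> g \<in> B \<and> B \<subseteq> U))"

definition isotropy :: "'g groupoid_data \<Rightarrow> 'g set" where
  "isotropy G = {g \<in> arrows G. rng G g = src G g}"

definition effective :: "'g groupoid_data \<Rightarrow> bool" where
  "effective G \<longleftrightarrow> gtop G interior_of isotropy G = units G"

definition subgroupoid :: "'g groupoid_data \<Rightarrow> 'g set \<Rightarrow> 'g groupoid_data" where
  "subgroupoid G H = G\<lparr>gtop := subtopology (gtop G) H\<rparr>"

definition groupoid_hom ::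
    "'g groupoid_data \<Rightarrow> 'h groupoid_data \<Rightarrow> ('g \<Rightarrow> 'h) \<Rightarrow> bool" where
  "groupoid_hom G H f \<longleftrightarrow> f ` arrows G \<subseteq> arrows H \<and>
     (\<forall>(g, h) \<in> composable G.
        (f g, f h) \<in> composable H \<and> f (gmult G g h) = gmult H (f g) (f h))"

section \<open>Twists\<close>

abbreviation circle :: "complex set" where
  "circle \<equiv> sphere 0 1"

definition circle_bundle :: "'g groupoid_data \<Rightarrow> (complex \<times> 'g) groupoid_data" where
  "circle_bundle G =
     \<lparr>gtop = prod_topology (top_of_set circle) (subtopology (gtop G) (units G)),
      gmult = (\<lambda>(z, x) (w, y). (z * w, x)),
      ginv = (\<lambda>(z, x). (inverse z, x))\<rparr>"

text \<open>The identification of the unit spaces of \<open>S\<close> and \<open>G\<close> along \<open>q\<close> is the condition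
  \<open>identification\<close>; without it the products in \<open>central\<close> need not be composable.  The
  inclusion \<open>\<iota>\<close> is therefore always applied to units of \<open>G\<close>, and \<open>r(\<gamma>)\<close> for an arrow \<open>\<gamma>\<close>
  of \<open>S\<close> is read as \<open>q (rng S \<gamma>)\<close>.\<close>

locale twist = Sigma: topological_groupoid S + Base: topological_groupoid G
  for S :: "'s groupoid_data" and G :: "'g groupoid_data" +
  fixes \<iota> :: "complex \<times> 'g \<Rightarrow> 's" and q :: "'s \<Rightarrow> 'g"
  assumes etale_base: "etale G"
    and iota_hom: "groupoid_hom (circle_bundle G) S \<iota>"
    and iota_continuous: "continuous_map (gtop (circle_bundle G)) (gtop S) \<iota>"
    and iota_inj: "inj_on \<iota> (circle \<times> units G)"
    and q_hom: "groupoid_hom S G q"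
    and q_continuous: "continuous_map (gtop S) (gtop G) q"
    and q_surj: "q ` arrows S = arrows G"
    and iota_units:
      "homeomorphic_map (subtopology (gtop (circle_bundle G)) ({1} \<times> units G))
         (subtopology (gtop S) (units S)) \<iota>"
    and q_units:
      "homeomorphic_map (subtopology (gtop S) (units S)) (subtopology (gtop G) (units G)) q"
    and identification: "x \<in> units G \<Longrightarrow> q (\<iota> (1, x)) = x"
    and exact: "{\<gamma> \<in> arrows S. q \<gamma> \<in> units G} = \<iota> ` (circle \<times> units G)"
    and central: "\<lbrakk>z \<in> circle; \<gamma> \<in> arrows S\<rbrakk>
      \<Longrightarrow> gmult S (\<iota> (z, q (rng S \<gamma>))) \<gamma> = gmult S \<gamma> (\<iota> (z, q (src S \<gamma>)))"
    and locally_trivial: "g \<in> arrows G \<Longrightarrow>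
      \<exists>U \<phi>. open_bisection G U \<and> g \<in> U \<and>
        continuous_map (subtopology (gtop G) U) (gtop S) \<phi> \<and> (\<forall>h\<in>U. q (\<phi> h) = h) \<and>
        homeomorphic_map (prod_topology (top_of_set circle) (subtopology (gtop G) U))
          (subtopology (gtop S) {\<gamma> \<in> arrows S. q \<gamma> \<in> U})
          (\<lambda>(z, h). gmult S (\<iota> (z, rng G h)) (\<phi> h))"

section \<open>C*-algebras\<close>

record 'a star_algebra =
  acarrier :: "'a set"
  aadd :: "'a \<Rightarrow> 'a \<Rightarrow> 'a"
  azero :: 'a
  ascale :: "complex \<Rightarrow> 'a \<Rightarrow> 'a"
  amult :: "'a \<Rightarrow> 'a \<Rightarrow> 'a"
  astar :: "'a \<Rightarrow> 'a"
  anorm :: "'a \<Rightarrow> real"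

definition asub :: "'a star_algebra \<Rightarrow> 'a \<Rightarrow> 'a \<Rightarrow> 'a" where
  "asub A a b = aadd A a (ascale A (-1) b)"

text \<open>Off the carrier the distance is set to \<open>0\<close> because \<open>Metric_space\<close> requires
  nonnegativity and symmetry on the whole type.\<close>

definition adist :: "'a star_algebra \<Rightarrow> 'a \<Rightarrow> 'a \<Rightarrow> real" where
  "adist A a b = (if a \<in> acarrier A \<and> b \<in> acarrier A then anorm A (asub A a b) else 0)"

definition atop :: "'a star_algebra \<Rightarrow> 'a topology" where
  "atop A = Metric_space.mtopology (acarrier A) (adist A)"

locale cstar_algebra =
  fixes A :: "'a star_algebra"
  assumes zero_closed: "azero A \<in> acarrier A"
    and add_closed: "\<lbrakk>a \<in> acarrier A; b \<in> acarrier A\<rbrakk> \<Longrightarrow> aadd A a b \<in> acarrier A"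
    and scale_closed: "a \<in> acarrier A \<Longrightarrow> ascale A c a \<in> acarrier A"
    and mult_closed: "\<lbrakk>a \<in> acarrier A; b \<in> acarrier A\<rbrakk> \<Longrightarrow> amult A a b \<in> acarrier A"
    and star_closed: "a \<in> acarrier A \<Longrightarrow> astar A a \<in> acarrier A"
    and add_assoc: "\<lbrakk>a \<in> acarrier A; b \<in> acarrier A; d \<in> acarrier A\<rbrakk>
      \<Longrightarrow> aadd A (aadd A a b) d = aadd A a (aadd A b d)"
    and add_commute: "\<lbrakk>a \<in> acarrier A; b \<in> acarrier A\<rbrakk> \<Longrightarrow> aadd A a b = aadd A b a"
    and add_zero: "a \<in> acarrier A \<Longrightarrow> aadd A a (azero A) = a"
    and sub_self: "a \<in> acarrier A \<Longrightarrow> asub A a a = azero A"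
    and scale_add: "\<lbrakk>a \<in> acarrier A; b \<in> acarrier A\<rbrakk>
      \<Longrightarrow> ascale A c (aadd A a b) = aadd A (ascale A c a) (ascale A c b)"
    and add_scale: "a \<in> acarrier A
      \<Longrightarrow> ascale A (c + c') a = aadd A (ascale A c a) (ascale A c' a)"
    and scale_scale: "a \<in> acarrier A \<Longrightarrow> ascale A c (ascale A c' a) = ascale A (c * c') a"
    and scale_one: "a \<in> acarrier A \<Longrightarrow> ascale A 1 a = a"
    and mult_assoc: "\<lbrakk>a \<in> acarrier A; b \<in> acarrier A; d \<in> acarrier A\<rbrakk>
      \<Longrightarrow> amult A (amult A a b) d = amult A a (amult A b d)"
    and mult_add: "\<lbrakk>a \<in> acarrier A; b \<in> acarrier A; d \<in> acarrier A\<rbrakk>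
      \<Longrightarrow> amult A a (aadd A b d) = aadd A (amult A a b) (amult A a d)"
    and add_mult: "\<lbrakk>a \<in> acarrier A; b \<in> acarrier A; d \<in> acarrier A\<rbrakk>
      \<Longrightarrow> amult A (aadd A a b) d = aadd A (amult A a d) (amult A b d)"
    and scale_mult: "\<lbrakk>a \<in> acarrier A; b \<in> acarrier A\<rbrakk>
      \<Longrightarrow> amult A (ascale A c a) b = ascale A c (amult A a b)"
    and mult_scale: "\<lbrakk>a \<in> acarrier A; b \<in> acarrier A\<rbrakk>
      \<Longrightarrow> amult A a (ascale A c b) = ascale A c (amult A a b)"
    and star_star: "a \<in> acarrier A \<Longrightarrow> astar A (astar A a) = a"
    and star_add: "\<lbrakk>a \<in> acarrier A; b \<in> acarrier A\<rbrakk>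
      \<Longrightarrow> astar A (aadd A a b) = aadd A (astar A a) (astar A b)"
    and star_scale: "a \<in> acarrier A \<Longrightarrow> astar A (ascale A c a) = ascale A (cnj c) (astar A a)"
    and star_mult: "\<lbrakk>a \<in> acarrier A; b \<in> acarrier A\<rbrakk>
      \<Longrightarrow> astar A (amult A a b) = amult A (astar A b) (astar A a)"
    and norm_nonneg: "a \<in> acarrier A \<Longrightarrow> 0 \<le> anorm A a"
    and norm_eq_zero: "a \<in> acarrier A \<Longrightarrow> anorm A a = 0 \<longleftrightarrow> a = azero A"
    and norm_triangle: "\<lbrakk>a \<in> acarrier A; b \<in> acarrier A\<rbrakk>
      \<Longrightarrow> anorm A (aadd A a b) \<le> anorm A a + anorm A b"
    and norm_scale: "a \<in> acarrier A \<Longrightarrow> anorm A (ascale A c a) = cmod c * anorm A a"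
    and norm_mult: "\<lbrakk>a \<in> acarrier A; b \<in> acarrier A\<rbrakk>
      \<Longrightarrow> anorm A (amult A a b) \<le> anorm A a * anorm A b"
    and cstar_identity: "a \<in> acarrier A \<Longrightarrow> anorm A (amult A (astar A a) a) = (anorm A a)\<^sup>2"
    and complete: "Metric_space.mcomplete (acarrier A) (adist A)"

definition cstar_subalgebra :: "'a star_algebra \<Rightarrow> 'a set \<Rightarrow> bool" where
  "cstar_subalgebra A B \<longleftrightarrow>
     B \<subseteq> acarrier A \<and> azero A \<in> B \<and>
     (\<forall>a\<in>B. \<forall>b\<in>B. aadd A a b \<in> B \<and> amult A a b \<in> B) \<and>
     (\<forall>a\<in>B. astar A a \<in> B \<and> (\<forall>c. ascale A c a \<in> B)) \<and>
     closedin (atop A) B"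

definition abelian_subalgebra :: "'a star_algebra \<Rightarrow> 'a set \<Rightarrow> bool" where
  "abelian_subalgebra A D \<longleftrightarrow>
     cstar_subalgebra A D \<and> (\<forall>a\<in>D. \<forall>b\<in>D. amult A a b = amult A b a)"

definition maximal_abelian :: "'a star_algebra \<Rightarrow> 'a set \<Rightarrow> bool" where
  "maximal_abelian A D \<longleftrightarrow>
     abelian_subalgebra A D \<and> (\<forall>D'. abelian_subalgebra A D' \<and> D \<subseteq> D' \<longrightarrow> D' = D)"

definition apositive :: "'a star_algebra \<Rightarrow> 'a \<Rightarrow> bool" where
  "apositive A a \<longleftrightarrow> (\<exists>b\<in>acarrier A. a = amult A (astar A b) b)"

definition aless_eq :: "'a star_algebra \<Rightarrow> 'a \<Rightarrow> 'a \<Rightarrow> bool" where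
  "aless_eq A a b \<longleftrightarrow> apositive A (asub A b a)"

definition conditional_expectation ::
    "'a star_algebra \<Rightarrow> 'a set \<Rightarrow> ('a \<Rightarrow> 'a) \<Rightarrow> bool" where
  "conditional_expectation A D E \<longleftrightarrow>
     (\<forall>a\<in>acarrier A. E a \<in> D) \<and> (\<forall>d\<in>D. E d = d) \<and>
     (\<forall>a\<in>acarrier A. \<forall>b\<in>acarrier A. E (aadd A a b) = aadd A (E a) (E b)) \<and>
     (\<forall>a\<in>acarrier A. \<forall>c. E (ascale A c a) = ascale A c (E a)) \<and>
     (\<forall>a\<in>acarrier A. anorm A (E a) \<le> anorm A a) \<and>
     (\<forall>a\<in>acarrier A. apositive A a \<longrightarrow> apositive A (E a)) \<and>
     (\<forall>a\<in>acarrier A. \<forall>d\<in>D. E (amult A d a) = amult A d (E a) \<and>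
                               E (amult A a d) = amult A (E a) d)"

definition faithful_on :: "'a star_algebra \<Rightarrow> ('a \<Rightarrow> 'a) \<Rightarrow> bool" where
  "faithful_on A E \<longleftrightarrow>
     (\<forall>a\<in>acarrier A. E (amult A (astar A a) a) = azero A \<longrightarrow> a = azero A)"

text \<open>An increasing approximate unit of positive contractions, viewed as a net indexed by
  the upward directed set \<open>L\<close> of its own members.\<close>

definition contains_approximate_unit :: "'a star_algebra \<Rightarrow> 'a set \<Rightarrow> bool" where
  "contains_approximate_unit A D \<longleftrightarrow>
     (\<exists>L\<subseteq>D. L \<noteq> {} \<and> (\<forall>e\<in>L. apositive A e \<and> anorm A e \<le> 1) \<and>
        (\<forall>e\<in>L. \<forall>e'\<in>L. \<exists>e''\<in>L. aless_eq A e e'' \<and> aless_eq A e' e'') \<and>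
        (\<forall>a\<in>acarrier A. \<forall>\<epsilon>>0. \<exists>e\<in>L. \<forall>e'\<in>L. aless_eq A e e' \<longrightarrow>
           anorm A (asub A (amult A e' a) a) < \<epsilon> \<and> anorm A (asub A (amult A a e') a) < \<epsilon>))"

definition normalizers :: "'a star_algebra \<Rightarrow> 'a set \<Rightarrow> 'a set" where
  "normalizers A D =
     {n \<in> acarrier A. \<forall>d\<in>D. amult A (amult A n d) (astar A n) \<in> D \<and>
                              amult A (amult A (astar A n) d) n \<in> D}"

definition generates :: "'a star_algebra \<Rightarrow> 'a set \<Rightarrow> bool" where
  "generates A X \<longleftrightarrow> (\<forall>B. cstar_subalgebra A B \<and> X \<subseteq> B \<longrightarrow> B = acarrier A)"

inductive_set aspan :: "'a star_algebra \<Rightarrow> 'a set \<Rightarrow> 'a set" for A X where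
  aspan_zero: "azero A \<in> aspan A X"
| aspan_base: "x \<in> X \<Longrightarrow> x \<in> aspan A X"
| aspan_scale: "a \<in> aspan A X \<Longrightarrow> ascale A c a \<in> aspan A X"
| aspan_add: "\<lbrakk>a \<in> aspan A X; b \<in> aspan A X\<rbrakk> \<Longrightarrow> aadd A a b \<in> aspan A X"

definition cartan_subalgebra :: "'a star_algebra \<Rightarrow> 'a set \<Rightarrow> bool" where
  "cartan_subalgebra A D \<longleftrightarrow>
     cstar_algebra A \<and> maximal_abelian A D \<and>
     (\<exists>E. conditional_expectation A D E \<and> faithful_on A E) \<and>
     contains_approximate_unit A D \<and> generates A (normalizers A D)"

section \<open>Gradings by a discrete abelian group and \<open>\<Gamma>\<close>-Cartan pairs\<close>

text \<open>The group \<open>\<Gamma>\<close> is the type \<open>'t\<close>.  As it is discrete, every character is continuous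
  and the compact-open topology on its dual is the topology of pointwise convergence,
  that is, the subspace topology from the function space \<open>'t \<Rightarrow> complex\<close>.\<close>

definition dual_group :: "('t::ab_group_add \<Rightarrow> complex) set" where
  "dual_group = {\<omega>. (\<forall>t. \<omega> t \<in> circle) \<and> (\<forall>s t. \<omega> (s + t) = \<omega> s * \<omega> t)}"

definition star_automorphism :: "'a star_algebra \<Rightarrow> ('a \<Rightarrow> 'a) \<Rightarrow> bool" where
  "star_automorphism A f \<longleftrightarrow> bij_betw f (acarrier A) (acarrier A) \<and>
     (\<forall>a\<in>acarrier A. \<forall>b\<in>acarrier A.
        f (aadd A a b) = aadd A (f a) (f b) \<and> f (amult A a b) = amult A (f a) (f b)) \<and>
     (\<forall>a\<in>acarrier A. f (astar A a) = astar A (f a) \<and>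
        (\<forall>c. f (ascale A c a) = ascale A c (f a)))"

definition strongly_continuous_action ::
    "'a star_algebra \<Rightarrow> (('t::ab_group_add \<Rightarrow> complex) \<Rightarrow> 'a \<Rightarrow> 'a) \<Rightarrow> bool" where
  "strongly_continuous_action A \<alpha> \<longleftrightarrow>
     (\<forall>\<omega>\<in>dual_group. star_automorphism A (\<alpha> \<omega>)) \<and>
     (\<forall>a\<in>acarrier A. \<alpha> (\<lambda>t. 1) a = a) \<and>
     (\<forall>\<omega>\<in>dual_group. \<forall>\<omega>'\<in>dual_group. \<forall>a\<in>acarrier A.
        \<alpha> (\<lambda>t. \<omega> t * \<omega>' t) a = \<alpha> \<omega> (\<alpha> \<omega>' a)) \<and>
     (\<forall>a\<in>acarrier A. continuous_map (top_of_set dual_group) (atop A) (\<lambda>\<omega>. \<alpha> \<omega> a))"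

definition graded_subspace ::
    "'a star_algebra \<Rightarrow> (('t::ab_group_add \<Rightarrow> complex) \<Rightarrow> 'a \<Rightarrow> 'a) \<Rightarrow> 't \<Rightarrow> 'a set" where
  "graded_subspace A \<alpha> t = {a \<in> acarrier A. \<forall>\<omega>\<in>dual_group. \<alpha> \<omega> a = ascale A (\<omega> t) a}"

definition Gamma_Cartan_pair ::
    "'a star_algebra \<Rightarrow> 'a set \<Rightarrow> (('t::ab_group_add \<Rightarrow> complex) \<Rightarrow> 'a \<Rightarrow> 'a) \<Rightarrow> bool" where
  "Gamma_Cartan_pair A D \<alpha> \<longleftrightarrow>
     cstar_algebra A \<and> strongly_continuous_action A \<alpha> \<and>
     abelian_subalgebra A D \<and> D \<subseteq> graded_subspace A \<alpha> 0 \<and>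
     cartan_subalgebra (A\<lparr>acarrier := graded_subspace A \<alpha> 0\<rparr>) D \<and>
     atop A closure_of aspan A (normalizers A D) = acarrier A"

section \<open>Completions and extension by continuity\<close>

text \<open>The elements of the completion are the equivalence classes of Cauchy sequences modulo
  null sequences.\<close>

definition cauchy_class :: "'a star_algebra \<Rightarrow> (nat \<Rightarrow> 'a) \<Rightarrow> (nat \<Rightarrow> 'a) set" where
  "cauchy_class P u =
     {v. Metric_space.MCauchy (acarrier P) (adist P) v \<and> (\<lambda>n. adist P (u n) (v n)) \<longlonglongrightarrow> 0}"

definition some_seq :: "(nat \<Rightarrow> 'a) set \<Rightarrow> nat \<Rightarrow> 'a" where
  "some_seq X = (SOME u. u \<in> X)"

definition completion :: "'a star_algebra \<Rightarrow> (nat \<Rightarrow> 'a) set star_algebra" where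
  "completion P =
     \<lparr>acarrier = {cauchy_class P u |u. Metric_space.MCauchy (acarrier P) (adist P) u},
      aadd = (\<lambda>X Y. cauchy_class P (\<lambda>n. aadd P (some_seq X n) (some_seq Y n))),
      azero = cauchy_class P (\<lambda>n. azero P),
      ascale = (\<lambda>c X. cauchy_class P (\<lambda>n. ascale P c (some_seq X n))),
      amult = (\<lambda>X Y. cauchy_class P (\<lambda>n. amult P (some_seq X n) (some_seq Y n))),
      astar = (\<lambda>X. cauchy_class P (\<lambda>n. astar P (some_seq X n))),
      anorm = (\<lambda>X. lim (\<lambda>n. anorm P (some_seq X n)))\<rparr>"

definition completion_emb :: "'a star_algebra \<Rightarrow> 'a \<Rightarrow> (nat \<Rightarrow> 'a) set" where
  "completion_emb P a = cauchy_class P (\<lambda>n. a)"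

text \<open>The value at \<open>x\<close> of the continuous extension to the space \<open>X\<close> of a map \<open>f\<close> into \<open>Y\<close>
  defined on a set \<open>P\<close> that is densely mapped into \<open>X\<close> by \<open>j\<close>: the limit of \<open>f p\<close> as \<open>p\<close>
  runs through \<open>P\<close> with \<open>j p\<close> tending to \<open>x\<close>.\<close>

definition continuous_extension ::
    "'x topology \<Rightarrow> ('p \<Rightarrow> 'x) \<Rightarrow> 'p set \<Rightarrow> 'y topology \<Rightarrow> ('p \<Rightarrow> 'y) \<Rightarrow> 'x \<Rightarrow> 'y" where
  "continuous_extension X j P Y f x =
     (THE y. limitin Y f y (inf (filtercomap j (nhdsin X x)) (principal P)))"

section \<open>The reduced C*-algebra of a twist\<close>

context twist
begin

definition act :: "complex \<Rightarrow> 's \<Rightarrow> 's" where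
  "act z \<gamma> = gmult S (\<iota> (z, q (rng S \<gamma>))) \<gamma>"

text \<open>Equivariance makes every summand below depend only on the arrow \<open>h\<close> of \<open>G\<close> and not on
  the representative \<open>lift h\<close> of it.\<close>

definition lift :: "'g \<Rightarrow> 's" where
  "lift h = (SOME \<eta>. \<eta> \<in> arrows S \<and> q \<eta> = h)"

text \<open>Functions on a subset of \<open>S\<close> or \<open>G\<close> are total functions vanishing off that subset.\<close>

definition Cc :: "('s \<Rightarrow> complex) set" where
  "Cc = {f. (\<forall>\<gamma>. \<gamma> \<notin> arrows S \<longrightarrow> f \<gamma> = 0) \<and>
            continuous_map (gtop S) euclidean f \<and>
            compactin (gtop S) (gtop S closure_of {\<gamma> \<in> arrows S. f \<gamma> \<noteq> 0}) \<and>
            (\<forall>z\<in>circle. \<forall>\<gamma>\<in>arrows S. f (act z \<gamma>) = cnj z * f \<gamma>)}"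

definition conv :: "('s \<Rightarrow> complex) \<Rightarrow> ('s \<Rightarrow> complex) \<Rightarrow> 's \<Rightarrow> complex" where
  "conv f g \<gamma> =
     (if \<gamma> \<in> arrows S
      then \<Sum>\<^sub>\<infinity>h\<in>{h \<in> arrows G. rng G h = rng G (q \<gamma>)}.
             f (lift h) * g (gmult S (ginv S (lift h)) \<gamma>)
      else 0)"

definition invol :: "('s \<Rightarrow> complex) \<Rightarrow> 's \<Rightarrow> complex" where
  "invol f \<gamma> = (if \<gamma> \<in> arrows S then cnj (f (ginv S \<gamma>)) else 0)"

definition source_fibre :: "'g \<Rightarrow> 's set" where
  "source_fibre x = {\<gamma> \<in> arrows S. q (src S \<gamma>) = x}"

definition base_fibre :: "'g \<Rightarrow> 'g set" where
  "base_fibre x = {h \<in> arrows G. src G h = x}"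

definition hilb :: "'g \<Rightarrow> ('s \<Rightarrow> complex) set" where
  "hilb x = {\<xi>. (\<forall>\<gamma>. \<gamma> \<notin> source_fibre x \<longrightarrow> \<xi> \<gamma> = 0) \<and>
                (\<forall>z\<in>circle. \<forall>\<gamma>\<in>source_fibre x. \<xi> (act z \<gamma>) = cnj z * \<xi> \<gamma>) \<and>
                (\<lambda>h. (cmod (\<xi> (lift h)))\<^sup>2) summable_on base_fibre x}"

definition hilb_norm :: "'g \<Rightarrow> ('s \<Rightarrow> complex) \<Rightarrow> real" where
  "hilb_norm x \<xi> = sqrt (\<Sum>\<^sub>\<infinity>h\<in>base_fibre x. (cmod (\<xi> (lift h)))\<^sup>2)"

definition regular_rep :: "'g \<Rightarrow> ('s \<Rightarrow> complex) \<Rightarrow> ('s \<Rightarrow> complex) \<Rightarrow> 's \<Rightarrow> complex" where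
  "regular_rep x f \<xi> \<gamma> =
     (if \<gamma> \<in> source_fibre x
      then \<Sum>\<^sub>\<infinity>h\<in>{h \<in> arrows G. rng G h = rng G (q \<gamma>)}.
             f (lift h) * \<xi> (gmult S (ginv S (lift h)) \<gamma>)
      else 0)"

definition rep_norm :: "'g \<Rightarrow> ('s \<Rightarrow> complex) \<Rightarrow> real" where
  "rep_norm x f = Sup {hilb_norm x (regular_rep x f \<xi>) |\<xi>. \<xi> \<in> hilb x \<and> hilb_norm x \<xi> \<le> 1}"

text \<open>Inserting \<open>0\<close> only matters for the empty groupoid, where the supremum in
  \<open>[0, \<infinity>)\<close> of the empty set is \<open>0\<close>.\<close>

definition reduced_norm :: "('s \<Rightarrow> complex) \<Rightarrow> real" where
  "reduced_norm f = Sup (insert 0 ((\<lambda>x. rep_norm x f) ` units G))"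

definition Cc_algebra :: "('s \<Rightarrow> complex) star_algebra" where
  "Cc_algebra =
     \<lparr>acarrier = Cc,
      aadd = (\<lambda>f g \<gamma>. f \<gamma> + g \<gamma>),
      azero = (\<lambda>\<gamma>. 0),
      ascale = (\<lambda>c f \<gamma>. c * f \<gamma>),
      amult = conv,
      astar = invol,
      anorm = reduced_norm\<rparr>"

definition reduced_algebra :: "(nat \<Rightarrow> 's \<Rightarrow> complex) set star_algebra" where
  "reduced_algebra = completion Cc_algebra"

definition C0_units :: "('g \<Rightarrow> complex) set" where
  "C0_units = {\<phi>. (\<forall>x. x \<notin> units G \<longrightarrow> \<phi> x = 0) \<and>
                 continuous_map (subtopology (gtop G) (units G)) euclidean \<phi> \<and>
                 (\<forall>\<epsilon>>0. compactin (gtop G) {x \<in> units G. \<epsilon> \<le> cmod (\<phi> x)})}"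

definition Cc_units :: "('g \<Rightarrow> complex) set" where
  "Cc_units = {\<phi>. (\<forall>x. x \<notin> units G \<longrightarrow> \<phi> x = 0) \<and>
                 continuous_map (subtopology (gtop G) (units G)) euclidean \<phi> \<and>
                 compactin (subtopology (gtop G) (units G))
                   (subtopology (gtop G) (units G) closure_of {x \<in> units G. \<phi> x \<noteq> 0})}"

definition C0_algebra :: "('g \<Rightarrow> complex) star_algebra" where
  "C0_algebra =
     \<lparr>acarrier = C0_units,
      aadd = (\<lambda>\<phi> \<psi> x. \<phi> x + \<psi> x),
      azero = (\<lambda>x. 0),
      ascale = (\<lambda>c \<phi> x. c * \<phi> x),
      amult = (\<lambda>\<phi> \<psi> x. \<phi> x * \<psi> x),
      astar = (\<lambda>\<phi> x. cnj (\<phi> x)),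
      anorm = (\<lambda>\<phi>. Sup (insert 0 ((\<lambda>x. cmod (\<phi> x)) ` units G)))\<rparr>"

definition diag :: "('g \<Rightarrow> complex) \<Rightarrow> 's \<Rightarrow> complex" where
  "diag \<phi> \<gamma> =
     (if \<gamma> \<in> \<iota> ` (circle \<times> units G)
      then case inv_into (circle \<times> units G) \<iota> \<gamma> of (z, x) \<Rightarrow> cnj z * \<phi> x
      else 0)"

definition C0_inclusion :: "('g \<Rightarrow> complex) \<Rightarrow> (nat \<Rightarrow> 's \<Rightarrow> complex) set" where
  "C0_inclusion =
     continuous_extension (atop C0_algebra) (\<lambda>\<phi>. \<phi>) Cc_units (atop reduced_algebra)
       (\<lambda>\<phi>. completion_emb Cc_algebra (diag \<phi>))"

definition C0_subalgebra :: "(nat \<Rightarrow> 's \<Rightarrow> complex) set set" where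
  "C0_subalgebra = C0_inclusion ` C0_units"

end

section \<open>Graded twists\<close>

locale graded_twist = twist S G \<iota> q
  for S :: "'s groupoid_data" and G :: "'g groupoid_data"
    and \<iota> :: "complex \<times> 'g \<Rightarrow> 's" and q :: "'s \<Rightarrow> 'g" +
  fixes cS :: "'s \<Rightarrow> 't::ab_group_add" and cG :: "'g \<Rightarrow> 't"
  assumes cS_continuous: "continuous_map (gtop S) (discrete_topology UNIV) cS"
    and cG_continuous: "continuous_map (gtop G) (discrete_topology UNIV) cG"
    and cS_hom: "(\<gamma>, \<eta>) \<in> composable S \<Longrightarrow> cS (gmult S \<gamma> \<eta>) = cS \<gamma> + cS \<eta>"
    and cG_hom: "(g, h) \<in> composable G \<Longrightarrow> cG (gmult G g h) = cG g + cG h"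
    and cS_eq: "\<gamma> \<in> arrows S \<Longrightarrow> cS \<gamma> = cG (q \<gamma>)"
begin

definition dual_action ::
    "('t \<Rightarrow> complex) \<Rightarrow> (nat \<Rightarrow> 's \<Rightarrow> complex) set \<Rightarrow> (nat \<Rightarrow> 's \<Rightarrow> complex) set" where
  "dual_action \<omega> =
     continuous_extension (atop reduced_algebra) (completion_emb Cc_algebra) Cc
       (atop reduced_algebra) (\<lambda>f. completion_emb Cc_algebra (\<lambda>\<gamma>. \<omega> (cS \<gamma>) * f \<gamma>))"

end

end

theory Submission
  imports Defs
begin

text \<open>
  Choose a lift \<open>\<sigma>(h)\<close> of every arrow \<open>h\<close> of \<open>G\<close>.  A function \<open>f\<close> in \<open>C\<^sub>c(\<Sigma>;G)\<close> acts on the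
  Hilbert space over \<open>x\<close> by the matrix with entries \<open>f(\<sigma>(h) \<sigma>(k)\<inverse>)\<close> for \<open>h, k\<close> in \<open>Gx\<close>, and
  \<open>\<parallel>f\<parallel> \<le> C\<close> means that all finite submatrices of all these matrices have norm at most \<open>C\<close>.  This
  condition passes to pointwise limits, so an element \<open>a\<close> of the completion is determined by the
  pointwise limit \<open>j(a)\<close> of any Cauchy sequence representing it, and its norm can be read off from
  the continuous function \<open>j(a)\<close>.

  The dual action multiplies \<open>j(a)\<close> by \<open>\<langle>\<omega>, c\<rangle>\<close>.  Since characters separate the points of \<open>\<Gamma>\<close>,
  the algebra \<open>A\<^sub>0\<close> consists of the elements for which \<open>j(a)\<close> is supported in degree \<open>0\<close>, and
  \<open>C\<^sub>0(G\<^sup>(\<^sup>0\<^sup>))\<close> of those supported over the units.  Restricting functions to degree \<open>0\<close>, or to the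
  units, compresses matrices to block diagonals and is therefore contractive; this replaces
  integration over the dual group and yields the conditional expectation.  The expectation is
  faithful because \<open>j(a\<^sup>*a)(s(\<gamma>)) \<ge> |j(a)(\<gamma>)|\<^sup>2\<close>.

  If \<open>a\<close> in \<open>A\<^sub>0\<close> commutes with \<open>C\<^sub>0(G\<^sup>(\<^sup>0\<^sup>))\<close>, then \<open>j(a)\<close> is supported over an open subset of the
  isotropy of \<open>c\<inverse>(0)\<close>, hence over the units by effectiveness.  Functions supported over a bisection
  are normalizers, and by bump functions they span \<open>C\<^sub>c(\<Sigma>;G)\<close>.
\<close>

section \<open>Characters separate the points of an abelian group\<close>

text \<open>Elements of the completion are classes of Cauchy sequences whose operations pick
  representatives by choice, and no general convolution formula is proved for them. Linear
  relations, adjoints, norms and supports are read off from \<open>coeff\<close>, whereas products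
  are computed on representing sequences in \<open>Cc\<close> and pushed to the limit. Product
  formulas are therefore kept to the cases at hand, such as a diagonal factor, conjugation by a
  function on a bisection, or the value of a* a at a unit, where an inequality survives the limit.
  Finite submatrices suffice because a function in \<open>Cc\<close> has finitely many nonzero
  entries in every row and column: an open bisection contributes at most one, and finitely many
  bisections cover a compact set. Matrix products are then finite sums, and no operator on an
  infinite dimensional space has to be built. The same sparsity bounds a function on a bisection by
  its supremum, which is the source of the explicit upper bounds on the reduced norm. Neither the
  group nor the unit space comes with countability, so characters are produced by Zorn's lemma and
  the approximate unit is a net.\<close>

definition zmul :: "int \<Rightarrow> 'a::ab_group_add \<Rightarrow> 'a" where
  "zmul k s = (if 0 \<le> k then ((+) s ^^ nat k) 0 else - ((+) s ^^ nat (- k)) 0)"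

lemma zmul_0 [simp]: "zmul 0 s = 0"
  by (simp add: zmul_def)

lemma zmul_add_1: "zmul (k + 1) s = zmul k s + s"
proof (cases "0 \<le> k")
  case True
  then show ?thesis by (simp add: zmul_def nat_add_distrib add.commute)
next
  case False
  then have "nat (- k) = Suc (nat (- (k + 1)))" by simp
  then show ?thesis using False by (cases "k = -1") (simp_all add: zmul_def)
qed

lemma zmul_diff_1: "zmul (k - 1) s = zmul k s - s"
  using zmul_add_1[of "k - 1" s] by simp

lemma zmul_1 [simp]: "zmul 1 s = s"
  using zmul_add_1[of 0 s] by simp

lemma zmul_add: "zmul (k + l) s = zmul k s + zmul l s"
proof (induction l rule: int_induct[where k = 0])
  case base
  show ?case by simp
next
  case (step1 i)
  then show ?case using zmul_add_1[of "k + i" s] by (simp add: zmul_add_1 add.assoc)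
next
  case (step2 i)
  then show ?case using zmul_diff_1[of "k + i" s] by (simp add: zmul_diff_1 algebra_simps)
qed

lemma zmul_diff: "zmul (k - l) s = zmul k s - zmul l s"
  using zmul_add[of "k - l" l s] by simp

lemma zmul_mult: "zmul (k * l) s = zmul k (zmul l s)"
proof (induction k rule: int_induct[where k = 0])
  case base
  show ?case by simp
next
  case (step1 i)
  then show ?case by (simp add: zmul_add_1 zmul_add distrib_right)
next
  case (step2 i)
  then show ?case by (simp add: zmul_diff_1 zmul_diff left_diff_distrib)
qed

text \<open>Graphs of homomorphisms from subgroups to the circle.\<close>

definition partial_character :: "('a::ab_group_add \<times> complex) set \<Rightarrow> bool" where
  "partial_character R \<longleftrightarrow> R \<subseteq> UNIV \<times> circle \<and> (0, 1) \<in> R \<and>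
     (\<forall>a z b w. (a, z) \<in> R \<longrightarrow> (b, w) \<in> R \<longrightarrow> (a - b, z / w) \<in> R) \<and>
     (\<forall>z. (0, z) \<in> R \<longrightarrow> z = 1)"

lemma partial_character_diff:
  "\<lbrakk>partial_character R; (a, z) \<in> R; (b, w) \<in> R\<rbrakk> \<Longrightarrow> (a - b, z / w) \<in> R"
  unfolding partial_character_def by blast

lemma partial_character_circle: "\<lbrakk>partial_character R; (a, z) \<in> R\<rbrakk> \<Longrightarrow> cmod z = 1"
  unfolding partial_character_def by auto

text \<open>The definition asks for a single value only over \<open>0\<close>; the quotient of two
  values over \<open>a\<close> lies there.\<close>

lemma partial_character_unique:
  assumes "partial_character R" "(a, z) \<in> R" "(a, w) \<in> R"
  shows "z = w"
proof -
  have "(0, z / w) \<in> R" using partial_character_diff[OF assms] by simp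
  then have "z / w = 1" using assms(1) unfolding partial_character_def by blast
  then show ?thesis using partial_character_circle[OF assms(1,3)] by auto
qed

lemma partial_character_uminus:
  assumes "partial_character R" "(a, z) \<in> R" shows "(- a, 1 / z) \<in> R"
  using partial_character_diff[OF assms(1) _ assms(2), of 0 1] assms(1)
  by (simp add: partial_character_def)

lemma partial_character_add:
  assumes "partial_character R" "(a, z) \<in> R" "(b, w) \<in> R" shows "(a + b, z * w) \<in> R"
  using partial_character_diff[OF assms(1,2) partial_character_uminus[OF assms(1,3)]] by simp

lemma partial_character_zmul:
  assumes R: "partial_character R" and a: "(a, z) \<in> R"
  shows "(zmul k a, z powi k) \<in> R"
proof -
  have z: "z \<noteq> 0" using partial_character_circle[OF R a] by auto
  show ?thesis
  proof (induction k rule: int_induct[where k = 0])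
    case base
    show ?case using R by (simp add: partial_character_def)
  next
    case (step1 i)
    then show ?case using partial_character_add[OF R _ a] z
      by (simp add: zmul_add_1 power_int_add_1)
  next
    case (step2 i)
    then show ?case using partial_character_diff[OF R _ a] z
      by (simp add: zmul_diff_1 power_int_diff)
  qed
qed

text \<open>For \<open>n\<close> at least \<open>2\<close> there are several \<open>n\<close>-th
  roots of \<open>w\<close>, so one of them avoids \<open>1\<close>. A nontrivial value can thus be
  given to an element whose \<open>n\<close>-th multiple already has a prescribed value.\<close>

lemma circle_root_neq_1:
  assumes "cmod w = 1" "2 \<le> n"
  shows "\<exists>u. cmod u = 1 \<and> u ^ n = w \<and> u \<noteq> 1"
proof (cases "w = 1")
  case True
  \<comment> \<open>A primitive root of unity: its angle is positive and at most \<pi>, where the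
    cosine is below its value at zero.\<close>
  let ?u = "cis (2 * pi / real n)"
  have n: "0 < real n" "2 \<le> real n" using assms(2) by simp_all
  have "2 * pi / real n \<le> 2 * pi / 2" by (rule divide_left_mono) (use n in auto)
  then have "2 * pi / real n \<le> pi" by simp
  then have "cos (2 * pi / real n) < cos 0"
    by (intro cos_monotone_0_pi) (use n in auto)
  then have "?u \<noteq> 1" by (auto simp: complex_eq_iff)
  moreover have "?u ^ n = w" using True n by (simp add: Complex.DeMoivre)
  ultimately show ?thesis by (intro exI[of _ ?u]) simp
next
  case False
  obtain t where t: "w = cis t" using assms(1) by (metis cis_Arg norm_zero sgn_div_norm div_by_1 of_real_1 scaleR_one inverse_1 zero_neq_one)
  let ?u = "cis (t / real n)"
  have "?u ^ n = w" using t assms(2) by (simp add: Complex.DeMoivre)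
  moreover from this have "?u \<noteq> 1" using False by auto
  ultimately show ?thesis by (intro exI[of _ ?u]) simp
qed

text \<open>The value \<open>u\<close> at \<open>s\<close> must agree with \<open>R\<close> on the
  multiples of \<open>s\<close> that already lie in the domain. If a positive multiple does, let
  \<open>n\<close> be the least one: division with remainder shows that only multiples of
  \<open>n\<close> occur, so \<open>u ^ n = w\<close> is the sole constraint, and \<open>n\<close>
  is at least \<open>2\<close> because \<open>s\<close> itself is outside. If none does, only
  \<open>k = 0\<close> is constrained and \<open>-1\<close> is one admissible value.\<close>

lemma partial_character_choice:
  assumes R: "partial_character R" and s: "s \<notin> Domain R"
  shows "\<exists>u. cmod u = 1 \<and> u \<noteq> 1 \<and> (\<forall>k. zmul k s \<in> Domain R \<longrightarrow> (zmul k s, u powi k) \<in> R)"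
proof (cases "\<exists>n>0. zmul (int n) s \<in> Domain R")
  case True
  define n where "n = (LEAST n. 0 < n \<and> zmul (int n) s \<in> Domain R)"
  have n: "0 < n" "zmul (int n) s \<in> Domain R"
    unfolding n_def using LeastI_ex[OF True] by auto
  have least: "n \<le> m" if "0 < m" "zmul (int m) s \<in> Domain R" for m
    unfolding n_def using that by (simp add: Least_le)
  obtain w where w: "(zmul (int n) s, w) \<in> R" using n by blast
  have "n \<noteq> 1" using n(2) s by (auto simp: Domain_iff)
  then have "2 \<le> n" using n by simp
  then obtain u where u: "cmod u = 1" "u ^ n = w" "u \<noteq> 1"
    using circle_root_neq_1 partial_character_circle[OF R w] by blast
  have "(zmul k s, u powi k) \<in> R" if k: "zmul k s \<in> Domain R" for k
  proof -
    let ?d = "k div int n" and ?m = "k mod int n"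
    have kd: "k = ?d * int n + ?m" by simp
    have d: "(zmul (?d * int n) s, w powi ?d) \<in> R"
      using partial_character_zmul[OF R w] by (simp add: zmul_mult)
    obtain v where "(zmul k s, v) \<in> R" using k by blast
    from partial_character_diff[OF R this d] have "zmul ?m s \<in> Domain R"
      by (auto simp: zmul_diff[symmetric] minus_div_mult_eq_mod Domain_iff)
    moreover have "?m < int n" "0 \<le> ?m" using n by simp_all
    ultimately have "\<not> 0 < ?m"
      using least[of "nat ?m"] by (metis int_nat_eq linorder_not_less nat_less_iff zero_less_nat_eq)
    then have "?m = 0" using n by (metis of_nat_0_less_iff order_le_less pos_mod_sign)
    then have k': "k = int n * ?d" using kd by (simp add: mult.commute)
    have "u powi k = w powi ?d"
      using u(2) by (subst k') (simp add: power_int_mult power_int_of_nat)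
    then show ?thesis using d k' by (metis mult.commute)
  qed
  then show ?thesis using u by blast
next
  case False
  have k0: "k = 0" if k: "zmul k s \<in> Domain R" for k
  proof (rule ccontr)
    assume "k \<noteq> 0"
    obtain v where v: "(zmul k s, v) \<in> R" using k by blast
    have "zmul (- k) s \<in> Domain R"
      using partial_character_uminus[OF R v] zmul_diff[of 0 k s] by (auto simp: Domain_iff)
    then have "zmul (int (nat \<bar>k\<bar>)) s \<in> Domain R" using k by (cases "0 \<le> k") auto
    moreover have "0 < nat \<bar>k\<bar>" using \<open>k \<noteq> 0\<close> by simp
    ultimately show False using False by blast
  qed
  then show ?thesis using R
    by (intro exI[of _ "-1"]) (auto simp: partial_character_def dest!: k0)
qed

text \<open>Adjoin \<open>s\<close> by sending \<open>a + k s\<close> to \<open>z u^k\<close>. The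
  agreement of \<open>u\<close> with \<open>R\<close> on the multiples of \<open>s\<close> in its
  domain is exactly what makes this well defined.\<close>

lemma partial_character_extend:
  assumes R: "partial_character R" and s: "s \<notin> Domain R"
  shows "\<exists>u R'. partial_character R' \<and> R \<subseteq> R' \<and> (s, u) \<in> R' \<and> u \<noteq> 1"
proof -
  obtain u where u: "cmod u = 1" "u \<noteq> 1"
    and uR: "\<And>k. zmul k s \<in> Domain R \<Longrightarrow> (zmul k s, u powi k) \<in> R"
    using partial_character_choice[OF assms] by blast
  define R' where "R' = {(a + zmul k s, z * u powi k) |a z k. (a, z) \<in> R}"
  have u0: "u \<noteq> 0" using u by auto
  have R'I: "(a + zmul k s, z * u powi k) \<in> R'" if "(a, z) \<in> R" for a z k
    using that unfolding R'_def by blast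
  have 01: "(0, 1) \<in> R" using R by (simp add: partial_character_def)
  have "R \<subseteq> R'" using R'I[where k = 0] by auto
  moreover have "(s, u) \<in> R'" using R'I[OF 01, of 1] by simp
  moreover have "partial_character R'"
    unfolding partial_character_def
  proof (intro conjI allI impI)
    show "R' \<subseteq> UNIV \<times> circle"
      using partial_character_circle[OF R] u by (auto simp: R'_def norm_mult norm_power_int)
    show "(0, 1) \<in> R'" using R'I[OF 01, of 0] by simp
    show "(a - b, z / w) \<in> R'" if az: "(a, z) \<in> R'" and bw: "(b, w) \<in> R'" for a z b w
    proof -
      obtain a' z' k where a: "a = a' + zmul k s" "z = z' * u powi k" "(a', z') \<in> R"
        using az unfolding R'_def by blast
      obtain b' w' l where b: "b = b' + zmul l s" "w = w' * u powi l" "(b', w') \<in> R"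
        using bw unfolding R'_def by blast
      show ?thesis
        using R'I[OF partial_character_diff[OF R a(3) b(3)], of "k - l"] u0 a b
        by (simp add: zmul_diff power_int_diff algebra_simps)
    qed
    show "z = 1" if 0: "(0, z) \<in> R'" for z
    proof -
      obtain a y k where a: "0 = a + zmul k s" "z = y * u powi k" "(a, y) \<in> R"
      proof -
        from 0 obtain a y k where "(0, z) = (a + zmul k s, y * u powi k)" "(a, y) \<in> R"
          unfolding R'_def by blast
        then show thesis by (intro that[of a k y]) (simp_all only: prod.inject)
      qed
      \<comment> \<open>Single-valuedness over \<open>0\<close>: here \<open>k s = - a\<close> lies
        in the domain of \<open>R\<close>, so \<open>u powi k\<close> is forced to be
        \<open>1 / y\<close>.\<close>
      have eq: "zmul k s = - a" using a(1) by (simp add: eq_neg_iff_add_eq_0 add.commute)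
      have m: "(- a, 1 / y) \<in> R" by (rule partial_character_uminus[OF R a(3)])
      then have "zmul k s \<in> Domain R" unfolding eq by blast
      then have "(- a, u powi k) \<in> R" using uR eq by metis
      then have "u powi k = 1 / y" using partial_character_unique[OF R] m by blast
      then show ?thesis using a partial_character_circle[OF R a(3)] by auto
    qed
  qed
  ultimately show ?thesis using u by blast
qed

text \<open>The character of the trivial subgroup is first extended so that \<open>t\<close> has a
  value other than \<open>1\<close>. Zorn's lemma is applied only above this extension, so a maximal
  partial character keeps that value, and maximality makes its domain the whole group.\<close>

lemma characters_separate_points:
  fixes t :: "'a::ab_group_add"
  assumes "t \<noteq> 0"
  shows "\<exists>\<omega>\<in>dual_group. \<omega> t \<noteq> 1"
proof -
  have "partial_character {(0::'a, 1)}" by (auto simp: partial_character_def)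
  then obtain u R1 where R1: "partial_character R1" "(t, u) \<in> R1" "u \<noteq> 1"
    using partial_character_extend[of "{(0, 1)}" t] assms by auto
  let ?A = "{R. partial_character R \<and> R1 \<subseteq> R}"
  have "\<exists>M\<in>?A. \<forall>X\<in>?A. M \<subseteq> X \<longrightarrow> X = M"
  proof (rule subset_Zorn_nonempty)
    show "?A \<noteq> {}" using R1 by blast
    show "\<Union>C \<in> ?A" if ne: "C \<noteq> {}" and C: "subset.chain ?A C" for C
    proof -
      have pc: "partial_character X" "R1 \<subseteq> X" if "X \<in> C" for X
        using C that by (auto simp: subset.chain_def)
      have chain: "X \<subseteq> Y \<or> Y \<subseteq> X" if "X \<in> C" "Y \<in> C" for X Y
        using C that unfolding subset_chain_def by blast
      have "partial_character (\<Union>C)"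
        unfolding partial_character_def
      proof (intro conjI allI impI)
        show "\<Union>C \<subseteq> UNIV \<times> circle" using pc(1) unfolding partial_character_def by blast
        show "(0, 1) \<in> \<Union>C" using ne pc(1) unfolding partial_character_def by blast
        show "(a - b, z / w) \<in> \<Union>C" if "(a, z) \<in> \<Union>C" "(b, w) \<in> \<Union>C" for a z b w
        proof -
          from that obtain X Y where X: "X \<in> C" "(a, z) \<in> X" and Y: "Y \<in> C" "(b, w) \<in> Y"
            by blast
          show ?thesis
          proof (cases "X \<subseteq> Y")
            case True
            then show ?thesis using partial_character_diff[OF pc(1)[OF Y(1)] _ Y(2)] X Y by blast
          next
            case False
            then have "Y \<subseteq> X" using chain X Y by blast
            then show ?thesis using partial_character_diff[OF pc(1)[OF X(1)] X(2)] X Y by blast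
          qed
        qed
        show "z = 1" if "(0, z) \<in> \<Union>C" for z
          using that pc(1) unfolding partial_character_def by blast
      qed
      moreover have "R1 \<subseteq> \<Union>C" using ne pc(2) by blast
      ultimately show ?thesis by blast
    qed
  qed
  then obtain M where "M \<in> ?A" and max0: "\<forall>X\<in>?A. M \<subseteq> X \<longrightarrow> X = M" ..
  then have M: "partial_character M" "R1 \<subseteq> M" by simp_all
  have max: "X = M" if "partial_character X" "M \<subseteq> X" for X
    using max0 that M(2) by (metis (mono_tags, lifting) mem_Collect_eq order.trans)
  have dom: "s \<in> Domain M" for s
  proof (rule ccontr)
    assume s: "s \<notin> Domain M"
    then obtain v X where "partial_character X" "M \<subseteq> X" "(s, v) \<in> X"
      using partial_character_extend[OF M(1)] by blast
    then show False using max s by blast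
  qed
  define \<omega> where "\<omega> s = (SOME z. (s, z) \<in> M)" for s
  have \<omega>M: "(s, \<omega> s) \<in> M" for s
    using dom[of s] unfolding \<omega>_def by (auto intro: someI)
  have "\<omega> (a + b) = \<omega> a * \<omega> b" for a b
    by (rule partial_character_unique[OF M(1) \<omega>M partial_character_add[OF M(1) \<omega>M \<omega>M]])
  then have "\<omega> \<in> dual_group"
    using partial_character_circle[OF M(1) \<omega>M] by (simp add: dual_group_def)
  moreover have "\<omega> t = u" using partial_character_unique[OF M(1) \<omega>M] R1 M by blast
  ultimately show ?thesis using R1(3) by blast
qed

section \<open>Bounds for infinite matrices\<close>

definition kernel_bound :: "'i set \<Rightarrow> ('i \<Rightarrow> 'i \<Rightarrow> complex) \<Rightarrow> real \<Rightarrow> bool" where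
  "kernel_bound I K C \<longleftrightarrow>
     (\<forall>F F' \<xi>. finite F \<longrightarrow> F \<subseteq> I \<longrightarrow> finite F' \<longrightarrow> F' \<subseteq> I \<longrightarrow>
        L2_set (\<lambda>h. cmod (\<Sum>k\<in>F'. K h k * \<xi> k)) F \<le> C * L2_set (\<lambda>k. cmod (\<xi> k)) F')"

lemma kernel_boundI:
  assumes "\<And>F F' \<xi>. \<lbrakk>finite F; F \<subseteq> I; finite F'; F' \<subseteq> I\<rbrakk> \<Longrightarrow>
     L2_set (\<lambda>h. cmod (\<Sum>k\<in>F'. K h k * \<xi> k)) F \<le> C * L2_set (\<lambda>k. cmod (\<xi> k)) F'"
  shows "kernel_bound I K C"
  using assms unfolding kernel_bound_def by blast

lemma kernel_boundD:
  "\<lbrakk>kernel_bound I K C; finite F; F \<subseteq> I; finite F'; F' \<subseteq> I\<rbrakk> \<Longrightarrow>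
     L2_set (\<lambda>h. cmod (\<Sum>k\<in>F'. K h k * \<xi> k)) F \<le> C * L2_set (\<lambda>k. cmod (\<xi> k)) F'"
  unfolding kernel_bound_def by blast

lemma kernel_boundD_sum:
  assumes "kernel_bound I K C" "finite F" "F \<subseteq> I" "finite F'" "F' \<subseteq> I"
  shows "(\<Sum>h\<in>F. (cmod (\<Sum>k\<in>F'. K h k * \<xi> k))\<^sup>2) \<le> C\<^sup>2 * (\<Sum>k\<in>F'. (cmod (\<xi> k))\<^sup>2)"
proof -
  have "(L2_set (\<lambda>h. cmod (\<Sum>k\<in>F'. K h k * \<xi> k)) F)\<^sup>2 \<le> (C * L2_set (\<lambda>k. cmod (\<xi> k)) F')\<^sup>2"
    by (rule power_mono[OF kernel_boundD[OF assms]]) simp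
  then show ?thesis by (simp add: L2_set_def power_mult_distrib sum_nonneg)
qed

lemma kernel_boundI_sum:
  assumes "0 \<le> C"
    and "\<And>F F' \<xi>. \<lbrakk>finite F; F \<subseteq> I; finite F'; F' \<subseteq> I\<rbrakk> \<Longrightarrow>
      (\<Sum>h\<in>F. (cmod (\<Sum>k\<in>F'. K h k * \<xi> k))\<^sup>2) \<le> C\<^sup>2 * (\<Sum>k\<in>F'. (cmod (\<xi> k))\<^sup>2)"
  shows "kernel_bound I K C"
proof (rule kernel_boundI)
  fix F F' \<xi> assume F: "finite F" "F \<subseteq> I" "finite F'" "F' \<subseteq> I"
  have "L2_set (\<lambda>h. cmod (\<Sum>k\<in>F'. K h k * \<xi> k)) F \<le> sqrt (C\<^sup>2 * (\<Sum>k\<in>F'. (cmod (\<xi> k))\<^sup>2))"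
    unfolding L2_set_def by (rule real_sqrt_le_mono[OF assms(2)[OF F]])
  also have "\<dots> = C * L2_set (\<lambda>k. cmod (\<xi> k)) F'"
    using assms(1) by (simp add: L2_set_def real_sqrt_mult)
  finally show "L2_set (\<lambda>h. cmod (\<Sum>k\<in>F'. K h k * \<xi> k)) F \<le> C * L2_set (\<lambda>k. cmod (\<xi> k)) F'" .
qed

lemma kernel_bound_cong:
  assumes "\<And>h k. \<lbrakk>h \<in> I; k \<in> I\<rbrakk> \<Longrightarrow> K h k = L h k"
  shows "kernel_bound I K C \<longleftrightarrow> kernel_bound I L C"
proof -
  have "L2_set (\<lambda>h. cmod (\<Sum>k\<in>F'. K h k * \<xi> k)) F = L2_set (\<lambda>h. cmod (\<Sum>k\<in>F'. L h k * \<xi> k)) F"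
    if "F \<subseteq> I" "F' \<subseteq> I" for F F' \<xi>
    using that assms by (intro L2_set_cong refl arg_cong[where f = cmod] sum.cong) (auto simp: subset_eq)
  then show ?thesis unfolding kernel_bound_def by auto
qed

lemma kernel_bound_mono:
  assumes "kernel_bound I K C" "C \<le> D" shows "kernel_bound I K D"
  by (rule kernel_boundI, rule order_trans[OF kernel_boundD[OF assms(1)]])
     (auto intro: mult_right_mono assms(2))

lemma kernel_bound_add:
  assumes "kernel_bound I K C" "kernel_bound I L D"
  shows "kernel_bound I (\<lambda>h k. K h k + L h k) (C + D)"
proof (rule kernel_boundI)
  fix F F' \<xi> assume F: "finite F" "F \<subseteq> I" "finite F'" "F' \<subseteq> I"
  have "L2_set (\<lambda>h. cmod (\<Sum>k\<in>F'. (K h k + L h k) * \<xi> k)) F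
      \<le> L2_set (\<lambda>h. cmod (\<Sum>k\<in>F'. K h k * \<xi> k) + cmod (\<Sum>k\<in>F'. L h k * \<xi> k)) F"
    by (rule L2_set_mono) (auto simp: distrib_right sum.distrib norm_triangle_ineq)
  also have "\<dots> \<le> L2_set (\<lambda>h. cmod (\<Sum>k\<in>F'. K h k * \<xi> k)) F
      + L2_set (\<lambda>h. cmod (\<Sum>k\<in>F'. L h k * \<xi> k)) F"
    by (rule L2_set_triangle_ineq)
  also have "\<dots> \<le> (C + D) * L2_set (\<lambda>k. cmod (\<xi> k)) F'"
    using kernel_boundD[OF assms(1) F] kernel_boundD[OF assms(2) F]
    by (simp add: distrib_right add_mono)
  finally show "L2_set (\<lambda>h. cmod (\<Sum>k\<in>F'. (K h k + L h k) * \<xi> k)) F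
      \<le> (C + D) * L2_set (\<lambda>k. cmod (\<xi> k)) F'" .
qed

lemma kernel_bound_scale:
  assumes "kernel_bound I K C"
  shows "kernel_bound I (\<lambda>h k. c * K h k) (cmod c * C)"
proof (rule kernel_boundI)
  fix F F' \<xi> assume F: "finite F" "F \<subseteq> I" "finite F'" "F' \<subseteq> I"
  have "L2_set (\<lambda>h. cmod (\<Sum>k\<in>F'. c * K h k * \<xi> k)) F
      = cmod c * L2_set (\<lambda>h. cmod (\<Sum>k\<in>F'. K h k * \<xi> k)) F"
    by (simp add: L2_set_right_distrib norm_mult[symmetric] sum_distrib_left mult.assoc)
  then show "L2_set (\<lambda>h. cmod (\<Sum>k\<in>F'. c * K h k * \<xi> k)) F
      \<le> cmod c * C * L2_set (\<lambda>k. cmod (\<xi> k)) F'"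
    using mult_left_mono[OF kernel_boundD[OF assms F], of "cmod c"] by (simp add: mult.assoc)
qed

text \<open>A vector supported in \<open>F'\<close> is sent by \<open>L\<close> to one supported in
  the finite set \<open>N\<close>, so the bounds for \<open>L\<close> and \<open>K\<close> can be
  chained through \<open>N\<close>. The entries of \<open>M'\<close> may be computed over any finite
  set containing the column support, which lets one \<open>N\<close> serve all columns in
  \<open>F'\<close>.\<close>

lemma kernel_bound_mult:
  assumes K: "kernel_bound I K C" and L: "kernel_bound I L D" and "0 \<le> C"
    and fin: "\<And>k. k \<in> I \<Longrightarrow> finite {l \<in> I. L l k \<noteq> 0}"
    and M: "\<And>M h k. \<lbrakk>finite M; M \<subseteq> I; {l \<in> I. L l k \<noteq> 0} \<subseteq> M; h \<in> I; k \<in> I\<rbrakk>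
      \<Longrightarrow> M' h k = (\<Sum>l\<in>M. K h l * L l k)"
  shows "kernel_bound I M' (C * D)"
proof (rule kernel_boundI)
  fix F F' \<xi> assume F: "finite F" "F \<subseteq> I" "finite F'" "F' \<subseteq> I"
  define N where "N = (\<Union>k\<in>F'. {l \<in> I. L l k \<noteq> 0})"
  have N: "finite N" "N \<subseteq> I" using F fin by (auto simp: N_def)
  have "(\<Sum>k\<in>F'. M' h k * \<xi> k) = (\<Sum>l\<in>N. K h l * (\<Sum>k\<in>F'. L l k * \<xi> k))" if "h \<in> I" for h
  proof -
    have "(\<Sum>k\<in>F'. M' h k * \<xi> k) = (\<Sum>k\<in>F'. (\<Sum>l\<in>N. K h l * L l k) * \<xi> k)"
      using F that by (intro sum.cong refl arg_cong2[where f = "(*)"] M N) (auto simp: N_def)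
    also have "\<dots> = (\<Sum>k\<in>F'. \<Sum>l\<in>N. K h l * L l k * \<xi> k)" by (simp add: sum_distrib_right)
    also have "\<dots> = (\<Sum>l\<in>N. \<Sum>k\<in>F'. K h l * L l k * \<xi> k)" by (rule sum.swap)
    finally show ?thesis by (simp add: sum_distrib_left mult.assoc)
  qed
  then have "L2_set (\<lambda>h. cmod (\<Sum>k\<in>F'. M' h k * \<xi> k)) F
      = L2_set (\<lambda>h. cmod (\<Sum>l\<in>N. K h l * (\<Sum>k\<in>F'. L l k * \<xi> k))) F"
    using F by (intro L2_set_cong) auto
  also have "\<dots> \<le> C * L2_set (\<lambda>l. cmod (\<Sum>k\<in>F'. L l k * \<xi> k)) N"
    by (rule kernel_boundD[OF K F(1,2) N])
  also have "\<dots> \<le> C * (D * L2_set (\<lambda>k. cmod (\<xi> k)) F')"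
    by (rule mult_left_mono[OF kernel_boundD[OF L N F(3,4)] \<open>0 \<le> C\<close>])
  finally show "L2_set (\<lambda>h. cmod (\<Sum>k\<in>F'. M' h k * \<xi> k)) F
      \<le> C * D * L2_set (\<lambda>k. cmod (\<xi> k)) F'" by (simp add: mult.assoc)
qed

text \<open>Here \<open>M'\<close> is the matrix of K* K. For \<open>v = K \<xi>\<close> the squared
  norm of \<open>v\<close> is the pairing of \<open>\<xi>\<close> with \<open>M' \<xi>\<close>, and
  Cauchy-Schwarz bounds it by \<open>C\<close> times the squared norm of
  \<open>\<xi>\<close>.\<close>

lemma kernel_bound_of_adjoint_mult:
  assumes bd: "kernel_bound I M' C" and "0 \<le> C"
    and fin: "\<And>k. k \<in> I \<Longrightarrow> finite {l \<in> I. K l k \<noteq> 0}"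
    and M: "\<And>M h k. \<lbrakk>finite M; M \<subseteq> I; {l \<in> I. K l k \<noteq> 0} \<subseteq> M; h \<in> I; k \<in> I\<rbrakk>
      \<Longrightarrow> M' h k = (\<Sum>l\<in>M. cnj (K l h) * K l k)"
  shows "kernel_bound I K (sqrt C)"
proof (rule kernel_boundI)
  fix F F' and \<xi> :: "'a \<Rightarrow> complex" assume F: "finite F" "F \<subseteq> I" "finite F'" "F' \<subseteq> I"
  \<comment> \<open>\<open>N\<close> contains the full supports of the columns in \<open>F'\<close>,
    as the formula for \<open>M'\<close> requires, and also the rows \<open>F\<close> that are to be
    estimated.\<close>
  define N where "N = F \<union> (\<Union>k\<in>F'. {l \<in> I. K l k \<noteq> 0})"
  have N: "finite N" "N \<subseteq> I" "F \<subseteq> N" using F fin by (auto simp: N_def)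
  define v where "v l = (\<Sum>k\<in>F'. K l k * \<xi> k)" for l
  let ?n = "L2_set (\<lambda>k. cmod (\<xi> k)) F'"
  have "of_real (\<Sum>l\<in>N. (cmod (v l))\<^sup>2) = (\<Sum>l\<in>N. cnj (v l) * v l)"
    by (simp add: complex_norm_square mult.commute del: of_real_power)
  also have "\<dots> = (\<Sum>l\<in>N. \<Sum>h\<in>F'. \<Sum>k\<in>F'. cnj (\<xi> h) * (cnj (K l h) * K l k * \<xi> k))"
    unfolding v_def cnj_sum complex_cnj_mult sum_product by (simp add: mult_ac)
  also have "\<dots> = (\<Sum>h\<in>F'. \<Sum>l\<in>N. \<Sum>k\<in>F'. cnj (\<xi> h) * (cnj (K l h) * K l k * \<xi> k))"
    by (rule sum.swap)
  also have "\<dots> = (\<Sum>h\<in>F'. \<Sum>k\<in>F'. \<Sum>l\<in>N. cnj (\<xi> h) * (cnj (K l h) * K l k * \<xi> k))"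
    by (intro sum.cong refl sum.swap)
  also have "\<dots> = (\<Sum>h\<in>F'. cnj (\<xi> h) * (\<Sum>k\<in>F'. (\<Sum>l\<in>N. cnj (K l h) * K l k) * \<xi> k))"
    by (simp add: sum_distrib_left sum_distrib_right)
  also have "\<dots> = (\<Sum>h\<in>F'. cnj (\<xi> h) * (\<Sum>k\<in>F'. M' h k * \<xi> k))"
  proof -
    have "(\<Sum>l\<in>N. cnj (K l h) * K l k) = M' h k" if "h \<in> F'" "k \<in> F'" for h k
      using that F N by (intro M[symmetric]) (auto simp: N_def)
    then show ?thesis by (intro sum.cong arg_cong2[where f = "(*)"] refl) auto
  qed
  finally have eq: "of_real (\<Sum>l\<in>N. (cmod (v l))\<^sup>2)
      = (\<Sum>h\<in>F'. cnj (\<xi> h) * (\<Sum>k\<in>F'. M' h k * \<xi> k))" .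
  have "(\<Sum>l\<in>N. (cmod (v l))\<^sup>2) = cmod (\<Sum>h\<in>F'. cnj (\<xi> h) * (\<Sum>k\<in>F'. M' h k * \<xi> k))"
    unfolding eq[symmetric] norm_of_real by (simp add: sum_nonneg)
  also have "\<dots> \<le> (\<Sum>h\<in>F'. \<bar>cmod (\<xi> h)\<bar> * \<bar>cmod (\<Sum>k\<in>F'. M' h k * \<xi> k)\<bar>)"
    by (rule order_trans[OF norm_sum]) (simp add: norm_mult)
  also have "\<dots> \<le> ?n * L2_set (\<lambda>h. cmod (\<Sum>k\<in>F'. M' h k * \<xi> k)) F'"
    by (rule L2_set_mult_ineq)
  also have "\<dots> \<le> ?n * (C * ?n)"
    by (rule mult_left_mono[OF kernel_boundD[OF bd F(3,4) F(3,4)]]) simp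
  finally have "L2_set (\<lambda>l. cmod (v l)) N \<le> sqrt (C * ?n\<^sup>2)"
    unfolding L2_set_def[of _ N] by (simp add: power2_eq_square mult_ac)
  also have "\<dots> = sqrt C * ?n" by (simp add: real_sqrt_mult)
  finally have "L2_set (\<lambda>l. cmod (v l)) N \<le> sqrt C * ?n" .
  moreover have "L2_set (\<lambda>l. cmod (v l)) F \<le> L2_set (\<lambda>l. cmod (v l)) N"
    unfolding L2_set_def by (intro real_sqrt_le_mono sum_mono2 N) auto
  ultimately show "L2_set (\<lambda>l. cmod (\<Sum>k\<in>F'. K l k * \<xi> k)) F \<le> sqrt C * ?n"
    unfolding v_def by linarith
qed

text \<open>Each inequality involves finitely many entries and so survives entrywise convergence.
  The constants may vary with \<open>n\<close>, so that the norms along a Cauchy sequence can be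
  inserted.\<close>

lemma kernel_bound_limit:
  assumes bd: "\<And>n. kernel_bound I (K n) (C n)"
    and K: "\<And>h k. \<lbrakk>h \<in> I; k \<in> I\<rbrakk> \<Longrightarrow> (\<lambda>n. K n h k) \<longlonglongrightarrow> L h k" and C: "C \<longlonglongrightarrow> D"
  shows "kernel_bound I L D"
proof (rule kernel_boundI)
  fix F F' \<xi> assume F: "finite F" "F \<subseteq> I" "finite F'" "F' \<subseteq> I"
  show "L2_set (\<lambda>h. cmod (\<Sum>k\<in>F'. L h k * \<xi> k)) F \<le> D * L2_set (\<lambda>k. cmod (\<xi> k)) F'"
  proof (rule LIMSEQ_le)
    show "(\<lambda>n. L2_set (\<lambda>h. cmod (\<Sum>k\<in>F'. K n h k * \<xi> k)) F)
        \<longlonglongrightarrow> L2_set (\<lambda>h. cmod (\<Sum>k\<in>F'. L h k * \<xi> k)) F"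
      unfolding L2_set_def using F by (intro tendsto_intros K) auto
    show "(\<lambda>n. C n * L2_set (\<lambda>k. cmod (\<xi> k)) F') \<longlonglongrightarrow> D * L2_set (\<lambda>k. cmod (\<xi> k)) F'"
      by (intro tendsto_intros C)
  qed (use kernel_boundD[OF bd F] in auto)
qed

lemma kernel_bound_entry:
  assumes "kernel_bound I K C" "h \<in> I" "k \<in> I" shows "cmod (K h k) \<le> C"
  using kernel_boundD[OF assms(1), of "{h}" "{k}" "\<lambda>_. 1"] assms by simp

lemma sum_at_most_one_nonzero:
  assumes "finite F" "\<And>k k'. \<lbrakk>k \<in> F; k' \<in> F; f k \<noteq> 0; f k' \<noteq> 0\<rbrakk> \<Longrightarrow> k = k'"
  shows "sum f F = 0 \<or> (\<exists>k\<in>F. sum f F = f k)"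
proof (cases "\<forall>k\<in>F. f k = 0")
  case False
  then obtain k where k: "k \<in> F" "f k \<noteq> 0" by blast
  then have "\<forall>k'\<in>F - {k}. f k' = 0" using assms(2) by blast
  then have "sum f F = f k" using k assms(1) by (simp add: sum.remove)
  then show ?thesis using k by blast
qed simp

text \<open>Such a matrix is a weighted partial permutation, so its norm is controlled by its
  largest entry. Functions supported on a bisection and functions supported over the units have
  matrices of this kind.\<close>

lemma kernel_bound_sparse:
  assumes "0 \<le> C" and C: "\<And>h k. \<lbrakk>h \<in> I; k \<in> I\<rbrakk> \<Longrightarrow> cmod (K h k) \<le> C"
    and row: "\<And>h k k'. \<lbrakk>h \<in> I; k \<in> I; k' \<in> I; K h k \<noteq> 0; K h k' \<noteq> 0\<rbrakk> \<Longrightarrow> k = k'"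
    and col: "\<And>h h' k. \<lbrakk>h \<in> I; h' \<in> I; k \<in> I; K h k \<noteq> 0; K h' k \<noteq> 0\<rbrakk> \<Longrightarrow> h = h'"
  shows "kernel_bound I K C"
proof (rule kernel_boundI_sum[OF \<open>0 \<le> C\<close>])
  fix F F' and \<xi> :: "'a \<Rightarrow> complex" assume F: "finite F" "F \<subseteq> I" "finite F'" "F' \<subseteq> I"
  have "(cmod (\<Sum>k\<in>F'. K h k * \<xi> k))\<^sup>2 \<le> (\<Sum>k\<in>F'. (cmod (K h k))\<^sup>2 * (cmod (\<xi> k))\<^sup>2)" if "h \<in> F" for h
  proof -
    have "k = k'" if "k \<in> F'" "k' \<in> F'" "K h k * \<xi> k \<noteq> 0" "K h k' * \<xi> k' \<noteq> 0" for k k'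
      using row[of h k k'] that \<open>h \<in> F\<close> F by auto
    with sum_at_most_one_nonzero[OF F(3), of "\<lambda>k. K h k * \<xi> k"]
    have "(\<Sum>k\<in>F'. K h k * \<xi> k) = 0 \<or> (\<exists>k\<in>F'. (\<Sum>k\<in>F'. K h k * \<xi> k) = K h k * \<xi> k)" by metis
    then show ?thesis
    proof (elim disjE bexE)
      fix k assume k: "k \<in> F'" "(\<Sum>k\<in>F'. K h k * \<xi> k) = K h k * \<xi> k"
      then show ?thesis
        using member_le_sum[OF k(1), of "\<lambda>k. (cmod (K h k))\<^sup>2 * (cmod (\<xi> k))\<^sup>2"] F(3)
        by (simp add: norm_mult power_mult_distrib)
    qed (simp add: sum_nonneg)
  qed
  then have "(\<Sum>h\<in>F. (cmod (\<Sum>k\<in>F'. K h k * \<xi> k))\<^sup>2)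
      \<le> (\<Sum>h\<in>F. \<Sum>k\<in>F'. (cmod (K h k))\<^sup>2 * (cmod (\<xi> k))\<^sup>2)" by (rule sum_mono)
  also have "\<dots> = (\<Sum>k\<in>F'. (\<Sum>h\<in>F. (cmod (K h k))\<^sup>2) * (cmod (\<xi> k))\<^sup>2)"
    by (subst sum.swap) (simp add: sum_distrib_right)
  also have "\<dots> \<le> (\<Sum>k\<in>F'. C\<^sup>2 * (cmod (\<xi> k))\<^sup>2)"
  proof (intro sum_mono mult_right_mono)
    fix k assume k: "k \<in> F'"
    have "h = h'" if "h \<in> F" "h' \<in> F" "(cmod (K h k))\<^sup>2 \<noteq> 0" "(cmod (K h' k))\<^sup>2 \<noteq> 0" for h h'
      using col[of h h' k] that k F by auto
    with sum_at_most_one_nonzero[OF F(1), of "\<lambda>h. (cmod (K h k))\<^sup>2"]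
    have "(\<Sum>h\<in>F. (cmod (K h k))\<^sup>2) = 0 \<or> (\<exists>h\<in>F. (\<Sum>h\<in>F. (cmod (K h k))\<^sup>2) = (cmod (K h k))\<^sup>2)"
      by metis
    then show "(\<Sum>h\<in>F. (cmod (K h k))\<^sup>2) \<le> C\<^sup>2"
    proof (elim disjE bexE)
      fix h assume h: "h \<in> F" "(\<Sum>h\<in>F. (cmod (K h k))\<^sup>2) = (cmod (K h k))\<^sup>2"
      have "(cmod (K h k))\<^sup>2 \<le> C\<^sup>2" using C[of h k] F h k by (intro power_mono) auto
      then show ?thesis using h by simp
    qed simp
  qed simp
  finally show "(\<Sum>h\<in>F. (cmod (\<Sum>k\<in>F'. K h k * \<xi> k))\<^sup>2) \<le> C\<^sup>2 * (\<Sum>k\<in>F'. (cmod (\<xi> k))\<^sup>2)"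
    by (simp add: sum_distrib_left)
qed

text \<open>For matrices of functions on a groupoid, labelling by the grading compresses to the part
  of degree \<open>0\<close>, and labelling each arrow by itself compresses to the part over the units.\<close>

lemma kernel_bound_block:
  assumes K: "kernel_bound I K C" and "0 \<le> C"
  shows "kernel_bound I (\<lambda>h k. if c h = c k then K h k else 0) C"
proof (rule kernel_boundI_sum[OF \<open>0 \<le> C\<close>])
  fix F F' and \<xi> :: "'a \<Rightarrow> complex" assume F: "finite F" "F \<subseteq> I" "finite F'" "F' \<subseteq> I"
  let ?T = "c ` (F \<union> F')"
  let ?K = "\<lambda>h k. (if c h = c k then K h k else 0) * \<xi> k"
  have "(\<Sum>h\<in>F. (cmod (\<Sum>k\<in>F'. ?K h k))\<^sup>2)
      = (\<Sum>t\<in>?T. \<Sum>h | h \<in> F \<and> c h = t. (cmod (\<Sum>k\<in>F'. ?K h k))\<^sup>2)"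
    using F by (intro sum.group[symmetric]) auto
  also have "\<dots> = (\<Sum>t\<in>?T. \<Sum>h | h \<in> F \<and> c h = t.
      (cmod (\<Sum>k | k \<in> F' \<and> c k = t. K h k * \<xi> k))\<^sup>2)"
  proof -
    have "(\<Sum>k\<in>F'. ?K h k) = (\<Sum>k | k \<in> F' \<and> c k = c h. K h k * \<xi> k)" for h
      using F(3) by (subst sum.inter_filter) (auto intro!: sum.cong)
    then show ?thesis by (intro sum.cong refl) simp
  qed
  \<comment> \<open>Rows with label \<open>t\<close> see only the columns with label
    \<open>t\<close>, so the bound for \<open>K\<close> applies to each block separately and the
    squared norms of the blocks add up.\<close>
  also have "\<dots> \<le> (\<Sum>t\<in>?T. C\<^sup>2 * (\<Sum>k | k \<in> F' \<and> c k = t. (cmod (\<xi> k))\<^sup>2))"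
    using F by (intro sum_mono kernel_boundD_sum[OF K]) auto
  also have "\<dots> = C\<^sup>2 * (\<Sum>t\<in>?T. \<Sum>k | k \<in> F' \<and> c k = t. (cmod (\<xi> k))\<^sup>2)"
    by (simp add: sum_distrib_left)
  also have "\<dots> = C\<^sup>2 * (\<Sum>k\<in>F'. (cmod (\<xi> k))\<^sup>2)"
    using F by (subst sum.group) auto
  finally show "(\<Sum>h\<in>F. (cmod (\<Sum>k\<in>F'. ?K h k))\<^sup>2) \<le> C\<^sup>2 * (\<Sum>k\<in>F'. (cmod (\<xi> k))\<^sup>2)" .
qed

text \<open>Conjugation by the diagonal unitary with entries \<open>u\<close>. When \<open>u\<close>
  is a character evaluated at the degree, this is the dual action on matrices.\<close>

lemma kernel_bound_conjugate:
  assumes K: "kernel_bound I K C" and u: "\<And>h. h \<in> I \<Longrightarrow> cmod (u h) = 1"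
  shows "kernel_bound I (\<lambda>h k. u h * cnj (u k) * K h k) C"
proof (rule kernel_boundI)
  fix F F' \<xi> assume F: "finite F" "F \<subseteq> I" "finite F'" "F' \<subseteq> I"
  have "L2_set (\<lambda>h. cmod (\<Sum>k\<in>F'. u h * cnj (u k) * K h k * \<xi> k)) F
      = L2_set (\<lambda>h. cmod (\<Sum>k\<in>F'. K h k * (cnj (u k) * \<xi> k))) F"
  proof (rule L2_set_cong[OF refl])
    fix h assume "h \<in> F"
    have "(\<Sum>k\<in>F'. u h * cnj (u k) * K h k * \<xi> k) = u h * (\<Sum>k\<in>F'. K h k * (cnj (u k) * \<xi> k))"
      by (simp add: sum_distrib_left mult_ac)
    then show "cmod (\<Sum>k\<in>F'. u h * cnj (u k) * K h k * \<xi> k)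
        = cmod (\<Sum>k\<in>F'. K h k * (cnj (u k) * \<xi> k))"
      using u F \<open>h \<in> F\<close> by (auto simp: norm_mult)
  qed
  also have "\<dots> \<le> C * L2_set (\<lambda>k. cmod (cnj (u k) * \<xi> k)) F'" by (rule kernel_boundD[OF K F])
  also have "L2_set (\<lambda>k. cmod (cnj (u k) * \<xi> k)) F' = L2_set (\<lambda>k. cmod (\<xi> k)) F'"
    using F u by (intro L2_set_cong) (auto simp: norm_mult)
  finally show "L2_set (\<lambda>h. cmod (\<Sum>k\<in>F'. u h * cnj (u k) * K h k * \<xi> k)) F
      \<le> C * L2_set (\<lambda>k. cmod (\<xi> k)) F'" .
qed

section \<open>Completions of normed star algebras with the C*-identity\<close>

text \<open>The axioms of \<open>cstar_algebra\<close> apart from completeness. They hold for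
  \<open>Cc_algebra\<close> and are inherited by its completion and by closed subalgebras; in the
  last two cases completeness is added by a separate argument.\<close>

locale pre_cstar_algebra =
  fixes A :: "'a star_algebra"
  assumes zero_closed: "azero A \<in> acarrier A"
    and add_closed: "\<lbrakk>a \<in> acarrier A; b \<in> acarrier A\<rbrakk> \<Longrightarrow> aadd A a b \<in> acarrier A"
    and scale_closed: "a \<in> acarrier A \<Longrightarrow> ascale A c a \<in> acarrier A"
    and mult_closed: "\<lbrakk>a \<in> acarrier A; b \<in> acarrier A\<rbrakk> \<Longrightarrow> amult A a b \<in> acarrier A"
    and star_closed: "a \<in> acarrier A \<Longrightarrow> astar A a \<in> acarrier A"
    and add_assoc: "\<lbrakk>a \<in> acarrier A; b \<in> acarrier A; d \<in> acarrier A\<rbrakk>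
      \<Longrightarrow> aadd A (aadd A a b) d = aadd A a (aadd A b d)"
    and add_commute: "\<lbrakk>a \<in> acarrier A; b \<in> acarrier A\<rbrakk> \<Longrightarrow> aadd A a b = aadd A b a"
    and add_zero: "a \<in> acarrier A \<Longrightarrow> aadd A a (azero A) = a"
    and sub_self: "a \<in> acarrier A \<Longrightarrow> asub A a a = azero A"
    and scale_add: "\<lbrakk>a \<in> acarrier A; b \<in> acarrier A\<rbrakk>
      \<Longrightarrow> ascale A c (aadd A a b) = aadd A (ascale A c a) (ascale A c b)"
    and add_scale: "a \<in> acarrier A
      \<Longrightarrow> ascale A (c + c') a = aadd A (ascale A c a) (ascale A c' a)"
    and scale_scale: "a \<in> acarrier A \<Longrightarrow> ascale A c (ascale A c' a) = ascale A (c * c') a"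
    and scale_one: "a \<in> acarrier A \<Longrightarrow> ascale A 1 a = a"
    and mult_assoc: "\<lbrakk>a \<in> acarrier A; b \<in> acarrier A; d \<in> acarrier A\<rbrakk>
      \<Longrightarrow> amult A (amult A a b) d = amult A a (amult A b d)"
    and mult_add: "\<lbrakk>a \<in> acarrier A; b \<in> acarrier A; d \<in> acarrier A\<rbrakk>
      \<Longrightarrow> amult A a (aadd A b d) = aadd A (amult A a b) (amult A a d)"
    and add_mult: "\<lbrakk>a \<in> acarrier A; b \<in> acarrier A; d \<in> acarrier A\<rbrakk>
      \<Longrightarrow> amult A (aadd A a b) d = aadd A (amult A a d) (amult A b d)"
    and scale_mult: "\<lbrakk>a \<in> acarrier A; b \<in> acarrier A\<rbrakk>
      \<Longrightarrow> amult A (ascale A c a) b = ascale A c (amult A a b)"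
    and mult_scale: "\<lbrakk>a \<in> acarrier A; b \<in> acarrier A\<rbrakk>
      \<Longrightarrow> amult A a (ascale A c b) = ascale A c (amult A a b)"
    and star_star: "a \<in> acarrier A \<Longrightarrow> astar A (astar A a) = a"
    and star_add: "\<lbrakk>a \<in> acarrier A; b \<in> acarrier A\<rbrakk>
      \<Longrightarrow> astar A (aadd A a b) = aadd A (astar A a) (astar A b)"
    and star_scale: "a \<in> acarrier A \<Longrightarrow> astar A (ascale A c a) = ascale A (cnj c) (astar A a)"
    and star_mult: "\<lbrakk>a \<in> acarrier A; b \<in> acarrier A\<rbrakk>
      \<Longrightarrow> astar A (amult A a b) = amult A (astar A b) (astar A a)"
    and norm_nonneg: "a \<in> acarrier A \<Longrightarrow> 0 \<le> anorm A a"
    and norm_eq_zero: "a \<in> acarrier A \<Longrightarrow> anorm A a = 0 \<longleftrightarrow> a = azero A"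
    and norm_triangle: "\<lbrakk>a \<in> acarrier A; b \<in> acarrier A\<rbrakk>
      \<Longrightarrow> anorm A (aadd A a b) \<le> anorm A a + anorm A b"
    and norm_scale: "a \<in> acarrier A \<Longrightarrow> anorm A (ascale A c a) = cmod c * anorm A a"
    and norm_mult: "\<lbrakk>a \<in> acarrier A; b \<in> acarrier A\<rbrakk>
      \<Longrightarrow> anorm A (amult A a b) \<le> anorm A a * anorm A b"
    and cstar_identity: "a \<in> acarrier A \<Longrightarrow> anorm A (amult A (astar A a) a) = (anorm A a)\<^sup>2"
begin

section \<open>Arithmetic and metric of a normed star algebra\<close>

lemma asub_closed: "\<lbrakk>a \<in> acarrier A; b \<in> acarrier A\<rbrakk> \<Longrightarrow> asub A a b \<in> acarrier A"
  by (simp add: asub_def add_closed scale_closed)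

lemma add_left_commute:
  "\<lbrakk>a \<in> acarrier A; b \<in> acarrier A; d \<in> acarrier A\<rbrakk>
    \<Longrightarrow> aadd A a (aadd A b d) = aadd A b (aadd A a d)"
  by (metis add_assoc add_commute)

lemmas add_ac = add_assoc add_commute add_left_commute

lemma zero_add: "a \<in> acarrier A \<Longrightarrow> aadd A (azero A) a = a"
  by (metis add_commute add_zero zero_closed)

lemma add_neg: "a \<in> acarrier A \<Longrightarrow> aadd A a (ascale A (-1) a) = azero A"
  using sub_self by (simp add: asub_def)

lemma neg_add_cancel:
  "\<lbrakk>a \<in> acarrier A; b \<in> acarrier A\<rbrakk> \<Longrightarrow> aadd A (ascale A (-1) b) (aadd A b a) = a"
  by (metis add_assoc add_commute add_neg scale_closed zero_add)

lemma scale_zero_left: "a \<in> acarrier A \<Longrightarrow> ascale A 0 a = azero A"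
  using add_scale[of a 1 "-1"] scale_one add_neg by simp

lemma scale_zero_right: "ascale A c (azero A) = azero A"
  by (metis scale_zero_left zero_closed scale_scale mult_zero_right)

lemma asub_eq_zero_iff:
  assumes "a \<in> acarrier A" "b \<in> acarrier A"
  shows "asub A a b = azero A \<longleftrightarrow> a = b"
proof
  assume "asub A a b = azero A"
  then have "aadd A (aadd A a (ascale A (-1) b)) b = b" using assms by (simp add: asub_def zero_add)
  then show "a = b" using assms
    by (simp add: add_assoc scale_closed add_commute[of "ascale A (-1) b" b] add_neg add_zero)
qed (simp add: assms sub_self)

lemma asub_commute:
  assumes "a \<in> acarrier A" "b \<in> acarrier A"
  shows "asub A b a = ascale A (-1) (asub A a b)"
  using assms by (simp add: asub_def scale_add scale_closed scale_scale scale_one add_commute)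

lemma asub_add_asub:
  assumes "a \<in> acarrier A" "b \<in> acarrier A" "d \<in> acarrier A"
  shows "aadd A (asub A a b) (asub A b d) = asub A a d"
  using assms by (simp add: asub_def add_assoc add_closed scale_closed neg_add_cancel)

lemma asub_add:
  assumes "a \<in> acarrier A" "b \<in> acarrier A" "d \<in> acarrier A" "e \<in> acarrier A"
  shows "asub A (aadd A a b) (aadd A d e) = aadd A (asub A a d) (asub A b e)"
  using assms by (simp add: asub_def scale_add add_closed scale_closed add_ac)

lemma asub_scale:
  assumes "a \<in> acarrier A" "b \<in> acarrier A"
  shows "asub A (ascale A c a) (ascale A c b) = ascale A c (asub A a b)"
  using assms by (simp add: asub_def scale_add scale_closed scale_scale)

lemma asub_star:
  assumes "a \<in> acarrier A" "b \<in> acarrier A"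
  shows "asub A (astar A a) (astar A b) = astar A (asub A a b)"
  using assms by (simp add: asub_def star_add scale_closed star_scale)

lemma asub_mult:
  assumes "a \<in> acarrier A" "b \<in> acarrier A" "d \<in> acarrier A" "e \<in> acarrier A"
  shows "asub A (amult A a b) (amult A d e)
    = aadd A (amult A (asub A a d) b) (amult A d (asub A b e))"
  using assms
  by (simp add: asub_def mult_add add_mult scale_closed mult_closed scale_mult mult_scale
      add_assoc add_closed neg_add_cancel)

lemma norm_zero: "anorm A (azero A) = 0"
  using norm_eq_zero zero_closed by blast

text \<open>By the C*-identity and submultiplicativity, the square of the norm of \<open>a\<close>
  is at most the product of the norms of \<open>astar A a\<close> and \<open>a\<close>. Divide by
  the norm of \<open>a\<close>, then exchange \<open>a\<close> with its adjoint.\<close>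

lemma norm_star: "a \<in> acarrier A \<Longrightarrow> anorm A (astar A a) = anorm A a"
proof -
  have le: "anorm A a \<le> anorm A (astar A a)" if a: "a \<in> acarrier A" for a
  proof (cases "anorm A a = 0")
    case True
    then show ?thesis using norm_nonneg star_closed a by simp
  next
    case False
    then have "0 < anorm A a" using norm_nonneg[OF a] by simp
    moreover have "anorm A a * anorm A a \<le> anorm A (astar A a) * anorm A a"
      using cstar_identity[OF a] norm_mult[OF star_closed[OF a] a] by (simp add: power2_eq_square)
    ultimately show ?thesis by simp
  qed
  assume "a \<in> acarrier A"
  then show ?thesis using le[of a] le[of "astar A a"] star_closed star_star by force
qed

lemma adist_eq: "\<lbrakk>a \<in> acarrier A; b \<in> acarrier A\<rbrakk> \<Longrightarrow> adist A a b = anorm A (asub A a b)"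
  by (simp add: adist_def)

sublocale metric: Metric_space "acarrier A" "adist A"
proof
  show "0 \<le> adist A a b" for a b
    by (simp add: adist_def norm_nonneg asub_closed)
  show "adist A a b = adist A b a" for a b
    by (auto simp: adist_def asub_commute[of a b] norm_scale asub_closed)
  show "adist A a b = 0 \<longleftrightarrow> a = b" if "a \<in> acarrier A" "b \<in> acarrier A" for a b
    using that by (simp add: adist_eq norm_eq_zero asub_closed asub_eq_zero_iff)
  show "adist A a c \<le> adist A a b + adist A b c"
    if "a \<in> acarrier A" "b \<in> acarrier A" "c \<in> acarrier A" for a b c
    using norm_triangle[of "asub A a b" "asub A b c"] that
    by (simp add: adist_eq asub_closed asub_add_asub)
qed

lemma adist_zero: "a \<in> acarrier A \<Longrightarrow> adist A a (azero A) = anorm A a"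
  by (simp add: adist_eq zero_closed asub_def scale_zero_right add_zero)

lemma abs_norm_diff_le:
  assumes "a \<in> acarrier A" "b \<in> acarrier A"
  shows "\<bar>anorm A a - anorm A b\<bar> \<le> adist A a b"
  using metric.triangle[OF assms zero_closed] metric.triangle[OF assms(2,1) zero_closed]
    adist_zero assms metric.commute[of a b] by simp

lemma adist_scale:
  assumes "a \<in> acarrier A" "b \<in> acarrier A"
  shows "adist A (ascale A c a) (ascale A c b) = cmod c * adist A a b"
  using assms by (simp add: adist_eq scale_closed asub_scale norm_scale asub_closed)

lemma adist_star:
  assumes "a \<in> acarrier A" "b \<in> acarrier A"
  shows "adist A (astar A a) (astar A b) = adist A a b"
  using assms by (simp add: adist_eq star_closed asub_star norm_star asub_closed)

text \<open>One Lipschitz condition covering both addition and multiplication.\<close>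

definition lipschitz_op :: "('a \<Rightarrow> 'a \<Rightarrow> 'a) \<Rightarrow> bool" where
  "lipschitz_op F \<longleftrightarrow> (\<forall>a\<in>acarrier A. \<forall>b\<in>acarrier A. F a b \<in> acarrier A) \<and>
     (\<forall>a\<in>acarrier A. \<forall>b\<in>acarrier A. \<forall>d\<in>acarrier A. \<forall>e\<in>acarrier A.
        adist A (F a b) (F d e) \<le> adist A a d * (1 + anorm A b) + (1 + anorm A d) * adist A b e)"

lemma lipschitz_add: "lipschitz_op (aadd A)"
  unfolding lipschitz_op_def
proof (intro conjI ballI)
  fix a b d e assume abde: "a \<in> acarrier A" "b \<in> acarrier A" "d \<in> acarrier A" "e \<in> acarrier A"
  have "adist A (aadd A a b) (aadd A d e) \<le> adist A a d + adist A b e"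
    using abde norm_triangle[of "asub A a d" "asub A b e"]
    by (simp add: adist_eq add_closed asub_add asub_closed)
  also have "\<dots> \<le> adist A a d * (1 + anorm A b) + (1 + anorm A d) * adist A b e"
    using abde norm_nonneg by (intro add_mono) (auto simp: algebra_simps)
  finally show "adist A (aadd A a b) (aadd A d e)
      \<le> adist A a d * (1 + anorm A b) + (1 + anorm A d) * adist A b e" .
qed (simp add: add_closed)

lemma lipschitz_mult: "lipschitz_op (amult A)"
  unfolding lipschitz_op_def
proof (intro conjI ballI)
  fix a b d e assume abde: "a \<in> acarrier A" "b \<in> acarrier A" "d \<in> acarrier A" "e \<in> acarrier A"
  have "adist A (amult A a b) (amult A d e)
      \<le> anorm A (amult A (asub A a d) b) + anorm A (amult A d (asub A b e))"
    using abde by (simp add: adist_eq mult_closed asub_mult asub_closed norm_triangle)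
  also have "\<dots> \<le> adist A a d * anorm A b + anorm A d * adist A b e"
    using abde by (simp add: adist_eq norm_mult asub_closed add_mono)
  also have "\<dots> \<le> adist A a d * (1 + anorm A b) + (1 + anorm A d) * adist A b e"
    using abde norm_nonneg by (intro add_mono) (auto simp: algebra_simps)
  finally show "adist A (amult A a b) (amult A d e)
      \<le> adist A a d * (1 + anorm A b) + (1 + anorm A d) * adist A b e" .
qed (simp add: mult_closed)

section \<open>Cauchy sequences and Lipschitz operations\<close>

abbreviation cauchy :: "(nat \<Rightarrow> 'a) \<Rightarrow> bool" where
  "cauchy \<equiv> Metric_space.MCauchy (acarrier A) (adist A)"

lemma cauchy_carrier: "cauchy u \<Longrightarrow> u n \<in> acarrier A"
  unfolding metric.MCauchy_def by blast

lemma cauchy_const: "a \<in> acarrier A \<Longrightarrow> cauchy (\<lambda>n. a)"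
  by (auto simp: metric.MCauchy_def)

lemma cauchy_norm_convergent:
  assumes "cauchy u" shows "convergent (\<lambda>n. anorm A (u n))"
proof -
  have "Cauchy (\<lambda>n. anorm A (u n))"
    unfolding Cauchy_def dist_real_def
  proof (intro allI impI)
    fix e :: real assume "0 < e"
    then obtain N where "\<And>n n'. N \<le> n \<Longrightarrow> N \<le> n' \<Longrightarrow> adist A (u n) (u n') < e"
      using assms unfolding metric.MCauchy_def by blast
    then show "\<exists>M. \<forall>m\<ge>M. \<forall>n\<ge>M. \<bar>anorm A (u m) - anorm A (u n)\<bar> < e"
      using abs_norm_diff_le[OF cauchy_carrier[OF assms] cauchy_carrier[OF assms]]
      by (meson le_less_trans)
  qed
  then show ?thesis by (simp add: Cauchy_convergent)
qed

lemma cauchy_norm_bounded: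
  assumes "cauchy u" obtains B where "0 < B" "\<And>n. 1 + anorm A (u n) \<le> B"
proof -
  from convergent_imp_Bseq[OF cauchy_norm_convergent[OF assms]]
  obtain K where "\<And>n. \<bar>anorm A (u n)\<bar> \<le> K" unfolding Bseq_def by auto
  then show ?thesis
    by (intro that[of "1 + \<bar>K\<bar>"]) (auto intro: order_trans[OF abs_ge_self] order_trans[OF _ abs_ge_self])
qed

text \<open>Each of the two error terms is a small distance times a norm that stays bounded along a
  Cauchy sequence.\<close>

lemma cauchy_lipschitz_op:
  assumes F: "lipschitz_op F" and u: "cauchy u" and v: "cauchy v"
  shows "cauchy (\<lambda>n. F (u n) (v n))"
  unfolding metric.MCauchy_def
proof (intro conjI allI impI)
  show "range (\<lambda>n. F (u n) (v n)) \<subseteq> acarrier A"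
    using F cauchy_carrier[OF u] cauchy_carrier[OF v] by (auto simp: lipschitz_op_def)
  fix e :: real assume e: "0 < e"
  obtain B where B: "0 < B" "\<And>n. 1 + anorm A (u n) \<le> B" using cauchy_norm_bounded[OF u] by blast
  obtain D where D: "0 < D" "\<And>n. 1 + anorm A (v n) \<le> D" using cauchy_norm_bounded[OF v] by blast
  have "0 < e / (2 * D)" "0 < e / (2 * B)" using e B D by simp_all
  then obtain N N' where
    N: "\<And>n n'. N \<le> n \<Longrightarrow> N \<le> n' \<Longrightarrow> adist A (u n) (u n') < e / (2 * D)" and
    N': "\<And>n n'. N' \<le> n \<Longrightarrow> N' \<le> n' \<Longrightarrow> adist A (v n) (v n') < e / (2 * B)"
    using u v unfolding metric.MCauchy_def by meson
  have "adist A (F (u n) (v n)) (F (u n') (v n')) < e" if "max N N' \<le> n" "max N N' \<le> n'" for n n'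
  proof -
    have "adist A (F (u n) (v n)) (F (u n') (v n'))
        \<le> adist A (u n) (u n') * (1 + anorm A (v n)) + (1 + anorm A (u n')) * adist A (v n) (v n')"
      using F cauchy_carrier[OF u] cauchy_carrier[OF v] by (auto simp: lipschitz_op_def)
    also have "\<dots> \<le> adist A (u n) (u n') * D + B * adist A (v n) (v n')"
      using B D by (intro add_mono mult_left_mono mult_right_mono) auto
    also have "\<dots> < e / (2 * D) * D + B * (e / (2 * B))"
      using N[of n n'] N'[of n n'] that B D
      by (intro add_strict_mono mult_strict_left_mono mult_strict_right_mono) auto
    also have "\<dots> = e" using B D by simp
    finally show ?thesis .
  qed
  then show "\<exists>N. \<forall>n n'. N \<le> n \<longrightarrow> N \<le> n' \<longrightarrow> adist A (F (u n) (v n)) (F (u n') (v n')) < e" by blast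
qed

lemma lipschitz_op_null:
  assumes F: "lipschitz_op F" and c: "cauchy u" "cauchy v" "cauchy u'" "cauchy v'"
    and u: "(\<lambda>n. adist A (u n) (u' n)) \<longlonglongrightarrow> 0" and v: "(\<lambda>n. adist A (v n) (v' n)) \<longlonglongrightarrow> 0"
  shows "(\<lambda>n. adist A (F (u n) (v n)) (F (u' n) (v' n))) \<longlonglongrightarrow> 0"
proof (rule tendsto_sandwich[OF _ _ tendsto_const])
  show "\<forall>\<^sub>F n in sequentially. adist A (F (u n) (v n)) (F (u' n) (v' n))
      \<le> adist A (u n) (u' n) * (1 + anorm A (v n)) + (1 + anorm A (u' n)) * adist A (v n) (v' n)"
    using F c[THEN cauchy_carrier] by (auto simp: lipschitz_op_def)
  obtain a where a: "(\<lambda>n. anorm A (v n)) \<longlonglongrightarrow> a"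
    using cauchy_norm_convergent[OF c(2)] by (auto simp: convergent_def)
  obtain b where b: "(\<lambda>n. anorm A (u' n)) \<longlonglongrightarrow> b"
    using cauchy_norm_convergent[OF c(3)] by (auto simp: convergent_def)
  have "(\<lambda>n. adist A (u n) (u' n) * (1 + anorm A (v n)) + (1 + anorm A (u' n)) * adist A (v n) (v' n))
      \<longlonglongrightarrow> 0 * (1 + a) + (1 + b) * 0"
    by (intro tendsto_intros u v a b)
  then show "(\<lambda>n. adist A (u n) (u' n) * (1 + anorm A (v n)) + (1 + anorm A (u' n)) * adist A (v n) (v' n))
      \<longlonglongrightarrow> 0" by simp
qed simp

definition lipschitz_map :: "real \<Rightarrow> ('a \<Rightarrow> 'a) \<Rightarrow> bool" where
  "lipschitz_map c F \<longleftrightarrow> (\<forall>a\<in>acarrier A. F a \<in> acarrier A) \<and>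
     (\<forall>a\<in>acarrier A. \<forall>b\<in>acarrier A. adist A (F a) (F b) \<le> c * adist A a b)"

lemma lipschitz_map_null:
  assumes F: "lipschitz_map c F" and cu: "cauchy u" "cauchy u'"
    and u: "(\<lambda>n. adist A (u n) (u' n)) \<longlonglongrightarrow> 0"
  shows "(\<lambda>n. adist A (F (u n)) (F (u' n))) \<longlonglongrightarrow> 0"
proof (rule tendsto_sandwich[OF _ _ tendsto_const])
  show "\<forall>\<^sub>F n in sequentially. adist A (F (u n)) (F (u' n)) \<le> c * adist A (u n) (u' n)"
    using F cu[THEN cauchy_carrier] by (auto simp: lipschitz_map_def)
  show "(\<lambda>n. c * adist A (u n) (u' n)) \<longlonglongrightarrow> 0"
    by (rule tendsto_mult_right_zero[OF u])
qed simp

lemma cauchy_lipschitz_map: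
  assumes F: "lipschitz_map c F" and u: "cauchy u"
  shows "cauchy (\<lambda>n. F (u n))"
  unfolding metric.MCauchy_def
proof (intro conjI allI impI)
  show "range (\<lambda>n. F (u n)) \<subseteq> acarrier A"
    using F cauchy_carrier[OF u] by (auto simp: lipschitz_map_def)
  fix e :: real assume e: "0 < e"
  \<comment> \<open>The constant \<open>c\<close> may be zero or negative, so the positive constant
    \<open>\<bar>c\<bar> + 1\<close> takes its place.\<close>
  then have "0 < e / (\<bar>c\<bar> + 1)" by simp
  then obtain N where N: "\<And>n n'. N \<le> n \<Longrightarrow> N \<le> n' \<Longrightarrow> adist A (u n) (u n') < e / (\<bar>c\<bar> + 1)"
    using u unfolding metric.MCauchy_def by meson
  have "adist A (F (u n)) (F (u n')) < e" if "N \<le> n" "N \<le> n'" for n n'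
  proof -
    have "adist A (F (u n)) (F (u n')) \<le> c * adist A (u n) (u n')"
      using F cauchy_carrier[OF u] by (auto simp: lipschitz_map_def)
    also have "\<dots> \<le> (\<bar>c\<bar> + 1) * adist A (u n) (u n')"
      by (rule mult_right_mono) auto
    also have "\<dots> < (\<bar>c\<bar> + 1) * (e / (\<bar>c\<bar> + 1))"
      using N[OF that] by (intro mult_strict_left_mono) auto
    finally show ?thesis by simp
  qed
  then show "\<exists>N. \<forall>n n'. N \<le> n \<longrightarrow> N \<le> n' \<longrightarrow> adist A (F (u n)) (F (u n')) < e" by blast
qed

lemma lipschitz_scale: "lipschitz_map (cmod c) (ascale A c)"
  by (simp add: lipschitz_map_def scale_closed adist_scale)

lemma lipschitz_star: "lipschitz_map 1 (astar A)"
  by (simp add: lipschitz_map_def star_closed adist_star)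

section \<open>The algebra of Cauchy classes\<close>

abbreviation cls :: "(nat \<Rightarrow> 'a) \<Rightarrow> (nat \<Rightarrow> 'a) set" where
  "cls \<equiv> cauchy_class A"

abbreviation completed :: "(nat \<Rightarrow> 'a) set star_algebra" where
  "completed \<equiv> completion A"

lemma carrier_completion: "acarrier completed = {cls u |u. cauchy u}"
  by (simp add: completion_def)

lemma cls_closed: "cauchy u \<Longrightarrow> cls u \<in> acarrier completed"
  by (auto simp: carrier_completion)

lemma carrier_completionE:
  assumes "X \<in> acarrier completed" obtains u where "cauchy u" "X = cls u"
  using assms by (auto simp: carrier_completion)

lemma mem_cls: "cauchy u \<Longrightarrow> u \<in> cls u"
  using cauchy_carrier by (auto simp: cauchy_class_def)

lemma null_trans:
  assumes c: "cauchy u" "cauchy v" "cauchy w"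
    and "(\<lambda>n. adist A (u n) (v n)) \<longlonglongrightarrow> 0" "(\<lambda>n. adist A (v n) (w n)) \<longlonglongrightarrow> 0"
  shows "(\<lambda>n. adist A (u n) (w n)) \<longlonglongrightarrow> 0"
proof (rule tendsto_sandwich[OF _ _ tendsto_const])
  show "\<forall>\<^sub>F n in sequentially. adist A (u n) (w n) \<le> adist A (u n) (v n) + adist A (v n) (w n)"
    using c[THEN cauchy_carrier] by (simp add: metric.triangle)
  show "(\<lambda>n. adist A (u n) (v n) + adist A (v n) (w n)) \<longlonglongrightarrow> 0"
    using tendsto_add[OF assms(4,5)] by simp
qed simp

lemma cls_eqI:
  assumes "cauchy u" "cauchy v" and lim: "(\<lambda>n. adist A (u n) (v n)) \<longlonglongrightarrow> 0"
  shows "cls u = cls v"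
proof -
  have lim': "(\<lambda>n. adist A (v n) (u n)) \<longlonglongrightarrow> 0" using lim by (simp add: metric.commute)
  show ?thesis
    unfolding cauchy_class_def using null_trans[OF assms(1,2) _ lim] null_trans[OF assms(2,1) _ lim']
    by (auto intro: null_trans[OF assms(1,2) _ lim] null_trans[OF assms(2,1) _ lim'])
qed

text \<open>The operations of \<open>completion\<close> act on representatives picked by
  \<open>some_seq\<close>. A computation with any other representative passes through the fact that
  the two differ by a null sequence.\<close>

lemma some_seq_cls:
  assumes "cauchy u"
  shows "cauchy (some_seq (cls u))" "(\<lambda>n. adist A (u n) (some_seq (cls u) n)) \<longlonglongrightarrow> 0"
proof -
  have "some_seq (cls u) \<in> cls u"
    unfolding some_seq_def by (rule someI[of _ u]) (rule mem_cls[OF assms])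
  then show "cauchy (some_seq (cls u))" "(\<lambda>n. adist A (u n) (some_seq (cls u) n)) \<longlonglongrightarrow> 0"
    by (auto simp: cauchy_class_def)
qed

lemma lipschitz_op_cls:
  assumes "lipschitz_op F" "cauchy u" "cauchy v"
  shows "cls (\<lambda>n. F (some_seq (cls u) n) (some_seq (cls v) n)) = cls (\<lambda>n. F (u n) (v n))"
  by (rule cls_eqI[OF cauchy_lipschitz_op[OF assms] cauchy_lipschitz_op[OF assms(1)]
        lipschitz_op_null[OF assms], symmetric])
     (rule some_seq_cls assms)+

lemma lipschitz_map_cls:
  assumes "lipschitz_map c F" "cauchy u"
  shows "cls (\<lambda>n. F (some_seq (cls u) n)) = cls (\<lambda>n. F (u n))"
  by (rule cls_eqI[OF cauchy_lipschitz_map[OF assms] cauchy_lipschitz_map[OF assms(1)]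
        lipschitz_map_null[OF assms], symmetric])
     (rule some_seq_cls assms)+

lemma add_cls: "\<lbrakk>cauchy u; cauchy v\<rbrakk> \<Longrightarrow> aadd completed (cls u) (cls v) = cls (\<lambda>n. aadd A (u n) (v n))"
  by (simp add: completion_def lipschitz_op_cls[OF lipschitz_add])

lemma mult_cls: "\<lbrakk>cauchy u; cauchy v\<rbrakk> \<Longrightarrow> amult completed (cls u) (cls v) = cls (\<lambda>n. amult A (u n) (v n))"
  by (simp add: completion_def lipschitz_op_cls[OF lipschitz_mult])

lemma scale_cls: "cauchy u \<Longrightarrow> ascale completed c (cls u) = cls (\<lambda>n. ascale A c (u n))"
  by (simp add: completion_def lipschitz_map_cls[OF lipschitz_scale])

lemma star_cls: "cauchy u \<Longrightarrow> astar completed (cls u) = cls (\<lambda>n. astar A (u n))"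
  by (simp add: completion_def lipschitz_map_cls[OF lipschitz_star])

lemma zero_cls: "azero completed = cls (\<lambda>n. azero A)"
  by (simp add: completion_def)

lemmas cauchy_ops = cauchy_lipschitz_op[OF lipschitz_add] cauchy_lipschitz_op[OF lipschitz_mult]
  cauchy_lipschitz_map[OF lipschitz_scale] cauchy_lipschitz_map[OF lipschitz_star]
  cauchy_const[OF zero_closed]

lemmas cls_ops = add_cls mult_cls scale_cls star_cls zero_cls

lemma sub_cls: "\<lbrakk>cauchy u; cauchy v\<rbrakk> \<Longrightarrow> asub completed (cls u) (cls v) = cls (\<lambda>n. asub A (u n) (v n))"
  by (simp add: asub_def cls_ops cauchy_ops)

lemma cauchy_sub: "\<lbrakk>cauchy u; cauchy v\<rbrakk> \<Longrightarrow> cauchy (\<lambda>n. asub A (u n) (v n))"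
  by (simp add: asub_def cauchy_ops)

lemma norm_cls: 
  assumes "cauchy u" shows "(\<lambda>n. anorm A (u n)) \<longlonglongrightarrow> anorm completed (cls u)"
proof -
  let ?s = "some_seq (cls u)"
  have s: "cauchy ?s" "(\<lambda>n. adist A (u n) (?s n)) \<longlonglongrightarrow> 0" by (rule some_seq_cls[OF assms])+
  have "(\<lambda>n. anorm A (?s n)) \<longlonglongrightarrow> anorm completed (cls u)"
    using cauchy_norm_convergent[OF s(1)] by (simp add: completion_def convergent_LIMSEQ_iff)
  moreover have "(\<lambda>n. anorm A (u n) - anorm A (?s n)) \<longlonglongrightarrow> 0"
    by (rule tendsto_rabs_zero_cancel, rule tendsto_sandwich[OF _ _ tendsto_const s(2)])
       (simp_all add: abs_norm_diff_le cauchy_carrier[OF assms] cauchy_carrier[OF s(1)])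
  ultimately show ?thesis using tendsto_add by fastforce
qed

lemma adist_cls:
  assumes "cauchy u" "cauchy v"
  shows "(\<lambda>n. adist A (u n) (v n)) \<longlonglongrightarrow> adist completed (cls u) (cls v)"
  using norm_cls[OF cauchy_sub[OF assms]] assms
  by (simp add: adist_def cls_closed sub_cls cauchy_carrier)

text \<open>Identities between the algebraic operations hold term by term on representatives.
  Relations involving the norm are limits of the same relations along a representative.\<close>

lemma pre_cstar_algebra_completion: "pre_cstar_algebra completed"
proof
  note carr = cauchy_carrier
  show "azero completed \<in> acarrier completed"
    unfolding zero_cls by (rule cls_closed[OF cauchy_const[OF zero_closed]])
  fix X Y Z :: "(nat \<Rightarrow> 'a) set" and c c'
  assume X: "X \<in> acarrier completed"
  then obtain u where u: "cauchy u" "X = cls u" by (rule carrier_completionE)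
  note cu = cauchy_carrier[OF u(1)]
  show "ascale completed c X \<in> acarrier completed" by (simp add: u cls_ops cls_closed cauchy_ops)
  show "astar completed X \<in> acarrier completed" by (simp add: u cls_ops cls_closed cauchy_ops)
  show "aadd completed X (azero completed) = X" by (simp add: u cls_ops zero_closed cu add_zero)
  show "asub completed X X = azero completed" by (simp add: u cls_ops sub_cls cu sub_self)
  show "ascale completed (c + c') X = aadd completed (ascale completed c X) (ascale completed c' X)"
    by (simp add: u cls_ops cauchy_ops cu add_scale)
  show "ascale completed c (ascale completed c' X) = ascale completed (c * c') X"
    by (simp add: u cls_ops cauchy_ops cu scale_scale)
  show "ascale completed 1 X = X" by (simp add: u cls_ops cauchy_ops cu scale_one)
  show "astar completed (astar completed X) = X" by (simp add: u cls_ops cauchy_ops cu star_star)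
  show "astar completed (ascale completed c X) = ascale completed (cnj c) (astar completed X)"
    by (simp add: u cls_ops cauchy_ops cu star_scale)
  show nonneg: "0 \<le> anorm completed X"
    using LIMSEQ_le_const[OF norm_cls[OF u(1)], of 0] cu by (auto simp: u norm_nonneg)
  show "anorm completed X = 0 \<longleftrightarrow> X = azero completed"
  proof
    assume "anorm completed X = 0"
    then have "(\<lambda>n. adist A (u n) (azero A)) \<longlonglongrightarrow> 0"
      using norm_cls[OF u(1)] by (simp add: u adist_zero cu)
    then show "X = azero completed" unfolding u cls_ops by (rule cls_eqI[OF u(1) cauchy_const[OF zero_closed]])
  next
    assume "X = azero completed"
    then show "anorm completed X = 0"
      using norm_cls[OF cauchy_const[OF zero_closed]] by (simp add: cls_ops norm_zero LIMSEQ_const_iff)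
  qed
  show "anorm completed (ascale completed c X) = cmod c * anorm completed X"
  proof (rule LIMSEQ_unique)
    show "(\<lambda>n. anorm A (ascale A c (u n))) \<longlonglongrightarrow> anorm completed (ascale completed c X)"
      using norm_cls[OF cauchy_ops(3)[OF u(1)]] by (simp add: u cls_ops)
    show "(\<lambda>n. anorm A (ascale A c (u n))) \<longlonglongrightarrow> cmod c * anorm completed X"
      using tendsto_mult_left[OF norm_cls[OF u(1)]] by (simp add: u norm_scale cu)
  qed
  show "anorm completed (amult completed (astar completed X) X) = (anorm completed X)\<^sup>2"
  proof (rule LIMSEQ_unique)
    show "(\<lambda>n. anorm A (amult A (astar A (u n)) (u n))) \<longlonglongrightarrow> anorm completed (amult completed (astar completed X) X)"
      using norm_cls[OF cauchy_ops(2)[OF cauchy_ops(4)[OF u(1)] u(1)]] u(1) by (simp add: u(2) cls_ops cauchy_ops)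
    show "(\<lambda>n. anorm A (amult A (astar A (u n)) (u n))) \<longlonglongrightarrow> (anorm completed X)\<^sup>2"
      using tendsto_power[OF norm_cls[OF u(1)], of 2] by (simp add: u cstar_identity cu)
  qed
  assume Y: "Y \<in> acarrier completed"
  then obtain v where v: "cauchy v" "Y = cls v" by (rule carrier_completionE)
  note cv = cauchy_carrier[OF v(1)]
  show "aadd completed X Y \<in> acarrier completed" by (simp add: u v cls_ops cls_closed cauchy_ops)
  show "amult completed X Y \<in> acarrier completed" by (simp add: u v cls_ops cls_closed cauchy_ops)
  show "aadd completed X Y = aadd completed Y X"
    using add_commute[OF cu cv] by (simp add: u v cls_ops)
  show "ascale completed c (aadd completed X Y) = aadd completed (ascale completed c X) (ascale completed c Y)"
    by (simp add: u v cls_ops cauchy_ops cu cv scale_add)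
  show "amult completed (ascale completed c X) Y = ascale completed c (amult completed X Y)"
    by (simp add: u v cls_ops cauchy_ops cu cv scale_mult)
  show "amult completed X (ascale completed c Y) = ascale completed c (amult completed X Y)"
    by (simp add: u v cls_ops cauchy_ops cu cv mult_scale)
  show "astar completed (aadd completed X Y) = aadd completed (astar completed X) (astar completed Y)"
    by (simp add: u v cls_ops cauchy_ops cu cv star_add)
  show "astar completed (amult completed X Y) = amult completed (astar completed Y) (astar completed X)"
    by (simp add: u v cls_ops cauchy_ops cu cv star_mult)
  show "anorm completed (aadd completed X Y) \<le> anorm completed X + anorm completed Y"
  proof (rule LIMSEQ_le)
    show "(\<lambda>n. anorm A (aadd A (u n) (v n))) \<longlonglongrightarrow> anorm completed (aadd completed X Y)"
      using norm_cls[OF cauchy_ops(1)[OF u(1) v(1)]] u(1) v(1) by (simp add: u(2) v(2) cls_ops)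
    show "(\<lambda>n. anorm A (u n) + anorm A (v n)) \<longlonglongrightarrow> anorm completed X + anorm completed Y"
      unfolding u v by (intro tendsto_add norm_cls u v)
  qed (simp add: cu cv norm_triangle)
  show "anorm completed (amult completed X Y) \<le> anorm completed X * anorm completed Y"
  proof (rule LIMSEQ_le)
    show "(\<lambda>n. anorm A (amult A (u n) (v n))) \<longlonglongrightarrow> anorm completed (amult completed X Y)"
      using norm_cls[OF cauchy_ops(2)[OF u(1) v(1)]] u(1) v(1) by (simp add: u(2) v(2) cls_ops)
    show "(\<lambda>n. anorm A (u n) * anorm A (v n)) \<longlonglongrightarrow> anorm completed X * anorm completed Y"
      unfolding u v by (intro tendsto_mult norm_cls u v)
  qed (simp add: cu cv norm_mult)
  assume Z: "Z \<in> acarrier completed"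
  then obtain w where w: "cauchy w" "Z = cls w" by (rule carrier_completionE)
  note cw = cauchy_carrier[OF w(1)]
  show "aadd completed (aadd completed X Y) Z = aadd completed X (aadd completed Y Z)"
    by (simp add: u v w cls_ops cauchy_ops cu cv cw add_assoc)
  show "amult completed (amult completed X Y) Z = amult completed X (amult completed Y Z)"
    by (simp add: u v w cls_ops cauchy_ops cu cv cw mult_assoc)
  show "amult completed X (aadd completed Y Z) = aadd completed (amult completed X Y) (amult completed X Z)"
    by (simp add: u v w cls_ops cauchy_ops cu cv cw mult_add)
  show "amult completed (aadd completed X Y) Z = aadd completed (amult completed X Z) (amult completed Y Z)"
    by (simp add: u v w cls_ops cauchy_ops cu cv cw add_mult)
qed

lemma completion_emb_closed: "a \<in> acarrier A \<Longrightarrow> completion_emb A a \<in> acarrier completed"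
  by (simp add: completion_emb_def cls_closed cauchy_const)

lemma adist_completion_emb:
  assumes "a \<in> acarrier A" "b \<in> acarrier A"
  shows "adist completed (completion_emb A a) (completion_emb A b) = adist A a b"
  using adist_cls[OF cauchy_const[OF assms(1)] cauchy_const[OF assms(2)]]
  by (simp add: completion_emb_def LIMSEQ_const_iff)

lemma adist_emb_cls_le:
  assumes "cauchy u" "a \<in> acarrier A" "\<And>n. N \<le> n \<Longrightarrow> adist A a (u n) \<le> e"
  shows "adist completed (completion_emb A a) (cls u) \<le> e"
  unfolding completion_emb_def
  by (rule LIMSEQ_le_const2[OF adist_cls[OF cauchy_const[OF assms(2)] assms(1)]])
     (use assms(3) in blast)

lemma completion_emb_dense:
  assumes "X \<in> acarrier completed" "0 < e"
  shows "\<exists>a\<in>acarrier A. adist completed (completion_emb A a) X < e"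
proof -
  obtain u where u: "cauchy u" "X = cls u" using assms(1) by (rule carrier_completionE)
  \<comment> \<open>A limit of distances is only weakly bounded; halving \<open>e\<close> restores
    the strict inequality.\<close>
  have "0 < e / 2" using assms(2) by simp
  then obtain N where N: "\<And>n n'. N \<le> n \<Longrightarrow> N \<le> n' \<Longrightarrow> adist A (u n) (u n') < e / 2"
    using u(1) unfolding metric.MCauchy_def by meson
  have "adist completed (completion_emb A (u N)) X \<le> e / 2"
    unfolding u(2) by (rule adist_emb_cls_le[OF u(1) cauchy_carrier[OF u(1)], of N]) (use N less_imp_le in auto)
  then show ?thesis using cauchy_carrier[OF u(1)] assms(2) by (intro bexI[of _ "u N"]) auto
qed

text \<open>Choose elements \<open>p k\<close> of \<open>A\<close> whose images are within
  \<open>1 / real (Suc k)\<close> of \<open>X k\<close>. The sequence \<open>p\<close> is Cauchy in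
  \<open>A\<close>, and its class is the limit of \<open>X\<close>.\<close>

lemma mcomplete_completion: "Metric_space.mcomplete (acarrier completed) (adist completed)"
proof -
  interpret C: pre_cstar_algebra completed by (rule pre_cstar_algebra_completion)
  show ?thesis
    unfolding C.metric.mcomplete_def
  proof (intro allI impI)
    fix X assume X: "C.metric.MCauchy X"
    note cX = C.cauchy_carrier[OF X]
    have "\<exists>a\<in>acarrier A. adist completed (completion_emb A a) (X k) < 1 / real (Suc k)" for k
      by (rule completion_emb_dense[OF cX]) simp
    then obtain p where p: "\<And>k. p k \<in> acarrier A"
      "\<And>k. adist completed (completion_emb A (p k)) (X k) < 1 / real (Suc k)" by metis
    note ep = completion_emb_closed[OF p(1)]
    have "cauchy p"
      unfolding metric.MCauchy_def
    proof (intro conjI allI impI)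
      show "range p \<subseteq> acarrier A" using p by blast
      fix e :: real assume "0 < e"
      then have "0 < e / 3" by simp
      then obtain N where N: "\<And>n n'. N \<le> n \<Longrightarrow> N \<le> n' \<Longrightarrow> adist completed (X n) (X n') < e / 3"
        using X unfolding C.metric.MCauchy_def by meson
      obtain M where M: "1 / real (Suc M) < e / 3" using nat_approx_posE[OF \<open>0 < e / 3\<close>] by blast
      have small: "adist completed (completion_emb A (p n)) (X n) < e / 3" if "M \<le> n" for n
      proof -
        have "1 / real (Suc n) \<le> 1 / real (Suc M)" using that by (simp add: frac_le)
        then show ?thesis using p(2)[of n] M by linarith
      qed
      have "adist A (p n) (p n') < e" if "max M N \<le> n" "max M N \<le> n'" for n n'
        using C.metric.triangle[OF ep[of n] cX[of n] ep[of n']]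
          C.metric.triangle[OF cX[of n] cX[of n'] ep[of n']] small[of n] small[of n'] N[of n n'] that
          C.metric.commute[of "X n'" "completion_emb A (p n')"]
        by (simp add: adist_completion_emb[OF p(1) p(1), symmetric])
      then show "\<exists>N. \<forall>n n'. N \<le> n \<longrightarrow> N \<le> n' \<longrightarrow> adist A (p n) (p n') < e" by blast
    qed
    have "limitin C.metric.mtopology X (cls p) sequentially"
      unfolding C.metric.limit_metric_sequentially
    proof (intro conjI allI impI)
      show "cls p \<in> acarrier completed" by (rule cls_closed[OF \<open>cauchy p\<close>])
      fix e :: real assume "0 < e"
      then have "0 < e / 2" by simp
      then obtain N where N: "\<And>n n'. N \<le> n \<Longrightarrow> N \<le> n' \<Longrightarrow> adist A (p n) (p n') < e / 2"
        using \<open>cauchy p\<close> unfolding metric.MCauchy_def by meson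
      obtain M where M: "1 / real (Suc M) < e / 2" using nat_approx_posE[OF \<open>0 < e / 2\<close>] by blast
      have "adist completed (X n) (cls p) < e" if "max M N \<le> n" for n
      proof -
        have "1 / real (Suc n) \<le> 1 / real (Suc M)" using that by (simp add: frac_le)
        then have "adist completed (X n) (completion_emb A (p n)) < e / 2"
          using p(2)[of n] M C.metric.commute[of "X n" "completion_emb A (p n)"] by linarith
        moreover have "adist completed (completion_emb A (p n)) (cls p) \<le> e / 2"
          by (rule adist_emb_cls_le[OF \<open>cauchy p\<close> p(1), of N]) (use N that less_imp_le in auto)
        ultimately show ?thesis
          using C.metric.triangle[OF cX[of n] ep[of n] cls_closed[OF \<open>cauchy p\<close>]] by linarith
      qed
      then show "\<exists>N. \<forall>n\<ge>N. X n \<in> acarrier completed \<and> adist completed (X n) (cls p) < e"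
        using cX by blast
    qed
    then show "\<exists>x. limitin C.metric.mtopology X x sequentially" by blast
  qed
qed

lemma cstar_algebraI:
  assumes "Metric_space.mcomplete (acarrier A) (adist A)"
  shows "cstar_algebra A"
  using pre_cstar_algebra_axioms assms unfolding pre_cstar_algebra_def cstar_algebra_def
  by (elim conjE) (intro conjI; assumption)

end

sublocale cstar_algebra \<subseteq> pre_cstar_algebra
  using cstar_algebra_axioms unfolding pre_cstar_algebra_def cstar_algebra_def
  by (elim conjE) (intro conjI; assumption)

theorem (in pre_cstar_algebra) cstar_algebra_completion: "cstar_algebra completed"
  by (rule pre_cstar_algebra.cstar_algebraI[OF pre_cstar_algebra_completion mcomplete_completion])

section \<open>Closed subalgebras and extension by continuity\<close>

lemma asub_acarrier_update [simp]: "asub (A\<lparr>acarrier := B\<rparr>) = asub A"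
  by (intro ext) (simp add: asub_def)

text \<open>Distances in \<open>B\<close> agree with those in \<open>A\<close>, so a Cauchy sequence
  in \<open>B\<close> has a limit in \<open>A\<close>, and closedness puts that limit back into
  \<open>B\<close>.\<close>

lemma (in cstar_algebra) cstar_algebra_subalgebra:
  assumes B: "cstar_subalgebra A B"
  shows "cstar_algebra (A\<lparr>acarrier := B\<rparr>)"
proof -
  note sub = B[unfolded cstar_subalgebra_def]
  have carr: "a \<in> acarrier A" if "a \<in> B" for a using sub that by blast
  interpret B: pre_cstar_algebra "A\<lparr>acarrier := B\<rparr>"
    by unfold_locales
      (use sub in \<open>auto simp: carr add_zero sub_self scale_add add_scale scale_scale scale_one
        scale_mult mult_scale star_star star_add star_scale star_mult norm_nonneg norm_eq_zero
        norm_triangle norm_scale norm_mult cstar_identity add_assoc mult_assoc mult_add add_mult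
        intro: add_commute\<close>)
  have eq: "adist (A\<lparr>acarrier := B\<rparr>) a b = adist A a b" if "a \<in> B" "b \<in> B" for a b
    using that by (simp add: adist_def carr)
  show ?thesis
  proof (rule B.cstar_algebraI, unfold B.metric.mcomplete_def, intro allI impI)
    fix u assume u: "B.metric.MCauchy u"
    then have uB: "u n \<in> B" for n using B.cauchy_carrier by fastforce
    have "cauchy u"
      using u unfolding metric.MCauchy_def B.metric.MCauchy_def by (auto simp: eq uB carr)
    then obtain l where l: "limitin metric.mtopology u l sequentially"
      using complete unfolding metric.mcomplete_def by blast
    have "closedin metric.mtopology B" using sub by (simp add: atop_def)
    moreover have "range u \<subseteq> B" using uB by (rule image_subsetI)
    ultimately have "l \<in> B"
      using l unfolding metric.metric_closedin_iff_sequentially_closed by metis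
    then have "limitin B.metric.mtopology u l sequentially"
      using l unfolding metric.limit_metric_sequentially B.metric.limit_metric_sequentially
      by (simp add: eq uB carr)
    then show "\<exists>x. limitin B.metric.mtopology u x sequentially" by blast
  qed
qed

text \<open>\<open>continuous_extension\<close> is a definite description, so it takes existence and
  uniqueness of the limit to evaluate it. Existence is \<open>lim\<close>. Uniqueness follows in a
  metric target once the filter is nontrivial, and this is where \<open>dense\<close>
  enters.\<close>

lemma continuous_extension_metric_eqI:
  assumes M1: "Metric_space M1 d1" and M2: "Metric_space M2 d2"
    and x: "x \<in> M1" and y: "y \<in> M2"
    and j: "\<And>p. p \<in> P \<Longrightarrow> j p \<in> M1" and f: "\<And>p. p \<in> P \<Longrightarrow> f p \<in> M2"
    and dense: "\<And>e. 0 < e \<Longrightarrow> \<exists>p\<in>P. d1 (j p) x < e"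
    and lim: "\<And>e. 0 < e \<Longrightarrow> \<exists>d>0. \<forall>p\<in>P. d1 (j p) x < d \<longrightarrow> d2 (f p) y < e"
  shows "continuous_extension (Metric_space.mtopology M1 d1) j P (Metric_space.mtopology M2 d2) f x = y"
proof -
  interpret M1: Metric_space M1 d1 by fact
  interpret M2: Metric_space M2 d2 by fact
  let ?F = "inf (filtercomap j (nhdsin M1.mtopology x)) (principal P)"
  \<comment> \<open>Unfolded form of the filter: neighbourhoods of \<open>x\<close>, pulled back
    along \<open>j\<close> and cut down to \<open>P\<close>.\<close>
  have ev: "eventually Q ?F \<longleftrightarrow> (\<exists>U. openin M1.mtopology U \<and> x \<in> U \<and> (\<forall>p\<in>P. j p \<in> U \<longrightarrow> Q p))" for Q
  proof
    assume "eventually Q ?F"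
    then obtain R where R: "eventually R (nhdsin M1.mtopology x)" "\<And>p. R (j p) \<Longrightarrow> p \<in> P \<Longrightarrow> Q p"
      by (auto simp: eventually_inf_principal eventually_filtercomap)
    then obtain U where "openin M1.mtopology U" "x \<in> U" "\<forall>y\<in>U. R y"
      using x by (auto simp: eventually_nhdsin)
    then show "\<exists>U. openin M1.mtopology U \<and> x \<in> U \<and> (\<forall>p\<in>P. j p \<in> U \<longrightarrow> Q p)" using R(2) by blast
  next
    assume "\<exists>U. openin M1.mtopology U \<and> x \<in> U \<and> (\<forall>p\<in>P. j p \<in> U \<longrightarrow> Q p)"
    then obtain U where U: "openin M1.mtopology U" "x \<in> U" "\<forall>p\<in>P. j p \<in> U \<longrightarrow> Q p" by blast
    have "eventually (\<lambda>y. y \<in> U) (nhdsin M1.mtopology x)" using U by (auto simp: eventually_nhdsin)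
    then show "eventually Q ?F"
      using U(3) by (auto simp: eventually_inf_principal eventually_filtercomap)
  qed
  have nontriv: "\<not> trivial_limit ?F"
  proof
    assume "trivial_limit ?F"
    then obtain U where U: "openin M1.mtopology U" "x \<in> U" "\<forall>p\<in>P. j p \<notin> U"
      using ev[of "\<lambda>p. False"] by (auto simp: trivial_limit_def)
    then obtain r where r: "0 < r" "M1.mball x r \<subseteq> U" by (auto simp: M1.openin_mtopology)
    obtain p where p: "p \<in> P" "d1 (j p) x < r" using dense[OF r(1)] by blast
    have "j p \<in> M1.mball x r" using p j x by (simp add: M1.commute)
    then show False using U(3) r(2) p by blast
  qed
  have limy: "limitin M2.mtopology f y ?F"
    unfolding M2.limitin_metric
  proof (intro conjI allI impI y)
    fix e :: real assume "0 < e"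
    then obtain d where d: "0 < d" "\<forall>p\<in>P. d1 (j p) x < d \<longrightarrow> d2 (f p) y < e" using lim by blast
    have "openin M1.mtopology (M1.mball x d) \<and> x \<in> M1.mball x d \<and>
        (\<forall>p\<in>P. j p \<in> M1.mball x d \<longrightarrow> f p \<in> M2 \<and> d2 (f p) y < e)"
      using d f x by (auto simp: M1.commute)
    then show "eventually (\<lambda>p. f p \<in> M2 \<and> d2 (f p) y < e) ?F" unfolding ev by blast
  qed
  show ?thesis
    unfolding continuous_extension_def
    using limy by (rule the_equality) (rule M2.limitin_metric_unique[OF _ limy nontriv])
qed

section \<open>Groupoids\<close>

lemma composableD:
  assumes "(g, h) \<in> composable G" shows "g \<in> arrows G" "h \<in> arrows G" "src G g = rng G h"
  using assms by (simp_all add: composable_def)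

context topological_groupoid
begin

lemma src_inv [simp]: "g \<in> arrows G \<Longrightarrow> src G (ginv G g) = rng G g"
  by (simp add: src_def rng_def inv_inv)

lemma rng_inv [simp]: "g \<in> arrows G \<Longrightarrow> rng G (ginv G g) = src G g"
  by (simp add: src_def rng_def inv_inv)

declare inv_closed [simp] inv_inv [simp] src_mult [simp] rng_mult [simp] mult_closed [simp]
  mult_src [simp] rng_mult_self [simp]

lemma inv_composable [simp]:
  "g \<in> arrows G \<Longrightarrow> (ginv G g, g) \<in> composable G"
  "g \<in> arrows G \<Longrightarrow> (g, ginv G g) \<in> composable G"
  by (simp_all add: composable_def)

lemma src_closed [simp]: "g \<in> arrows G \<Longrightarrow> src G g \<in> arrows G"
  unfolding src_def by simp

lemma rng_closed [simp]: "g \<in> arrows G \<Longrightarrow> rng G g \<in> arrows G"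
  unfolding rng_def by simp

lemma mult_inv [simp]: "g \<in> arrows G \<Longrightarrow> gmult G g (ginv G g) = rng G g"
  by (simp add: rng_def)

lemma inv_mult_self [simp]: "g \<in> arrows G \<Longrightarrow> gmult G (ginv G g) g = src G g"
  by (simp add: src_def)

lemma src_src [simp]: "g \<in> arrows G \<Longrightarrow> src G (src G g) = src G g"
  by (metis src_mult inv_composable(1) inv_mult_self)

lemma rng_src [simp]: "g \<in> arrows G \<Longrightarrow> rng G (src G g) = src G g"
  by (metis rng_mult inv_composable(1) inv_mult_self rng_inv)

lemma src_rng [simp]: "g \<in> arrows G \<Longrightarrow> src G (rng G g) = rng G g"
  by (metis src_mult inv_composable(2) mult_inv src_inv)

lemma rng_rng [simp]: "g \<in> arrows G \<Longrightarrow> rng G (rng G g) = rng G g"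
  by (metis rng_mult inv_composable(2) mult_inv)

lemma units_iff: "x \<in> units G \<longleftrightarrow> x \<in> arrows G \<and> src G x = x"
  by (force simp: units_def)

lemma unit_arrow [simp]: "x \<in> units G \<Longrightarrow> x \<in> arrows G"
  by (simp add: units_iff)

lemma src_unit [simp]: "x \<in> units G \<Longrightarrow> src G x = x"
  by (simp add: units_iff)

lemma rng_unit [simp]: "x \<in> units G \<Longrightarrow> rng G x = x"
  using rng_src[of x] by simp

lemma src_in_units [simp]: "g \<in> arrows G \<Longrightarrow> src G g \<in> units G"
  unfolding units_iff by simp

lemma rng_in_units [simp]: "g \<in> arrows G \<Longrightarrow> rng G g \<in> units G"
  unfolding units_iff by simp

lemma inv_unit [simp]: "x \<in> units G \<Longrightarrow> ginv G x = x"
  using mult_inv[of x] rng_mult_self[of "ginv G x"] by simp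

lemma mult_unit: "\<lbrakk>g \<in> arrows G; x = src G g\<rbrakk> \<Longrightarrow> gmult G g x = g"
  by simp

lemma unit_mult: "\<lbrakk>g \<in> arrows G; x = rng G g\<rbrakk> \<Longrightarrow> gmult G x g = g"
  by simp

lemma inv_mult_cancel: "(g, h) \<in> composable G \<Longrightarrow> gmult G (ginv G g) (gmult G g h) = h"
  using mult_assoc[of "ginv G g" g h] composableD[of g h G] by simp

lemma mult_inv_cancel: "(g, h) \<in> composable G \<Longrightarrow> gmult G (gmult G g h) (ginv G h) = g"
  using mult_assoc[of g h "ginv G h"] composableD[of g h G] by (simp add: mult_unit)

lemma inv_mult:
  assumes "(g, h) \<in> composable G"
  shows "ginv G (gmult G g h) = gmult G (ginv G h) (ginv G g)"
proof -
  note c = composableD[OF assms]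
  let ?k = "gmult G (ginv G h) (ginv G g)"
  have k: "(ginv G h, ginv G g) \<in> composable G" using c by (simp add: composable_def)
  have gh: "(gmult G g h, ?k) \<in> composable G" using assms c k by (simp add: composable_def)
  have "gmult G (gmult G g h) ?k = gmult G (gmult G (gmult G g h) (ginv G h)) (ginv G g)"
    using assms c k by (intro mult_assoc[symmetric]) (simp_all add: composable_def)
  also have "\<dots> = rng G g" using assms c by (simp add: mult_inv_cancel)
  finally have "?k = gmult G (ginv G (gmult G g h)) (rng G g)"
    using inv_mult_cancel[OF gh] by simp
  also have "\<dots> = ginv G (gmult G g h)" using assms c by (intro mult_unit) simp_all
  finally show ?thesis by simp
qed

text \<open>Cancelling \<open>e\<close> on the left of \<open>gmult G e e = e\<close> leaves the
  source of \<open>e\<close> equal to \<open>e\<close>.\<close>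

lemma idempotent_unit:
  assumes "e \<in> arrows G" "(e, e) \<in> composable G" "gmult G e e = e" shows "e \<in> units G"
  unfolding units_iff using inv_mult_cancel[OF assms(2)] assms by simp

end

locale groupoid_morphism = A: topological_groupoid A + B: topological_groupoid B
  for A :: "'a groupoid_data" and B :: "'b groupoid_data" +
  fixes f assumes hom: "groupoid_hom A B f"
begin

lemma map_closed [simp]: "g \<in> arrows A \<Longrightarrow> f g \<in> arrows B"
  using hom by (auto simp: groupoid_hom_def)

lemma map_composable: "(g, h) \<in> composable A \<Longrightarrow> (f g, f h) \<in> composable B"
  using hom by (auto simp: groupoid_hom_def)

lemma map_mult: "(g, h) \<in> composable A \<Longrightarrow> f (gmult A g h) = gmult B (f g) (f h)"
  using hom by (auto simp: groupoid_hom_def)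

text \<open>\<open>groupoid_hom\<close> speaks only of products; that sources, inverses and ranges
  are preserved has to be derived. Here \<open>f g\<close> is cancelled on the left of the image of
  \<open>g\<close> times its source.\<close>

lemma map_src:
  assumes g: "g \<in> arrows A" shows "f (src A g) = src B (f g)"
proof -
  have c: "(g, src A g) \<in> composable A" using g by (simp add: composable_def)
  have "gmult B (f g) (f (src A g)) = f g" using map_mult[OF c] g by simp
  then show ?thesis using B.inv_mult_cancel[OF map_composable[OF c]] g by simp
qed

lemma map_inv:
  assumes g: "g \<in> arrows A" shows "f (ginv A g) = ginv B (f g)"
proof -
  have c: "(ginv A g, g) \<in> composable A" using g by simp
  have "gmult B (f (ginv A g)) (f g) = src B (f g)" using map_mult[OF c] g by (simp add: map_src)
  then have "gmult B (src B (f g)) (ginv B (f g)) = f (ginv A g)"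
    using B.mult_inv_cancel[OF map_composable[OF c]] by simp
  then show ?thesis using g by (simp add: B.unit_mult)
qed

lemma map_rng: "g \<in> arrows A \<Longrightarrow> f (rng A g) = rng B (f g)"
  using map_src[of "ginv A g"] by (simp add: map_inv)

end

section \<open>The circle action and lifts\<close>

lemma circle_mult: "\<lbrakk>z \<in> circle; w \<in> circle\<rbrakk> \<Longrightarrow> z * w \<in> circle"
  by (simp add: norm_mult)

lemma circle_cnj_mult: "z \<in> circle \<Longrightarrow> cnj z * z = 1"
  by (simp add: complex_norm_square[symmetric] mult.commute)

lemma circle_inverse: "z \<in> circle \<Longrightarrow> inverse z = cnj z"
  using circle_cnj_mult[of z] by (intro inverse_unique) (simp add: mult.commute)

context twist
begin

sublocale q: groupoid_morphism S G q
  by unfold_locales (rule q_hom)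

declare q.map_src [simp] q.map_rng [simp] q.map_inv [simp]

lemma arrows_circle_bundle: "arrows (circle_bundle G) = circle \<times> units G"
  using Base.unit_arrow by (auto simp: arrows_def circle_bundle_def)

lemma circle_bundle_composable:
  assumes "z \<in> circle" "w \<in> circle" "x \<in> units G"
  shows "((z, x), (w, x)) \<in> composable (circle_bundle G)"
  using assms circle_cnj_mult[of z] circle_cnj_mult[of w]
  by (simp add: composable_def arrows_circle_bundle src_def rng_def circle_inverse)
     (simp add: circle_bundle_def circle_inverse mult.commute)

lemma iota_closed [simp]: "\<lbrakk>z \<in> circle; x \<in> units G\<rbrakk> \<Longrightarrow> \<iota> (z, x) \<in> arrows S"
  using iota_hom unfolding groupoid_hom_def arrows_circle_bundle by blast

lemma iota_composable:
  "\<lbrakk>z \<in> circle; w \<in> circle; x \<in> units G\<rbrakk> \<Longrightarrow> (\<iota> (z, x), \<iota> (w, x)) \<in> composable S"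
  using iota_hom circle_bundle_composable[of z w x] unfolding groupoid_hom_def by blast

lemma iota_mult:
  assumes "z \<in> circle" "w \<in> circle" "x \<in> units G"
  shows "gmult S (\<iota> (z, x)) (\<iota> (w, x)) = \<iota> (z * w, x)"
proof -
  have "\<iota> (gmult (circle_bundle G) (z, x) (w, x)) = gmult S (\<iota> (z, x)) (\<iota> (w, x))"
    using iota_hom circle_bundle_composable[OF assms] unfolding groupoid_hom_def by blast
  then show ?thesis by (simp add: circle_bundle_def)
qed

lemma iota_one_unit: "x \<in> units G \<Longrightarrow> \<iota> (1, x) \<in> units S"
  using iota_composable[of 1 1 x] iota_mult[of 1 1 x] by (intro Sigma.idempotent_unit) simp_all

lemma src_iota [simp]: "\<lbrakk>z \<in> circle; x \<in> units G\<rbrakk> \<Longrightarrow> src S (\<iota> (z, x)) = \<iota> (1, x)"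
  using iota_composable[of z 1 x] iota_one_unit[of x] by (simp add: composable_def)

lemma rng_iota [simp]: "\<lbrakk>z \<in> circle; x \<in> units G\<rbrakk> \<Longrightarrow> rng S (\<iota> (z, x)) = \<iota> (1, x)"
  using iota_composable[of 1 z x] iota_one_unit[of x] by (simp add: composable_def)

lemma q_iota [simp]:
  assumes "z \<in> circle" "x \<in> units G" shows "q (\<iota> (z, x)) = x"
proof -
  have "\<iota> (z, x) \<in> {\<gamma> \<in> arrows S. q \<gamma> \<in> units G}" using assms by (subst exact) blast
  then have "q (\<iota> (z, x)) = src G (q (\<iota> (z, x)))" by simp
  also have "\<dots> = q (\<iota> (1, x))" using assms q.map_src[of "\<iota> (z, x)"] by simp
  finally show ?thesis using assms by (simp add: identification)
qed

lemma inv_iota: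
  assumes "z \<in> circle" "x \<in> units G" shows "ginv S (\<iota> (z, x)) = \<iota> (cnj z, x)"
proof -
  have "gmult S (\<iota> (cnj z, x)) (\<iota> (z, x)) = \<iota> (1, x)"
    using assms by (simp add: iota_mult circle_cnj_mult)
  then have "\<iota> (cnj z, x) = gmult S (\<iota> (1, x)) (ginv S (\<iota> (z, x)))"
    using Sigma.mult_inv_cancel[OF iota_composable[of "cnj z" z x]] assms by simp
  also have "\<dots> = ginv S (\<iota> (z, x))" using assms by (intro Sigma.unit_mult) simp_all
  finally show ?thesis by simp
qed

lemma q_inj_units: "\<lbrakk>x \<in> units S; y \<in> units S; q x = q y\<rbrakk> \<Longrightarrow> x = y"
  using q_units Sigma.unit_arrow
  by (auto simp: homeomorphic_eq_everything_map arrows_def inj_on_def)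

lemma unit_eq_iota: "x \<in> units S \<Longrightarrow> x = \<iota> (1, q x)"
proof -
  assume x: "x \<in> units S"
  then have "q x \<in> units G" unfolding Base.units_iff using q.map_src[of x] by simp
  then show ?thesis using x by (intro q_inj_units iota_one_unit) (simp_all add: identification)
qed

lemma src_eq_iff: "\<lbrakk>\<gamma> \<in> arrows S; \<eta> \<in> arrows S\<rbrakk> \<Longrightarrow> src S \<gamma> = rng S \<eta> \<longleftrightarrow> src G (q \<gamma>) = rng G (q \<eta>)"
  using q_inj_units[of "src S \<gamma>" "rng S \<eta>"] q.map_src q.map_rng by (metis Sigma.rng_in_units Sigma.src_in_units)

text \<open>Since \<open>q\<close> is injective on units, composability in \<open>S\<close> can be
  decided in \<open>G\<close>. Later proofs check it there.\<close>

lemma composable_iff_q: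
  "\<lbrakk>\<gamma> \<in> arrows S; \<eta> \<in> arrows S\<rbrakk> \<Longrightarrow> (\<gamma>, \<eta>) \<in> composable S \<longleftrightarrow> src G (q \<gamma>) = rng G (q \<eta>)"
  by (simp add: composable_def src_eq_iff)

lemma iota_rng_composable:
  "\<lbrakk>z \<in> circle; \<gamma> \<in> arrows S\<rbrakk> \<Longrightarrow> (\<iota> (z, rng G (q \<gamma>)), \<gamma>) \<in> composable S"
  by (simp add: composable_iff_q)

lemma iota_src_composable:
  "\<lbrakk>z \<in> circle; \<gamma> \<in> arrows S\<rbrakk> \<Longrightarrow> (\<gamma>, \<iota> (z, src G (q \<gamma>))) \<in> composable S"
  by (simp add: composable_iff_q)

lemma act_eq: "\<gamma> \<in> arrows S \<Longrightarrow> act z \<gamma> = gmult S (\<iota> (z, rng G (q \<gamma>))) \<gamma>"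
  by (simp add: act_def)

lemma act_eq_right:
  "\<lbrakk>z \<in> circle; \<gamma> \<in> arrows S\<rbrakk> \<Longrightarrow> act z \<gamma> = gmult S \<gamma> (\<iota> (z, src G (q \<gamma>)))"
  using central[of z \<gamma>] by (simp add: act_eq)

lemma act_closed [simp]: "\<lbrakk>z \<in> circle; \<gamma> \<in> arrows S\<rbrakk> \<Longrightarrow> act z \<gamma> \<in> arrows S"
  using iota_rng_composable by (simp add: act_eq)

lemma src_act [simp]: "\<lbrakk>z \<in> circle; \<gamma> \<in> arrows S\<rbrakk> \<Longrightarrow> src S (act z \<gamma>) = src S \<gamma>"
  using iota_rng_composable by (simp add: act_eq)

lemma q_act [simp]: "\<lbrakk>z \<in> circle; \<gamma> \<in> arrows S\<rbrakk> \<Longrightarrow> q (act z \<gamma>) = q \<gamma>"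
  using iota_rng_composable by (simp add: act_eq q.map_mult)

lemma rng_act [simp]: "\<lbrakk>z \<in> circle; \<gamma> \<in> arrows S\<rbrakk> \<Longrightarrow> rng S (act z \<gamma>) = rng S \<gamma>"
  using q_inj_units[of "rng S (act z \<gamma>)" "rng S \<gamma>"] by simp

lemma act_one [simp]: "\<gamma> \<in> arrows S \<Longrightarrow> act 1 \<gamma> = \<gamma>"
  using unit_eq_iota[of "rng S \<gamma>"] Sigma.rng_mult_self[of \<gamma>] by (simp add: act_eq)

lemma act_act:
  assumes "z \<in> circle" "w \<in> circle" "\<gamma> \<in> arrows S"
  shows "act z (act w \<gamma>) = act (z * w) \<gamma>"
proof -
  have "act z (act w \<gamma>) = gmult S (\<iota> (z, rng G (q \<gamma>))) (gmult S (\<iota> (w, rng G (q \<gamma>))) \<gamma>)"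
    using assms by (simp add: act_eq[of "act w \<gamma>"]) (simp add: act_eq)
  also have "\<dots> = gmult S (gmult S (\<iota> (z, rng G (q \<gamma>))) (\<iota> (w, rng G (q \<gamma>)))) \<gamma>"
    using assms iota_rng_composable by (intro Sigma.mult_assoc[symmetric] iota_composable) simp_all
  finally show ?thesis using assms by (simp add: iota_mult act_eq)
qed

lemma act_mult_left:
  assumes "z \<in> circle" "(\<gamma>, \<eta>) \<in> composable S"
  shows "gmult S (act z \<gamma>) \<eta> = act z (gmult S \<gamma> \<eta>)"
proof -
  note c = composableD[OF assms(2)]
  have "act z (gmult S \<gamma> \<eta>) = gmult S (\<iota> (z, rng G (q \<gamma>))) (gmult S \<gamma> \<eta>)"
    using assms c q.map_composable[OF assms(2)] by (simp add: act_eq q.map_mult)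
  also have "\<dots> = gmult S (gmult S (\<iota> (z, rng G (q \<gamma>))) \<gamma>) \<eta>"
    using assms c iota_rng_composable by (intro Sigma.mult_assoc[symmetric]) simp_all
  finally show ?thesis using c by (simp add: act_eq)
qed

lemma act_mult_right:
  assumes "z \<in> circle" "(\<gamma>, \<eta>) \<in> composable S"
  shows "gmult S \<gamma> (act z \<eta>) = act z (gmult S \<gamma> \<eta>)"
proof -
  note c = composableD[OF assms(2)]
  have s: "src G (q \<gamma>) = rng G (q \<eta>)" using composableD(3)[OF q.map_composable[OF assms(2)]] .
  have "gmult S \<gamma> (act z \<eta>) = gmult S \<gamma> (gmult S (\<iota> (z, rng G (q \<eta>))) \<eta>)"
    using c by (simp add: act_eq)
  also have "\<dots> = gmult S (gmult S \<gamma> (\<iota> (z, src G (q \<gamma>)))) \<eta>"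
    using assms c s iota_rng_composable[of z \<eta>] iota_src_composable[of z \<gamma>]
    by (subst Sigma.mult_assoc) simp_all
  also have "\<dots> = gmult S (act z \<gamma>) \<eta>" using assms c by (simp add: act_eq_right)
  finally show ?thesis using assms by (simp add: act_mult_left)
qed

lemma inv_act:
  assumes "z \<in> circle" "\<gamma> \<in> arrows S"
  shows "ginv S (act z \<gamma>) = act (cnj z) (ginv S \<gamma>)"
  using assms iota_rng_composable[of z \<gamma>] act_eq_right[of "cnj z" "ginv S \<gamma>"]
  by (simp add: act_eq[of \<gamma>] Sigma.inv_mult inv_iota)

text \<open>The product of \<open>\<eta>\<close> with the inverse of \<open>\<gamma>\<close> lies
  over a unit, so exactness writes it as some \<open>\<iota> (z, x)\<close>. Multiplying back by
  \<open>\<gamma>\<close> turns this into the action of \<open>z\<close>.\<close>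

lemma same_fibre:
  assumes "\<gamma> \<in> arrows S" "\<eta> \<in> arrows S" "q \<gamma> = q \<eta>"
  shows "\<exists>z\<in>circle. \<eta> = act z \<gamma>"
proof -
  have c: "(\<eta>, ginv S \<gamma>) \<in> composable S" using assms by (simp add: composable_iff_q)
  let ?e = "gmult S \<eta> (ginv S \<gamma>)"
  have qe: "q ?e = rng G (q \<gamma>)" using assms c by (simp add: q.map_mult)
  then have "?e \<in> \<iota> ` (circle \<times> units G)"
    using assms c by (subst exact[symmetric]) simp
  then obtain z x where z: "z \<in> circle" "x \<in> units G" "?e = \<iota> (z, x)" by blast
  then have "x = rng G (q \<gamma>)" using qe by simp
  then have "act z \<gamma> = gmult S ?e \<gamma>" using z assms by (simp add: act_eq)
  also have "\<dots> = \<eta>" using Sigma.mult_inv_cancel[OF c] assms by simp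
  finally show ?thesis using z by auto
qed

lemma act_inj:
  assumes "z \<in> circle" "w \<in> circle" "\<gamma> \<in> arrows S" "act z \<gamma> = act w \<gamma>"
  shows "z = w"
proof -
  have "\<iota> (z, rng G (q \<gamma>)) = \<iota> (w, rng G (q \<gamma>))"
    using Sigma.mult_inv_cancel[OF iota_rng_composable[of z \<gamma>]]
      Sigma.mult_inv_cancel[OF iota_rng_composable[of w \<gamma>]] assms by (metis act_eq)
  from inj_onD[OF iota_inj this] show ?thesis using assms by simp
qed

lemma lift: "h \<in> arrows G \<Longrightarrow> lift h \<in> arrows S \<and> q (lift h) = h"
  unfolding lift_def using q_surj by (intro someI_ex[where P = "\<lambda>\<eta>. \<eta> \<in> arrows S \<and> q \<eta> = h"]) force

lemma lift_closed [simp]: "h \<in> arrows G \<Longrightarrow> lift h \<in> arrows S"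
  and q_lift [simp]: "h \<in> arrows G \<Longrightarrow> q (lift h) = h"
  using lift by blast+

text \<open>The algebraic part of membership in \<open>Cc\<close>, kept apart from continuity and
  support because vectors in \<open>hilb x\<close> and limits \<open>coeff a\<close> satisfy it as
  well.\<close>

definition equivariant :: "('s \<Rightarrow> complex) \<Rightarrow> bool" where
  "equivariant f \<longleftrightarrow> (\<forall>\<gamma>. \<gamma> \<notin> arrows S \<longrightarrow> f \<gamma> = 0) \<and>
     (\<forall>z\<in>circle. \<forall>\<gamma>\<in>arrows S. f (act z \<gamma>) = cnj z * f \<gamma>)"

lemma equivariant_off: "\<lbrakk>equivariant f; \<gamma> \<notin> arrows S\<rbrakk> \<Longrightarrow> f \<gamma> = 0"
  by (simp add: equivariant_def)

lemma equivariant_act: "\<lbrakk>equivariant f; z \<in> circle; \<gamma> \<in> arrows S\<rbrakk> \<Longrightarrow> f (act z \<gamma>) = cnj z * f \<gamma>"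
  by (simp add: equivariant_def)

lemma equivariant_norm_eq:
  assumes "equivariant f" "\<gamma> \<in> arrows S" "\<eta> \<in> arrows S" "q \<gamma> = q \<eta>"
  shows "cmod (f \<gamma>) = cmod (f \<eta>)"
  using same_fibre[OF assms(2-4)] assms by (auto simp: equivariant_act norm_mult)

lemma equivariant_zero_iff:
  assumes "equivariant f" "\<gamma> \<in> arrows S" "\<eta> \<in> arrows S" "q \<gamma> = q \<eta>"
  shows "f \<gamma> = 0 \<longleftrightarrow> f \<eta> = 0"
  using equivariant_norm_eq[OF assms] by auto

lemma base_fibreI: "\<lbrakk>h \<in> arrows G; src G h = x\<rbrakk> \<Longrightarrow> h \<in> base_fibre x"
  by (simp add: base_fibre_def)

lemma base_fibreD [simp]: "h \<in> base_fibre x \<Longrightarrow> h \<in> arrows G" "h \<in> base_fibre x \<Longrightarrow> src G h = x"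
  by (auto simp: base_fibre_def)

lemma base_fibre_composable: 
  "\<lbrakk>h \<in> base_fibre x; k \<in> base_fibre x\<rbrakk> \<Longrightarrow> (h, ginv G k) \<in> composable G"
  by (simp add: composable_def)

definition kernel :: "('s \<Rightarrow> complex) \<Rightarrow> 'g \<Rightarrow> 'g \<Rightarrow> complex" where
  "kernel f h k = f (gmult S (lift h) (ginv S (lift k)))"

text \<open>The sum defining \<open>conv\<close> runs over \<open>h\<close> with the range of \<open>\<gamma>\<close>; substituting
  \<open>h = q \<gamma> l\<^sup>-\<^sup>1\<close> turns it into a product of kernels.\<close>

lemma conv_mult_inv:
  assumes f: "equivariant f" and g: "equivariant g"
    and \<gamma>: "\<gamma> \<in> arrows S" and \<kappa>: "\<kappa> \<in> arrows S" and eq: "src S \<gamma> = src S \<kappa>"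
  shows "conv f g (gmult S \<gamma> (ginv S \<kappa>))
    = (\<Sum>\<^sub>\<infinity>l\<in>base_fibre (src G (q \<gamma>)). f (gmult S \<gamma> (ginv S (lift l))) * g (gmult S (lift l) (ginv S \<kappa>)))"
proof -
  let ?x = "src G (q \<gamma>)"
  let ?\<tau> = "gmult S \<gamma> (ginv S \<kappa>)"
  let ?H = "{h \<in> arrows G. rng G h = rng G (q ?\<tau>)}"
  have eq': "src G (q \<gamma>) = src G (q \<kappa>)" using arg_cong[OF eq, of q] \<gamma> \<kappa> by simp
  have c: "(\<gamma>, ginv S \<kappa>) \<in> composable S" using \<gamma> \<kappa> eq' by (simp add: composable_iff_q)
  have \<tau>: "?\<tau> \<in> arrows S" "rng G (q ?\<tau>) = rng G (q \<gamma>)"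
    using c \<gamma> q.map_composable[OF c] \<kappa> by (simp_all add: q.map_mult)
  have "bij_betw (\<lambda>l. gmult G (q \<gamma>) (ginv G l)) (base_fibre ?x) ?H"
  proof (rule bij_betw_byWitness[where f' = "\<lambda>h. gmult G (ginv G h) (q \<gamma>)"])
    show "\<forall>l\<in>base_fibre ?x. gmult G (ginv G (gmult G (q \<gamma>) (ginv G l))) (q \<gamma>) = l"
    proof
      fix l assume l: "l \<in> base_fibre ?x"
      have c': "(q \<gamma>, ginv G l) \<in> composable G" "(l, ginv G (q \<gamma>)) \<in> composable G"
        using l \<gamma> by (auto simp: composable_def)
      then show "gmult G (ginv G (gmult G (q \<gamma>) (ginv G l))) (q \<gamma>) = l"
        using l \<gamma> Base.mult_inv_cancel[OF c'(2)] by (simp add: Base.inv_mult)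
    qed
    show "\<forall>h\<in>?H. gmult G (q \<gamma>) (ginv G (gmult G (ginv G h) (q \<gamma>))) = h"
    proof
      fix h assume h: "h \<in> ?H"
      have c': "(ginv G h, q \<gamma>) \<in> composable G" "(ginv G (q \<gamma>), h) \<in> composable G"
        using h \<gamma> \<tau> by (auto simp: composable_def)
      then show "gmult G (q \<gamma>) (ginv G (gmult G (ginv G h) (q \<gamma>))) = h"
        using h \<gamma> Base.inv_mult_cancel[OF c'(2)] by (simp add: Base.inv_mult)
    qed
    show "(\<lambda>l. gmult G (q \<gamma>) (ginv G l)) ` base_fibre ?x \<subseteq> ?H"
    proof (intro image_subsetI)
      fix l assume "l \<in> base_fibre ?x"
      then have "(q \<gamma>, ginv G l) \<in> composable G" using \<gamma> by (auto simp: composable_def)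
      then show "gmult G (q \<gamma>) (ginv G l) \<in> ?H" using \<tau> by simp
    qed
    show "(\<lambda>h. gmult G (ginv G h) (q \<gamma>)) ` ?H \<subseteq> base_fibre ?x"
    proof (intro image_subsetI)
      fix h assume "h \<in> ?H"
      then have "(ginv G h, q \<gamma>) \<in> composable G" using \<gamma> \<tau> by (auto simp: composable_def)
      then show "gmult G (ginv G h) (q \<gamma>) \<in> base_fibre ?x" by (intro base_fibreI) (use \<gamma> in simp_all)
    qed
  qed
  from infsum_reindex_bij_betw[OF this, of "\<lambda>h. f (lift h) * g (gmult S (ginv S (lift h)) ?\<tau>)"]
  have "conv f g ?\<tau> = (\<Sum>\<^sub>\<infinity>l\<in>base_fibre ?x. f (lift (gmult G (q \<gamma>) (ginv G l)))
      * g (gmult S (ginv S (lift (gmult G (q \<gamma>) (ginv G l)))) ?\<tau>))"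
    using \<tau> by (simp add: conv_def)
  also have "\<dots> = (\<Sum>\<^sub>\<infinity>l\<in>base_fibre ?x.
      f (gmult S \<gamma> (ginv S (lift l))) * g (gmult S (lift l) (ginv S \<kappa>)))"
  proof (rule infsum_cong)
    fix l assume l: "l \<in> base_fibre ?x"
    let ?\<eta> = "gmult S \<gamma> (ginv S (lift l))" and ?\<eta>' = "lift (gmult G (q \<gamma>) (ginv G l))"
    have cG: "(q \<gamma>, ginv G l) \<in> composable G" using l \<gamma> by (auto simp: composable_def)
    have c1: "(\<gamma>, ginv S (lift l)) \<in> composable S" using l \<gamma> by (simp add: composable_iff_q)
    have c2: "(lift l, ginv S \<gamma>) \<in> composable S" using l \<gamma> by (simp add: composable_iff_q)
    have "q ?\<eta> = q ?\<eta>'" using l cG c1 by (simp add: q.map_mult)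
    \<comment> \<open>The lift chosen for the arrow and the product of lifts differ by a phase
      \<open>z\<close>. It enters through \<open>f\<close> as \<open>cnj z\<close> and through
      \<open>g\<close> as \<open>z\<close>, so it cancels.\<close>
    then obtain z where z: "z \<in> circle" "?\<eta>' = act z ?\<eta>"
      using same_fibre[of ?\<eta> ?\<eta>'] c1 cG by auto
    have inv: "ginv S ?\<eta> = gmult S (lift l) (ginv S \<gamma>)"
      using c1 l by (simp add: Sigma.inv_mult)
    have ci: "(gmult S (lift l) (ginv S \<gamma>), \<gamma>) \<in> composable S"
      "(gmult S (lift l) (ginv S \<gamma>), ?\<tau>) \<in> composable S"
      using c c2 \<gamma> by (simp_all add: composable_def)
    have "gmult S (ginv S ?\<eta>) ?\<tau> = gmult S (gmult S (gmult S (lift l) (ginv S \<gamma>)) \<gamma>) (ginv S \<kappa>)"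
      unfolding inv using ci c by (intro Sigma.mult_assoc[symmetric]) simp_all
    also have "\<dots> = gmult S (lift l) (ginv S \<kappa>)" using Sigma.mult_inv_cancel[OF c2] \<gamma> by simp
    finally have e: "gmult S (ginv S ?\<eta>) ?\<tau> = gmult S (lift l) (ginv S \<kappa>)" .
    have c3: "(lift l, ginv S \<kappa>) \<in> composable S" using l \<kappa> eq' by (simp add: composable_iff_q)
    have "gmult S (ginv S ?\<eta>') ?\<tau> = act (cnj z) (gmult S (lift l) (ginv S \<kappa>))"
      using z c1 ci(2) by (simp add: inv_act act_mult_left inv e[unfolded inv])
    then show "f ?\<eta>' * g (gmult S (ginv S ?\<eta>') ?\<tau>) = f ?\<eta> * g (gmult S (lift l) (ginv S \<kappa>))"
      using z c1 c3 circle_cnj_mult[of z] equivariant_act[OF f z(1), of ?\<eta>]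
        equivariant_act[OF g, of "cnj z" "gmult S (lift l) (ginv S \<kappa>)"]
      by (simp add: mult_ac)
  qed
  finally show ?thesis .
qed

lemma kernel_conv:
  assumes "equivariant f" "equivariant g" "h \<in> base_fibre x" "k \<in> base_fibre x"
  shows "kernel (conv f g) h k = (\<Sum>\<^sub>\<infinity>l\<in>base_fibre x. kernel f h l * kernel g l k)"
proof -
  have "src S (lift h) = src S (lift k)"
    using assms by (intro q_inj_units) simp_all
  from conv_mult_inv[OF assms(1,2) _ _ this] show ?thesis
    using assms(3,4) by (simp add: kernel_def)
qed

lemma conv_eq:
  assumes "equivariant f" "equivariant g" "\<gamma> \<in> arrows S"
  shows "conv f g \<gamma> = (\<Sum>\<^sub>\<infinity>l\<in>base_fibre (src G (q \<gamma>)). f (gmult S \<gamma> (ginv S (lift l))) * g (lift l))"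
proof -
  have "gmult S (lift l) (src S \<gamma>) = lift l" if "l \<in> base_fibre (src G (q \<gamma>))" for l
    using that assms(3) by (intro Sigma.mult_unit q_inj_units) simp_all
  then show ?thesis
    using conv_mult_inv[OF assms(1,2,3), of "src S \<gamma>"] assms(3) by (simp cong: infsum_cong)
qed

lemma equivariant_conv:
  assumes "equivariant f" "equivariant g" shows "equivariant (conv f g)"
  unfolding equivariant_def
proof (intro conjI allI impI ballI)
  show "conv f g \<gamma> = 0" if "\<gamma> \<notin> arrows S" for \<gamma> using that by (simp add: conv_def)
  fix z \<gamma> assume z: "z \<in> circle" and \<gamma>: "\<gamma> \<in> arrows S"
  have "g (gmult S (ginv S (lift h)) (act z \<gamma>)) = cnj z * g (gmult S (ginv S (lift h)) \<gamma>)"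
    if "h \<in> arrows G" "rng G h = rng G (q \<gamma>)" for h
  proof -
    have "(ginv S (lift h), \<gamma>) \<in> composable S" using that \<gamma> by (simp add: composable_iff_q)
    then show ?thesis using z assms(2) by (simp add: act_mult_right equivariant_act)
  qed
  then have "conv f g (act z \<gamma>) = (\<Sum>\<^sub>\<infinity>h\<in>{h \<in> arrows G. rng G h = rng G (q \<gamma>)}.
      cnj z * (f (lift h) * g (gmult S (ginv S (lift h)) \<gamma>)))"
    using z \<gamma> by (auto simp: conv_def mult_ac intro!: infsum_cong)
  then show "conv f g (act z \<gamma>) = cnj z * conv f g \<gamma>"
    using \<gamma> by (simp add: conv_def infsum_cmult_right')
qed

lemma equivariant_invol: "equivariant f \<Longrightarrow> equivariant (invol f)"
  by (auto simp: equivariant_def invol_def inv_act)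

lemma kernel_invol:
  assumes "h \<in> base_fibre x" "k \<in> base_fibre x"
  shows "kernel (invol f) h k = cnj (kernel f k h)"
proof -
  have "(lift h, ginv S (lift k)) \<in> composable S" using assms by (simp add: composable_iff_q)
  then show ?thesis using assms by (simp add: kernel_def invol_def Sigma.inv_mult)
qed

text \<open>Every value of \<open>f\<close> is, up to a phase, a matrix entry in the column of a
  unit. The phase depends on \<open>\<gamma>\<close> alone and not on the function, so entries of
  different functions can be compared.\<close>

lemma kernel_src:
  assumes f: "equivariant f" and \<gamma>: "\<gamma> \<in> arrows S"
  shows "\<exists>z\<in>circle. \<forall>f. equivariant f \<longrightarrow> kernel f (q \<gamma>) (src G (q \<gamma>)) = z * f \<gamma>"
proof -
  let ?h = "q \<gamma>" and ?x = "src G (q \<gamma>)"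
  have c: "(lift ?h, ginv S (lift ?x)) \<in> composable S" using \<gamma> by (simp add: composable_iff_q)
  then have "q (gmult S (lift ?h) (ginv S (lift ?x))) = q \<gamma>"
    using \<gamma> by (simp add: q.map_mult)
  then obtain z where z: "z \<in> circle" "gmult S (lift ?h) (ginv S (lift ?x)) = act z \<gamma>"
    using same_fibre[OF \<gamma>, of "gmult S (lift ?h) (ginv S (lift ?x))"] c by auto
  show ?thesis using z \<gamma> by (intro bexI[of _ "cnj z"]) (auto simp: kernel_def equivariant_act)
qed

text \<open>This turns identities in the convolution algebra into identities between matrices, where
  \<open>conv\<close> is an ordinary matrix product and \<open>invol\<close> the adjoint.\<close>

lemma equivariant_eqI:
  assumes f: "equivariant f" and g: "equivariant g"
    and eq: "\<And>x h k. \<lbrakk>x \<in> units G; h \<in> base_fibre x; k \<in> base_fibre x\<rbrakk> \<Longrightarrow> kernel f h k = kernel g h k"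
  shows "f = g"
proof
  fix \<gamma> show "f \<gamma> = g \<gamma>"
  proof (cases "\<gamma> \<in> arrows S")
    case True
    obtain z where "z \<in> circle" "\<And>f. equivariant f \<Longrightarrow> kernel f (q \<gamma>) (src G (q \<gamma>)) = z * f \<gamma>"
      using kernel_src[OF f True] by blast
    moreover have "kernel f (q \<gamma>) (src G (q \<gamma>)) = kernel g (q \<gamma>) (src G (q \<gamma>))"
      using True by (intro eq[of "src G (q \<gamma>)"] base_fibreI) simp_all
    ultimately show ?thesis using f g by auto
  qed (simp add: equivariant_off f g)
qed

lemma hilb_equivariant:
  assumes "\<xi> \<in> hilb x" shows "equivariant \<xi>"
  unfolding equivariant_def
proof (intro conjI allI impI ballI)
  have off: "\<xi> \<gamma> = 0" if "\<gamma> \<notin> source_fibre x" for \<gamma> using that assms by (simp add: hilb_def)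
  then show "\<xi> \<gamma> = 0" if "\<gamma> \<notin> arrows S" for \<gamma> using that by (simp add: source_fibre_def)
  fix z \<gamma> assume "z \<in> circle" "\<gamma> \<in> arrows S"
  then show "\<xi> (act z \<gamma>) = cnj z * \<xi> \<gamma>"
    using assms off[of \<gamma>] off[of "act z \<gamma>"] by (cases "\<gamma> \<in> source_fibre x") (auto simp: hilb_def source_fibre_def)
qed

lemma regular_rep_eq:
  assumes f: "equivariant f" and \<xi>: "\<xi> \<in> hilb x" and h: "h \<in> base_fibre x"
  shows "regular_rep x f \<xi> (lift h) = (\<Sum>\<^sub>\<infinity>k\<in>base_fibre x. kernel f h k * \<xi> (lift k))"
proof -
  have "regular_rep x f \<xi> (lift h) = conv f \<xi> (lift h)"
    using h by (simp add: regular_rep_def conv_def source_fibre_def)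
  then show ?thesis
    using conv_eq[OF f hilb_equivariant[OF \<xi>], of "lift h"] h by (simp add: kernel_def)
qed

text \<open>The half with sources makes the columns of the kernel finite, the half with ranges its
  rows and the sum in \<open>conv\<close>.\<close>

definition fibre_finite :: "('s \<Rightarrow> complex) \<Rightarrow> bool" where
  "fibre_finite f \<longleftrightarrow> (\<forall>x\<in>units G. finite {h \<in> arrows G. src G h = x \<and> f (lift h) \<noteq> 0} \<and>
     finite {h \<in> arrows G. rng G h = x \<and> f (lift h) \<noteq> 0})"

lemma kernel_eq_zero_iff:
  assumes "equivariant f" "h \<in> base_fibre x" "k \<in> base_fibre x"
  shows "kernel f h k = 0 \<longleftrightarrow> f (lift (gmult G h (ginv G k))) = 0"
proof -
  have "(lift h, ginv S (lift k)) \<in> composable S" using assms by (simp add: composable_iff_q)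
  then show ?thesis
    unfolding kernel_def using assms base_fibre_composable[of h x k]
    by (intro equivariant_zero_iff) (simp_all add: q.map_mult)
qed

text \<open>Right multiplication by the inverse of \<open>k\<close> carries the support of this
  column into the arrows with source \<open>rng G k\<close> over which \<open>f\<close> does not
  vanish; multiplication by \<open>k\<close> undoes it.\<close>

lemma kernel_finite_column:
  assumes f: "equivariant f" "fibre_finite f" and k: "k \<in> base_fibre x"
  shows "finite {l \<in> base_fibre x. kernel f l k \<noteq> 0}"
proof (rule finite_subset)
  let ?H = "{h \<in> arrows G. src G h = rng G k \<and> f (lift h) \<noteq> 0}"
  show "finite ((\<lambda>h. gmult G h k) ` ?H)" using f k by (simp add: fibre_finite_def)
  show "{l \<in> base_fibre x. kernel f l k \<noteq> 0} \<subseteq> (\<lambda>h. gmult G h k) ` ?H"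
  proof
    fix l assume l: "l \<in> {l \<in> base_fibre x. kernel f l k \<noteq> 0}"
    have c: "(l, ginv G k) \<in> composable G" using l k base_fibre_composable[of l x k] by blast
    show "l \<in> (\<lambda>h. gmult G h k) ` ?H"
      using l k c kernel_eq_zero_iff[OF f(1), of l x k] Base.mult_inv_cancel[OF c]
      by (intro image_eqI[of _ _ "gmult G l (ginv G k)"]) auto
  qed
qed

lemma kernel_finite_row:
  assumes f: "equivariant f" "fibre_finite f" and h: "h \<in> base_fibre x"
  shows "finite {l \<in> base_fibre x. kernel f h l \<noteq> 0}"
proof (rule finite_subset)
  let ?H = "{g \<in> arrows G. rng G g = rng G h \<and> f (lift g) \<noteq> 0}"
  show "finite ((\<lambda>g. gmult G (ginv G g) h) ` ?H)" using f h by (simp add: fibre_finite_def)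
  show "{l \<in> base_fibre x. kernel f h l \<noteq> 0} \<subseteq> (\<lambda>g. gmult G (ginv G g) h) ` ?H"
  proof
    fix l assume l: "l \<in> {l \<in> base_fibre x. kernel f h l \<noteq> 0}"
    have c: "(h, ginv G l) \<in> composable G" "(l, ginv G h) \<in> composable G"
      using l h base_fibre_composable[of h x l] base_fibre_composable[of l x h] by blast+
    show "l \<in> (\<lambda>g. gmult G (ginv G g) h) ` ?H"
      using l h c kernel_eq_zero_iff[OF f(1), of h x l] Base.mult_inv_cancel[OF c(2)]
      by (intro image_eqI[of _ _ "gmult G h (ginv G l)"]) (auto simp: Base.inv_mult)
  qed
qed

end

section \<open>Topological preliminaries\<close>

lemma continuous_map_locallyI:
  assumes "\<And>x. x \<in> topspace X \<Longrightarrow> \<exists>T. openin X T \<and> x \<in> T \<and> continuous_map (subtopology X T) Y f"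
  shows "continuous_map X Y f"
  by (rule pasting_lemma[where I = "{T. openin X T \<and> continuous_map (subtopology X T) Y f}"
        and T = "\<lambda>T. T" and f = "\<lambda>T. f"]) (use assms in auto)

lemma continuous_map_indicator:
  assumes "openin X A" "closedin X A"
  shows "continuous_map X euclidean (\<lambda>x. if x \<in> A then 1 else 0 :: complex)"
proof (rule continuous_map_locallyI)
  fix x assume x: "x \<in> topspace X"
  let ?f = "\<lambda>x. if x \<in> A then 1 else 0 :: complex"
  show "\<exists>T. openin X T \<and> x \<in> T \<and> continuous_map (subtopology X T) euclidean ?f"
  proof (cases "x \<in> A")
    case True
    have "continuous_map (subtopology X A) euclidean ?f"
      by (rule continuous_map_eq[where f = "\<lambda>_. 1"]) auto
    then show ?thesis using True assms by blast
  next
    case False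
    have "continuous_map (subtopology X (topspace X - A)) euclidean ?f"
      by (rule continuous_map_eq[where f = "\<lambda>_. 0"]) auto
    moreover have "openin X (topspace X - A)" using assms(2) by blast
    ultimately show ?thesis using False x by blast
  qed
qed

lemma continuous_map_cmult:
  fixes f g :: "'a \<Rightarrow> complex"
  assumes "continuous_map X euclidean f" "continuous_map X euclidean g"
  shows "continuous_map X euclidean (\<lambda>x. f x * g x)"
  using assms by (simp add: continuous_map_atin tendsto_mult)

lemma continuous_map_cnj:
  "continuous_map X euclidean f \<Longrightarrow> continuous_map X euclidean (\<lambda>x. cnj (f x))"
  by (simp add: continuous_map_atin tendsto_cnj)

lemma continuous_map_of_real:
  fixes f :: "'a \<Rightarrow> real"
  shows "continuous_map X euclidean f \<Longrightarrow> continuous_map X euclidean (\<lambda>x. of_real (f x) :: complex)"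
  by (simp add: continuous_map_atin tendsto_of_real)

text \<open>By local compactness \<open>K\<close> is covered by finitely many open sets, each inside
  a compact subset of \<open>U\<close>. A Urysohn function that is \<open>0\<close> on
  \<open>K\<close> and \<open>1\<close> off this cover is subtracted from \<open>1\<close>; the
  result vanishes off the union \<open>L\<close> of the compact sets.\<close>

lemma compact_bump:
  assumes X: "Hausdorff_space X" "locally_compact_space X"
    and K: "compactin X K" and U: "openin X U" "K \<subseteq> U"
  obtains h :: "'a \<Rightarrow> real" and L where "continuous_map X euclidean h"
    "\<forall>x\<in>topspace X. 0 \<le> h x \<and> h x \<le> 1" "\<forall>x\<in>K. h x = 1"
    "compactin X L" "L \<subseteq> U" "\<forall>x\<in>topspace X - L. h x = 0"
proof -
  have KX: "K \<subseteq> topspace X" by (rule compactin_subset_topspace[OF K])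
  have "\<forall>x\<in>K. \<exists>V C. openin X V \<and> compactin X C \<and> x \<in> V \<and> V \<subseteq> C \<and> C \<subseteq> U"
    using X U locally_compact_space_neighbourhood_base[of X]
    unfolding neighbourhood_base_of by (meson subsetD)
  then obtain V C where VC: "\<And>x. x \<in> K \<Longrightarrow> openin X (V x)" "\<And>x. x \<in> K \<Longrightarrow> compactin X (C x)"
    "\<And>x. x \<in> K \<Longrightarrow> x \<in> V x" "\<And>x. x \<in> K \<Longrightarrow> V x \<subseteq> C x" "\<And>x. x \<in> K \<Longrightarrow> C x \<subseteq> U" by metis
  have "\<forall>W\<in>V ` K. openin X W" "K \<subseteq> \<Union>(V ` K)" using VC by auto
  then obtain \<F> where \<F>: "finite \<F>" "\<F> \<subseteq> V ` K" "K \<subseteq> \<Union>\<F>"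
    using K unfolding compactin_def by meson
  then obtain F where F: "finite F" "F \<subseteq> K" "K \<subseteq> (\<Union>x\<in>F. V x)"
    by (metis finite_subset_image)
  let ?V = "\<Union>x\<in>F. V x" and ?L = "\<Union>x\<in>F. C x"
  have V: "openin X ?V" using F VC by (intro openin_Union) auto
  have L: "compactin X ?L" using F VC by (intro compactin_Union) auto
  have reg: "completely_regular_space X"
    using X locally_compact_regular_imp_completely_regular_space
      locally_compact_Hausdorff_imp_regular_space by blast
  have "disjnt (topspace X - ?V) K" using F(3) by (auto simp: disjnt_iff)
  moreover have "closedin X (topspace X - ?V)" using V by blast
  ultimately obtain f where f: "continuous_map X (top_of_set {0..1::real}) f"
    "f ` K \<subseteq> {0}" "f ` (topspace X - ?V) \<subseteq> {1}"
    using Urysohn_completely_regular_closed_compact[of 0 1 X "topspace X - ?V" K] reg K by auto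
  have f01: "f x \<in> {0..1}" if "x \<in> topspace X" for x
    using f(1) that by (auto simp: continuous_map_in_subtopology Pi_iff)
  show thesis
  proof (rule that[of "\<lambda>x. 1 - f x" ?L])
    show "continuous_map X euclidean (\<lambda>x. 1 - f x)"
      using f(1) by (intro continuous_map_diff) (auto simp: continuous_map_in_subtopology)
    show "\<forall>x\<in>topspace X. 0 \<le> 1 - f x \<and> 1 - f x \<le> 1" using f01 by auto
    show "\<forall>x\<in>K. 1 - f x = 1" using f(2) by auto
    show "?L \<subseteq> U" using F(2) VC(5) by (intro UN_least) auto
    show "\<forall>x\<in>topspace X - ?L. 1 - f x = 0"
    proof
      fix x assume x: "x \<in> topspace X - ?L"
      have "?V \<subseteq> ?L" using F(2) VC(4) by (intro UN_mono) auto
      then have "f x \<in> f ` (topspace X - ?V)" using x by blast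
      then show "1 - f x = 0" using f(3) by auto
    qed
  qed (rule L)
qed

lemma compact_neighbourhood:
  assumes X: "Hausdorff_space X" "locally_compact_space X" and U: "openin X U" "x \<in> U"
  obtains V C where "openin X V" "compactin X C" "x \<in> V" "V \<subseteq> C" "C \<subseteq> U"
  using X U locally_compact_space_neighbourhood_base[of X]
  unfolding neighbourhood_base_of by meson

lemma open_bisectionD:
  assumes "open_bisection G B"
  shows "openin (gtop G) B" "B \<subseteq> arrows G" "inj_on (src G) B" "inj_on (rng G) B"
    "openin (gtop G) (rng G ` B)"
proof -
  show B: "openin (gtop G) B" "openin (gtop G) (rng G ` B)" using assms by (simp_all add: open_bisection_def)
  then show "B \<subseteq> arrows G" by (simp add: arrows_def openin_subset)
  then have "topspace (gtop G) \<inter> B = B" by (auto simp: arrows_def)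
  then show "inj_on (src G) B" "inj_on (rng G) B"
    using assms by (auto simp: open_bisection_def homeomorphic_eq_everything_map)
qed

context topological_groupoid
begin

section \<open>Topology of a groupoid: units, fibres and products\<close>

lemma continuous_map_gmult:
  assumes "continuous_map X (gtop G) a" "continuous_map X (gtop G) b"
    and "\<And>x. x \<in> topspace X \<Longrightarrow> (a x, b x) \<in> composable G"
  shows "continuous_map X (gtop G) (\<lambda>x. gmult G (a x) (b x))"
proof -
  have "continuous_map X (subtopology (prod_topology (gtop G) (gtop G)) (composable G)) (\<lambda>x. (a x, b x))"
    using assms by (auto simp: continuous_map_in_subtopology continuous_map_paired)
  from continuous_map_compose[OF this continuous_mult] show ?thesis by (simp add: o_def)
qed

lemma continuous_map_ginv:
  "continuous_map X (gtop G) a \<Longrightarrow> continuous_map X (gtop G) (\<lambda>x. ginv G (a x))"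
  using continuous_map_compose[OF _ continuous_inv, of X a] by (simp add: o_def)

lemma continuous_map_closed:
  "continuous_map X (gtop G) a \<Longrightarrow> x \<in> topspace X \<Longrightarrow> a x \<in> arrows G"
  by (auto simp: arrows_def continuous_map_def)

lemma continuous_map_src:
  assumes "continuous_map X (gtop G) a" shows "continuous_map X (gtop G) (\<lambda>x. src G (a x))"
  unfolding src_def
  by (intro continuous_map_gmult continuous_map_ginv assms) (simp add: continuous_map_closed[OF assms])

lemma continuous_map_rng:
  assumes "continuous_map X (gtop G) a" shows "continuous_map X (gtop G) (\<lambda>x. rng G (a x))"
  unfolding rng_def
  by (intro continuous_map_gmult continuous_map_ginv assms) (simp add: continuous_map_closed[OF assms])

lemmas continuous_src = continuous_map_src[OF continuous_map_id[unfolded id_def]]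
lemmas continuous_rng = continuous_map_rng[OF continuous_map_id[unfolded id_def]]

text \<open>The units are the fixed points of the continuous map \<open>src\<close>, and the fixed
  points of a continuous self-map of a Hausdorff space form a closed set.\<close>

lemma closedin_units: "closedin (gtop G) (units G)"
proof -
  have eq: "units G = {x \<in> topspace (gtop G). src G x = x}"
  proof (intro set_eqI iffI)
    fix x assume "x \<in> units G"
    then show "x \<in> {x \<in> topspace (gtop G). src G x = x}"
      using unit_arrow[of x] src_unit[of x] by (simp only: mem_Collect_eq arrows_def)
  next
    fix x assume "x \<in> {x \<in> topspace (gtop G). src G x = x}"
    then have "x \<in> arrows G \<and> src G x = x" by (simp only: mem_Collect_eq arrows_def)
    then show "x \<in> units G" by (rule units_iff[THEN iffD2])
  qed
  show ?thesis
    unfolding eq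
    using closedin_continuous_maps_eq[OF Hausdorff continuous_src continuous_map_id] by (simp only: id_apply)
qed

text \<open>Take a bisection \<open>B\<close> around a unit and those \<open>g\<close> in
  \<open>B\<close> whose source is again in \<open>B\<close>. Then \<open>g\<close> and its source
  are two points of \<open>B\<close> with the same source, hence equal, so these \<open>g\<close>
  are units and they form an open set.\<close>

lemma openin_units:
  assumes "etale G" shows "openin (gtop G) (units G)"
proof (subst openin_subopen, intro ballI)
  fix x assume x: "x \<in> units G"
  have "x \<in> topspace (gtop G)" using unit_arrow[OF x] by (simp only: arrows_def)
  from assms[unfolded etale_def, rule_format, OF conjI[OF openin_topspace this]]
  obtain B where B: "open_bisection G B" "x \<in> B" by blast
  note BD = open_bisectionD[OF B(1)]
  let ?V = "{g \<in> B. src G g \<in> B}"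
  have "openin (gtop G) ?V"
    by (rule openin_continuous_map_preimage_gen[OF continuous_src BD(1) BD(1)])
  moreover have "?V \<subseteq> units G"
  proof
    fix g assume g: "g \<in> ?V"
    then have "g \<in> arrows G" using BD(2) by blast
    moreover from this have "src G g = g" using g BD(3) by (auto simp: inj_on_def)
    ultimately show "g \<in> units G" unfolding units_iff by blast
  qed
  moreover have "x \<in> ?V" using B x by simp
  ultimately show "\<exists>T. openin (gtop G) T \<and> x \<in> T \<and> T \<subseteq> units G" by blast
qed

text \<open>Finitely many open bisections cover \<open>K\<close>, and each meets a source or range
  fibre in at most one arrow.\<close>

lemma compact_fibre_finite:
  assumes "etale G" and K: "compactin (gtop G) K"
  shows "finite {h \<in> K. src G h = x}" "finite {h \<in> K. rng G h = x}"
proof -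
  let ?\<U> = "{B. open_bisection G B}"
  have "K \<subseteq> \<Union>?\<U>"
  proof
    fix g assume "g \<in> K"
    then have "g \<in> topspace (gtop G)" using compactin_subset_topspace[OF K] by blast
    from assms(1)[unfolded etale_def, rule_format, OF conjI[OF openin_topspace this]]
    show "g \<in> \<Union>?\<U>" by blast
  qed
  moreover have "\<forall>B\<in>?\<U>. openin (gtop G) B" using open_bisectionD(1) by blast
  ultimately obtain \<F> where \<F>: "finite \<F>" "\<F> \<subseteq> ?\<U>" "K \<subseteq> \<Union>\<F>"
    using K unfolding compactin_def by meson
  have fin: "finite {h \<in> B. p h = x}" if "inj_on p B" for p :: "'g \<Rightarrow> 'g" and B
  proof (rule finite_subset)
    show "{h \<in> B. p h = x} \<subseteq> {the_inv_into B p x}" using that by (auto simp: the_inv_into_f_f)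
  qed simp
  have "{h \<in> K. src G h = x} \<subseteq> (\<Union>B\<in>\<F>. {h \<in> B. src G h = x})"
    "{h \<in> K. rng G h = x} \<subseteq> (\<Union>B\<in>\<F>. {h \<in> B. rng G h = x})" using \<F>(3) by auto
  moreover have "finite (\<Union>B\<in>\<F>. {h \<in> B. src G h = x})" "finite (\<Union>B\<in>\<F>. {h \<in> B. rng G h = x})"
    using \<F>(1,2) by (auto intro!: fin dest: open_bisectionD(3,4))
  ultimately show "finite {h \<in> K. src G h = x}" "finite {h \<in> K. rng G h = x}"
    by (auto dest: finite_subset)
qed

text \<open>Composability is the equality of two continuous maps into a Hausdorff space, hence a
  closed condition, so the composable pairs from \<open>K\<close> and \<open>L\<close> form a
  compact set. The image contains the support of a convolution.\<close>

lemma compactin_product: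
  assumes "compactin (gtop G) K" "compactin (gtop G) L"
  shows "compactin (gtop G) {gmult G g h |g h. g \<in> K \<and> h \<in> L \<and> (g, h) \<in> composable G}"
proof -
  let ?X = "prod_topology (gtop G) (gtop G)"
  have "composable G = {p \<in> topspace ?X. src G (fst p) = rng G (snd p)}"
    by (auto simp: composable_def arrows_def)
  then have "closedin ?X (composable G)"
    using closedin_continuous_maps_eq[OF Hausdorff continuous_map_src[OF continuous_map_fst]
        continuous_map_rng[OF continuous_map_snd]] by simp
  moreover have "compactin ?X (K \<times> L)" using assms by (simp add: compactin_Times)
  ultimately have "compactin (subtopology ?X (composable G)) ((K \<times> L) \<inter> composable G)"
    by (auto simp: compactin_subtopology compact_Int_closedin)
  from image_compactin[OF this continuous_mult]
  have "compactin (gtop G) ((\<lambda>(g, h). gmult G g h) ` ((K \<times> L) \<inter> composable G))" .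
  moreover have "(\<lambda>(g, h). gmult G g h) ` ((K \<times> L) \<inter> composable G)
      = {gmult G g h |g h. g \<in> K \<and> h \<in> L \<and> (g, h) \<in> composable G}" by force
  ultimately show ?thesis by simp
qed

end

section \<open>Functions with compact support on a twist\<close>

context twist
begin

text \<open>The function \<open>p\<close> is the circle coordinate of a local trivialization of the
  twist. With it every arrow over \<open>U\<close> is a continuous phase times the section
  \<open>\<phi>\<close>, and the homeomorphism need not be carried along.\<close>

definition trivializes :: "'g set \<Rightarrow> ('g \<Rightarrow> 's) \<Rightarrow> ('s \<Rightarrow> complex) \<Rightarrow> bool" where
  "trivializes U \<phi> p \<longleftrightarrow> open_bisection G U \<and>
     continuous_map (subtopology (gtop G) U) (gtop S) \<phi> \<and>
     (\<forall>h\<in>U. \<phi> h \<in> arrows S \<and> q (\<phi> h) = h) \<and>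
     continuous_map (subtopology (gtop S) {\<gamma> \<in> arrows S. q \<gamma> \<in> U}) euclidean p \<and>
     (\<forall>\<gamma>\<in>arrows S. q \<gamma> \<in> U \<longrightarrow> p \<gamma> \<in> circle \<and> \<gamma> = act (p \<gamma>) (\<phi> (q \<gamma>)))"

lemma topspace_G [simp]: "topspace (gtop G) = arrows G" by (simp add: arrows_def)
lemma topspace_S [simp]: "topspace (gtop S) = arrows S" by (simp add: arrows_def)

text \<open>The phase is the first coordinate of the inverse of the trivializing homeomorphism. The
  clause on compact sets is recorded here because it uses the homeomorphism itself: over
  \<open>L\<close> the twist is a copy of the circle times \<open>L\<close>.\<close>

lemma trivialization:
  assumes g: "g \<in> arrows G"
  shows "\<exists>U \<phi> p. trivializes U \<phi> p \<and> g \<in> U \<and>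
    (\<forall>L. compactin (gtop G) L \<longrightarrow> L \<subseteq> U \<longrightarrow> compactin (gtop S) {\<gamma> \<in> arrows S. q \<gamma> \<in> L})"
proof -
  let ?q' = "\<lambda>U. {\<gamma> \<in> arrows S. q \<gamma> \<in> U}"
  obtain U \<phi> where U: "open_bisection G U" "g \<in> U"
    and "continuous_map (subtopology (gtop G) U) (gtop S) \<phi>" and "\<forall>h\<in>U. q (\<phi> h) = h"
    and homeo: "homeomorphic_map (prod_topology (top_of_set circle) (subtopology (gtop G) U))
          (subtopology (gtop S) (?q' U)) (\<lambda>(z, h). gmult S (\<iota> (z, rng G h)) (\<phi> h))"
    using locally_trivial[OF g] by (elim exE conjE) (rule that)
  then have \<phi>: "continuous_map (subtopology (gtop G) U) (gtop S) \<phi>" "\<And>h. h \<in> U \<Longrightarrow> q (\<phi> h) = h"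
    by blast+
  let ?f = "\<lambda>(z, h). gmult S (\<iota> (z, rng G h)) (\<phi> h)"
  note UD = open_bisectionD[OF U(1)]
  have UG: "arrows G \<inter> U = U" using UD(2) by blast
  have \<phi>S: "\<phi> h \<in> arrows S" if "h \<in> U" for h
    using continuous_map_image_subset_topspace[OF \<phi>(1)] that UG by auto
  have f_act: "?f (z, h) = act z (\<phi> h)" if "h \<in> U" for z h
    using that \<phi>S \<phi>(2) by (simp add: act_eq)
  obtain k where k: "homeomorphic_maps (prod_topology (top_of_set circle) (subtopology (gtop G) U))
          (subtopology (gtop S) (?q' U)) ?f k"
    using homeo unfolding homeomorphic_map_maps by blast
  have kc: "continuous_map (subtopology (gtop S) (?q' U)) (prod_topology (top_of_set circle) (subtopology (gtop G) U)) k"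
    and fc: "continuous_map (prod_topology (top_of_set circle) (subtopology (gtop G) U)) (subtopology (gtop S) (?q' U)) ?f"
    and fk: "\<And>\<gamma>. \<gamma> \<in> arrows S \<Longrightarrow> q \<gamma> \<in> U \<Longrightarrow> ?f (k \<gamma>) = \<gamma>"
    using k by (auto simp: homeomorphic_maps_def)
  have k_in: "fst (k \<gamma>) \<in> circle \<and> snd (k \<gamma>) \<in> U" if "\<gamma> \<in> arrows S" "q \<gamma> \<in> U" for \<gamma>
  proof -
    have "k \<gamma> \<in> circle \<times> (arrows G \<inter> U)"
      using continuous_map_image_subset_topspace[OF kc] that by (auto simp: image_subset_iff)
    then show ?thesis by (metis IntD2 mem_Times_iff)
  qed
  define p where "p \<gamma> = fst (k \<gamma>)" for \<gamma>
  have p: "p \<gamma> \<in> circle \<and> \<gamma> = act (p \<gamma>) (\<phi> (q \<gamma>))" if "\<gamma> \<in> arrows S" "q \<gamma> \<in> U" for \<gamma>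
  proof -
    obtain z h where zh: "k \<gamma> = (z, h)" by (rule prod.exhaust)
    have in_U: "z \<in> circle" "h \<in> U" using k_in[OF that] unfolding zh by simp_all
    have "\<gamma> = ?f (k \<gamma>)" by (rule fk[OF that, symmetric])
    also have "\<dots> = act z (\<phi> h)" unfolding zh by (rule f_act[OF in_U(2)])
    finally have e: "\<gamma> = act z (\<phi> h)" .
    have "q \<gamma> = q (act z (\<phi> h))" by (rule arg_cong[OF e])
    also have "\<dots> = h" using in_U \<phi>S \<phi>(2) by simp
    finally have qh: "q \<gamma> = h" .
    have pz: "p \<gamma> = z" by (simp add: p_def zh)
    show ?thesis unfolding qh pz using e in_U by blast
  qed
  have "continuous_map (subtopology (gtop S) (?q' U)) (top_of_set circle) p"
    using continuous_map_compose[OF kc continuous_map_fst] unfolding p_def[abs_def] o_def .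
  then have pc: "continuous_map (subtopology (gtop S) (?q' U)) euclidean p"
    by (rule continuous_map_into_fulltopology)
  have "compactin (gtop S) (?q' L)" if L: "compactin (gtop G) L" "L \<subseteq> U" for L
  proof -
    have "compactin (prod_topology (top_of_set circle) (subtopology (gtop G) U)) (circle \<times> L)"
      using L by (simp add: compactin_Times compactin_subtopology)
    from image_compactin[OF this fc]
    have "compactin (gtop S) (?f ` (circle \<times> L))" by (simp add: compactin_subtopology)
    moreover have "?f ` (circle \<times> L) = ?q' L"
    proof (intro equalityI subsetI)
      fix \<gamma> assume "\<gamma> \<in> ?f ` (circle \<times> L)"
      then obtain z h where "z \<in> circle" "h \<in> L" "\<gamma> = ?f (z, h)" by auto
      then show "\<gamma> \<in> ?q' L" using L(2) \<phi>S \<phi>(2) f_act[of h z] by auto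
    next
      fix \<gamma> assume \<gamma>: "\<gamma> \<in> ?q' L"
      then have "\<gamma> = ?f (p \<gamma>, q \<gamma>)" "p \<gamma> \<in> circle" using p[of \<gamma>] L(2) f_act[of "q \<gamma>" "p \<gamma>"] by auto
      then show "\<gamma> \<in> ?f ` (circle \<times> L)" using \<gamma> by blast
    qed
    ultimately show ?thesis by simp
  qed
  then show ?thesis using U \<phi> \<phi>S p pc by (intro exI[of _ U] exI[of _ \<phi>] exI[of _ p]) (auto simp: trivializes_def)
qed

text \<open>This says that \<open>q\<close> is proper. Each point of \<open>L\<close> has a compact
  neighbourhood \<open>C\<close> inside a trivializing bisection; the preimage of the compact set
  \<open>L \<inter> C\<close> is compact by \<open>trivialization\<close>, and finitely many such
  pieces exhaust \<open>L\<close>.\<close>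

lemma compactin_q_preimage:
  assumes L: "compactin (gtop G) L"
  shows "compactin (gtop S) {\<gamma> \<in> arrows S. q \<gamma> \<in> L}"
proof -
  let ?q' = "\<lambda>U. {\<gamma> \<in> arrows S. q \<gamma> \<in> U}"
  let ?P = "\<lambda>V. openin (gtop G) V \<and> (\<exists>C. V \<subseteq> C \<and> closedin (gtop G) C \<and> compactin (gtop S) (?q' (L \<inter> C)))"
  have "\<exists>V. ?P V \<and> g \<in> V" if "g \<in> L" for g
  proof -
    have g: "g \<in> arrows G" using that compactin_subset_topspace[OF L] by auto
    obtain U \<phi> p where U: "trivializes U \<phi> p" "g \<in> U"
      and cpt: "\<And>L. compactin (gtop G) L \<Longrightarrow> L \<subseteq> U \<Longrightarrow> compactin (gtop S) (?q' L)"
      using trivialization[OF g] by blast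
    have "openin (gtop G) U" using U(1) by (simp add: trivializes_def open_bisectionD)
    then obtain V C where V: "openin (gtop G) V" "compactin (gtop G) C" "g \<in> V" "V \<subseteq> C" "C \<subseteq> U"
      using compact_neighbourhood[OF Base.Hausdorff Base.locally_compact _ U(2)] by blast
    have C: "closedin (gtop G) C" by (rule compactin_imp_closedin[OF Base.Hausdorff V(2)])
    have "compactin (gtop S) (?q' (L \<inter> C))"
      using compact_Int_closedin[OF L C] V(5) by (intro cpt) auto
    then show ?thesis using V C by blast
  qed
  then have "L \<subseteq> \<Union>{V. ?P V}" by blast
  then obtain \<F> where \<F>: "finite \<F>" "\<F> \<subseteq> {V. ?P V}" "L \<subseteq> \<Union>\<F>"
    using L unfolding compactin_def by (metis (no_types, lifting) mem_Collect_eq)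
  then have "\<forall>V\<in>\<F>. \<exists>C. V \<subseteq> C \<and> compactin (gtop S) (?q' (L \<inter> C))" by blast
  then obtain C where C: "\<And>V. V \<in> \<F> \<Longrightarrow> V \<subseteq> C V" "\<And>V. V \<in> \<F> \<Longrightarrow> compactin (gtop S) (?q' (L \<inter> C V))"
    by metis
  have "compactin (gtop S) (\<Union>V\<in>\<F>. ?q' (L \<inter> C V))" using \<F>(1) C(2) by (intro compactin_Union) auto
  moreover have "(\<Union>V\<in>\<F>. ?q' (L \<inter> C V)) = ?q' L" using \<F>(3) C(1) by blast
  ultimately show ?thesis by simp
qed

text \<open>Because \<open>q\<close> is proper, compactness of the support can be tested in
  \<open>G\<close>. There any compact set that contains the image of the nonvanishing set will do,
  so closures of supports disappear from later proofs.\<close>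

lemma Cc_iff:
  "f \<in> Cc \<longleftrightarrow> equivariant f \<and> continuous_map (gtop S) euclidean f \<and>
     (\<exists>L. compactin (gtop G) L \<and> (\<forall>\<gamma>\<in>arrows S. f \<gamma> \<noteq> 0 \<longrightarrow> q \<gamma> \<in> L))" (is "_ \<longleftrightarrow> ?R")
proof
  let ?Z = "{\<gamma> \<in> arrows S. f \<gamma> \<noteq> 0}"
  assume f: "f \<in> Cc"
  then have K: "compactin (gtop S) (gtop S closure_of ?Z)" by (simp add: Cc_def)
  have "?Z \<subseteq> gtop S closure_of ?Z" by (rule closure_of_subset) auto
  then show ?R
    using f image_compactin[OF K q_continuous]
    by (auto simp: Cc_def equivariant_def intro!: exI[of _ "q ` (gtop S closure_of ?Z)"])
next
  let ?Z = "{\<gamma> \<in> arrows S. f \<gamma> \<noteq> 0}"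
  assume f: ?R
  then obtain L where L: "compactin (gtop G) L" "\<And>\<gamma>. \<gamma> \<in> arrows S \<Longrightarrow> f \<gamma> \<noteq> 0 \<Longrightarrow> q \<gamma> \<in> L" by blast
  let ?K = "{\<gamma> \<in> arrows S. q \<gamma> \<in> L}"
  have K: "compactin (gtop S) ?K" by (rule compactin_q_preimage[OF L(1)])
  have "?Z \<subseteq> ?K" using L(2) by blast
  then have "gtop S closure_of ?Z \<subseteq> ?K"
    by (rule closure_of_minimal) (rule compactin_imp_closedin[OF Sigma.Hausdorff K])
  then have "compactin (gtop S) (gtop S closure_of ?Z)"
    by (intro closed_compactin[OF K]) auto
  then show "f \<in> Cc" using f by (auto simp: Cc_def equivariant_def)
qed

lemma Cc_equivariant: "f \<in> Cc \<Longrightarrow> equivariant f" by (simp add: Cc_iff)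
lemma Cc_continuous: "f \<in> Cc \<Longrightarrow> continuous_map (gtop S) euclidean f" by (simp add: Cc_iff)

lemma Cc_support:
  assumes "f \<in> Cc"
  obtains L where "compactin (gtop G) L" "\<forall>\<gamma>. f \<gamma> \<noteq> 0 \<longrightarrow> \<gamma> \<in> arrows S \<and> q \<gamma> \<in> L"
  using assms unfolding Cc_iff equivariant_def by blast

lemma Cc_I:
  assumes "equivariant f" "continuous_map (gtop S) euclidean f" "compactin (gtop G) L"
    "\<And>\<gamma>. \<gamma> \<in> arrows S \<Longrightarrow> f \<gamma> \<noteq> 0 \<Longrightarrow> q \<gamma> \<in> L"
  shows "f \<in> Cc"
  using assms unfolding Cc_iff by blast

lemma Cc_bounded:
  assumes "f \<in> Cc" obtains B where "0 \<le> B" "\<And>\<gamma>. cmod (f \<gamma>) \<le> B"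
proof -
  obtain L where L: "compactin (gtop G) L" "\<forall>\<gamma>. f \<gamma> \<noteq> 0 \<longrightarrow> \<gamma> \<in> arrows S \<and> q \<gamma> \<in> L"
    by (rule Cc_support[OF assms])
  have "compact (f ` {\<gamma> \<in> arrows S. q \<gamma> \<in> L})"
    using image_compactin[OF compactin_q_preimage[OF L(1)] Cc_continuous[OF assms]] by simp
  from compact_imp_bounded[OF this]
  obtain B where B: "\<forall>y\<in>f ` {\<gamma> \<in> arrows S. q \<gamma> \<in> L}. cmod y \<le> B" unfolding bounded_iff ..
  show thesis
  proof (rule that[of "\<bar>B\<bar>"])
    show "cmod (f \<gamma>) \<le> \<bar>B\<bar>" for \<gamma>
      using B L(2)[rule_format, of \<gamma>] by (cases "f \<gamma> = 0") auto
  qed simp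
qed

lemma Cc_fibre_finite: "f \<in> Cc \<Longrightarrow> fibre_finite f"
proof -
  assume "f \<in> Cc"
  then obtain L where L: "compactin (gtop G) L" "\<forall>\<gamma>. f \<gamma> \<noteq> 0 \<longrightarrow> \<gamma> \<in> arrows S \<and> q \<gamma> \<in> L"
    by (rule Cc_support)
  have "h \<in> L" if "h \<in> arrows G" "f (lift h) \<noteq> 0" for h using L(2)[rule_format, OF that(2)] that(1) by simp
  then have "{h \<in> arrows G. src G h = x \<and> f (lift h) \<noteq> 0} \<subseteq> {h \<in> L. src G h = x}"
    "{h \<in> arrows G. rng G h = x \<and> f (lift h) \<noteq> 0} \<subseteq> {h \<in> L. rng G h = x}" for x by auto
  then show "fibre_finite f"
    unfolding fibre_finite_def using Base.compact_fibre_finite[OF etale_base L(1)] by (meson finite_subset)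
qed

lemma Cc_zero: "(\<lambda>\<gamma>. 0) \<in> Cc"
  by (rule Cc_I[of _ "{}"]) (simp_all add: equivariant_def)

lemma equivariant_add: "\<lbrakk>equivariant f; equivariant g\<rbrakk> \<Longrightarrow> equivariant (\<lambda>\<gamma>. f \<gamma> + g \<gamma>)"
  by (simp add: equivariant_def distrib_left)

lemma equivariant_multiplier: "equivariant f \<Longrightarrow> equivariant (\<lambda>\<gamma>. m (q \<gamma>) * f \<gamma>)"
  by (simp add: equivariant_def)

lemma Cc_add:
  assumes "f \<in> Cc" "g \<in> Cc" shows "(\<lambda>\<gamma>. f \<gamma> + g \<gamma>) \<in> Cc"
proof -
  obtain K where K: "compactin (gtop G) K" "\<forall>\<gamma>. f \<gamma> \<noteq> 0 \<longrightarrow> \<gamma> \<in> arrows S \<and> q \<gamma> \<in> K"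
    by (rule Cc_support[OF assms(1)]) 
  obtain L where L: "compactin (gtop G) L" "\<forall>\<gamma>. g \<gamma> \<noteq> 0 \<longrightarrow> \<gamma> \<in> arrows S \<and> q \<gamma> \<in> L"
    by (rule Cc_support[OF assms(2)])
  show ?thesis
  proof (rule Cc_I)
    show "compactin (gtop G) (K \<union> L)" using K L by (simp add: compactin_Un)
    fix \<gamma> assume "f \<gamma> + g \<gamma> \<noteq> 0"
    then have "f \<gamma> \<noteq> 0 \<or> g \<gamma> \<noteq> 0" by auto
    then show "q \<gamma> \<in> K \<union> L" using K L by blast
  qed (use assms in \<open>auto intro: equivariant_add continuous_map_add simp: Cc_iff\<close>)
qed

lemma Cc_multiplier:
  assumes f: "f \<in> Cc" and m: "continuous_map (gtop G) euclidean m"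
  shows "(\<lambda>\<gamma>. m (q \<gamma>) * f \<gamma>) \<in> Cc"
proof -
  obtain K where K: "compactin (gtop G) K" "\<forall>\<gamma>. f \<gamma> \<noteq> 0 \<longrightarrow> \<gamma> \<in> arrows S \<and> q \<gamma> \<in> K"
    by (rule Cc_support[OF f])
  have "continuous_map (gtop S) euclidean (\<lambda>\<gamma>. m (q \<gamma>))"
    using continuous_map_compose[OF q_continuous m] by (simp add: o_def)
  then have "continuous_map (gtop S) euclidean (\<lambda>\<gamma>. m (q \<gamma>) * f \<gamma>)"
    by (rule continuous_map_cmult[OF _ Cc_continuous[OF f]])
  then show ?thesis
    using K(2) by (intro Cc_I[OF equivariant_multiplier[OF Cc_equivariant[OF f]] _ K(1)]) auto
qed

lemma Cc_scale: "f \<in> Cc \<Longrightarrow> (\<lambda>\<gamma>. c * f \<gamma>) \<in> Cc"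
  using Cc_multiplier[of f "\<lambda>_. c"] by simp

definition local_support :: "('s \<Rightarrow> complex) \<Rightarrow> 'g set \<Rightarrow> ('g \<Rightarrow> 's) \<Rightarrow> 'g set \<Rightarrow> bool" where
  "local_support f U \<phi> L \<longleftrightarrow> (\<exists>p. trivializes U \<phi> p) \<and> compactin (gtop G) L \<and> L \<subseteq> U \<and>
     (\<forall>\<gamma>. f \<gamma> \<noteq> 0 \<longrightarrow> \<gamma> \<in> arrows S \<and> q \<gamma> \<in> L)"

text \<open>Instead of a partition of unity: \<open>f = fh + f(1 - h)\<close>, where \<open>h\<close> is a bump function
  equal to \<open>1\<close> on one of finitely many sets covering the support of \<open>f\<close>.\<close>

lemma Cc_induct [consumes 1, case_names zero add local]:
  assumes f: "f \<in> Cc"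
    and zero: "P (\<lambda>\<gamma>. 0)"
    and add: "\<And>f g. \<lbrakk>f \<in> Cc; g \<in> Cc; P f; P g\<rbrakk> \<Longrightarrow> P (\<lambda>\<gamma>. f \<gamma> + g \<gamma>)"
    and loc: "\<And>f U \<phi> L. \<lbrakk>f \<in> Cc; local_support f U \<phi> L\<rbrakk> \<Longrightarrow> P f"
  shows "P f"
proof -
  define bump where "bump V h \<longleftrightarrow> openin (gtop G) V \<and> continuous_map (gtop G) euclidean h \<and>
    (\<forall>g\<in>V. h g = 1) \<and> (\<exists>U \<phi> p L. trivializes U \<phi> p \<and> compactin (gtop G) L \<and> L \<subseteq> U \<and>
      (\<forall>g\<in>arrows G. h g \<noteq> 0 \<longrightarrow> g \<in> L))" for V and h :: "'g \<Rightarrow> complex"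
  have step: "P f" if "finite F" "f \<in> Cc" "\<forall>V\<in>F. \<exists>h. bump V h"
    "\<And>\<gamma>. f \<gamma> \<noteq> 0 \<Longrightarrow> q \<gamma> \<in> \<Union>F" for F f
    using that
  proof (induction F arbitrary: f)
    case empty
    then have "f = (\<lambda>\<gamma>. 0)" by auto
    then show ?case using zero by simp
  next
    case (insert V F)
    obtain h where h: "bump V h" using insert.prems by blast
    have hc: "continuous_map (gtop G) euclidean h" using h by (simp add: bump_def)
    have h1c: "continuous_map (gtop G) euclidean (\<lambda>g. 1 - h g)"
      using hc by (intro continuous_map_diff) auto
    let ?f1 = "\<lambda>\<gamma>. h (q \<gamma>) * f \<gamma>" and ?f2 = "\<lambda>\<gamma>. (1 - h (q \<gamma>)) * f \<gamma>"
    have C: "?f1 \<in> Cc" "?f2 \<in> Cc"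
      using Cc_multiplier[OF insert.prems(1) hc] Cc_multiplier[OF insert.prems(1) h1c] by auto
    have "P ?f2"
    proof (rule insert.IH[OF C(2)])
      show "\<forall>V\<in>F. \<exists>h. bump V h" using insert.prems by blast
      fix \<gamma> assume "(1 - h (q \<gamma>)) * f \<gamma> \<noteq> 0"
      \<comment> \<open>On \<open>V\<close> the bump is \<open>1\<close>, so the remainder
        \<open>?f2\<close> lives over the other sets of the cover.\<close>
      moreover from this have "q \<gamma> \<notin> V" using h by (auto simp: bump_def)
      ultimately show "q \<gamma> \<in> \<Union>F" using insert.prems(3)[of \<gamma>] by auto
    qed
    obtain U \<phi> p L where U: "trivializes U \<phi> p" "compactin (gtop G) L" "L \<subseteq> U"
      "\<forall>g\<in>arrows G. h g \<noteq> 0 \<longrightarrow> g \<in> L" using h unfolding bump_def by blast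
    have "local_support ?f1 U \<phi> L"
      unfolding local_support_def
    proof (intro conjI allI impI exI[of _ p] U(1-3))
      fix \<gamma> assume nz: "h (q \<gamma>) * f \<gamma> \<noteq> 0"
      then show "\<gamma> \<in> arrows S" using equivariant_off[OF Cc_equivariant[OF insert.prems(1)]] by auto
      then show "q \<gamma> \<in> L" using U(4) nz by auto
    qed
    then have "P ?f1" using loc[OF C(1)] by blast
    with add[OF C _ \<open>P ?f2\<close>] show ?case by (simp add: algebra_simps)
  qed
  obtain L where L: "compactin (gtop G) L" "\<forall>\<gamma>. f \<gamma> \<noteq> 0 \<longrightarrow> \<gamma> \<in> arrows S \<and> q \<gamma> \<in> L"
    by (rule Cc_support[OF f])
  have "\<exists>V. (\<exists>h. bump V h) \<and> g \<in> V" if "g \<in> L" for g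
  proof -
    have g: "g \<in> arrows G" using that compactin_subset_topspace[OF L(1)] by auto
    obtain U \<phi> p where U: "trivializes U \<phi> p" "g \<in> U" using trivialization[OF g] by blast
    have Uo: "openin (gtop G) U" using U(1) by (simp add: trivializes_def open_bisectionD)
    then obtain V C where V: "openin (gtop G) V" "compactin (gtop G) C" "g \<in> V" "V \<subseteq> C" "C \<subseteq> U"
      using compact_neighbourhood[OF Base.Hausdorff Base.locally_compact _ U(2)] by blast
    obtain h :: "'g \<Rightarrow> real" and L' where h: "continuous_map (gtop G) euclidean h"
      "\<forall>x\<in>topspace (gtop G). 0 \<le> h x \<and> h x \<le> 1" "\<forall>x\<in>C. h x = 1"
      "compactin (gtop G) L'" "L' \<subseteq> U" "\<forall>x\<in>topspace (gtop G) - L'. h x = 0"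
      by (rule compact_bump[OF Base.Hausdorff Base.locally_compact V(2) Uo V(5)])
    have "bump V (\<lambda>x. of_real (h x))"
      unfolding bump_def
    proof (intro conjI)
      have "\<forall>g\<in>arrows G. complex_of_real (h g) \<noteq> 0 \<longrightarrow> g \<in> L'" using h(6) by auto
      then show "\<exists>U \<phi> p L. trivializes U \<phi> p \<and> compactin (gtop G) L \<and> L \<subseteq> U \<and>
          (\<forall>g\<in>arrows G. complex_of_real (h g) \<noteq> 0 \<longrightarrow> g \<in> L)"
        using U(1) h(4,5) by blast
      show "continuous_map (gtop G) euclidean (\<lambda>x. complex_of_real (h x))"
        by (rule continuous_map_of_real[OF h(1)])
    qed (use V U(1) h in auto)
    then show ?thesis using V(3) by blast
  qed
  then have "L \<subseteq> \<Union>{V. \<exists>h. bump V h}" by blast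
  moreover have "\<forall>V\<in>{V. \<exists>h. bump V h}. openin (gtop G) V" by (auto simp: bump_def)
  ultimately obtain \<F> where "finite \<F>" "\<F> \<subseteq> {V. \<exists>h. bump V h}" "L \<subseteq> \<Union>\<F>"
    using L(1) unfolding compactin_def by meson
  then show ?thesis using L(2) by (intro step[of \<F> f] f) blast+
qed

end

section \<open>The convolution algebra\<close>

lemma real_infsum_le:
  fixes f :: "'b \<Rightarrow> real"
  assumes "\<And>x. x \<in> A \<Longrightarrow> 0 \<le> f x" and bd: "\<And>F. \<lbrakk>finite F; F \<subseteq> A\<rbrakk> \<Longrightarrow> sum f F \<le> C"
  shows "f summable_on A" "infsum f A \<le> C"
proof -
  show s: "f summable_on A"
    using assms(1) by (rule nonneg_bounded_partial_sums_imp_summable_on)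
      (auto intro!: eventually_finite_subsets_at_top_weakI bd)
  show "infsum f A \<le> C" by (rule infsum_le_finite_sums[OF s bd])
qed

lemma infsum_finite_support:
  fixes f :: "'b \<Rightarrow> complex"
  assumes "finite M" "M \<subseteq> I" "\<And>i. i \<in> I - M \<Longrightarrow> f i = 0"
  shows "infsum f I = sum f M"
proof -
  have "infsum f I = infsum f M"
    using assms by (intro infsum_cong_neutral) auto
  then show ?thesis using assms(1) by simp
qed

lemma summable_on_finite_support:
  fixes f :: "'b \<Rightarrow> complex"
  assumes "finite {i \<in> I. f i \<noteq> 0}" shows "f summable_on I"
  using summable_on_finite[OF assms, of f] by (subst summable_on_cong_neutral[where T = "{i \<in> I. f i \<noteq> 0}" and g = f]) auto

context twist
begin

text \<open>Changing the representative multiplies the two factors by \<open>cnj z\<close> and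
  \<open>z\<close>.\<close>

lemma conv_term:
  assumes f: "equivariant f" and g: "equivariant g" and \<eta>: "\<eta> \<in> arrows S" "\<eta>' \<in> arrows S" "q \<eta> = q \<eta>'"
    and \<gamma>: "\<gamma> \<in> arrows S" "rng G (q \<eta>) = rng G (q \<gamma>)"
  shows "f \<eta>' * g (gmult S (ginv S \<eta>') \<gamma>) = f \<eta> * g (gmult S (ginv S \<eta>) \<gamma>)"
proof -
  obtain z where z: "z \<in> circle" "\<eta>' = act z \<eta>" using same_fibre[OF \<eta>] by blast
  have c: "(ginv S \<eta>, \<gamma>) \<in> composable S" using \<eta> \<gamma> by (simp add: composable_iff_q)
  have "gmult S (ginv S \<eta>') \<gamma> = act (cnj z) (gmult S (ginv S \<eta>) \<gamma>)"
    using z \<eta> c by (simp add: inv_act act_mult_left)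
  then show ?thesis
    using z \<eta> c circle_cnj_mult[OF z(1)] equivariant_act[OF f z(1) \<eta>(1)]
      equivariant_act[OF g, of "cnj z" "gmult S (ginv S \<eta>) \<gamma>"] by (simp add: mult_ac)
qed

lemma conv_single:
  assumes f: "equivariant f" and g: "equivariant g" and \<gamma>: "\<gamma> \<in> arrows S" and \<eta>: "\<eta> \<in> arrows S"
    and r: "rng G (q \<eta>) = rng G (q \<gamma>)"
    and single: "\<And>h. \<lbrakk>h \<in> arrows G; rng G h = rng G (q \<gamma>); f (lift h) \<noteq> 0\<rbrakk> \<Longrightarrow> h = q \<eta>"
  shows "conv f g \<gamma> = f \<eta> * g (gmult S (ginv S \<eta>) \<gamma>)"
proof -
  let ?H = "{h \<in> arrows G. rng G h = rng G (q \<gamma>)}"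
  let ?t = "\<lambda>h. f (lift h) * g (gmult S (ginv S (lift h)) \<gamma>)"
  have "infsum ?t ?H = sum ?t {q \<eta>}"
    using \<eta> r single by (intro infsum_finite_support) auto
  then have "conv f g \<gamma> = ?t (q \<eta>)" using \<gamma> by (simp add: conv_def)
  also have "\<dots> = f \<eta> * g (gmult S (ginv S \<eta>) \<gamma>)"
    using \<eta> r \<gamma> by (intro conv_term[OF f g]) simp_all
  finally show ?thesis .
qed

lemma conv_summable:
  assumes "fibre_finite f" "\<gamma> \<in> arrows S"
  shows "(\<lambda>h. f (lift h) * g (gmult S (ginv S (lift h)) \<gamma>))
    summable_on {h \<in> arrows G. rng G h = rng G (q \<gamma>)}"
proof (rule summable_on_finite_support, rule finite_subset)
  show "finite {h \<in> arrows G. rng G h = rng G (q \<gamma>) \<and> f (lift h) \<noteq> 0}"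
    using assms by (simp add: fibre_finite_def)
qed auto

lemma conv_add_left:
  assumes "fibre_finite f" "fibre_finite f'"
  shows "conv (\<lambda>\<gamma>. f \<gamma> + f' \<gamma>) g = (\<lambda>\<gamma>. conv f g \<gamma> + conv f' g \<gamma>)"
proof
  show "conv (\<lambda>\<gamma>. f \<gamma> + f' \<gamma>) g \<gamma> = conv f g \<gamma> + conv f' g \<gamma>" for \<gamma>
  proof (cases "\<gamma> \<in> arrows S")
    case True
    then show ?thesis
      using infsum_add[OF conv_summable[OF assms(1) True, of g] conv_summable[OF assms(2) True, of g]]
      by (simp add: conv_def distrib_right)
  qed (simp add: conv_def)
qed

lemma conv_add_right:
  assumes "fibre_finite f"
  shows "conv f (\<lambda>\<gamma>. g \<gamma> + g' \<gamma>) = (\<lambda>\<gamma>. conv f g \<gamma> + conv f g' \<gamma>)"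
proof
  show "conv f (\<lambda>\<gamma>. g \<gamma> + g' \<gamma>) \<gamma> = conv f g \<gamma> + conv f g' \<gamma>" for \<gamma>
  proof (cases "\<gamma> \<in> arrows S")
    case True
    then show ?thesis
      using infsum_add[OF conv_summable[OF assms True, of g] conv_summable[OF assms True, of g']]
      by (simp add: conv_def distrib_left)
  qed (simp add: conv_def)
qed

lemma conv_scale_left: "conv (\<lambda>\<gamma>. c * f \<gamma>) g = (\<lambda>\<gamma>. c * conv f g \<gamma>)"
  by (intro ext) (simp add: conv_def mult.assoc infsum_cmult_right')

lemma conv_scale_right: "conv f (\<lambda>\<gamma>. c * g \<gamma>) = (\<lambda>\<gamma>. c * conv f g \<gamma>)"
  by (intro ext) (simp add: conv_def mult.left_commute[of _ c] infsum_cmult_right')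

lemma conv_support:
  assumes f: "\<forall>\<gamma>. f \<gamma> \<noteq> 0 \<longrightarrow> \<gamma> \<in> arrows S \<and> q \<gamma> \<in> K" and g: "\<forall>\<gamma>. g \<gamma> \<noteq> 0 \<longrightarrow> \<gamma> \<in> arrows S \<and> q \<gamma> \<in> L"
    and nz: "conv f g \<gamma> \<noteq> 0"
  obtains h k where "h \<in> K" "k \<in> L" "(h, k) \<in> composable G" "q \<gamma> = gmult G h k"
proof -
  let ?H = "{h \<in> arrows G. rng G h = rng G (q \<gamma>)}"
  have \<gamma>: "\<gamma> \<in> arrows S" using nz by (auto simp: conv_def split: if_splits)
  have "\<exists>h\<in>?H. f (lift h) * g (gmult S (ginv S (lift h)) \<gamma>) \<noteq> 0"
  proof (rule ccontr)
    assume "\<not> ?thesis"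
    then have "conv f g \<gamma> = 0" using \<gamma> unfolding conv_def by (auto intro: infsum_0)
    then show False using nz by simp
  qed
  then obtain h where h: "h \<in> arrows G" "rng G h = rng G (q \<gamma>)" "f (lift h) \<noteq> 0"
    "g (gmult S (ginv S (lift h)) \<gamma>) \<noteq> 0" by auto
  have c: "(ginv S (lift h), \<gamma>) \<in> composable S" using h \<gamma> by (simp add: composable_iff_q)
  have cG: "(ginv G h, q \<gamma>) \<in> composable G" using h \<gamma> by (simp add: composable_def)
  have "h \<in> K" using f[rule_format, OF h(3)] h(1) by simp
  moreover have "gmult G (ginv G h) (q \<gamma>) \<in> L"
    using g[rule_format, OF h(4)] h(1) c by (simp add: q.map_mult)
  moreover have "(h, gmult G (ginv G h) (q \<gamma>)) \<in> composable G"
    using h \<gamma> cG by (simp add: composable_def)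
  moreover have "gmult G h (gmult G (ginv G h) (q \<gamma>)) = q \<gamma>"
    using Base.inv_mult_cancel[OF cG] h by simp
  ultimately show thesis by (intro that) auto
qed

text \<open>Over the range of \<open>U\<close> a single term of the sum can survive, that of the
  arrow of \<open>U\<close> with the range of \<open>\<gamma>\<close>, and it depends continuously
  on \<open>\<gamma>\<close>. Off the range of \<open>L\<close>, which is closed because it is
  compact, the convolution vanishes. The two open sets cover \<open>S\<close> because
  \<open>L\<close> is contained in \<open>U\<close>.\<close>

lemma conv_continuous_local:
  assumes f: "f \<in> Cc" "local_support f U \<phi> L" and g: "g \<in> Cc"
  shows "continuous_map (gtop S) euclidean (conv f g)"
proof (rule continuous_map_locallyI)
  note ef = Cc_equivariant[OF f(1)] and eg = Cc_equivariant[OF g]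
  obtain p where tr: "trivializes U \<phi> p" and L: "compactin (gtop G) L" "L \<subseteq> U"
    "\<forall>\<gamma>. f \<gamma> \<noteq> 0 \<longrightarrow> \<gamma> \<in> arrows S \<and> q \<gamma> \<in> L" using f(2) unfolding local_support_def by blast
  have U: "open_bisection G U" and \<phi>c: "continuous_map (subtopology (gtop G) U) (gtop S) \<phi>"
    and \<phi>: "\<And>h. h \<in> U \<Longrightarrow> \<phi> h \<in> arrows S" "\<And>h. h \<in> U \<Longrightarrow> q (\<phi> h) = h"
    using tr unfolding trivializes_def by blast+
  note UD = open_bisectionD[OF U]
  have UG: "arrows G \<inter> U = U" using UD(2) by blast
  have rq: "continuous_map (gtop S) (gtop G) (\<lambda>\<gamma>. rng G (q \<gamma>))"
    by (rule Base.continuous_map_rng[OF q_continuous])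
  obtain \<rho> where \<rho>: "homeomorphic_maps (subtopology (gtop G) U) (subtopology (gtop G) (rng G ` U)) (rng G) \<rho>"
    using U unfolding open_bisection_def homeomorphic_map_maps by blast
  have \<rho>c: "continuous_map (subtopology (gtop G) (rng G ` U)) (subtopology (gtop G) U) \<rho>"
    and \<rho>r: "\<And>h. h \<in> U \<Longrightarrow> \<rho> (rng G h) = h"
    using \<rho> UG unfolding homeomorphic_maps_def by auto
  fix \<gamma>0 assume "\<gamma>0 \<in> topspace (gtop S)"
  then have \<gamma>0: "\<gamma>0 \<in> arrows S" by simp
  show "\<exists>T. openin (gtop S) T \<and> \<gamma>0 \<in> T \<and> continuous_map (subtopology (gtop S) T) euclidean (conv f g)"
  proof (cases "rng G (q \<gamma>0) \<in> rng G ` U")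
    case True
    let ?T = "{\<gamma> \<in> topspace (gtop S). rng G (q \<gamma>) \<in> rng G ` U}"
    let ?X = "subtopology (gtop S) ?T"
    \<comment> \<open>\<open>\<rho>\<close> inverts the range map on the bisection, so
      \<open>\<eta> \<gamma>\<close> lifts the surviving arrow continuously, which the arbitrary
      choice \<open>lift\<close> would not do.\<close>
    define \<eta> where "\<eta> \<gamma> = \<phi> (\<rho> (rng G (q \<gamma>)))" for \<gamma>
    have T: "openin (gtop S) ?T" by (rule openin_continuous_map_preimage[OF rq UD(5)])
    have topX: "topspace ?X = ?T" by auto
    have "continuous_map ?X (subtopology (gtop G) (rng G ` U)) (\<lambda>\<gamma>. rng G (q \<gamma>))"
      using continuous_map_from_subtopology[OF rq] by (auto simp: continuous_map_in_subtopology)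
    from continuous_map_compose[OF continuous_map_compose[OF this \<rho>c] \<phi>c]
    have \<eta>c: "continuous_map ?X (gtop S) \<eta>" unfolding \<eta>_def[abs_def] o_def .
    have \<eta>: "\<eta> \<gamma> \<in> arrows S" "q (\<eta> \<gamma>) \<in> U" "rng G (q (\<eta> \<gamma>)) = rng G (q \<gamma>)" if \<gamma>T: "\<gamma> \<in> ?T" for \<gamma>
    proof -
      obtain h where h: "h \<in> U" "rng G (q \<gamma>) = rng G h" using \<gamma>T by blast
      then have "\<eta> \<gamma> = \<phi> h" by (simp add: \<eta>_def \<rho>r)
      then show "\<eta> \<gamma> \<in> arrows S" "q (\<eta> \<gamma>) \<in> U" "rng G (q (\<eta> \<gamma>)) = rng G (q \<gamma>)"
        using h \<phi> by simp_all
    qed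
    have idc: "continuous_map ?X (gtop S) (\<lambda>\<gamma>. \<gamma>)"
      using continuous_map_from_subtopology[OF continuous_map_id, of "gtop S" ?T] by (simp add: id_def)
    have mc: "continuous_map ?X (gtop S) (\<lambda>\<gamma>. gmult S (ginv S (\<eta> \<gamma>)) \<gamma>)"
    proof (rule Sigma.continuous_map_gmult[OF Sigma.continuous_map_ginv[OF \<eta>c] idc])
      fix \<gamma> assume "\<gamma> \<in> topspace ?X"
      then have \<gamma>: "\<gamma> \<in> ?T" "\<gamma> \<in> arrows S" by auto
      then show "(ginv S (\<eta> \<gamma>), \<gamma>) \<in> composable S"
        using \<eta>[OF \<gamma>(1)] by (simp add: composable_iff_q)
    qed
    have "continuous_map ?X euclidean (\<lambda>\<gamma>. f (\<eta> \<gamma>) * g (gmult S (ginv S (\<eta> \<gamma>)) \<gamma>))"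
      using continuous_map_compose[OF \<eta>c Cc_continuous[OF f(1)]]
        continuous_map_compose[OF mc Cc_continuous[OF g]]
      by (intro continuous_map_cmult) (simp_all only: o_def)
    then have "continuous_map ?X euclidean (conv f g)"
    proof (rule continuous_map_eq)
      fix \<gamma> assume "\<gamma> \<in> topspace ?X"
      then have \<gamma>: "\<gamma> \<in> ?T" "\<gamma> \<in> arrows S" by auto
      note \<eta>\<gamma> = \<eta>[OF \<gamma>(1)]
      show "f (\<eta> \<gamma>) * g (gmult S (ginv S (\<eta> \<gamma>)) \<gamma>) = conv f g \<gamma>"
      proof (rule conv_single[OF ef eg \<gamma>(2) \<eta>\<gamma>(1,3), symmetric])
        fix h assume h: "h \<in> arrows G" "rng G h = rng G (q \<gamma>)" "f (lift h) \<noteq> 0"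
        have "h \<in> U" using L(3)[rule_format, OF h(3)] L(2) h(1) by auto
        then show "h = q (\<eta> \<gamma>)" using inj_onD[OF UD(4), of h "q (\<eta> \<gamma>)"] h(2) \<eta>\<gamma> by simp
      qed
    qed
    then show ?thesis using T True \<gamma>0 by (intro exI[of _ ?T]) auto
  next
    case False
    let ?T = "{\<gamma> \<in> topspace (gtop S). rng G (q \<gamma>) \<in> topspace (gtop G) - rng G ` L}"
    have "compactin (gtop G) (rng G ` L)" by (rule image_compactin[OF L(1) Base.continuous_rng])
    then have "openin (gtop G) (topspace (gtop G) - rng G ` L)"
      using compactin_imp_closedin[OF Base.Hausdorff] by blast
    then have T: "openin (gtop S) ?T" by (rule openin_continuous_map_preimage[OF rq])
    have zero: "conv f g \<gamma> = 0" if \<gamma>: "\<gamma> \<in> ?T" for \<gamma>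
    proof (rule ccontr)
      assume "conv f g \<gamma> \<noteq> 0"
      from conv_support[OF L(3) _ this, of UNIV] obtain h k where
        hk: "h \<in> L" "(h, k) \<in> composable G" "q \<gamma> = gmult G h k"
        using equivariant_off[OF eg] by blast
      then have "rng G (q \<gamma>) = rng G h" by simp
      then show False using \<gamma> hk(1) by auto
    qed
    have "continuous_map (subtopology (gtop S) ?T) euclidean (\<lambda>\<gamma>. 0 :: complex)" by simp
    then have "continuous_map (subtopology (gtop S) ?T) euclidean (conv f g)"
    proof (rule continuous_map_eq)
      fix \<gamma> assume "\<gamma> \<in> topspace (subtopology (gtop S) ?T)"
      then have "\<gamma> \<in> ?T" unfolding topspace_subtopology by blast
      then show "0 = conv f g \<gamma>" by (rule zero[symmetric])
    qed
    moreover have "\<gamma>0 \<in> ?T" using False \<gamma>0 L(2) by auto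
    ultimately show ?thesis using T by blast
  qed
qed

lemma Cc_conv:
  assumes f: "f \<in> Cc" and g: "g \<in> Cc" shows "conv f g \<in> Cc"
proof -
  have "continuous_map (gtop S) euclidean (conv f g)"
    using f
  proof (induction f rule: Cc_induct)
    case zero
    have "conv (\<lambda>\<gamma>. 0) g = (\<lambda>\<gamma>. 0)" by (intro ext) (simp add: conv_def)
    then show ?case by simp
  next
    case (add f f')
    then show ?case by (simp add: conv_add_left Cc_fibre_finite continuous_map_add)
  next
    case (local f U \<phi> L)
    then show ?case using conv_continuous_local g by blast
  qed
  moreover
  obtain K where K: "compactin (gtop G) K" "\<forall>\<gamma>. f \<gamma> \<noteq> 0 \<longrightarrow> \<gamma> \<in> arrows S \<and> q \<gamma> \<in> K"
    by (rule Cc_support[OF f])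
  obtain L where L: "compactin (gtop G) L" "\<forall>\<gamma>. g \<gamma> \<noteq> 0 \<longrightarrow> \<gamma> \<in> arrows S \<and> q \<gamma> \<in> L"
    by (rule Cc_support[OF g])
  ultimately show ?thesis
  proof (intro Cc_I[OF equivariant_conv[OF Cc_equivariant[OF f] Cc_equivariant[OF g]] _
        Base.compactin_product[OF K(1) L(1)]])
    fix \<gamma> assume "conv f g \<gamma> \<noteq> 0"
    then obtain h k where "h \<in> K" "k \<in> L" "(h, k) \<in> composable G" "q \<gamma> = gmult G h k"
      by (rule conv_support[OF K(2) L(2)])
    then show "q \<gamma> \<in> {gmult G g h |g h. g \<in> K \<and> h \<in> L \<and> (g, h) \<in> composable G}" by blast
  qed
qed

lemma Cc_invol:
  assumes f: "f \<in> Cc" shows "invol f \<in> Cc"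
proof -
  obtain K where K: "compactin (gtop G) K" "\<forall>\<gamma>. f \<gamma> \<noteq> 0 \<longrightarrow> \<gamma> \<in> arrows S \<and> q \<gamma> \<in> K"
    by (rule Cc_support[OF f])
  have "continuous_map (gtop S) euclidean (\<lambda>\<gamma>. cnj (f (ginv S \<gamma>)))"
    using continuous_map_compose[OF Sigma.continuous_inv Cc_continuous[OF f]]
    by (intro continuous_map_cnj) (simp only: o_def)
  then have "continuous_map (gtop S) euclidean (invol f)"
    by (rule continuous_map_eq) (simp add: invol_def)
  then show ?thesis
  proof (rule Cc_I[OF equivariant_invol[OF Cc_equivariant[OF f]] _
        image_compactin[OF K(1) Base.continuous_inv]])
    fix \<gamma> assume \<gamma>: "\<gamma> \<in> arrows S" "invol f \<gamma> \<noteq> 0"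
    then have "q (ginv S \<gamma>) \<in> K" using K(2) by (auto simp: invol_def)
    then show "q \<gamma> \<in> ginv G ` K" using \<gamma>(1) by (intro image_eqI[of _ _ "q (ginv S \<gamma>)"]) simp_all
  qed
qed

lemma kernel_conv_sum:
  assumes "equivariant f" "equivariant g" "h \<in> base_fibre x" "k \<in> base_fibre x"
    and "finite M" "M \<subseteq> base_fibre x" "\<And>l. \<lbrakk>l \<in> base_fibre x; l \<notin> M\<rbrakk> \<Longrightarrow> kernel f h l * kernel g l k = 0"
  shows "kernel (conv f g) h k = (\<Sum>l\<in>M. kernel f h l * kernel g l k)"
  unfolding kernel_conv[OF assms(1-4)] using assms(5-7) by (intro infsum_finite_support) auto

lemma Cc_kernel_finite:
  assumes "f \<in> Cc" "k \<in> base_fibre x"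
  shows "finite {l \<in> base_fibre x. kernel f l k \<noteq> 0}" "finite {l \<in> base_fibre x. kernel f k l \<noteq> 0}"
  using assms Cc_equivariant Cc_fibre_finite by (auto intro: kernel_finite_column kernel_finite_row)

text \<open>Associativity of the matrix product. The column \<open>k\<close> of \<open>e\<close> is
  supported in \<open>?M\<close>, and the columns of \<open>g\<close> indexed by \<open>?M\<close>
  are supported in \<open>?N\<close>; both sets are finite, so the double sum may be
  exchanged.\<close>

lemma conv_assoc:
  assumes f: "f \<in> Cc" and g: "g \<in> Cc" and e: "e \<in> Cc"
  shows "conv (conv f g) e = conv f (conv g e)"
proof (rule equivariant_eqI)
  note eq = Cc_equivariant[OF f] Cc_equivariant[OF g] Cc_equivariant[OF e]
  show "equivariant (conv (conv f g) e)" "equivariant (conv f (conv g e))"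
    by (intro equivariant_conv eq)+
  fix x h k assume hk: "h \<in> base_fibre x" "k \<in> base_fibre x"
  let ?M = "{l \<in> base_fibre x. kernel e l k \<noteq> 0}"
  let ?N = "\<Union>l\<in>?M. {m \<in> base_fibre x. kernel g m l \<noteq> 0}"
  have M: "finite ?M" by (rule Cc_kernel_finite[OF e hk(2)])
  have N: "finite ?N" using M Cc_kernel_finite(1)[OF g] by auto
  have ge: "kernel (conv g e) m k = (\<Sum>l\<in>?M. kernel g m l * kernel e l k)" if "m \<in> base_fibre x" for m
    using that hk M by (intro kernel_conv_sum eq) auto
  have "kernel (conv (conv f g) e) h k = (\<Sum>l\<in>?M. kernel (conv f g) h l * kernel e l k)"
    using hk M by (intro kernel_conv_sum equivariant_conv eq) auto
  also have "\<dots> = (\<Sum>l\<in>?M. (\<Sum>m\<in>?N. kernel f h m * kernel g m l) * kernel e l k)"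
    using hk N by (intro sum.cong refl arg_cong2[where f = "(*)"] kernel_conv_sum eq) auto
  also have "\<dots> = (\<Sum>m\<in>?N. kernel f h m * (\<Sum>l\<in>?M. kernel g m l * kernel e l k))"
    by (simp add: sum_distrib_left sum_distrib_right mult.assoc) (rule sum.swap)
  also have "\<dots> = (\<Sum>m\<in>?N. kernel f h m * kernel (conv g e) m k)"
    by (intro sum.cong refl) (auto simp: ge)
  also have "\<dots> = kernel (conv f (conv g e)) h k"
  proof (rule kernel_conv_sum[OF eq(1) equivariant_conv[OF eq(2,3)] hk N, symmetric])
    fix m assume m: "m \<in> base_fibre x" "m \<notin> ?N"
    then have "kernel g m l * kernel e l k = 0" if "l \<in> ?M" for l using that by auto
    then show "kernel f h m * kernel (conv g e) m k = 0" unfolding ge[OF m(1)] by simp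
  qed auto
  finally show "kernel (conv (conv f g) e) h k = kernel (conv f (conv g e)) h k" .
qed

lemma invol_conv:
  assumes f: "f \<in> Cc" and g: "g \<in> Cc"
  shows "invol (conv f g) = conv (invol g) (invol f)"
proof (rule equivariant_eqI)
  note eq = Cc_equivariant[OF f] Cc_equivariant[OF g]
  show "equivariant (invol (conv f g))" "equivariant (conv (invol g) (invol f))"
    by (intro equivariant_conv equivariant_invol eq)+
  fix x h k assume hk: "h \<in> base_fibre x" "k \<in> base_fibre x"
  let ?M = "{l \<in> base_fibre x. kernel g l h \<noteq> 0}"
  have M: "finite ?M" by (rule Cc_kernel_finite[OF g hk(1)])
  have "kernel (invol (conv f g)) h k = cnj (\<Sum>l\<in>?M. kernel f k l * kernel g l h)"
    unfolding kernel_invol[OF hk] using hk M by (intro arg_cong[where f = cnj] kernel_conv_sum eq) auto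
  also have "\<dots> = (\<Sum>l\<in>?M. kernel (invol g) h l * kernel (invol f) l k)"
    using hk unfolding cnj_sum by (intro sum.cong refl) (auto simp: kernel_invol[of _ x])
  also have "\<dots> = kernel (conv (invol g) (invol f)) h k"
    using hk M by (intro kernel_conv_sum[symmetric] equivariant_invol eq) (auto simp: kernel_invol[of _ x])
  finally show "kernel (invol (conv f g)) h k = kernel (conv (invol g) (invol f)) h k" .
qed

section \<open>The reduced norm\<close>

definition bounded_by :: "('s \<Rightarrow> complex) \<Rightarrow> real \<Rightarrow> bool" where
  "bounded_by f C \<longleftrightarrow> (\<forall>x\<in>units G. kernel_bound (base_fibre x) (kernel f) C)"

lemma bounded_by_add:
  assumes "bounded_by f C" "bounded_by g D" shows "bounded_by (\<lambda>\<gamma>. f \<gamma> + g \<gamma>) (C + D)"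
proof -
  have "kernel (\<lambda>\<gamma>. f \<gamma> + g \<gamma>) = (\<lambda>h k. kernel f h k + kernel g h k)" by (simp add: kernel_def fun_eq_iff)
  then show ?thesis using assms by (simp add: bounded_by_def kernel_bound_add)
qed

lemma bounded_by_scale:
  assumes "bounded_by f C" shows "bounded_by (\<lambda>\<gamma>. c * f \<gamma>) (cmod c * C)"
proof -
  have "kernel (\<lambda>\<gamma>. c * f \<gamma>) = (\<lambda>h k. c * kernel f h k)" by (simp add: kernel_def fun_eq_iff)
  then show ?thesis using assms by (simp add: bounded_by_def kernel_bound_scale)
qed

text \<open>A nonzero entry at \<open>h\<close>, \<open>k\<close> puts the product of
  \<open>h\<close> with the inverse of \<open>k\<close> into \<open>U\<close>. The range of this
  arrow is that of \<open>h\<close> and its source is the range of \<open>k\<close>. As range and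
  source are injective on \<open>U\<close>, each row and each column has at most one nonzero
  entry.\<close>

lemma bounded_by_local:
  assumes "f \<in> Cc" "local_support f U \<phi> L" "0 \<le> B" "\<And>\<gamma>. cmod (f \<gamma>) \<le> B"
  shows "bounded_by f B"
proof -
  have U: "open_bisection G U" and L: "L \<subseteq> U" "\<forall>\<gamma>. f \<gamma> \<noteq> 0 \<longrightarrow> \<gamma> \<in> arrows S \<and> q \<gamma> \<in> L"
    using assms(2) unfolding local_support_def trivializes_def by blast+
  have inU: "gmult G h (ginv G k) \<in> U"
    if "h \<in> base_fibre x" "k \<in> base_fibre x" "kernel f h k \<noteq> 0" for x h k
  proof -
    have "f (lift (gmult G h (ginv G k))) \<noteq> 0"
      using that kernel_eq_zero_iff[OF Cc_equivariant[OF assms(1)]] by blast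
    from L(2)[rule_format, OF this] show ?thesis
      using L(1) base_fibre_composable[OF that(1,2)] by auto
  qed
  have "kernel_bound (base_fibre x) (kernel f) B" for x
  proof (rule kernel_bound_sparse[OF assms(3)])
    show "cmod (kernel f h k) \<le> B" for h k by (simp add: kernel_def assms(4))
    fix h k k' assume hk: "h \<in> base_fibre x" "k \<in> base_fibre x" "k' \<in> base_fibre x"
      "kernel f h k \<noteq> 0" "kernel f h k' \<noteq> 0"
    note c = base_fibre_composable[OF hk(1,2)] base_fibre_composable[OF hk(1,3)]
    have "gmult G h (ginv G k) = gmult G h (ginv G k')"
      by (rule inj_onD[OF open_bisectionD(4)[OF U] _ inU[OF hk(1,2,4)] inU[OF hk(1,3,5)]])
         (simp add: Base.rng_mult[OF c(1)] Base.rng_mult[OF c(2)])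
    then have "ginv G k = ginv G k'" using c Base.inv_mult_cancel by metis
    then show "k = k'" using hk Base.inv_inv by (metis base_fibreD(1))
  next
    fix h h' k assume hk: "h \<in> base_fibre x" "h' \<in> base_fibre x" "k \<in> base_fibre x"
      "kernel f h k \<noteq> 0" "kernel f h' k \<noteq> 0"
    note c = base_fibre_composable[OF hk(1,3)] base_fibre_composable[OF hk(2,3)]
    have "gmult G h (ginv G k) = gmult G h' (ginv G k)"
      by (rule inj_onD[OF open_bisectionD(3)[OF U] _ inU[OF hk(1,3,4)] inU[OF hk(2,3,5)]])
         (simp add: Base.src_mult[OF c(1)] Base.src_mult[OF c(2)])
    then show "h = h'" using c Base.mult_inv_cancel by metis
  qed
  then show ?thesis by (simp add: bounded_by_def)
qed

text \<open>Finiteness of the reduced norm. The bound adds up over the bisections of a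
  decomposition; only its existence is of interest.\<close>

lemma Cc_bounded_by: "f \<in> Cc \<Longrightarrow> \<exists>C\<ge>0. bounded_by f C"
proof (induction f rule: Cc_induct)
  case zero
  have "kernel_bound I (kernel (\<lambda>\<gamma>. 0)) 0" for I
    by (rule kernel_boundI) (simp add: kernel_def L2_set_def)
  then show ?case by (auto simp: bounded_by_def)
next
  case (add f g)
  then obtain C D where "0 \<le> C" "0 \<le> D" "bounded_by f C" "bounded_by g D" by blast
  then have "bounded_by (\<lambda>\<gamma>. f \<gamma> + g \<gamma>) (C + D)" "0 \<le> C + D"
    by (simp_all add: bounded_by_add)
  then show ?case by blast
next
  case (local f U \<phi> L)
  obtain B where "0 \<le> B" "\<And>\<gamma>. cmod (f \<gamma>) \<le> B" using Cc_bounded[OF local(1)] by blast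
  then show ?case using bounded_by_local[OF local] by blast
qed

lemma regular_rep_sum:
  assumes f: "f \<in> Cc" and \<xi>: "\<xi> \<in> hilb x" and h: "h \<in> base_fibre x"
    and M: "finite M" "M \<subseteq> base_fibre x"
    and z: "\<And>l. \<lbrakk>l \<in> base_fibre x; l \<notin> M\<rbrakk> \<Longrightarrow> kernel f h l * \<xi> (lift l) = 0"
  shows "regular_rep x f \<xi> (lift h) = (\<Sum>k\<in>M. kernel f h k * \<xi> (lift k))"
  unfolding regular_rep_eq[OF Cc_equivariant[OF f] \<xi> h] using M z by (intro infsum_finite_support) auto

text \<open>The vector may have infinite support, but the finitely many rows in \<open>F\<close> are
  finite and see only the coordinates in \<open>?M\<close>, so the bound on finite submatrices
  applies.\<close>

lemma regular_rep_partial_sum: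
  assumes f: "f \<in> Cc" and C: "0 \<le> C" "kernel_bound (base_fibre x) (kernel f) C" and \<xi>: "\<xi> \<in> hilb x"
    and F: "finite F" "F \<subseteq> base_fibre x"
  shows "(\<Sum>h\<in>F. (cmod (regular_rep x f \<xi> (lift h)))\<^sup>2) \<le> C\<^sup>2 * (hilb_norm x \<xi>)\<^sup>2"
proof -
  let ?M = "\<Union>h\<in>F. {k \<in> base_fibre x. kernel f h k \<noteq> 0}"
  have M: "finite ?M" "?M \<subseteq> base_fibre x" using F Cc_kernel_finite(2)[OF f] by auto
  have "(\<Sum>h\<in>F. (cmod (regular_rep x f \<xi> (lift h)))\<^sup>2)
      = (\<Sum>h\<in>F. (cmod (\<Sum>k\<in>?M. kernel f h k * \<xi> (lift k)))\<^sup>2)"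
    using F M by (intro sum.cong refl arg_cong[where f = "\<lambda>z. (cmod z)\<^sup>2"] regular_rep_sum[OF f \<xi>]) auto
  also have "\<dots> \<le> C\<^sup>2 * (\<Sum>k\<in>?M. (cmod (\<xi> (lift k)))\<^sup>2)"
    by (rule kernel_boundD_sum[OF C(2) F M])
  also have "\<dots> \<le> C\<^sup>2 * (hilb_norm x \<xi>)\<^sup>2"
    unfolding hilb_norm_def using M \<xi>
    by (intro mult_left_mono) (auto simp: infsum_nonneg hilb_def intro!: finite_sum_le_infsum)
  finally show ?thesis .
qed

lemma hilb_norm_regular_rep_le:
  assumes "f \<in> Cc" "0 \<le> C" "kernel_bound (base_fibre x) (kernel f) C" "\<xi> \<in> hilb x"
  shows "hilb_norm x (regular_rep x f \<xi>) \<le> C * hilb_norm x \<xi>"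
    "(\<lambda>h. (cmod (regular_rep x f \<xi> (lift h)))\<^sup>2) summable_on base_fibre x"
proof -
  have nn: "0 \<le> hilb_norm x \<xi>" by (simp add: hilb_norm_def infsum_nonneg)
  note r = real_infsum_le[OF _ regular_rep_partial_sum[OF assms]]
  show "(\<lambda>h. (cmod (regular_rep x f \<xi> (lift h)))\<^sup>2) summable_on base_fibre x"
    by (rule r(1)) auto
  have "(\<Sum>\<^sub>\<infinity>h\<in>base_fibre x. (cmod (regular_rep x f \<xi> (lift h)))\<^sup>2) \<le> (C * hilb_norm x \<xi>)\<^sup>2"
    unfolding power_mult_distrib by (rule r(2)) auto
  then show "hilb_norm x (regular_rep x f \<xi>) \<le> C * hilb_norm x \<xi>"
    unfolding hilb_norm_def[of x "regular_rep x f \<xi>"] using assms(2) nn by (intro real_le_lsqrt) auto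
qed

text \<open>Values on finitely many chosen lifts can be prescribed freely: equivariance determines
  the rest of each fibre, because the circle acts freely and transitively on it.\<close>

lemma hilb_extension:
  assumes F: "finite F" "F \<subseteq> base_fibre x"
  obtains \<xi> where "\<xi> \<in> hilb x" "\<And>k. k \<in> base_fibre x \<Longrightarrow> \<xi> (lift k) = (if k \<in> F then \<zeta> k else 0)"
    "hilb_norm x \<xi> = L2_set (\<lambda>k. cmod (\<zeta> k)) F"
proof -
  \<comment> \<open>The phase of \<open>\<gamma>\<close> relative to the lift of its image;
    \<open>act_inj\<close> makes it unique.\<close>
  define w where "w \<gamma> = (SOME z. z \<in> circle \<and> \<gamma> = act z (lift (q \<gamma>)))" for \<gamma>
  have w: "w \<gamma> \<in> circle \<and> \<gamma> = act (w \<gamma>) (lift (q \<gamma>))" if "\<gamma> \<in> arrows S" for \<gamma>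
    unfolding w_def by (rule someI_ex) (use same_fibre[of "lift (q \<gamma>)" \<gamma>] that in auto)
  have wu: "w \<gamma> = z" if "z \<in> circle" "\<gamma> = act z (lift (q \<gamma>))" "\<gamma> \<in> arrows S" for z \<gamma>
    using act_inj[of "w \<gamma>" z "lift (q \<gamma>)"] w[OF that(3)] that by simp
  define \<xi> where "\<xi> \<gamma> = (if \<gamma> \<in> arrows S \<and> q \<gamma> \<in> F then cnj (w \<gamma>) * \<zeta> (q \<gamma>) else 0)" for \<gamma>
  have sf: "\<gamma> \<in> source_fibre x \<longleftrightarrow> \<gamma> \<in> arrows S \<and> q \<gamma> \<in> base_fibre x" for \<gamma>
    unfolding source_fibre_def base_fibre_def by auto
  have lift: "\<xi> (lift k) = (if k \<in> F then \<zeta> k else 0)" if k: "k \<in> base_fibre x" for k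
    using k wu[of 1 "lift k"] by (simp add: \<xi>_def)
  have sum: "(\<Sum>\<^sub>\<infinity>h\<in>base_fibre x. (cmod (\<xi> (lift h)))\<^sup>2) = (\<Sum>h\<in>F. (cmod (\<zeta> h))\<^sup>2)"
    "(\<lambda>h. (cmod (\<xi> (lift h)))\<^sup>2) summable_on base_fibre x"
  proof -
    have "(\<Sum>\<^sub>\<infinity>h\<in>base_fibre x. (cmod (\<xi> (lift h)))\<^sup>2) = (\<Sum>\<^sub>\<infinity>h\<in>F. (cmod (\<zeta> h))\<^sup>2)"
      using F(2) by (intro infsum_cong_neutral) (auto simp: lift)
    then show "(\<Sum>\<^sub>\<infinity>h\<in>base_fibre x. (cmod (\<xi> (lift h)))\<^sup>2) = (\<Sum>h\<in>F. (cmod (\<zeta> h))\<^sup>2)"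
      using F by simp
    have "(\<lambda>h. (cmod (\<zeta> h))\<^sup>2) summable_on F" using F by simp
    then show "(\<lambda>h. (cmod (\<xi> (lift h)))\<^sup>2) summable_on base_fibre x"
      using F(2) by (subst summable_on_cong_neutral[where T = F and g = "\<lambda>h. (cmod (\<zeta> h))\<^sup>2"]) (auto simp: lift)
  qed
  have "\<xi> \<in> hilb x"
    unfolding hilb_def
  proof (intro CollectI conjI allI impI ballI sum(2))
    show "\<xi> \<gamma> = 0" if "\<gamma> \<notin> source_fibre x" for \<gamma> using that F(2) by (auto simp: \<xi>_def sf)
    fix z \<gamma> assume z: "z \<in> circle" and "\<gamma> \<in> source_fibre x"
    then have \<gamma>: "\<gamma> \<in> arrows S" by (simp add: sf)
    have "act z \<gamma> = act z (act (w \<gamma>) (lift (q \<gamma>)))"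
      by (rule arg_cong[OF conjunct2[OF w[OF \<gamma>]]])
    also have "\<dots> = act (z * w \<gamma>) (lift (q \<gamma>))"
      using w[OF \<gamma>] z \<gamma> by (intro act_act) auto
    finally have "w (act z \<gamma>) = z * w \<gamma>"
      using w[OF \<gamma>] z \<gamma> circle_mult[of z "w \<gamma>"] by (intro wu) auto
    then show "\<xi> (act z \<gamma>) = cnj z * \<xi> \<gamma>" using z \<gamma> by (simp add: \<xi>_def)
  qed
  then show thesis using lift sum(1) by (intro that[of \<xi>]) (auto simp: hilb_norm_def L2_set_def)
qed

lemma hilb_zero: "(\<lambda>\<gamma>. 0) \<in> hilb x" "hilb_norm x (\<lambda>\<gamma>. 0) = 0"
  by (simp_all add: hilb_def hilb_norm_def)

lemma rep_norm_set_bdd: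
  assumes f: "f \<in> Cc" and x: "x \<in> units G"
  shows "bdd_above {hilb_norm x (regular_rep x f \<xi>) |\<xi>. \<xi> \<in> hilb x \<and> hilb_norm x \<xi> \<le> 1}"
proof -
  obtain C where C: "0 \<le> C" "bounded_by f C" using Cc_bounded_by[OF f] by blast
  have "hilb_norm x (regular_rep x f \<xi>) \<le> C" if "\<xi> \<in> hilb x" "hilb_norm x \<xi> \<le> 1" for \<xi>
    using hilb_norm_regular_rep_le(1)[OF f C(1) _ that(1)] mult_left_mono[OF that(2) C(1)] C(2) x
    by (force simp: bounded_by_def)
  then show ?thesis unfolding bdd_above_def by blast
qed

text \<open>One direction applies the bound on finite submatrices to arbitrary vectors of
  \<open>hilb x\<close>. The other tests \<open>rep_norm\<close> on a normalized vector with support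
  \<open>F'\<close> and keeps only the coordinates in \<open>F\<close> of its image.\<close>

lemma rep_norm_le_iff:
  assumes f: "f \<in> Cc" and x: "x \<in> units G" and C: "0 \<le> C"
  shows "rep_norm x f \<le> C \<longleftrightarrow> kernel_bound (base_fibre x) (kernel f) C"
proof
  let ?B = "{hilb_norm x (regular_rep x f \<xi>) |\<xi>. \<xi> \<in> hilb x \<and> hilb_norm x \<xi> \<le> 1}"
  assume K: "kernel_bound (base_fibre x) (kernel f) C"
  show "rep_norm x f \<le> C"
    unfolding rep_norm_def
  proof (rule cSup_least)
    show "?B \<noteq> {}" using hilb_zero[of x] by force
    fix r assume "r \<in> ?B"
    then obtain \<xi> where \<xi>: "\<xi> \<in> hilb x" "hilb_norm x \<xi> \<le> 1" "r = hilb_norm x (regular_rep x f \<xi>)" by blast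
    then show "r \<le> C" using hilb_norm_regular_rep_le(1)[OF f C K \<xi>(1)] mult_left_mono[OF \<xi>(2) C] by simp
  qed
next
  let ?B = "{hilb_norm x (regular_rep x f \<xi>) |\<xi>. \<xi> \<in> hilb x \<and> hilb_norm x \<xi> \<le> 1}"
  assume le: "rep_norm x f \<le> C"
  \<comment> \<open>Some bound is needed beforehand: an unsummable \<open>infsum\<close> is
    \<open>0\<close>, so without summability the norm of the image would not dominate its finite
    partial sums.\<close>
  obtain D where D: "0 \<le> D" "kernel_bound (base_fibre x) (kernel f) D"
    using Cc_bounded_by[OF f] x by (auto simp: bounded_by_def)
  show "kernel_bound (base_fibre x) (kernel f) C"
  proof (rule kernel_boundI)
    fix F F' and \<zeta> :: "'g \<Rightarrow> complex"
    assume F: "finite F" "F \<subseteq> base_fibre x" "finite F'" "F' \<subseteq> base_fibre x"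
    let ?n = "L2_set (\<lambda>k. cmod (\<zeta> k)) F'"
    let ?lhs = "L2_set (\<lambda>h. cmod (\<Sum>k\<in>F'. kernel f h k * \<zeta> k)) F"
    show "?lhs \<le> C * ?n"
    proof (cases "?n = 0")
      case True
      then have "\<zeta> k = 0" if "k \<in> F'" for k using that F(3) by (simp add: L2_set_eq_0_iff)
      then show ?thesis using True by (simp add: L2_set_def)
    next
      case False
      then have n: "0 < ?n" using L2_set_nonneg[of "\<lambda>k. cmod (\<zeta> k)" F'] by linarith
      define c where "c = complex_of_real (1 / ?n)"
      have cn: "cmod c = 1 / ?n" using n by (simp add: c_def norm_divide)
      obtain \<xi> where \<xi>: "\<xi> \<in> hilb x" and \<xi>F: "\<And>k. k \<in> base_fibre x \<Longrightarrow> \<xi> (lift k) = (if k \<in> F' then c * \<zeta> k else 0)"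
        and nm: "hilb_norm x \<xi> = L2_set (\<lambda>k. cmod (c * \<zeta> k)) F'"
        using hilb_extension[OF F(3,4), of "\<lambda>k. c * \<zeta> k"] by metis
      have "hilb_norm x \<xi> = cmod c * ?n"
        unfolding nm by (simp add: norm_mult L2_set_right_distrib)
      then have "hilb_norm x \<xi> \<le> 1" using cn n by simp
      then have "hilb_norm x (regular_rep x f \<xi>) \<in> ?B" using \<xi> by blast
      then have "hilb_norm x (regular_rep x f \<xi>) \<le> C"
        using cSup_upper[OF _ rep_norm_set_bdd[OF f x]] le unfolding rep_norm_def by force
      moreover have "L2_set (\<lambda>h. cmod (regular_rep x f \<xi> (lift h))) F \<le> hilb_norm x (regular_rep x f \<xi>)"
        unfolding L2_set_def hilb_norm_def using F hilb_norm_regular_rep_le(2)[OF f D \<xi>]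
        by (intro real_sqrt_le_mono finite_sum_le_infsum) auto
      moreover have "L2_set (\<lambda>h. cmod (regular_rep x f \<xi> (lift h))) F = cmod c * ?lhs"
        unfolding L2_set_right_distrib[OF norm_ge_zero]
      proof (rule L2_set_cong[OF refl])
        fix h assume "h \<in> F"
        then have "regular_rep x f \<xi> (lift h) = (\<Sum>k\<in>F'. kernel f h k * \<xi> (lift k))"
          using F \<xi>F by (intro regular_rep_sum[OF f \<xi>]) auto
        also have "\<dots> = c * (\<Sum>k\<in>F'. kernel f h k * \<zeta> k)"
          unfolding sum_distrib_left using F(4) \<xi>F by (intro sum.cong refl) auto
        finally show "cmod (regular_rep x f \<xi> (lift h)) = cmod c * cmod (\<Sum>k\<in>F'. kernel f h k * \<zeta> k)"
          by (simp add: norm_mult)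
      qed
      ultimately have "1 / ?n * ?lhs \<le> C" using cn by simp
      then show ?thesis using n by (simp add: field_simps)
    qed
  qed
qed

lemma unit_in_base_fibre: "x \<in> units G \<Longrightarrow> x \<in> base_fibre x"
  by (rule base_fibreI) simp_all

lemma rep_norms_bdd:
  assumes "f \<in> Cc" shows "bdd_above (insert 0 ((\<lambda>x. rep_norm x f) ` units G))"
proof -
  obtain C where C: "0 \<le> C" "bounded_by f C" using Cc_bounded_by[OF assms] by blast
  have "\<forall>x\<in>units G. rep_norm x f \<le> C" using C rep_norm_le_iff[OF assms] by (auto simp: bounded_by_def)
  then show ?thesis using C(1) by (auto simp: bdd_above_def)
qed

lemma reduced_norm_nonneg: "f \<in> Cc \<Longrightarrow> 0 \<le> reduced_norm f"
  unfolding reduced_norm_def by (rule cSup_upper[OF _ rep_norms_bdd]) auto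

text \<open>The suprema in the definition of the norm are eliminated here; together with
  nonnegativity this equivalence reduces norm estimates to matrix bounds.\<close>

lemma reduced_norm_le_iff:
  assumes f: "f \<in> Cc" and C: "0 \<le> C" shows "reduced_norm f \<le> C \<longleftrightarrow> bounded_by f C"
proof -
  have "reduced_norm f \<le> C \<longleftrightarrow> (\<forall>r\<in>insert 0 ((\<lambda>x. rep_norm x f) ` units G). r \<le> C)"
    unfolding reduced_norm_def using rep_norms_bdd[OF f] by (intro cSup_le_iff) auto
  then show ?thesis using C rep_norm_le_iff[OF f _ C] by (auto simp: bounded_by_def)
qed

lemma bounded_by_reduced_norm: "f \<in> Cc \<Longrightarrow> bounded_by f (reduced_norm f)"
  using reduced_norm_le_iff reduced_norm_nonneg by blast

text \<open>Each value is, up to a phase, an entry of a matrix. Hence the reduced norm dominates the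
  supremum norm, and sequences that are Cauchy for it converge pointwise.\<close>

lemma bounded_by_value:
  assumes "equivariant f" "bounded_by f C" "\<gamma> \<in> arrows S" shows "cmod (f \<gamma>) \<le> C"
proof -
  obtain z where z: "z \<in> circle" "kernel f (q \<gamma>) (src G (q \<gamma>)) = z * f \<gamma>"
    using kernel_src[OF assms(1,3)] assms(1) by blast
  have "cmod (kernel f (q \<gamma>) (src G (q \<gamma>))) \<le> C"
    using assms(2,3) by (intro kernel_bound_entry[of "base_fibre (src G (q \<gamma>))"] base_fibreI)
      (simp_all add: bounded_by_def)
  then show ?thesis using z by (simp add: norm_mult)
qed

lemma reduced_norm_add:
  assumes "f \<in> Cc" "g \<in> Cc"
  shows "reduced_norm (\<lambda>\<gamma>. f \<gamma> + g \<gamma>) \<le> reduced_norm f + reduced_norm g"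
proof -
  have "bounded_by (\<lambda>\<gamma>. f \<gamma> + g \<gamma>) (reduced_norm f + reduced_norm g)"
    by (intro bounded_by_add bounded_by_reduced_norm assms)
  then show ?thesis using reduced_norm_le_iff[OF Cc_add[OF assms]] reduced_norm_nonneg assms by simp
qed

lemma reduced_norm_scale_le:
  assumes "f \<in> Cc" shows "reduced_norm (\<lambda>\<gamma>. c * f \<gamma>) \<le> cmod c * reduced_norm f"
proof -
  have "bounded_by (\<lambda>\<gamma>. c * f \<gamma>) (cmod c * reduced_norm f)"
    by (intro bounded_by_scale bounded_by_reduced_norm assms)
  then show ?thesis using reduced_norm_le_iff[OF Cc_scale[OF assms]] reduced_norm_nonneg[OF assms] by simp
qed

lemma reduced_norm_scale:
  assumes "f \<in> Cc" shows "reduced_norm (\<lambda>\<gamma>. c * f \<gamma>) = cmod c * reduced_norm f"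
proof (cases "c = 0")
  case True
  then show ?thesis using reduced_norm_scale_le[OF assms, of 0] reduced_norm_nonneg[OF Cc_zero] by simp
next
  case False
  have "cmod c * reduced_norm f \<le> cmod c * (cmod (1 / c) * reduced_norm (\<lambda>\<gamma>. c * f \<gamma>))"
    using reduced_norm_scale_le[OF Cc_scale[OF assms, of c], of "1 / c"] False
    by (intro mult_left_mono) simp_all
  also have "\<dots> = reduced_norm (\<lambda>\<gamma>. c * f \<gamma>)" using False by (simp add: norm_divide)
  finally show ?thesis using reduced_norm_scale_le[OF assms, of c] by simp
qed

lemma reduced_norm_conv:
  assumes f: "f \<in> Cc" and g: "g \<in> Cc"
  shows "reduced_norm (conv f g) \<le> reduced_norm f * reduced_norm g"
proof -
  note eq = Cc_equivariant[OF f] Cc_equivariant[OF g]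
  have "kernel_bound (base_fibre x) (kernel (conv f g)) (reduced_norm f * reduced_norm g)"
    if "x \<in> units G" for x
  proof (rule kernel_bound_mult[where K = "kernel f" and L = "kernel g"])
    show "kernel (conv f g) h k = (\<Sum>l\<in>M. kernel f h l * kernel g l k)"
      if "finite M" "M \<subseteq> base_fibre x" "{l \<in> base_fibre x. kernel g l k \<noteq> 0} \<subseteq> M"
        "h \<in> base_fibre x" "k \<in> base_fibre x" for M h k
      using that by (intro kernel_conv_sum eq) auto
  qed (use that bounded_by_reduced_norm f g reduced_norm_nonneg Cc_kernel_finite in \<open>auto simp: bounded_by_def\<close>)
  then have "bounded_by (conv f g) (reduced_norm f * reduced_norm g)" by (simp add: bounded_by_def)
  then show ?thesis using reduced_norm_le_iff[OF Cc_conv[OF f g]] reduced_norm_nonneg f g by simp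
qed

text \<open>If \<open>K\<close> is the matrix of \<open>f\<close>, then K* K is the matrix of
  \<open>conv (invol f) f\<close>, and \<open>kernel_bound_of_adjoint_mult\<close> gives the
  nontrivial half of the C*-identity.\<close>

lemma reduced_norm_square_le:
  assumes f: "f \<in> Cc" shows "(reduced_norm f)\<^sup>2 \<le> reduced_norm (conv (invol f) f)"
proof -
  let ?C = "reduced_norm (conv (invol f) f)"
  note ff = Cc_conv[OF Cc_invol[OF f] f]
  have "kernel_bound (base_fibre x) (kernel f) (sqrt ?C)" if "x \<in> units G" for x
  proof (rule kernel_bound_of_adjoint_mult)
    show "kernel (conv (invol f) f) h k = (\<Sum>l\<in>M. cnj (kernel f l h) * kernel f l k)"
      if "finite M" "M \<subseteq> base_fibre x" "{l \<in> base_fibre x. kernel f l k \<noteq> 0} \<subseteq> M"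
        "h \<in> base_fibre x" "k \<in> base_fibre x" for M h k
    proof -
      have "kernel (conv (invol f) f) h k = (\<Sum>l\<in>M. kernel (invol f) h l * kernel f l k)"
        using that by (intro kernel_conv_sum equivariant_invol Cc_equivariant f) auto
      then show ?thesis using that by (simp add: kernel_invol[of h x] subset_iff)
    qed
  qed (use that bounded_by_reduced_norm[OF ff] reduced_norm_nonneg[OF ff] Cc_kernel_finite[OF f] in
      \<open>auto simp: bounded_by_def\<close>)
  then have "bounded_by f (sqrt ?C)" by (simp add: bounded_by_def)
  then have "reduced_norm f \<le> sqrt ?C" using reduced_norm_le_iff[OF f] reduced_norm_nonneg[OF ff] by simp
  then have "(reduced_norm f)\<^sup>2 \<le> (sqrt ?C)\<^sup>2" by (rule power_mono) (rule reduced_norm_nonneg[OF f])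
  then show ?thesis using reduced_norm_nonneg[OF ff] by simp
qed

lemma invol_invol: "f \<in> Cc \<Longrightarrow> invol (invol f) = f"
  using equivariant_off[OF Cc_equivariant] by (intro ext) (auto simp: invol_def)

text \<open>Together with submultiplicativity this gives the remaining half of the
  C*-identity.\<close>

lemma reduced_norm_invol: "f \<in> Cc \<Longrightarrow> reduced_norm (invol f) \<le> reduced_norm f"
proof -
  have le: "reduced_norm f \<le> reduced_norm (invol f)" if f: "f \<in> Cc" for f
  proof (cases "reduced_norm f = 0")
    case False
    then have "0 < reduced_norm f" using reduced_norm_nonneg[OF f] by simp
    moreover have "reduced_norm f * reduced_norm f \<le> reduced_norm (invol f) * reduced_norm f"
      using reduced_norm_square_le[OF f] reduced_norm_conv[OF Cc_invol[OF f] f] by (simp add: power2_eq_square)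
    ultimately show ?thesis by simp
  qed (simp add: reduced_norm_nonneg Cc_invol f)
  assume "f \<in> Cc"
  then show ?thesis using le[OF Cc_invol] invol_invol by force
qed

sublocale Cc: pre_cstar_algebra Cc_algebra
proof (rule pre_cstar_algebra.intro; (unfold asub_def)?; (simp only: Cc_algebra_def star_algebra.simps)?)
  show "reduced_norm (conv (invol f) f) = (reduced_norm f)\<^sup>2" if "f \<in> Cc" for f
    using that reduced_norm_square_le[OF that] reduced_norm_conv[OF Cc_invol[OF that] that]
      mult_right_mono[OF reduced_norm_invol[OF that] reduced_norm_nonneg[OF that]]
    by (simp add: power2_eq_square)
  show "reduced_norm f = 0 \<longleftrightarrow> f = (\<lambda>\<gamma>. 0)" if f: "f \<in> Cc" for f
  proof
    assume "reduced_norm f = 0"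
    then have "bounded_by f 0" using bounded_by_reduced_norm[OF f] by simp
    then have "f \<gamma> = 0" for \<gamma>
      using bounded_by_value[OF Cc_equivariant[OF f]] equivariant_off[OF Cc_equivariant[OF f]]
      by (cases "\<gamma> \<in> arrows S") force+
    then show "f = (\<lambda>\<gamma>. 0)" by blast
  next
    assume "f = (\<lambda>\<gamma>. 0)"
    then show "reduced_norm f = 0" using reduced_norm_scale[OF Cc_zero, of 0] by simp
  qed
qed (simp_all add: Cc_zero Cc_add Cc_scale Cc_conv Cc_invol conv_assoc conv_add_left conv_add_right
    Cc_fibre_finite conv_scale_left conv_scale_right invol_invol invol_conv reduced_norm_nonneg
    reduced_norm_add reduced_norm_scale reduced_norm_conv algebra_simps invol_def fun_eq_iff)

end

section \<open>Elements of the completion as functions\<close>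

lemma continuous_map_uniform_approx:
  fixes g :: "'a \<Rightarrow> complex"
  assumes "\<And>e. 0 < e \<Longrightarrow> \<exists>f. continuous_map X euclidean f \<and> (\<forall>x\<in>topspace X. cmod (f x - g x) < e)"
  shows "continuous_map X euclidean g"
proof -
  have "\<forall>n. \<exists>f. continuous_map X euclidean f \<and> (\<forall>x\<in>topspace X. cmod (f x - g x) < 1 / real (Suc n))"
    using assms by simp
  then obtain f where f: "\<And>n. continuous_map X euclidean (f n)"
    "\<And>n x. x \<in> topspace X \<Longrightarrow> cmod (f n x - g x) < 1 / real (Suc n)" by metis
  have "continuous_map X Met_TC.mtopology g"
  proof (rule Met_TC.continuous_map_uniform_limit[where F = sequentially and f = f])
    fix e :: real assume "0 < e"
    then obtain N where N: "1 / real (Suc N) < e" using nat_approx_posE by blast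
    have "dist (f n x) (g x) < e" if "N \<le> n" "x \<in> topspace X" for n x
    proof -
      have "1 / real (Suc n) \<le> 1 / real (Suc N)" using that(1) by (simp add: frac_le)
      then show ?thesis using f(2)[OF that(2), of n] N unfolding dist_norm by linarith
    qed
    then show "\<forall>\<^sub>F n in sequentially. \<forall>x\<in>topspace X. g x \<in> UNIV \<and> dist (f n x) (g x) < e"
      unfolding eventually_sequentially by blast
  qed (use f in auto)
  then show ?thesis by simp
qed

context twist
begin

lemma Cc_algebra_simps [simp]:
  "acarrier Cc_algebra = Cc" "aadd Cc_algebra f g = (\<lambda>\<gamma>. f \<gamma> + g \<gamma>)" "azero Cc_algebra = (\<lambda>\<gamma>. 0)"
  "ascale Cc_algebra c f = (\<lambda>\<gamma>. c * f \<gamma>)" "amult Cc_algebra f g = conv f g"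
  "astar Cc_algebra f = invol f" "anorm Cc_algebra f = reduced_norm f"
  "asub Cc_algebra f g = (\<lambda>\<gamma>. f \<gamma> - g \<gamma>)"
  by (simp_all add: Cc_algebra_def asub_def)

lemma Cc_diff: "\<lbrakk>f \<in> Cc; g \<in> Cc\<rbrakk> \<Longrightarrow> (\<lambda>\<gamma>. f \<gamma> - g \<gamma>) \<in> Cc"
  using Cc.asub_closed[of f g] by simp

lemma Cc_value_le: "f \<in> Cc \<Longrightarrow> cmod (f \<gamma>) \<le> reduced_norm f"
  using bounded_by_value[OF Cc_equivariant bounded_by_reduced_norm, of f \<gamma>] reduced_norm_nonneg[of f]
    equivariant_off[OF Cc_equivariant, of f \<gamma>] by (cases "\<gamma> \<in> arrows S") simp_all

lemma Cc_adist: "\<lbrakk>f \<in> Cc; g \<in> Cc\<rbrakk> \<Longrightarrow> adist Cc_algebra f g = reduced_norm (\<lambda>\<gamma>. f \<gamma> - g \<gamma>)"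
  by (simp add: adist_def)

lemma Cc_value_diff_le: "\<lbrakk>f \<in> Cc; g \<in> Cc\<rbrakk> \<Longrightarrow> cmod (f \<gamma> - g \<gamma>) \<le> adist Cc_algebra f g"
  using Cc_value_le[OF Cc_diff] by (simp add: Cc_adist)

sublocale red: cstar_algebra reduced_algebra
  unfolding reduced_algebra_def by (rule Cc.cstar_algebra_completion)

abbreviation emb :: "('s \<Rightarrow> complex) \<Rightarrow> (nat \<Rightarrow> 's \<Rightarrow> complex) set" where
  "emb \<equiv> completion_emb Cc_algebra"

text \<open>The map written \<open>j\<close> in the overview. By \<open>coeff_LIMSEQ\<close> the
  limit does not depend on the representative chosen by \<open>some_seq\<close>.\<close>

definition coeff :: "(nat \<Rightarrow> 's \<Rightarrow> complex) set \<Rightarrow> 's \<Rightarrow> complex" where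
  "coeff a \<gamma> = lim (\<lambda>n. some_seq a n \<gamma>)"

lemma red_cls_ops:
  assumes "Cc.cauchy u" "Cc.cauchy v"
  shows "aadd reduced_algebra (Cc.cls u) (Cc.cls v) = Cc.cls (\<lambda>n \<gamma>. u n \<gamma> + v n \<gamma>)"
    "amult reduced_algebra (Cc.cls u) (Cc.cls v) = Cc.cls (\<lambda>n. conv (u n) (v n))"
    "ascale reduced_algebra c (Cc.cls u) = Cc.cls (\<lambda>n \<gamma>. c * u n \<gamma>)"
    "astar reduced_algebra (Cc.cls u) = Cc.cls (\<lambda>n. invol (u n))"
  using Cc.cls_ops assms by (simp_all add: reduced_algebra_def)

lemma red_cauchy_ops:
  assumes "Cc.cauchy u" "Cc.cauchy v"
  shows "Cc.cauchy (\<lambda>n \<gamma>. u n \<gamma> + v n \<gamma>)" "Cc.cauchy (\<lambda>n. conv (u n) (v n))"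
    "Cc.cauchy (\<lambda>n \<gamma>. c * u n \<gamma>)" "Cc.cauchy (\<lambda>n. invol (u n))"
  using Cc.cauchy_ops assms by simp_all

lemma red_carrierE:
  assumes "a \<in> acarrier reduced_algebra"
  obtains u where "Cc.cauchy u" "a = Cc.cls u" "\<forall>n. u n \<in> Cc"
proof -
  obtain u where "Cc.cauchy u" "a = Cc.cls u"
    using assms unfolding reduced_algebra_def by (rule Cc.carrier_completionE)
  then show thesis using Cc.cauchy_carrier by (intro that) auto
qed

lemma cls_closed: "Cc.cauchy u \<Longrightarrow> Cc.cls u \<in> acarrier reduced_algebra"
  unfolding reduced_algebra_def by (rule Cc.cls_closed)

lemma emb_closed: "f \<in> Cc \<Longrightarrow> emb f \<in> acarrier reduced_algebra"
  unfolding reduced_algebra_def by (rule Cc.completion_emb_closed) simp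

lemma emb_eq_cls: "emb f = Cc.cls (\<lambda>n. f)"
  by (simp add: completion_emb_def)

lemma emb_dense:
  "\<lbrakk>a \<in> acarrier reduced_algebra; 0 < e\<rbrakk> \<Longrightarrow> \<exists>f\<in>Cc. adist reduced_algebra (emb f) a < e"
  using Cc.completion_emb_dense[of a e] unfolding reduced_algebra_def by simp

text \<open>Values are dominated by the norm, so the chosen representative converges at
  \<open>\<gamma>\<close>, and its difference from \<open>u\<close>, being null in norm, tends to
  zero there.\<close>

lemma coeff_LIMSEQ:
  assumes u: "Cc.cauchy u" shows "(\<lambda>n. u n \<gamma>) \<longlonglongrightarrow> coeff (Cc.cls u) \<gamma>"
proof -
  let ?s = "some_seq (Cc.cls u)"
  have s: "Cc.cauchy ?s" "(\<lambda>n. adist Cc_algebra (u n) (?s n)) \<longlonglongrightarrow> 0" by (rule Cc.some_seq_cls[OF u])+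
  have sC: "?s n \<in> Cc" and uC: "u n \<in> Cc" for n using Cc.cauchy_carrier s(1) u by auto
  have "Cauchy (\<lambda>n. ?s n \<gamma>)"
    unfolding Cauchy_def dist_norm
  proof (intro allI impI)
    fix e :: real assume "0 < e"
    then obtain N where "\<And>n n'. N \<le> n \<Longrightarrow> N \<le> n' \<Longrightarrow> adist Cc_algebra (?s n) (?s n') < e"
      using s(1) unfolding Cc.metric.MCauchy_def by meson
    then show "\<exists>M. \<forall>m\<ge>M. \<forall>n\<ge>M. cmod (?s m \<gamma> - ?s n \<gamma>) < e"
      using Cc_value_diff_le[OF sC sC] by (meson le_less_trans)
  qed
  then have "(\<lambda>n. ?s n \<gamma>) \<longlonglongrightarrow> coeff (Cc.cls u) \<gamma>"
    unfolding coeff_def by (simp add: Cauchy_convergent_iff convergent_LIMSEQ_iff)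
  moreover have "(\<lambda>n. u n \<gamma> - ?s n \<gamma>) \<longlonglongrightarrow> 0"
    by (rule tendsto_norm_zero_cancel, rule tendsto_sandwich[OF _ _ tendsto_const s(2)])
       (simp_all add: Cc_value_diff_le sC uC)
  ultimately show ?thesis using tendsto_add by fastforce
qed

lemma coeff_eqI: "\<lbrakk>Cc.cauchy u; \<And>\<gamma>. (\<lambda>n. u n \<gamma>) \<longlonglongrightarrow> F \<gamma>\<rbrakk> \<Longrightarrow> coeff (Cc.cls u) = F"
  using LIMSEQ_unique[OF coeff_LIMSEQ] by blast

lemma Cc_cauchy_const: "f \<in> Cc \<Longrightarrow> Cc.cauchy (\<lambda>n. f)"
  by (rule Cc.cauchy_const) simp

lemma coeff_emb [simp]: "f \<in> Cc \<Longrightarrow> coeff (emb f) = f"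
  unfolding emb_eq_cls by (rule coeff_eqI[OF Cc_cauchy_const]) simp_all

lemma coeff_add:
  assumes "a \<in> acarrier reduced_algebra" "b \<in> acarrier reduced_algebra"
  shows "coeff (aadd reduced_algebra a b) = (\<lambda>\<gamma>. coeff a \<gamma> + coeff b \<gamma>)"
proof -
  obtain u where u: "Cc.cauchy u" "a = Cc.cls u" using assms(1) by (rule red_carrierE)
  obtain v where v: "Cc.cauchy v" "b = Cc.cls v" using assms(2) by (rule red_carrierE)
  show ?thesis
    unfolding u(2) v(2) red_cls_ops(1)[OF u(1) v(1)]
    by (intro coeff_eqI red_cauchy_ops u v tendsto_add coeff_LIMSEQ)
qed

lemma coeff_scale:
  assumes "a \<in> acarrier reduced_algebra"
  shows "coeff (ascale reduced_algebra c a) = (\<lambda>\<gamma>. c * coeff a \<gamma>)"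
proof -
  obtain u where u: "Cc.cauchy u" "a = Cc.cls u" using assms(1) by (rule red_carrierE)
  show ?thesis
    unfolding u(2) red_cls_ops(3)[OF u(1) u(1)]
    by (intro coeff_eqI red_cauchy_ops(3)[OF u(1) u(1)] tendsto_mult_left coeff_LIMSEQ u)
qed

lemma coeff_star:
  assumes "a \<in> acarrier reduced_algebra"
  shows "coeff (astar reduced_algebra a) = invol (coeff a)"
proof -
  obtain u where u: "Cc.cauchy u" "a = Cc.cls u" using assms(1) by (rule red_carrierE)
  show ?thesis
    unfolding u(2) red_cls_ops(4)[OF u(1) u(1)]
  proof (rule coeff_eqI[OF red_cauchy_ops(4)[OF u(1) u(1)]])
    show "(\<lambda>n. invol (u n) \<gamma>) \<longlonglongrightarrow> invol (coeff (Cc.cls u)) \<gamma>" for \<gamma>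
      using tendsto_cnj[OF coeff_LIMSEQ[OF u(1)]] by (simp add: invol_def)
  qed
qed

lemma coeff_sub:
  assumes "a \<in> acarrier reduced_algebra" "b \<in> acarrier reduced_algebra"
  shows "coeff (asub reduced_algebra a b) = (\<lambda>\<gamma>. coeff a \<gamma> - coeff b \<gamma>)"
  using assms by (simp add: asub_def coeff_add coeff_scale red.scale_closed)

lemma coeff_zero: "coeff (azero reduced_algebra) = (\<lambda>\<gamma>. 0)"
  using coeff_emb[OF Cc_zero] by (simp add: reduced_algebra_def completion_def completion_emb_def)

lemma equivariant_coeff:
  assumes "a \<in> acarrier reduced_algebra" shows "equivariant (coeff a)"
proof -
  obtain u where u: "Cc.cauchy u" "a = Cc.cls u" "\<forall>n. u n \<in> Cc" using assms(1) by (rule red_carrierE)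
  note eq = Cc_equivariant[OF u(3)[rule_format]]
  show ?thesis
    unfolding equivariant_def u(2)
  proof (intro conjI allI impI ballI)
    show "coeff (Cc.cls u) \<gamma> = 0" if "\<gamma> \<notin> arrows S" for \<gamma>
      using LIMSEQ_unique[OF coeff_LIMSEQ[OF u(1), of \<gamma>], of 0] equivariant_off[OF eq that] by simp
    fix z \<gamma> assume "z \<in> circle" "\<gamma> \<in> arrows S"
    then show "coeff (Cc.cls u) (act z \<gamma>) = cnj z * coeff (Cc.cls u) \<gamma>"
      using coeff_LIMSEQ[OF u(1), of "act z \<gamma>"] tendsto_mult_left[OF coeff_LIMSEQ[OF u(1), of \<gamma>], of "cnj z"]
      by (simp add: equivariant_act[OF eq] LIMSEQ_unique)
  qed
qed

lemma bounded_by_limit: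
  assumes "\<And>n. bounded_by (f n) (C n)" "\<And>\<gamma>. (\<lambda>n. f n \<gamma>) \<longlonglongrightarrow> g \<gamma>" "C \<longlonglongrightarrow> D"
  shows "bounded_by g D"
  unfolding bounded_by_def
proof
  fix x assume x: "x \<in> units G"
  show "kernel_bound (base_fibre x) (kernel g) D"
    by (rule kernel_bound_limit[of _ "\<lambda>n. kernel (f n)" C])
       (use assms x in \<open>simp_all add: bounded_by_def kernel_def\<close>)
qed

lemma bounded_by_mono: "\<lbrakk>bounded_by f C; C \<le> D\<rbrakk> \<Longrightarrow> bounded_by f D"
  by (meson bounded_by_def kernel_bound_mono)

text \<open>The norm of an element is that of the matrices of its coefficient function. If that
  function is bounded by \<open>C\<close>, a late \<open>u n\<close> differs from it by a function
  bounded by \<open>e\<close>, as a pointwise limit of differences within the sequence; so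
  \<open>u n\<close> is bounded by \<open>C + e\<close>.\<close>

lemma red_norm_le_iff:
  assumes a: "a \<in> acarrier reduced_algebra" and C: "0 \<le> C"
  shows "anorm reduced_algebra a \<le> C \<longleftrightarrow> bounded_by (coeff a) C"
proof -
  obtain u where u: "Cc.cauchy u" "a = Cc.cls u" "\<forall>n. u n \<in> Cc" using a by (rule red_carrierE)
  have nl: "(\<lambda>n. reduced_norm (u n)) \<longlonglongrightarrow> anorm reduced_algebra a"
    using Cc.norm_cls[OF u(1)] by (simp add: u(2) reduced_algebra_def)
  show ?thesis
  proof
    assume "anorm reduced_algebra a \<le> C"
    moreover have "bounded_by (coeff a) (anorm reduced_algebra a)"
      by (rule bounded_by_limit[OF bounded_by_reduced_norm[OF u(3)[rule_format]] _ nl]) (simp add: u(2) coeff_LIMSEQ[OF u(1)])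
    ultimately show "bounded_by (coeff a) C" by (rule bounded_by_mono[rotated])
  next
    assume bd: "bounded_by (coeff a) C"
    show "anorm reduced_algebra a \<le> C"
    proof (rule field_le_epsilon)
      fix e :: real assume e: "0 < e"
      then obtain N where N: "\<And>n n'. N \<le> n \<Longrightarrow> N \<le> n' \<Longrightarrow> adist Cc_algebra (u n) (u n') < e"
        using u(1) unfolding Cc.metric.MCauchy_def by meson
      have "reduced_norm (u n) \<le> C + e" if n: "N \<le> n" for n
      proof -
        \<comment> \<open>The shift by \<open>N\<close> makes the bound valid for every
          \<open>m\<close>, as \<open>bounded_by_limit\<close> requires.\<close>
        have "bounded_by (\<lambda>\<gamma>. u n \<gamma> - u (m + N) \<gamma>) e" for m
          using bounded_by_reduced_norm[OF Cc_diff[OF u(3)[rule_format, of n] u(3)[rule_format, of "m + N"]]] N[of n "m + N"] n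
          by (auto simp: Cc_adist u(3)[rule_format] intro: bounded_by_mono)
        then have "bounded_by (\<lambda>\<gamma>. u n \<gamma> - coeff a \<gamma>) e"
        proof (rule bounded_by_limit)
          show "(\<lambda>m. u n \<gamma> - u (m + N) \<gamma>) \<longlonglongrightarrow> u n \<gamma> - coeff a \<gamma>" for \<gamma>
            unfolding u(2) by (intro tendsto_diff tendsto_const LIMSEQ_ignore_initial_segment coeff_LIMSEQ u)
        qed simp
        from bounded_by_add[OF bd this] have "bounded_by (u n) (C + e)" by simp
        then show ?thesis using reduced_norm_le_iff[OF u(3)[rule_format]] C e by simp
      qed
      then show "anorm reduced_algebra a \<le> C + e" by (intro LIMSEQ_le_const2[OF nl]) blast
    qed
  qed
qed

lemma coeff_le: "a \<in> acarrier reduced_algebra \<Longrightarrow> cmod (coeff a \<gamma>) \<le> anorm reduced_algebra a"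
  using bounded_by_value[OF equivariant_coeff, of a "anorm reduced_algebra a" \<gamma>]
    red_norm_le_iff[of a "anorm reduced_algebra a"] red.norm_nonneg[of a]
    equivariant_off[OF equivariant_coeff, of a \<gamma>] by (cases "\<gamma> \<in> arrows S") simp_all

lemma coeff_diff_le:
  "\<lbrakk>a \<in> acarrier reduced_algebra; b \<in> acarrier reduced_algebra\<rbrakk>
    \<Longrightarrow> cmod (coeff a \<gamma> - coeff b \<gamma>) \<le> adist reduced_algebra a b"
  using coeff_le[OF red.asub_closed] by (simp add: red.adist_eq coeff_sub)

text \<open>An element with vanishing coefficients has all its matrices zero and therefore norm
  zero. Equations in the completion are from now on proved by comparing coefficients.\<close>

lemma coeff_inj:
  assumes "a \<in> acarrier reduced_algebra" "b \<in> acarrier reduced_algebra" "coeff a = coeff b"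
  shows "a = b"
proof -
  have "bounded_by (\<lambda>\<gamma>. 0) 0"
    using bounded_by_reduced_norm[OF Cc_zero] reduced_norm_scale[OF Cc_zero, of 0] by simp
  then have "anorm reduced_algebra (asub reduced_algebra a b) \<le> 0"
    using assms by (simp add: red_norm_le_iff red.asub_closed coeff_sub)
  then show ?thesis
    using assms red.norm_nonneg[OF red.asub_closed[OF assms(1,2)]]
    by (simp add: red.norm_eq_zero red.asub_closed red.asub_eq_zero_iff)
qed

lemma coeff_continuous:
  assumes "a \<in> acarrier reduced_algebra" shows "continuous_map (gtop S) euclidean (coeff a)"
proof (rule continuous_map_uniform_approx)
  fix e :: real assume "0 < e"
  then obtain f where f: "f \<in> Cc" "adist reduced_algebra (emb f) a < e" using emb_dense[OF assms] by blast
  then have "cmod (f \<gamma> - coeff a \<gamma>) < e" for \<gamma>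
    using coeff_diff_le[OF emb_closed[OF f(1)] assms, of \<gamma>] by simp
  then show "\<exists>f. continuous_map (gtop S) euclidean f \<and> (\<forall>\<gamma>\<in>topspace (gtop S). cmod (f \<gamma> - coeff a \<gamma>) < e)"
    using Cc_continuous[OF f(1)] by blast
qed

text \<open>Evaluation of the coefficients at a point is continuous in norm. Both the diagonal and
  the degree zero part are of this form, which makes them closed.\<close>

lemma closedin_vanishing:
  "closedin (atop reduced_algebra) {a \<in> acarrier reduced_algebra. \<forall>\<gamma>\<in>Z. coeff a \<gamma> = 0}"
  unfolding atop_def red.metric.metric_closedin_iff_sequentially_closed
proof (intro conjI allI impI)
  fix \<sigma> l assume *: "range \<sigma> \<subseteq> {a \<in> acarrier reduced_algebra. \<forall>\<gamma>\<in>Z. coeff a \<gamma> = 0} \<and>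
    limitin red.metric.mtopology \<sigma> l sequentially"
  then have l: "l \<in> acarrier reduced_algebra" and \<sigma>: "\<And>n. \<sigma> n \<in> acarrier reduced_algebra"
    and z: "\<And>n \<gamma>. \<gamma> \<in> Z \<Longrightarrow> coeff (\<sigma> n) \<gamma> = 0"
    by (auto simp: red.metric.limit_metric_sequentially)
  have "coeff l \<gamma> = 0" if \<gamma>: "\<gamma> \<in> Z" for \<gamma>
  proof (rule ccontr)
    assume "coeff l \<gamma> \<noteq> 0"
    then have "0 < cmod (coeff l \<gamma>)" by simp
    then obtain N where "adist reduced_algebra (\<sigma> N) l < cmod (coeff l \<gamma>)"
      using * unfolding red.metric.limit_metric_sequentially by blast
    then show False using coeff_diff_le[OF \<sigma> l, of N \<gamma>] z[OF \<gamma>, of N] by simp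
  qed
  then show "l \<in> {a \<in> acarrier reduced_algebra. \<forall>\<gamma>\<in>Z. coeff a \<gamma> = 0}" using l by blast
qed blast

section \<open>Contractive multipliers\<close>

text \<open>The condition ranges over all equivariant functions and not just \<open>Cc\<close>, so
  it applies directly to \<open>coeff a\<close>. The instances are \<open>unit_ind\<close> (the
  conditional expectation), \<open>chi \<omega>\<close> (the dual action) and
  \<open>zero_ind\<close> (the projection to degree zero).\<close>

definition contractive :: "('g \<Rightarrow> complex) \<Rightarrow> bool" where
  "contractive m \<longleftrightarrow> continuous_map (gtop G) euclidean m \<and>
     (\<forall>f C. equivariant f \<longrightarrow> 0 \<le> C \<longrightarrow> bounded_by f C \<longrightarrow> bounded_by (\<lambda>\<gamma>. m (q \<gamma>) * f \<gamma>) C)"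

definition multiplier :: "('g \<Rightarrow> complex) \<Rightarrow> (nat \<Rightarrow> 's \<Rightarrow> complex) set \<Rightarrow> (nat \<Rightarrow> 's \<Rightarrow> complex) set" where
  "multiplier m a = Cc.cls (\<lambda>n \<gamma>. m (q \<gamma>) * some_seq a n \<gamma>)"

lemma contractive_Cc: "\<lbrakk>contractive m; f \<in> Cc\<rbrakk> \<Longrightarrow> (\<lambda>\<gamma>. m (q \<gamma>) * f \<gamma>) \<in> Cc"
  by (rule Cc_multiplier) (auto simp: contractive_def)

lemma contractive_lipschitz:
  assumes m: "contractive m" shows "Cc.lipschitz_map 1 (\<lambda>f \<gamma>. m (q \<gamma>) * f \<gamma>)"
  unfolding Cc.lipschitz_map_def Cc_algebra_simps
proof (intro conjI ballI)
  fix f g assume fg: "f \<in> Cc" "g \<in> Cc"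
  note mC = contractive_Cc[OF m]
  have eq: "(\<lambda>\<gamma>. m (q \<gamma>) * f \<gamma> - m (q \<gamma>) * g \<gamma>) = (\<lambda>\<gamma>. m (q \<gamma>) * (f \<gamma> - g \<gamma>))"
    by (simp add: right_diff_distrib)
  have "bounded_by (\<lambda>\<gamma>. m (q \<gamma>) * (f \<gamma> - g \<gamma>)) (reduced_norm (\<lambda>\<gamma>. f \<gamma> - g \<gamma>))"
    using m Cc_equivariant[OF Cc_diff[OF fg]] bounded_by_reduced_norm[OF Cc_diff[OF fg]]
      reduced_norm_nonneg[OF Cc_diff[OF fg]] unfolding contractive_def by blast
  then show "adist Cc_algebra (\<lambda>\<gamma>. m (q \<gamma>) * f \<gamma>) (\<lambda>\<gamma>. m (q \<gamma>) * g \<gamma>) \<le> 1 * adist Cc_algebra f g"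
    using fg mC reduced_norm_le_iff[OF mC[OF Cc_diff[OF fg]]] reduced_norm_nonneg[OF Cc_diff[OF fg]]
    by (simp add: Cc_adist eq)
qed (rule contractive_Cc[OF m])

lemma multiplier_cls:
  assumes "contractive m" "Cc.cauchy u"
  shows "Cc.cauchy (\<lambda>n \<gamma>. m (q \<gamma>) * u n \<gamma>)" "multiplier m (Cc.cls u) = Cc.cls (\<lambda>n \<gamma>. m (q \<gamma>) * u n \<gamma>)"
  using Cc.cauchy_lipschitz_map[OF contractive_lipschitz[OF assms(1)] assms(2)]
    Cc.lipschitz_map_cls[OF contractive_lipschitz[OF assms(1)] assms(2)]
  by (simp_all add: multiplier_def)

lemma multiplier_closed:
  assumes "contractive m" "a \<in> acarrier reduced_algebra"
  shows "multiplier m a \<in> acarrier reduced_algebra"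
proof -
  obtain u where u: "Cc.cauchy u" "a = Cc.cls u" using assms(2) by (rule red_carrierE)
  show ?thesis unfolding u(2) multiplier_cls(2)[OF assms(1) u(1)] by (rule cls_closed[OF multiplier_cls(1)[OF assms(1) u(1)]])
qed

lemma coeff_multiplier:
  assumes "contractive m" "a \<in> acarrier reduced_algebra"
  shows "coeff (multiplier m a) = (\<lambda>\<gamma>. m (q \<gamma>) * coeff a \<gamma>)"
proof -
  obtain u where u: "Cc.cauchy u" "a = Cc.cls u" using assms(2) by (rule red_carrierE)
  show ?thesis
    unfolding u(2) multiplier_cls(2)[OF assms(1) u(1)]
    by (intro coeff_eqI multiplier_cls(1)[OF assms(1) u(1)] tendsto_mult_left coeff_LIMSEQ u)
qed

lemma multiplier_emb:
  "\<lbrakk>contractive m; f \<in> Cc\<rbrakk> \<Longrightarrow> multiplier m (emb f) = emb (\<lambda>\<gamma>. m (q \<gamma>) * f \<gamma>)"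
  by (rule coeff_inj) (simp_all add: multiplier_closed emb_closed contractive_Cc coeff_multiplier)

lemma multiplier_norm_le:
  assumes "contractive m" "a \<in> acarrier reduced_algebra"
  shows "anorm reduced_algebra (multiplier m a) \<le> anorm reduced_algebra a"
  using assms red_norm_le_iff[OF assms(2), of "anorm reduced_algebra a"] red.norm_nonneg[OF assms(2)]
    equivariant_coeff[OF assms(2)]
  by (simp add: red_norm_le_iff multiplier_closed coeff_multiplier) (simp add: contractive_def)

lemma multiplier_add:
  assumes "contractive m" "a \<in> acarrier reduced_algebra" "b \<in> acarrier reduced_algebra"
  shows "multiplier m (aadd reduced_algebra a b) = aadd reduced_algebra (multiplier m a) (multiplier m b)"
  by (rule coeff_inj)
     (use assms in \<open>simp_all add: multiplier_closed red.add_closed coeff_multiplier coeff_add distrib_left\<close>)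

lemma multiplier_scale:
  assumes "contractive m" "a \<in> acarrier reduced_algebra"
  shows "multiplier m (ascale reduced_algebra c a) = ascale reduced_algebra c (multiplier m a)"
  by (rule coeff_inj)
     (use assms in \<open>simp_all add: multiplier_closed red.scale_closed coeff_multiplier coeff_scale mult.left_commute\<close>)

lemma multiplier_sub:
  assumes "contractive m" "a \<in> acarrier reduced_algebra" "b \<in> acarrier reduced_algebra"
  shows "multiplier m (asub reduced_algebra a b) = asub reduced_algebra (multiplier m a) (multiplier m b)"
  using assms by (simp add: asub_def multiplier_add multiplier_scale red.scale_closed)

lemma multiplier_adist_le:
  assumes "contractive m" "a \<in> acarrier reduced_algebra" "b \<in> acarrier reduced_algebra"
  shows "adist reduced_algebra (multiplier m a) (multiplier m b) \<le> adist reduced_algebra a b"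
  using assms multiplier_norm_le[OF assms(1) red.asub_closed[OF assms(2,3)]]
  by (simp add: red.adist_eq multiplier_closed multiplier_sub)

lemma kernel_multiplier:
  assumes "h \<in> base_fibre x" "k \<in> base_fibre x"
  shows "kernel (\<lambda>\<gamma>. m (q \<gamma>) * f \<gamma>) h k = m (gmult G h (ginv G k)) * kernel f h k"
proof -
  have "(lift h, ginv S (lift k)) \<in> composable S" using assms by (simp add: composable_iff_q)
  then show ?thesis using assms by (simp add: kernel_def q.map_mult)
qed

lemma contractiveI:
  assumes "continuous_map (gtop G) euclidean m"
    and "\<And>x f C. \<lbrakk>x \<in> units G; 0 \<le> C; kernel_bound (base_fibre x) (kernel f) C\<rbrakk> \<Longrightarrow>
      kernel_bound (base_fibre x) (\<lambda>h k. m (gmult G h (ginv G k)) * kernel f h k) C"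
  shows "contractive m"
  unfolding contractive_def
proof (intro conjI allI impI)
  fix f C assume "equivariant f" "0 \<le> C" "bounded_by f C"
  then show "bounded_by (\<lambda>\<gamma>. m (q \<gamma>) * f \<gamma>) C"
    unfolding bounded_by_def
  proof (intro ballI)
    fix x assume x: "x \<in> units G" and bd: "\<forall>x\<in>units G. kernel_bound (base_fibre x) (kernel f) C"
    have eq: "kernel_bound (base_fibre x) (kernel (\<lambda>\<gamma>. m (q \<gamma>) * f \<gamma>)) C
        \<longleftrightarrow> kernel_bound (base_fibre x) (\<lambda>h k. m (gmult G h (ginv G k)) * kernel f h k) C"
      by (rule kernel_bound_cong) (rule kernel_multiplier)
    show "kernel_bound (base_fibre x) (kernel (\<lambda>\<gamma>. m (q \<gamma>) * f \<gamma>)) C"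
      unfolding eq by (rule assms(2)[OF x \<open>0 \<le> C\<close> bspec[OF bd x]])
  qed
qed (rule assms(1))

text \<open>This identifies the part of a matrix over the units with its diagonal.\<close>

lemma mult_inv_unit_iff:
  assumes "h \<in> base_fibre x" "k \<in> base_fibre x"
  shows "gmult G h (ginv G k) \<in> units G \<longleftrightarrow> h = k"
proof
  note c = base_fibre_composable[OF assms]
  assume u: "gmult G h (ginv G k) \<in> units G"
  then have "gmult G h (ginv G k) = rng G k" using Base.src_unit[OF u] assms Base.src_mult[OF c] by simp
  then have "gmult G (gmult G h (ginv G k)) k = k" using assms by simp
  moreover have "gmult G (gmult G h (ginv G k)) k = h"
    using Base.mult_inv_cancel[OF c] assms by simp
  ultimately show "h = k" by simp
next
  assume "h = k"
  then show "gmult G h (ginv G k) \<in> units G" using assms by simp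
qed

lemma openin_units: "openin (gtop G) (units G)"
  by (rule Base.openin_units[OF etale_base])

definition unit_ind :: "'g \<Rightarrow> complex" where
  "unit_ind g = (if g \<in> units G then 1 else 0)"

lemma unit_ind_continuous: "continuous_map (gtop G) euclidean unit_ind"
  unfolding unit_ind_def[abs_def]
  by (rule continuous_map_indicator[OF openin_units Base.closedin_units])

lemma contractive_unit_ind: "contractive unit_ind"
proof (rule contractiveI[OF unit_ind_continuous])
  fix x f C assume C: "0 \<le> C" "kernel_bound (base_fibre x) (kernel f) C"
  show "kernel_bound (base_fibre x) (\<lambda>h k. unit_ind (gmult G h (ginv G k)) * kernel f h k) C"
    using kernel_bound_block[OF C(2,1), of "\<lambda>h. h"]
    by (subst (asm) kernel_bound_cong[where L = "\<lambda>h k. unit_ind (gmult G h (ginv G k)) * kernel f h k"])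
       (auto simp: unit_ind_def mult_inv_unit_iff)
qed

section \<open>The diagonal subalgebra\<close>

abbreviation uval :: "('s \<Rightarrow> complex) \<Rightarrow> 'g \<Rightarrow> complex" where
  "uval f x \<equiv> f (\<iota> (1, x))"

lemma act_iota: "\<lbrakk>z \<in> circle; x \<in> units G\<rbrakk> \<Longrightarrow> act z (\<iota> (1, x)) = \<iota> (z, x)"
  by (simp add: act_eq iota_mult)

lemma over_unitE:
  assumes "\<gamma> \<in> arrows S" "q \<gamma> \<in> units G"
  obtains z where "z \<in> circle" "\<gamma> = \<iota> (z, q \<gamma>)"
proof -
  have "\<gamma> \<in> \<iota> ` (circle \<times> units G)" using assms by (subst exact[symmetric]) simp
  then obtain z x where "z \<in> circle" "x \<in> units G" "\<gamma> = \<iota> (z, x)" by blast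
  then show thesis by (intro that[of z]) simp_all
qed

lemma diag_iota:
  assumes "z \<in> circle" "x \<in> units G" shows "diag \<phi> (\<iota> (z, x)) = cnj z * \<phi> x"
proof -
  have "inv_into (circle \<times> units G) \<iota> (\<iota> (z, x)) = (z, x)"
    using assms by (intro inv_into_f_f[OF iota_inj]) simp
  then show ?thesis using assms by (auto simp: diag_def)
qed

lemma diag_off: "\<lbrakk>\<gamma> \<in> arrows S; q \<gamma> \<notin> units G\<rbrakk> \<Longrightarrow> diag \<phi> \<gamma> = 0"
  by (auto simp: diag_def)

lemma diag_uval [simp]: "x \<in> units G \<Longrightarrow> uval (diag \<phi>) x = \<phi> x"
  by (simp add: diag_iota)

lemma equivariant_diag: "equivariant (diag \<phi>)"
  unfolding equivariant_def
proof (intro conjI allI impI ballI)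
  show "diag \<phi> \<gamma> = 0" if "\<gamma> \<notin> arrows S" for \<gamma> using that by (auto simp: diag_def)
  fix z \<gamma> assume z: "z \<in> circle" and \<gamma>: "\<gamma> \<in> arrows S"
  show "diag \<phi> (act z \<gamma>) = cnj z * diag \<phi> \<gamma>"
  proof (cases "q \<gamma> \<in> units G")
    case True
    then obtain w where w: "w \<in> circle" "\<gamma> = \<iota> (w, q \<gamma>)" using over_unitE[OF \<gamma>] by blast
    have "act z \<gamma> = \<iota> (z * w, q \<gamma>)"
      using act_act[OF z w(1), of "\<iota> (1, q \<gamma>)"] True z w circle_mult[OF z w(1)]
      by (simp add: act_iota)
    then show ?thesis
      using diag_iota[OF w(1) True, of \<phi>] diag_iota[OF circle_mult[OF z w(1)] True, of \<phi>] w(2) by simp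
  next
    case False
    then show ?thesis using diag_off[OF \<gamma>] diag_off[of "act z \<gamma>" \<phi>] z \<gamma> by simp
  qed
qed

lemma equivariant_unit_support_eqI:
  assumes "equivariant f" "equivariant g"
    and "\<And>\<gamma>. \<lbrakk>\<gamma> \<in> arrows S; q \<gamma> \<notin> units G\<rbrakk> \<Longrightarrow> f \<gamma> = g \<gamma>"
    and "\<And>x. x \<in> units G \<Longrightarrow> uval f x = uval g x"
  shows "f = g"
proof
  fix \<gamma> show "f \<gamma> = g \<gamma>"
  proof (cases "\<gamma> \<in> arrows S \<and> q \<gamma> \<in> units G")
    case True
    then obtain z where z: "z \<in> circle" "\<gamma> = \<iota> (z, q \<gamma>)" using over_unitE by blast
    then have "\<gamma> = act z (\<iota> (1, q \<gamma>))" using True by (simp add: act_iota)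
    then show ?thesis
      using equivariant_act[OF assms(1) z(1), of "\<iota> (1, q \<gamma>)"] equivariant_act[OF assms(2) z(1), of "\<iota> (1, q \<gamma>)"]
        assms(4)[of "q \<gamma>"] True by simp
  next
    case False
    then show ?thesis
      using assms(3)[of \<gamma>] equivariant_off[OF assms(1), of \<gamma>] equivariant_off[OF assms(2), of \<gamma>]
      by (cases "\<gamma> \<in> arrows S") simp_all
  qed
qed

text \<open>The only unit with the range of \<open>\<gamma>\<close> is that range itself, so one
  term of the sum remains.\<close>

lemma conv_unit_support_left:
  assumes f: "equivariant f" "\<And>\<gamma>. \<lbrakk>\<gamma> \<in> arrows S; q \<gamma> \<notin> units G\<rbrakk> \<Longrightarrow> f \<gamma> = 0" and g: "equivariant g"
    and \<gamma>: "\<gamma> \<in> arrows S"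
  shows "conv f g \<gamma> = uval f (rng G (q \<gamma>)) * g \<gamma>"
proof -
  let ?x = "rng G (q \<gamma>)"
  have x: "?x \<in> units G" using \<gamma> by simp
  have "conv f g \<gamma> = uval f ?x * g (gmult S (ginv S (\<iota> (1, ?x))) \<gamma>)"
  proof (rule conv_single[OF f(1) g \<gamma>])
    show "h = q (\<iota> (1, ?x))" if "h \<in> arrows G" "rng G h = ?x" "f (lift h) \<noteq> 0" for h
      using f(2)[of "lift h"] that x Base.rng_unit[of h] by auto
  qed (use x in simp_all)
  moreover have "gmult S (\<iota> (1, ?x)) \<gamma> = \<gamma>" using act_eq[OF \<gamma>, of 1] \<gamma> by simp
  ultimately show ?thesis using x by (simp add: inv_iota)
qed

text \<open>The defining sum is indexed by the left factor. In the form \<open>conv_eq\<close> it is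
  indexed by the right factor, and again the unit \<open>src G (q \<gamma>)\<close> gives the only
  term.\<close>

lemma conv_unit_support_right:
  assumes f: "equivariant f" "\<And>\<gamma>. \<lbrakk>\<gamma> \<in> arrows S; q \<gamma> \<notin> units G\<rbrakk> \<Longrightarrow> f \<gamma> = 0" and g: "equivariant g"
    and \<gamma>: "\<gamma> \<in> arrows S"
  shows "conv g f \<gamma> = g \<gamma> * uval f (src G (q \<gamma>))"
proof -
  let ?x = "src G (q \<gamma>)"
  have x: "?x \<in> units G" using \<gamma> by simp
  have off: "f (lift l) = 0" if "l \<in> base_fibre ?x" "l \<noteq> ?x" for l
  proof -
    have "l \<notin> units G" using that(2) Base.src_unit[of l] base_fibreD(2)[OF that(1)] by metis
    then show ?thesis using f(2)[of "lift l"] that(1) by simp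
  qed
  have "conv g f \<gamma> = (\<Sum>l\<in>{?x}. g (gmult S \<gamma> (ginv S (lift l))) * f (lift l))"
    unfolding conv_eq[OF g f(1) \<gamma>]
    using unit_in_base_fibre[OF x] off by (intro infsum_finite_support) auto
  moreover obtain z where z: "z \<in> circle" "lift ?x = \<iota> (z, ?x)"
    using over_unitE[of "lift ?x"] x \<gamma> by auto
  moreover have "gmult S \<gamma> (\<iota> (cnj z, ?x)) = act (cnj z) \<gamma>"
    using z \<gamma> by (simp add: act_eq_right)
  moreover have "f (\<iota> (z, ?x)) = cnj z * uval f ?x"
    using equivariant_act[OF f(1) z(1), of "\<iota> (1, ?x)"] x z by (simp add: act_iota)
  ultimately show ?thesis
    using x \<gamma> circle_cnj_mult[OF z(1)] equivariant_act[OF g, of "cnj z" \<gamma>]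
    by (simp add: inv_iota mult_ac)
qed

text \<open>\<open>diag\<close> reads off its phase with \<open>inv_into\<close>, which shows no
  continuity. Relative to a local section, \<open>\<gamma>\<close> and its source have phases
  \<open>p \<gamma>\<close> and \<open>p (src S \<gamma>)\<close>, and their quotient is the circle
  coordinate of \<open>\<gamma>\<close>. The right-hand side is visibly continuous.\<close>

lemma unit_phase:
  assumes tr: "trivializes U \<phi> p" and \<gamma>: "\<gamma> \<in> arrows S" "q \<gamma> \<in> units G" "q \<gamma> \<in> U"
  shows "diag \<psi> \<gamma> = cnj (p \<gamma>) * p (src S \<gamma>) * \<psi> (q \<gamma>)"
proof -
  let ?e = "src S \<gamma>"
  have qe: "q ?e = q \<gamma>" using \<gamma> by simp
  have tr': "p \<eta> \<in> circle \<and> \<eta> = act (p \<eta>) (\<phi> (q \<eta>))" if "\<eta> \<in> arrows S" "q \<eta> \<in> U" for \<eta>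
    using tr that unfolding trivializes_def by blast
  have p: "p \<gamma> \<in> circle" "\<gamma> = act (p \<gamma>) (\<phi> (q \<gamma>))" using tr'[OF \<gamma>(1,3)] by blast+
  have pe: "p ?e \<in> circle" "?e = act (p ?e) (\<phi> (q \<gamma>))"
    using tr'[of ?e] \<gamma>(1,3) unfolding qe by simp_all
  have \<phi>: "\<phi> (q \<gamma>) \<in> arrows S" using tr \<gamma>(3) unfolding trivializes_def by blast
  have "act (p \<gamma> * cnj (p ?e)) ?e = act (p \<gamma> * cnj (p ?e) * p ?e) (\<phi> (q \<gamma>))"
    by (subst pe(2)) (use p pe(1) \<phi> in \<open>simp add: act_act norm_mult\<close>)
  also have "p \<gamma> * cnj (p ?e) * p ?e = p \<gamma>" using circle_cnj_mult[OF pe(1)] by (simp add: mult.assoc)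
  finally have "\<gamma> = act (p \<gamma> * cnj (p ?e)) ?e" using p(2) by simp
  moreover have "?e = \<iota> (1, q \<gamma>)" using unit_eq_iota[of ?e] \<gamma> qe by simp
  moreover have c: "p \<gamma> * cnj (p ?e) \<in> circle" using p pe(1) by (simp add: norm_mult)
  ultimately have "\<gamma> = \<iota> (p \<gamma> * cnj (p ?e), q \<gamma>)" using act_iota[OF c \<gamma>(2)] by simp
  then have "diag \<psi> \<gamma> = cnj (p \<gamma> * cnj (p ?e)) * \<psi> (q \<gamma>)" using diag_iota[OF c \<gamma>(2)] by metis
  then show ?thesis by simp
qed

text \<open>The units are open and closed. Near an arrow over a unit \<open>unit_phase\<close> gives
  a continuous formula, and over the complement the function is zero.\<close>

lemma diag_continuous:
  assumes \<psi>: "continuous_map (subtopology (gtop G) (units G)) euclidean \<psi>"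
  shows "continuous_map (gtop S) euclidean (diag \<psi>)"
proof (rule continuous_map_locallyI)
  fix \<gamma>0 assume "\<gamma>0 \<in> topspace (gtop S)"
  then have \<gamma>0: "\<gamma>0 \<in> arrows S" by simp
  show "\<exists>T. openin (gtop S) T \<and> \<gamma>0 \<in> T \<and> continuous_map (subtopology (gtop S) T) euclidean (diag \<psi>)"
  proof (cases "q \<gamma>0 \<in> units G")
    case True
    obtain U \<phi> p where tr: "trivializes U \<phi> p" "q \<gamma>0 \<in> U" using trivialization[of "q \<gamma>0"] \<gamma>0 by auto
    have U: "openin (gtop G) U" using tr(1) by (simp add: trivializes_def open_bisectionD)
    have pc: "continuous_map (subtopology (gtop S) {\<gamma> \<in> arrows S. q \<gamma> \<in> U}) euclidean p"
      using tr(1) by (simp add: trivializes_def)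
    let ?T = "{\<gamma> \<in> topspace (gtop S). q \<gamma> \<in> U \<inter> units G}"
    let ?X = "subtopology (gtop S) ?T"
    have T: "openin (gtop S) ?T" by (rule openin_continuous_map_preimage[OF q_continuous openin_Int[OF U openin_units]])
    have topX: "topspace ?X = ?T" by auto
    have pc': "continuous_map ?X euclidean p" by (rule continuous_map_from_subtopology_mono[OF pc]) auto
    have "continuous_map ?X (subtopology (gtop S) {\<gamma> \<in> arrows S. q \<gamma> \<in> U}) (src S)"
      unfolding continuous_map_in_subtopology
    proof
      show "continuous_map ?X (gtop S) (src S)" by (rule continuous_map_from_subtopology[OF Sigma.continuous_src])
      show "src S \<in> topspace ?X \<rightarrow> {\<gamma> \<in> arrows S. q \<gamma> \<in> U}" unfolding topX by auto
    qed
    from continuous_map_compose[OF this pc]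
    have psc: "continuous_map ?X euclidean (\<lambda>\<gamma>. p (src S \<gamma>))" unfolding o_def .
    have "continuous_map ?X (subtopology (gtop G) (units G)) q"
      unfolding continuous_map_in_subtopology
    proof
      show "continuous_map ?X (gtop G) q" by (rule continuous_map_from_subtopology[OF q_continuous])
      show "q \<in> topspace ?X \<rightarrow> units G" unfolding topX by auto
    qed
    from continuous_map_compose[OF this \<psi>]
    have \<psi>c: "continuous_map ?X euclidean (\<lambda>\<gamma>. \<psi> (q \<gamma>))" unfolding o_def .
    have "continuous_map ?X euclidean (\<lambda>\<gamma>. cnj (p \<gamma>) * p (src S \<gamma>) * \<psi> (q \<gamma>))"
      by (intro continuous_map_cmult continuous_map_cnj pc' psc \<psi>c)
    then have "continuous_map ?X euclidean (diag \<psi>)"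
    proof (rule continuous_map_eq)
      fix \<gamma> assume "\<gamma> \<in> topspace ?X"
      then have "\<gamma> \<in> ?T" by (simp only: topX)
      then show "cnj (p \<gamma>) * p (src S \<gamma>) * \<psi> (q \<gamma>) = diag \<psi> \<gamma>" using unit_phase[OF tr(1), of \<gamma> \<psi>] by simp
    qed
    then show ?thesis using T \<gamma>0 True tr(2) by (intro exI[of _ ?T]) simp
  next
    case False
    let ?T = "{\<gamma> \<in> topspace (gtop S). q \<gamma> \<in> topspace (gtop G) - units G}"
    have "openin (gtop G) (topspace (gtop G) - units G)" using Base.closedin_units by blast
    then have T: "openin (gtop S) ?T" by (rule openin_continuous_map_preimage[OF q_continuous])
    have "continuous_map (subtopology (gtop S) ?T) euclidean (\<lambda>\<gamma>. 0 :: complex)" by simp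
    then have "continuous_map (subtopology (gtop S) ?T) euclidean (diag \<psi>)"
    proof (rule continuous_map_eq)
      fix \<gamma> assume "\<gamma> \<in> topspace (subtopology (gtop S) ?T)"
      then have "\<gamma> \<in> ?T" unfolding topspace_subtopology by blast
      then show "0 = diag \<psi> \<gamma>" using diag_off[of \<gamma> \<psi>] by simp
    qed
    then show ?thesis using T \<gamma>0 False by (intro exI[of _ ?T]) simp
  qed
qed

lemma diag_Cc:
  assumes "continuous_map (subtopology (gtop G) (units G)) euclidean \<psi>"
    and "compactin (gtop G) L" "\<And>x. \<lbrakk>x \<in> units G; \<psi> x \<noteq> 0\<rbrakk> \<Longrightarrow> x \<in> L"
  shows "diag \<psi> \<in> Cc"
proof (rule Cc_I[OF equivariant_diag diag_continuous[OF assms(1)] assms(2)])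
  fix \<gamma> assume \<gamma>: "\<gamma> \<in> arrows S" "diag \<psi> \<gamma> \<noteq> 0"
  then have u: "q \<gamma> \<in> units G" using diag_off by blast
  obtain z where z: "z \<in> circle" "\<gamma> = \<iota> (z, q \<gamma>)" by (rule over_unitE[OF \<gamma>(1) u])
  then have "diag \<psi> \<gamma> = cnj z * \<psi> (q \<gamma>)" using diag_iota[OF z(1) u] by metis
  then show "q \<gamma> \<in> L" using assms(3)[OF u] \<gamma>(2) by auto
qed

text \<open>The matrices of \<open>diag \<psi>\<close> are diagonal, and their entries are values of
  \<open>\<psi>\<close> up to a phase.\<close>

lemma bounded_by_diag:
  assumes "0 \<le> C" "\<And>x. x \<in> units G \<Longrightarrow> cmod (\<psi> x) \<le> C" shows "bounded_by (diag \<psi>) C"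
  unfolding bounded_by_def
proof
  fix x
  have le: "cmod (diag \<psi> \<gamma>) \<le> C" if \<gamma>: "\<gamma> \<in> arrows S" for \<gamma>
  proof (cases "q \<gamma> \<in> units G")
    case True
    obtain z where z: "z \<in> circle" "\<gamma> = \<iota> (z, q \<gamma>)" by (rule over_unitE[OF \<gamma> True])
    then have "diag \<psi> \<gamma> = cnj z * \<psi> (q \<gamma>)" using diag_iota[OF z(1) True] by metis
    then show ?thesis using assms(2)[OF True] z(1) by (simp add: norm_mult)
  qed (simp add: diag_off that assms)
  have nz: "h = k" if "h \<in> base_fibre x" "k \<in> base_fibre x" "kernel (diag \<psi>) h k \<noteq> 0" for h k
  proof -
    have c: "(lift h, ginv S (lift k)) \<in> composable S" using that by (simp add: composable_iff_q)
    then have "gmult G h (ginv G k) \<in> units G"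
      using that diag_off[of "gmult S (lift h) (ginv S (lift k))" \<psi>] by (auto simp: kernel_def q.map_mult)
    then show ?thesis using mult_inv_unit_iff that by blast
  qed
  show "kernel_bound (base_fibre x) (kernel (diag \<psi>)) C"
  proof (rule kernel_bound_sparse[OF assms(1)])
    show "cmod (kernel (diag \<psi>) h k) \<le> C" if "h \<in> base_fibre x" "k \<in> base_fibre x" for h k
      unfolding kernel_def using that by (intro le Sigma.mult_closed) (simp add: composable_iff_q)
  qed (use nz in blast)+
qed

end

section \<open>Approximation criteria in a normed star algebra\<close>

context pre_cstar_algebra
begin

lemma asub_mult_left:
  "\<lbrakk>x \<in> acarrier A; a \<in> acarrier A; b \<in> acarrier A\<rbrakk>
    \<Longrightarrow> asub A (amult A x a) (amult A x b) = amult A x (asub A a b)"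
  by (simp add: asub_def mult_add mult_scale scale_closed)

lemma asub_mult_right:
  "\<lbrakk>x \<in> acarrier A; a \<in> acarrier A; b \<in> acarrier A\<rbrakk>
    \<Longrightarrow> asub A (amult A a x) (amult A b x) = amult A (asub A a b) x"
  by (simp add: asub_def add_mult scale_mult scale_closed)

lemma closure_of_eq_carrier:
  assumes "\<And>a e. \<lbrakk>a \<in> acarrier A; 0 < e\<rbrakk> \<Longrightarrow> \<exists>b\<in>X. b \<in> acarrier A \<and> adist A b a < e"
  shows "atop A closure_of X = acarrier A"
proof -
  have "\<exists>y\<in>X. y \<in> metric.mball a r" if "a \<in> acarrier A" "0 < r" for a r
    using assms[OF that] that(1) metric.commute[of a] by auto
  then show ?thesis unfolding atop_def metric.metric_closure_of by blast
qed

lemma closedin_approx: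
  assumes "closedin (atop A) B" "a \<in> acarrier A" "\<And>e. 0 < e \<Longrightarrow> \<exists>b\<in>B. adist A b a < e"
  shows "a \<in> B"
proof -
  have B: "B \<subseteq> acarrier A" using closedin_subset[OF assms(1)] by (simp add: atop_def)
  have "\<exists>y\<in>B. y \<in> metric.mball a r" if "0 < r" for r
    using assms(3)[OF that] assms(2) metric.commute[of a] B by auto
  then have "a \<in> atop A closure_of B" unfolding atop_def metric.metric_closure_of using assms(2) by blast
  then show ?thesis using closure_of_closedin[OF assms(1)] by simp
qed

end

context twist
begin

section \<open>Functions vanishing at infinity on the unit space\<close>

lemma C0_off: "\<lbrakk>\<phi> \<in> C0_units; x \<notin> units G\<rbrakk> \<Longrightarrow> \<phi> x = 0"
  by (simp add: C0_units_def)

lemma C0_continuous: "\<phi> \<in> C0_units \<Longrightarrow> continuous_map (subtopology (gtop G) (units G)) euclidean \<phi>"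
  by (simp add: C0_units_def)

lemma closedin_norm_ge:
  assumes "continuous_map (subtopology (gtop G) (units G)) euclidean \<phi>"
  shows "closedin (gtop G) {x \<in> units G. e \<le> cmod (\<phi> x)}"
proof -
  have top: "topspace (subtopology (gtop G) (units G)) = units G" using Base.unit_arrow by auto
  have "closed {z. e \<le> cmod z}" by (intro closed_Collect_le continuous_intros)
  then have "closedin euclidean {z. e \<le> cmod z}" by simp
  from closedin_continuous_map_preimage[OF assms this]
  have "closedin (subtopology (gtop G) (units G)) {x \<in> units G. e \<le> cmod (\<phi> x)}"
    unfolding top mem_Collect_eq .
  then show ?thesis by (rule closedin_trans_full[OF _ Base.closedin_units])
qed

lemma C0_I:
  assumes "\<And>x. x \<notin> units G \<Longrightarrow> \<phi> x = 0"
    and c: "continuous_map (subtopology (gtop G) (units G)) euclidean \<phi>"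
    and "\<And>e. 0 < e \<Longrightarrow> \<exists>L. compactin (gtop G) L \<and> {x \<in> units G. e \<le> cmod (\<phi> x)} \<subseteq> L"
  shows "\<phi> \<in> C0_units"
  unfolding C0_units_def using assms closed_compactin[OF _ _ closedin_norm_ge[OF c]] by blast

lemma C0_compact: "\<lbrakk>\<phi> \<in> C0_units; 0 < e\<rbrakk> \<Longrightarrow> compactin (gtop G) {x \<in> units G. e \<le> cmod (\<phi> x)}"
  by (simp add: C0_units_def)

lemma C0_bounded:
  assumes "\<phi> \<in> C0_units" shows "\<exists>B\<ge>0. \<forall>x. cmod (\<phi> x) \<le> B"
proof -
  let ?K = "{x \<in> units G. 1 \<le> cmod (\<phi> x)}"
  have "compactin (subtopology (gtop G) (units G)) ?K"
    using C0_compact[OF assms, of 1] by (simp add: compactin_subtopology)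
  from image_compactin[OF this C0_continuous[OF assms]] have "bounded (\<phi> ` ?K)"
    by (simp add: compact_imp_bounded)
  then obtain B where B: "\<forall>y\<in>\<phi> ` ?K. cmod y \<le> B" unfolding bounded_iff ..
  have "cmod (\<phi> x) \<le> \<bar>B\<bar> + 1" for x
    using B C0_off[OF assms, of x] by (cases "x \<in> ?K") (force, cases "x \<in> units G", auto)
  then show ?thesis by (intro exI[of _ "\<bar>B\<bar> + 1"]) auto
qed

lemma C0_add_scale:
  assumes \<phi>: "\<phi> \<in> C0_units" and \<psi>: "\<psi> \<in> C0_units"
  shows "(\<lambda>x. \<phi> x + c * \<psi> x) \<in> C0_units"
proof (rule C0_I)
  show "continuous_map (subtopology (gtop G) (units G)) euclidean (\<lambda>x. \<phi> x + c * \<psi> x)"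
    using C0_continuous[OF \<phi>] C0_continuous[OF \<psi>]
    by (intro continuous_map_add continuous_map_cmult) auto
  fix e :: real assume e: "0 < e"
  \<comment> \<open>Each summand is allowed half of \<open>e\<close>; using
    \<open>cmod c + 1\<close> instead of \<open>cmod c\<close> avoids division by zero.\<close>
  let ?e1 = "e / 2" and ?e2 = "e / (2 * (cmod c + 1))"
  have c1: "0 < cmod c + 1" using norm_ge_zero[of c] by linarith
  then have "0 < ?e1" "0 < ?e2" using e by simp_all
  then have "compactin (gtop G) ({x \<in> units G. ?e1 \<le> cmod (\<phi> x)} \<union> {x \<in> units G. ?e2 \<le> cmod (\<psi> x)})"
    by (intro compactin_Un C0_compact \<phi> \<psi>)
  moreover have "?e1 \<le> cmod (\<phi> x) \<or> ?e2 \<le> cmod (\<psi> x)" if "e \<le> cmod (\<phi> x + c * \<psi> x)" for x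
  proof (rule ccontr)
    assume "\<not> ?thesis"
    then have l: "cmod (\<phi> x) < ?e1" "cmod (\<psi> x) < ?e2" by auto
    have "cmod (c * \<psi> x) \<le> (cmod c + 1) * cmod (\<psi> x)" by (simp add: norm_mult mult_right_mono)
    also have "\<dots> \<le> (cmod c + 1) * ?e2" using l(2) c1 by (intro mult_left_mono) auto
    also have "\<dots> = e / 2" using c1 by (simp add: field_simps)
    finally have "cmod (\<phi> x + c * \<psi> x) < e"
      using l(1) norm_triangle_ineq[of "\<phi> x" "c * \<psi> x"] by linarith
    then show False using that by simp
  qed
  ultimately show "\<exists>L. compactin (gtop G) L \<and> {x \<in> units G. e \<le> cmod (\<phi> x + c * \<psi> x)} \<subseteq> L"
    by (intro exI conjI) auto
qed (simp add: C0_off \<phi> \<psi>)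

lemma C0_diff: "\<lbrakk>\<phi> \<in> C0_units; \<psi> \<in> C0_units\<rbrakk> \<Longrightarrow> (\<lambda>x. \<phi> x - \<psi> x) \<in> C0_units"
  using C0_add_scale[of \<phi> \<psi> "-1"] by simp

lemma C0_algebra_simps [simp]:
  "acarrier C0_algebra = C0_units" "asub C0_algebra \<phi> \<psi> = (\<lambda>x. \<phi> x - \<psi> x)"
  by (simp_all add: C0_algebra_def asub_def)

lemma C0_norm_le_iff:
  assumes "\<phi> \<in> C0_units" "0 \<le> C"
  shows "anorm C0_algebra \<phi> \<le> C \<longleftrightarrow> (\<forall>x. cmod (\<phi> x) \<le> C)"
proof -
  obtain B where "0 \<le> B" "\<forall>x. cmod (\<phi> x) \<le> B" using C0_bounded[OF assms(1)] by blast
  then have "bdd_above (insert 0 ((\<lambda>x. cmod (\<phi> x)) ` units G))" by (auto simp: bdd_above_def)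
  then have "anorm C0_algebra \<phi> \<le> C \<longleftrightarrow> (\<forall>r\<in>insert 0 ((\<lambda>x. cmod (\<phi> x)) ` units G). r \<le> C)"
    unfolding C0_algebra_def star_algebra.simps by (intro cSup_le_iff) auto
  also have "\<dots> \<longleftrightarrow> (\<forall>x. cmod (\<phi> x) \<le> C)"
  proof
    assume r: "\<forall>r\<in>insert 0 ((\<lambda>x. cmod (\<phi> x)) ` units G). r \<le> C"
    show "\<forall>x. cmod (\<phi> x) \<le> C"
    proof
      show "cmod (\<phi> x) \<le> C" for x
        using r assms(2) C0_off[OF assms(1), of x] by (cases "x \<in> units G") auto
    qed
  qed (use assms(2) in auto)
  finally show ?thesis .
qed

lemma C0_norm_nonneg:
  assumes "\<phi> \<in> C0_units" shows "0 \<le> anorm C0_algebra \<phi>"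
proof -
  obtain B where "0 \<le> B" "\<forall>x. cmod (\<phi> x) \<le> B" using C0_bounded[OF assms(1)] by blast
  then have "bdd_above (insert 0 ((\<lambda>x. cmod (\<phi> x)) ` units G))" by (auto simp: bdd_above_def)
  then show ?thesis unfolding C0_algebra_def star_algebra.simps by (intro cSup_upper) auto
qed

lemma C0_norm_upper: "\<phi> \<in> C0_units \<Longrightarrow> cmod (\<phi> x) \<le> anorm C0_algebra \<phi>"
  using C0_norm_le_iff C0_norm_nonneg by blast

lemma C0_adist: "\<lbrakk>\<phi> \<in> C0_units; \<psi> \<in> C0_units\<rbrakk> \<Longrightarrow> adist C0_algebra \<phi> \<psi> = anorm C0_algebra (\<lambda>x. \<phi> x - \<psi> x)"
  by (simp add: adist_def)

lemma C0_adist_le_iff: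
  assumes "\<phi> \<in> C0_units" "\<psi> \<in> C0_units" "0 \<le> C"
  shows "adist C0_algebra \<phi> \<psi> \<le> C \<longleftrightarrow> (\<forall>x. cmod (\<phi> x - \<psi> x) \<le> C)"
  using assms C0_norm_le_iff[OF C0_diff] by (simp add: C0_adist)

lemma C0_adist_upper: "\<lbrakk>\<phi> \<in> C0_units; \<psi> \<in> C0_units\<rbrakk> \<Longrightarrow> cmod (\<phi> x - \<psi> x) \<le> adist C0_algebra \<phi> \<psi>"
  using C0_norm_upper[OF C0_diff] by (simp add: C0_adist)

text \<open>\<open>C0_algebra\<close> enters only as the domain of a continuous extension, so its
  metric is all that has to be established.\<close>

lemma Metric_space_C0: "Metric_space C0_units (adist C0_algebra)"
proof
  show nn: "0 \<le> adist C0_algebra \<phi> \<psi>" for \<phi> \<psi>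
    by (auto simp: adist_def C0_norm_nonneg C0_diff)
  have comm: "adist C0_algebra \<phi> \<psi> \<le> adist C0_algebra \<psi> \<phi>" if "\<phi> \<in> C0_units" "\<psi> \<in> C0_units" for \<phi> \<psi>
    using that C0_adist_le_iff[OF that nn] C0_adist_upper[OF that(2,1)] by (simp add: norm_minus_commute)
  show "adist C0_algebra \<phi> \<psi> = adist C0_algebra \<psi> \<phi>" for \<phi> \<psi>
    using comm[of \<phi> \<psi>] comm[of \<psi> \<phi>]
    by (cases "\<phi> \<in> C0_units \<and> \<psi> \<in> C0_units") (auto simp: adist_def)
  show "adist C0_algebra \<phi> \<psi> = 0 \<longleftrightarrow> \<phi> = \<psi>" if "\<phi> \<in> C0_units" "\<psi> \<in> C0_units" for \<phi> \<psi>
    using C0_adist_le_iff[OF that, of 0] nn[of \<phi> \<psi>] by (auto simp: fun_eq_iff)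
  show "adist C0_algebra \<phi> \<theta> \<le> adist C0_algebra \<phi> \<psi> + adist C0_algebra \<psi> \<theta>"
    if "\<phi> \<in> C0_units" "\<psi> \<in> C0_units" "\<theta> \<in> C0_units" for \<phi> \<psi> \<theta>
  proof (subst C0_adist_le_iff[OF that(1,3)])
    show "\<forall>x. cmod (\<phi> x - \<theta> x) \<le> adist C0_algebra \<phi> \<psi> + adist C0_algebra \<psi> \<theta>"
    proof
      show "cmod (\<phi> x - \<theta> x) \<le> adist C0_algebra \<phi> \<psi> + adist C0_algebra \<psi> \<theta>" for x
        using norm_triangle_ineq[of "\<phi> x - \<psi> x" "\<psi> x - \<theta> x"] C0_adist_upper[OF that(1,2), of x]
          C0_adist_upper[OF that(2,3), of x] by simp
    qed
  qed (simp add: nn)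
qed

lemma Cc_units_I:
  assumes "\<And>x. x \<notin> units G \<Longrightarrow> \<phi> x = 0" "continuous_map (subtopology (gtop G) (units G)) euclidean \<phi>"
    "compactin (gtop G) L" "L \<subseteq> units G" "\<And>x. x \<in> units G \<Longrightarrow> \<phi> x \<noteq> 0 \<Longrightarrow> x \<in> L"
  shows "\<phi> \<in> Cc_units"
proof -
  let ?U = "subtopology (gtop G) (units G)"
  have L: "compactin ?U L" using assms by (simp add: compactin_subtopology)
  have "closedin ?U L"
    using compactin_imp_closedin[OF Hausdorff_space_subtopology[OF Base.Hausdorff] L] .
  then have "?U closure_of {x \<in> units G. \<phi> x \<noteq> 0} \<subseteq> L"
    using assms(5) by (intro closure_of_minimal) auto
  then have "compactin ?U (?U closure_of {x \<in> units G. \<phi> x \<noteq> 0})"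
    by (intro closed_compactin[OF L]) auto
  then show ?thesis using assms(1,2) by (simp add: Cc_units_def)
qed

lemma Cc_units_support:
  assumes "\<phi> \<in> Cc_units"
  obtains L where "compactin (gtop G) L" "L \<subseteq> units G" "\<forall>x. \<phi> x \<noteq> 0 \<longrightarrow> x \<in> L"
proof -
  let ?U = "subtopology (gtop G) (units G)"
  let ?L = "?U closure_of {x \<in> units G. \<phi> x \<noteq> 0}"
  have top: "topspace ?U = units G" using Base.unit_arrow by auto
  have "compactin ?U ?L" using assms by (simp add: Cc_units_def)
  then have "compactin (gtop G) ?L" "?L \<subseteq> units G" by (simp_all add: compactin_subtopology)
  moreover have "{x \<in> units G. \<phi> x \<noteq> 0} \<subseteq> ?L" by (rule closure_of_subset) (auto simp: top)
  then have "\<forall>x. \<phi> x \<noteq> 0 \<longrightarrow> x \<in> ?L" using assms by (auto simp: Cc_units_def)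
  ultimately show thesis by (rule that)
qed

lemma Cc_units_C0: assumes "\<phi> \<in> Cc_units" shows "\<phi> \<in> C0_units"
proof -
  obtain L where L: "compactin (gtop G) L" "L \<subseteq> units G" "\<forall>x. \<phi> x \<noteq> 0 \<longrightarrow> x \<in> L"
    using assms by (rule Cc_units_support)
  show ?thesis
  proof (rule C0_I)
    show "\<exists>L. compactin (gtop G) L \<and> {x \<in> units G. e \<le> cmod (\<phi> x)} \<subseteq> L" if "0 < e" for e
    proof (intro exI[of _ L] conjI L(1) subsetI)
      fix x assume "x \<in> {x \<in> units G. e \<le> cmod (\<phi> x)}"
      then have "\<phi> x \<noteq> 0" using that by auto
      then show "x \<in> L" using L(3) by blast
    qed
  qed (use assms in \<open>auto simp: Cc_units_def\<close>)
qed

lemma Cc_units_diag: assumes "\<phi> \<in> Cc_units" shows "diag \<phi> \<in> Cc"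
proof -
  obtain L where L: "compactin (gtop G) L" "L \<subseteq> units G" "\<forall>x. \<phi> x \<noteq> 0 \<longrightarrow> x \<in> L"
    using assms by (rule Cc_units_support)
  show ?thesis by (rule diag_Cc[OF _ L(1)]) (use assms L(3) in \<open>auto simp: Cc_units_def\<close>)
qed

text \<open>As the units are open, the bump can be given compact support inside
  \<open>U \<inter> units G\<close>; it is then set to zero off the units to fit the convention for
  total functions.\<close>

lemma unit_bump:
  assumes K: "compactin (gtop G) K" and U: "openin (gtop G) U" "K \<subseteq> U" "K \<subseteq> units G"
  obtains h :: "'g \<Rightarrow> real" where "(\<lambda>x. of_real (h x)) \<in> Cc_units" "\<forall>x. 0 \<le> h x \<and> h x \<le> 1"
    "\<forall>x\<in>K. h x = 1" "\<forall>x. x \<notin> U \<longrightarrow> h x = 0"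
proof -
  have KU: "K \<subseteq> U \<inter> units G" using U by blast
  obtain h :: "'g \<Rightarrow> real" and L where h: "continuous_map (gtop G) euclidean h"
      "\<forall>x\<in>topspace (gtop G). 0 \<le> h x \<and> h x \<le> 1" "\<forall>x\<in>K. h x = 1"
      "compactin (gtop G) L" "L \<subseteq> U \<inter> units G" "\<forall>x\<in>topspace (gtop G) - L. h x = 0"
    by (rule compact_bump[OF Base.Hausdorff Base.locally_compact K openin_Int[OF U(1) openin_units] KU])
  define h' where "h' x = (if x \<in> units G then h x else 0)" for x
  have L: "h' x = 0" if "x \<notin> L" for x
    using that h(6) Base.unit_arrow[of x] by (auto simp: h'_def)
  show thesis
  proof (rule that[of h'])
    have "continuous_map (subtopology (gtop G) (units G)) euclidean (\<lambda>x. of_real (h x) :: complex)"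
      by (intro continuous_map_from_subtopology continuous_map_of_real h)
    then have c: "continuous_map (subtopology (gtop G) (units G)) euclidean (\<lambda>x. of_real (h' x) :: complex)"
      by (rule continuous_map_eq) (auto simp: h'_def)
    show "(\<lambda>x. of_real (h' x)) \<in> Cc_units"
    proof (rule Cc_units_I[OF _ c h(4)])
      show "x \<in> L" if "complex_of_real (h' x) \<noteq> 0" for x using L[of x] that by auto
    qed (use h(5) h'_def in auto)
    show "\<forall>x. 0 \<le> h' x \<and> h' x \<le> 1"
      using h(2) Base.unit_arrow by (auto simp: h'_def)
    show "\<forall>x\<in>K. h' x = 1" using h(3) U(3) by (auto simp: h'_def)
    show "\<forall>x. x \<notin> U \<longrightarrow> h' x = 0" using L h(5) by blast
  qed
qed

text \<open>Multiply \<open>\<phi>\<close> by a bump that is \<open>1\<close> where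
  \<open>\<phi>\<close> has modulus at least \<open>e\<close>. Elsewhere the error is at most the
  modulus of \<open>\<phi>\<close>, which is below \<open>e\<close>.\<close>

lemma C0_approx:
  assumes \<phi>: "\<phi> \<in> C0_units" and e: "0 < e"
  shows "\<exists>\<psi>\<in>Cc_units. \<forall>x. cmod (\<psi> x - \<phi> x) < e"
proof -
  let ?K = "{x \<in> units G. e \<le> cmod (\<phi> x)}"
  have "?K \<subseteq> units G" by blast
  obtain h :: "'g \<Rightarrow> real" where h: "(\<lambda>x. of_real (h x)) \<in> Cc_units" "\<forall>x. 0 \<le> h x \<and> h x \<le> 1"
    "\<forall>x\<in>?K. h x = 1" "\<forall>x. x \<notin> units G \<longrightarrow> h x = 0"
    by (rule unit_bump[OF C0_compact[OF \<phi> e] openin_units \<open>?K \<subseteq> units G\<close> \<open>?K \<subseteq> units G\<close>])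
  obtain L where L: "compactin (gtop G) L" "L \<subseteq> units G" "\<forall>x. complex_of_real (h x) \<noteq> 0 \<longrightarrow> x \<in> L"
    using h(1) by (rule Cc_units_support)
  have "(\<lambda>x. of_real (h x) * \<phi> x) \<in> Cc_units"
  proof (rule Cc_units_I[OF _ _ L(1,2)])
    show "continuous_map (subtopology (gtop G) (units G)) euclidean (\<lambda>x. of_real (h x) * \<phi> x)"
      using h(1) C0_continuous[OF \<phi>] by (intro continuous_map_cmult) (auto simp: Cc_units_def)
    show "x \<in> L" if "complex_of_real (h x) * \<phi> x \<noteq> 0" for x using L(3) that by auto
  qed (simp add: C0_off[OF \<phi>])
  moreover have "\<forall>x. cmod (of_real (h x) * \<phi> x - \<phi> x) < e"
  proof
    fix x show "cmod (of_real (h x) * \<phi> x - \<phi> x) < e"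
  proof (cases "x \<in> ?K")
    case True
    then show ?thesis using h(3) e by auto
  next
    case False
    then have small: "cmod (\<phi> x) < e" using C0_off[OF \<phi>, of x] e by (cases "x \<in> units G") auto
    have "of_real (h x) * \<phi> x - \<phi> x = - (of_real (1 - h x) * \<phi> x)" by (simp add: algebra_simps)
    then have "cmod (of_real (h x) * \<phi> x - \<phi> x) = \<bar>1 - h x\<bar> * cmod (\<phi> x)"
      by (metis norm_minus_cancel norm_mult norm_of_real)
    also have "\<dots> \<le> 1 * cmod (\<phi> x)" using h(2)[rule_format, of x] by (intro mult_right_mono) auto
    finally show ?thesis using small by simp
    qed
  qed
  ultimately show ?thesis by (intro bexI[of _ "\<lambda>x. of_real (h x) * \<phi> x"])
qed

section \<open>The inclusion of the diagonal\<close>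

lemma diag_diff: "diag (\<lambda>x. \<phi> x - \<psi> x) = (\<lambda>\<gamma>. diag \<phi> \<gamma> - diag \<psi> \<gamma>)"
  by (intro ext) (simp add: diag_def right_diff_distrib split: prod.split)

text \<open>An intrinsic description of \<open>C0_subalgebra\<close>, shown equal to it in
  \<open>C0_subalgebra_eq\<close>. The bounded quantifier matches
  \<open>closedin_vanishing\<close>.\<close>

definition D_alg :: "(nat \<Rightarrow> 's \<Rightarrow> complex) set set" where
  "D_alg = {a \<in> acarrier reduced_algebra. \<forall>\<gamma>\<in>{\<gamma> \<in> arrows S. q \<gamma> \<notin> units G}. coeff a \<gamma> = 0}"

lemma D_carrier: "a \<in> D_alg \<Longrightarrow> a \<in> acarrier reduced_algebra"
  and D_off: "\<lbrakk>a \<in> D_alg; \<gamma> \<in> arrows S; q \<gamma> \<notin> units G\<rbrakk> \<Longrightarrow> coeff a \<gamma> = 0"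
  by (simp_all add: D_alg_def)

lemma D_I:
  "\<lbrakk>a \<in> acarrier reduced_algebra; \<And>\<gamma>. \<lbrakk>\<gamma> \<in> arrows S; q \<gamma> \<notin> units G\<rbrakk> \<Longrightarrow> coeff a \<gamma> = 0\<rbrakk> \<Longrightarrow> a \<in> D_alg"
  by (simp add: D_alg_def)

lemma D_eqI:
  assumes "a \<in> D_alg" "b \<in> D_alg" "\<And>x. x \<in> units G \<Longrightarrow> uval (coeff a) x = uval (coeff b) x"
  shows "a = b"
  by (rule coeff_inj, rule D_carrier[OF assms(1)], rule D_carrier[OF assms(2)],
      rule equivariant_unit_support_eqI)
     (use assms D_off in \<open>auto intro: equivariant_coeff D_carrier\<close>)

text \<open>\<open>diag\<close> does not increase norms, so a sequence in \<open>Cc_units\<close>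
  that approximates \<open>\<phi>\<close> uniformly yields a Cauchy sequence in \<open>Cc\<close>;
  its class has the required coefficients.\<close>

lemma C0_lift:
  assumes \<phi>: "\<phi> \<in> C0_units"
  shows "\<exists>a\<in>acarrier reduced_algebra. coeff a = diag \<phi>"
proof -
  have "\<forall>n. \<exists>\<psi>\<in>Cc_units. \<forall>x. cmod (\<psi> x - \<phi> x) < 1 / real (Suc n)"
    using C0_approx[OF \<phi>] by simp
  then obtain \<psi> where \<psi>: "\<And>n. \<psi> n \<in> Cc_units" "\<And>n x. cmod (\<psi> n x - \<phi> x) < 1 / real (Suc n)" by metis
  note dC = Cc_units_diag[OF \<psi>(1)]
  have "Cc.cauchy (\<lambda>n. diag (\<psi> n))"
    unfolding Cc.metric.MCauchy_def
  proof (intro conjI allI impI)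
    show "range (\<lambda>n. diag (\<psi> n)) \<subseteq> acarrier Cc_algebra" using dC by auto
    fix e :: real assume "0 < e"
    then have "0 < e / 4" by simp
    then obtain N where N: "1 / real (Suc N) < e / 4" using nat_approx_posE by blast
    have small: "cmod (\<psi> n x - \<phi> x) \<le> e / 4" if "N \<le> n" for n x
    proof -
      have "1 / real (Suc n) \<le> 1 / real (Suc N)" using that by (simp add: frac_le)
      then show ?thesis using \<psi>(2)[of n x] N by linarith
    qed
    have "adist Cc_algebra (diag (\<psi> n)) (diag (\<psi> n')) < e" if n: "N \<le> n" "N \<le> n'" for n n'
    proof -
      have "cmod (\<psi> n x - \<psi> n' x) \<le> e / 2" for x
        using norm_triangle_ineq4[of "\<psi> n x - \<phi> x" "\<psi> n' x - \<phi> x"] small[OF n(1), of x] small[OF n(2), of x]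
        by simp
      then have "bounded_by (diag (\<lambda>x. \<psi> n x - \<psi> n' x)) (e / 2)" using \<open>0 < e\<close> by (intro bounded_by_diag) auto
      then have "adist Cc_algebra (diag (\<psi> n)) (diag (\<psi> n')) \<le> e / 2"
        using reduced_norm_le_iff[OF Cc_diff[OF dC[of n] dC[of n']], of "e / 2"] \<open>0 < e\<close>
        by (simp add: Cc_adist dC diag_diff)
      then show ?thesis using \<open>0 < e\<close> by simp
    qed
    then show "\<exists>N. \<forall>n n'. N \<le> n \<longrightarrow> N \<le> n' \<longrightarrow> adist Cc_algebra (diag (\<psi> n)) (diag (\<psi> n')) < e" by blast
  qed
  moreover have "(\<lambda>n. diag (\<psi> n) \<gamma>) \<longlonglongrightarrow> diag \<phi> \<gamma>" for \<gamma>
  proof -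
    have lim: "(\<lambda>n. \<psi> n x) \<longlonglongrightarrow> \<phi> x" for x
    proof (rule LIM_zero_cancel, rule tendsto_norm_zero_cancel,
        rule tendsto_sandwich[where f = "\<lambda>_. 0" and h = "\<lambda>n. 1 / real (Suc n)"])
      show "(\<lambda>n. 1 / real (Suc n)) \<longlonglongrightarrow> 0" by (rule LIMSEQ_Suc[OF lim_1_over_n])
      show "\<forall>\<^sub>F n in sequentially. cmod (\<psi> n x - \<phi> x) \<le> 1 / real (Suc n)"
        using \<psi>(2) less_imp_le by (intro always_eventually) blast
    qed auto
    show ?thesis unfolding diag_def by (auto split: prod.split intro!: tendsto_mult_left lim)
  qed
  ultimately have "coeff (Cc.cls (\<lambda>n. diag (\<psi> n))) = diag \<phi>" "Cc.cls (\<lambda>n. diag (\<psi> n)) \<in> acarrier reduced_algebra"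
    by (intro coeff_eqI cls_closed; simp)+
  then show ?thesis by blast
qed

text \<open>Any element with coefficients \<open>diag \<phi>\<close> is the limit that defines
  \<open>C0_inclusion \<phi>\<close>. As \<open>diag\<close> does not increase norms, the given
  \<open>e\<close> serves as its own modulus of continuity.\<close>

lemma C0_inclusion_eqI:
  assumes \<phi>: "\<phi> \<in> C0_units" and a: "a \<in> acarrier reduced_algebra" "coeff a = diag \<phi>"
  shows "C0_inclusion \<phi> = a"
  unfolding C0_inclusion_def atop_def C0_algebra_simps
proof (rule continuous_extension_metric_eqI[OF Metric_space_C0 red.metric.Metric_space_axioms \<phi> a(1)])
  show "\<psi> \<in> C0_units" if "\<psi> \<in> Cc_units" for \<psi> using that by (rule Cc_units_C0)
  show "emb (diag \<psi>) \<in> acarrier reduced_algebra" if "\<psi> \<in> Cc_units" for \<psi>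
    using that by (intro emb_closed Cc_units_diag)
  fix e :: real assume e: "0 < e"
  show "\<exists>\<psi>\<in>Cc_units. adist C0_algebra \<psi> \<phi> < e"
  proof -
    have "0 < e / 2" using e by simp
    then obtain \<psi> where \<psi>: "\<psi> \<in> Cc_units" "\<forall>x. cmod (\<psi> x - \<phi> x) < e / 2" using C0_approx[OF \<phi>] by blast
    have "adist C0_algebra \<psi> \<phi> \<le> e / 2"
      using \<psi> e less_imp_le by (subst C0_adist_le_iff[OF Cc_units_C0[OF \<psi>(1)] \<phi>]) auto
    then show ?thesis using \<psi>(1) e by (intro bexI[of _ \<psi>]) auto
  qed
  show "\<exists>d>0. \<forall>\<psi>\<in>Cc_units. adist C0_algebra \<psi> \<phi> < d \<longrightarrow> adist reduced_algebra (emb (diag \<psi>)) a < e"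
  proof (intro exI[of _ e] conjI e ballI impI)
    fix \<psi> assume \<psi>: "\<psi> \<in> Cc_units" and d: "adist C0_algebra \<psi> \<phi> < e"
    note eC = emb_closed[OF Cc_units_diag[OF \<psi>]]
    have nn: "0 \<le> adist C0_algebra \<psi> \<phi>" by (rule Metric_space.nonneg[OF Metric_space_C0])
    have "bounded_by (diag (\<lambda>x. \<psi> x - \<phi> x)) (adist C0_algebra \<psi> \<phi>)"
      by (intro bounded_by_diag nn C0_adist_upper Cc_units_C0 \<psi> \<phi>)
    then have "anorm reduced_algebra (asub reduced_algebra (emb (diag \<psi>)) a) \<le> adist C0_algebra \<psi> \<phi>"
      using red_norm_le_iff[OF red.asub_closed[OF eC a(1)] nn] Cc_units_diag[OF \<psi>]
      by (simp add: coeff_sub eC a diag_diff)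
    then show "adist reduced_algebra (emb (diag \<psi>)) a < e" using d by (simp add: red.adist_eq eC a)
  qed
qed

lemma C0_inclusion:
  assumes "\<phi> \<in> C0_units"
  shows "C0_inclusion \<phi> \<in> D_alg" "coeff (C0_inclusion \<phi>) = diag \<phi>"
proof -
  obtain a where a: "a \<in> acarrier reduced_algebra" "coeff a = diag \<phi>" using C0_lift[OF assms] by blast
  have "C0_inclusion \<phi> = a" by (rule C0_inclusion_eqI[OF assms a])
  then show "C0_inclusion \<phi> \<in> D_alg" "coeff (C0_inclusion \<phi>) = diag \<phi>"
    using a by (auto simp: D_alg_def diag_off)
qed

definition restrict_units :: "('s \<Rightarrow> complex) \<Rightarrow> 'g \<Rightarrow> complex" where
  "restrict_units f x = (if x \<in> units G then uval f x else 0)"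

lemma continuous_iota_one: "continuous_map (subtopology (gtop G) (units G)) (gtop S) (\<lambda>x. \<iota> (1, x))"
proof -
  have "continuous_map (subtopology (gtop G) (units G)) (gtop (circle_bundle G)) (\<lambda>x. (1, x))"
    unfolding circle_bundle_def groupoid_data.simps continuous_map_paired
    using continuous_map_id[of "subtopology (gtop G) (units G)"] by (simp add: id_def)
  from continuous_map_compose[OF this iota_continuous] show ?thesis by (simp only: o_def)
qed

text \<open>If \<open>f\<close> in \<open>Cc\<close> is closer to \<open>a\<close> than
  \<open>e\<close>, then wherever \<open>coeff a\<close> has modulus at least \<open>e\<close> the
  function \<open>f\<close> cannot vanish, so the superlevel set lies in a compact set supporting
  \<open>f\<close>.\<close>

lemma restrict_units_C0:
  assumes a: "a \<in> acarrier reduced_algebra" shows "restrict_units (coeff a) \<in> C0_units"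
proof (rule C0_I)
  show "restrict_units (coeff a) x = 0" if "x \<notin> units G" for x using that by (simp add: restrict_units_def)
  have "continuous_map (subtopology (gtop G) (units G)) euclidean (\<lambda>x. uval (coeff a) x)"
    using continuous_map_compose[OF continuous_iota_one coeff_continuous[OF a]] by (simp only: o_def)
  then show "continuous_map (subtopology (gtop G) (units G)) euclidean (restrict_units (coeff a))"
    by (rule continuous_map_eq) (auto simp: restrict_units_def)
  fix e :: real assume "0 < e"
  then obtain f where f: "f \<in> Cc" "adist reduced_algebra (emb f) a < e" using emb_dense[OF a] by blast
  obtain L where L: "compactin (gtop G) L" "\<forall>\<gamma>. f \<gamma> \<noteq> 0 \<longrightarrow> \<gamma> \<in> arrows S \<and> q \<gamma> \<in> L"
    by (rule Cc_support[OF f(1)])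
  have "x \<in> L" if x: "x \<in> units G" "e \<le> cmod (restrict_units (coeff a) x)" for x
  proof -
    have "uval f x \<noteq> 0"
      using coeff_diff_le[OF emb_closed[OF f(1)] a, of "\<iota> (1, x)"] f x by (auto simp: restrict_units_def)
    then show ?thesis using L(2) x(1) by auto
  qed
  then show "\<exists>L. compactin (gtop G) L \<and> {x \<in> units G. e \<le> cmod (restrict_units (coeff a) x)} \<subseteq> L"
    using L(1) by blast
qed

text \<open>An element of \<open>D_alg\<close> is determined by its values on the units, and
  \<open>restrict_units_C0\<close> puts these into \<open>C0_units\<close>.\<close>

lemma C0_subalgebra_eq: "C0_subalgebra = D_alg"
proof
  show "C0_subalgebra \<subseteq> D_alg" unfolding C0_subalgebra_def using C0_inclusion(1) by blast
  show "D_alg \<subseteq> C0_subalgebra"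
  proof
    fix a assume a: "a \<in> D_alg"
    note \<phi> = restrict_units_C0[OF D_carrier[OF a]]
    have "a = C0_inclusion (restrict_units (coeff a))"
      by (rule D_eqI[OF a C0_inclusion(1)[OF \<phi>]]) (simp add: C0_inclusion(2)[OF \<phi>] restrict_units_def)
    then show "a \<in> C0_subalgebra" unfolding C0_subalgebra_def using \<phi> by blast
  qed
qed

section \<open>Products with diagonal elements\<close>

lemma expectation_D:
  assumes "a \<in> acarrier reduced_algebra" shows "multiplier unit_ind a \<in> D_alg"
  by (rule D_I) (use assms in \<open>simp_all add: multiplier_closed contractive_unit_ind coeff_multiplier unit_ind_def\<close>)

lemma expectation_uval:
  "\<lbrakk>a \<in> acarrier reduced_algebra; x \<in> units G\<rbrakk> \<Longrightarrow> uval (coeff (multiplier unit_ind a)) x = uval (coeff a) x"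
  by (simp add: coeff_multiplier contractive_unit_ind unit_ind_def)

lemma expectation_id: "a \<in> D_alg \<Longrightarrow> multiplier unit_ind a = a"
  by (rule D_eqI) (simp_all add: expectation_D expectation_uval D_carrier)

text \<open>Truncating a representing sequence to the units does not change its class, since the
  expectation fixes \<open>d\<close>. Products with a diagonal factor can then be computed term by
  term.\<close>

lemma D_cauchyE:
  assumes "d \<in> D_alg"
  obtains v where "Cc.cauchy v" "d = Cc.cls v" "\<forall>n. v n \<in> Cc"
    "\<forall>n. \<forall>\<gamma>\<in>arrows S. q \<gamma> \<notin> units G \<longrightarrow> v n \<gamma> = 0"
proof -
  obtain u where u: "Cc.cauchy u" "d = Cc.cls u" using D_carrier[OF assms] by (rule red_carrierE)
  let ?v = "\<lambda>n \<gamma>. unit_ind (q \<gamma>) * u n \<gamma>"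
  have v: "Cc.cauchy ?v" "d = Cc.cls ?v"
    using multiplier_cls[OF contractive_unit_ind u(1)] expectation_id[OF assms] u(2) by simp_all
  then have "\<forall>n. ?v n \<in> Cc" using Cc.cauchy_carrier[OF v(1)] by simp
  then show thesis using v by (intro that[of ?v]) (simp_all add: unit_ind_def)
qed

lemma coeff_mult_left:
  assumes d: "d \<in> D_alg" and a: "a \<in> acarrier reduced_algebra" and \<gamma>: "\<gamma> \<in> arrows S"
  shows "coeff (amult reduced_algebra d a) \<gamma> = uval (coeff d) (rng G (q \<gamma>)) * coeff a \<gamma>"
proof -
  obtain v where v: "Cc.cauchy v" "d = Cc.cls v" "\<forall>n. v n \<in> Cc"
    "\<forall>n. \<forall>\<gamma>\<in>arrows S. q \<gamma> \<notin> units G \<longrightarrow> v n \<gamma> = 0" using d by (rule D_cauchyE)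
  obtain u where u: "Cc.cauchy u" "a = Cc.cls u" "\<forall>n. u n \<in> Cc" using a by (rule red_carrierE)
  have "(\<lambda>n. conv (v n) (u n) \<gamma>) \<longlonglongrightarrow> coeff (amult reduced_algebra d a) \<gamma>"
    unfolding v(2) u(2) red_cls_ops(2)[OF v(1) u(1)] by (rule coeff_LIMSEQ[OF red_cauchy_ops(2)[OF v(1) u(1)]])
  moreover have "conv (v n) (u n) \<gamma> = uval (v n) (rng G (q \<gamma>)) * u n \<gamma>" for n
    using v(3,4) u(3) \<gamma> by (intro conv_unit_support_left Cc_equivariant) auto
  moreover have "(\<lambda>n. uval (v n) (rng G (q \<gamma>)) * u n \<gamma>) \<longlonglongrightarrow> uval (coeff d) (rng G (q \<gamma>)) * coeff a \<gamma>"
    unfolding v(2) u(2) by (intro tendsto_mult coeff_LIMSEQ v u)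
  ultimately show ?thesis using LIMSEQ_unique by simp
qed

lemma coeff_mult_right:
  assumes d: "d \<in> D_alg" and a: "a \<in> acarrier reduced_algebra" and \<gamma>: "\<gamma> \<in> arrows S"
  shows "coeff (amult reduced_algebra a d) \<gamma> = coeff a \<gamma> * uval (coeff d) (src G (q \<gamma>))"
proof -
  obtain v where v: "Cc.cauchy v" "d = Cc.cls v" "\<forall>n. v n \<in> Cc"
    "\<forall>n. \<forall>\<gamma>\<in>arrows S. q \<gamma> \<notin> units G \<longrightarrow> v n \<gamma> = 0" using d by (rule D_cauchyE)
  obtain u where u: "Cc.cauchy u" "a = Cc.cls u" "\<forall>n. u n \<in> Cc" using a by (rule red_carrierE)
  have "(\<lambda>n. conv (u n) (v n) \<gamma>) \<longlonglongrightarrow> coeff (amult reduced_algebra a d) \<gamma>"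
    unfolding v(2) u(2) red_cls_ops(2)[OF u(1) v(1)] by (rule coeff_LIMSEQ[OF red_cauchy_ops(2)[OF u(1) v(1)]])
  moreover have "conv (u n) (v n) \<gamma> = u n \<gamma> * uval (v n) (src G (q \<gamma>))" for n
    using v(3,4) u(3) \<gamma> by (intro conv_unit_support_right Cc_equivariant) auto
  moreover have "(\<lambda>n. u n \<gamma> * uval (v n) (src G (q \<gamma>))) \<longlonglongrightarrow> coeff a \<gamma> * uval (coeff d) (src G (q \<gamma>))"
    unfolding v(2) u(2) by (intro tendsto_mult coeff_LIMSEQ v u)
  ultimately show ?thesis using LIMSEQ_unique by simp
qed

text \<open>At the unit \<open>src G (q \<gamma>)\<close> the convolution is the sum of the squared
  moduli of \<open>f\<close> over all arrows with that source, so it dominates the term of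
  \<open>\<gamma>\<close>.\<close>

lemma conv_invol_self:
  assumes f: "f \<in> Cc" and \<gamma>: "\<gamma> \<in> arrows S"
  shows "Im (conv (invol f) f (\<iota> (1, src G (q \<gamma>)))) = 0 \<and>
    (cmod (f \<gamma>))\<^sup>2 \<le> Re (conv (invol f) f (\<iota> (1, src G (q \<gamma>))))"
proof -
  define x where "x = src G (q \<gamma>)"
  have x: "x \<in> units G" using \<gamma> by (simp add: x_def)
  \<comment> \<open>The arrow \<open>q \<gamma>\<close> is inserted so that its term belongs to the
    sum even if \<open>f\<close> vanishes there.\<close>
  let ?M = "insert (q \<gamma>) {l \<in> base_fibre x. f (lift l) \<noteq> 0}"
  have q\<gamma>: "q \<gamma> \<in> base_fibre x" using \<gamma> by (intro base_fibreI) (simp_all add: x_def)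
  have "{l \<in> base_fibre x. f (lift l) \<noteq> 0} \<subseteq> {h \<in> arrows G. src G h = x \<and> f (lift h) \<noteq> 0}" by auto
  then have M: "finite ?M" using Cc_fibre_finite[OF f] x unfolding fibre_finite_def by (auto intro: finite_subset)
  have t: "invol f (gmult S (\<iota> (1, x)) (ginv S (lift l))) = cnj (f (lift l))" if "l \<in> base_fibre x" for l
  proof -
    have r: "rng G (q (ginv S (lift l))) = x" using that by simp
    have "gmult S (\<iota> (1, rng G (q (ginv S (lift l))))) (ginv S (lift l)) = ginv S (lift l)"
      by (rule trans[OF act_eq[symmetric] act_one]) (use that in simp_all)
    then have "gmult S (\<iota> (1, x)) (ginv S (lift l)) = ginv S (lift l)" unfolding r .
    moreover have "ginv S (lift l) \<in> arrows S" "ginv S (ginv S (lift l)) = lift l" using that by simp_all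
    ultimately show ?thesis by (simp only: invol_def if_True)
  qed
  have "conv (invol f) f (\<iota> (1, x)) = (\<Sum>l\<in>?M. invol f (gmult S (\<iota> (1, x)) (ginv S (lift l))) * f (lift l))"
  proof -
    have qx: "src G (q (\<iota> (1, x))) = x" using x by simp
    have M': "?M \<subseteq> base_fibre x" using q\<gamma> by blast
    have "conv (invol f) f (\<iota> (1, x))
        = (\<Sum>\<^sub>\<infinity>l\<in>base_fibre x. invol f (gmult S (\<iota> (1, x)) (ginv S (lift l))) * f (lift l))"
      using conv_eq[OF equivariant_invol[OF Cc_equivariant[OF f]] Cc_equivariant[OF f], of "\<iota> (1, x)"] x
      unfolding qx by simp
    also have "\<dots> = (\<Sum>l\<in>?M. invol f (gmult S (\<iota> (1, x)) (ginv S (lift l))) * f (lift l))"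
      by (rule infsum_finite_support[OF M M']) auto
    finally show ?thesis .
  qed
  also have "\<dots> = (\<Sum>l\<in>?M. of_real ((cmod (f (lift l)))\<^sup>2))"
  proof (rule sum.cong[OF refl])
    fix l assume "l \<in> ?M"
    then have l: "l \<in> base_fibre x" using q\<gamma> by blast
    show "invol f (gmult S (\<iota> (1, x)) (ginv S (lift l))) * f (lift l) = of_real ((cmod (f (lift l)))\<^sup>2)"
      unfolding t[OF l] by (simp add: complex_norm_square mult.commute del: of_real_power)
  qed
  finally have eq: "conv (invol f) f (\<iota> (1, x)) = of_real (\<Sum>l\<in>?M. (cmod (f (lift l)))\<^sup>2)" by simp
  have "cmod (f \<gamma>) = cmod (f (lift (q \<gamma>)))" using \<gamma> by (intro equivariant_norm_eq Cc_equivariant f) simp_all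
  moreover have "(cmod (f (lift (q \<gamma>))))\<^sup>2 \<le> (\<Sum>l\<in>?M. (cmod (f (lift l)))\<^sup>2)"
    using M by (intro member_le_sum) auto
  ultimately show ?thesis unfolding x_def[symmetric] eq by simp
qed

text \<open>The sum of squares need not be identified in the completion: realness and the inequality
  pass to the limit along a representing sequence.\<close>

lemma coeff_star_mult_self:
  assumes a: "a \<in> acarrier reduced_algebra" and \<gamma>: "\<gamma> \<in> arrows S"
  shows "Im (uval (coeff (amult reduced_algebra (astar reduced_algebra a) a)) (src G (q \<gamma>))) = 0 \<and>
    (cmod (coeff a \<gamma>))\<^sup>2 \<le> Re (uval (coeff (amult reduced_algebra (astar reduced_algebra a) a)) (src G (q \<gamma>)))"
proof -
  let ?y = "\<iota> (1, src G (q \<gamma>))"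
  obtain u where u: "Cc.cauchy u" "a = Cc.cls u" "\<forall>n. u n \<in> Cc" using a by (rule red_carrierE)
  note c = red_cauchy_ops(4)[OF u(1) u(1)]
  have lim: "(\<lambda>n. conv (invol (u n)) (u n) ?y) \<longlonglongrightarrow> coeff (amult reduced_algebra (astar reduced_algebra a) a) ?y"
    unfolding u(2) red_cls_ops(4)[OF u(1) u(1)] red_cls_ops(2)[OF c u(1)]
    by (rule coeff_LIMSEQ[OF red_cauchy_ops(2)[OF c u(1)]])
  have n: "Im (conv (invol (u n)) (u n) ?y) = 0" "(cmod (u n \<gamma>))\<^sup>2 \<le> Re (conv (invol (u n)) (u n) ?y)" for n
    using conv_invol_self[OF u(3)[rule_format] \<gamma>] by blast+
  have "(\<lambda>n. (cmod (u n \<gamma>))\<^sup>2) \<longlonglongrightarrow> (cmod (coeff a \<gamma>))\<^sup>2"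
    unfolding u(2) by (intro tendsto_power tendsto_norm coeff_LIMSEQ u)
  from LIMSEQ_le[OF this tendsto_Re[OF lim]] have "(cmod (coeff a \<gamma>))\<^sup>2 \<le> Re (coeff (amult reduced_algebra (astar reduced_algebra a) a) ?y)"
    using n(2) by blast
  moreover have "Im (coeff (amult reduced_algebra (astar reduced_algebra a) a) ?y) = 0"
    using LIMSEQ_unique[OF tendsto_Im[OF lim], of 0] n(1) by simp
  ultimately show ?thesis by blast
qed

lemma emb_diag_D: "\<phi> \<in> Cc_units \<Longrightarrow> emb (diag \<phi>) \<in> D_alg"
  by (rule D_I) (simp_all add: emb_closed Cc_units_diag diag_off)

lemma abelian_D: "abelian_subalgebra reduced_algebra D_alg"
  unfolding abelian_subalgebra_def cstar_subalgebra_def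
proof (intro conjI ballI allI)
  show "D_alg \<subseteq> acarrier reduced_algebra" using D_carrier by blast
  show "azero reduced_algebra \<in> D_alg" by (rule D_I) (simp_all add: red.zero_closed coeff_zero)
  show "closedin (atop reduced_algebra) D_alg" unfolding D_alg_def by (rule closedin_vanishing)
  fix a assume a: "a \<in> D_alg"
  note aC = D_carrier[OF a]
  show "astar reduced_algebra a \<in> D_alg"
  proof (rule D_I)
    show "coeff (astar reduced_algebra a) \<gamma> = 0" if "\<gamma> \<in> arrows S" "q \<gamma> \<notin> units G" for \<gamma>
    proof -
      have "q (ginv S \<gamma>) \<notin> units G"
      proof
        assume "q (ginv S \<gamma>) \<in> units G"
        then have "ginv G (q \<gamma>) \<in> units G" using that by simp
        then have "ginv G (ginv G (q \<gamma>)) \<in> units G" by simp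
        then show False using that by simp
      qed
      then show ?thesis using D_off[OF a, of "ginv S \<gamma>"] that by (simp add: coeff_star aC invol_def)
    qed
  qed (rule red.star_closed[OF aC])
  show "ascale reduced_algebra c a \<in> D_alg" for c
    by (rule D_I) (simp_all add: red.scale_closed aC coeff_scale D_off[OF a])
  fix b assume b: "b \<in> D_alg"
  note bC = D_carrier[OF b]
  show "aadd reduced_algebra a b \<in> D_alg"
    by (rule D_I) (simp_all add: red.add_closed aC bC coeff_add D_off[OF a] D_off[OF b])
  show ab: "amult reduced_algebra a b \<in> D_alg"
    by (rule D_I) (simp_all add: red.mult_closed aC bC coeff_mult_left[OF a bC] D_off[OF b])
  have ba: "amult reduced_algebra b a \<in> D_alg"
    by (rule D_I) (simp_all add: red.mult_closed aC bC coeff_mult_left[OF b aC] D_off[OF a])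
  show "amult reduced_algebra a b = amult reduced_algebra b a"
    by (rule D_eqI[OF ab ba]) (simp add: coeff_mult_left[OF a bC] coeff_mult_left[OF b aC])
qed

lemma D_closed:
  assumes "a \<in> D_alg"
  shows "astar reduced_algebra a \<in> D_alg" "ascale reduced_algebra c a \<in> D_alg"
    "b \<in> D_alg \<Longrightarrow> aadd reduced_algebra a b \<in> D_alg" "b \<in> D_alg \<Longrightarrow> amult reduced_algebra a b \<in> D_alg"
    "b \<in> D_alg \<Longrightarrow> asub reduced_algebra a b \<in> D_alg"
  using abelian_D assms unfolding abelian_subalgebra_def cstar_subalgebra_def asub_def by blast+

text \<open>Positivity in \<open>apositive\<close> is relative to a carrier. A square root taken in
  \<open>C0_units\<close> is a witness inside the diagonal and so serves every carrier that contains
  \<open>D_alg\<close>.\<close>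

lemma D_sqrt:
  assumes a: "a \<in> D_alg"
    and pos: "\<And>x. x \<in> units G \<Longrightarrow> Im (uval (coeff a) x) = 0 \<and> 0 \<le> Re (uval (coeff a) x)"
  shows "\<exists>b\<in>D_alg. a = amult reduced_algebra (astar reduced_algebra b) b"
proof -
  let ?\<phi> = "restrict_units (coeff a)"
  let ?r = "\<lambda>x. complex_of_real (sqrt (Re (?\<phi> x)))"
  note \<phi> = restrict_units_C0[OF D_carrier[OF a]]
  \<comment> \<open>Where the root has modulus at least \<open>e\<close>, the function has modulus
    at least \<open>e\<^sup>2\<close>; hence the root vanishes at infinity too.\<close>
  have nr: "cmod (?r x) = sqrt (cmod (?\<phi> x))" for x
  proof -
    have "Im (?\<phi> x) = 0 \<and> 0 \<le> Re (?\<phi> x)" using pos by (simp add: restrict_units_def)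
    then have "cmod (?\<phi> x) = Re (?\<phi> x)" by (simp add: cmod_def)
    then show ?thesis by (simp add: pos restrict_units_def)
  qed
  have r: "?r \<in> C0_units"
  proof (rule C0_I)
    show "?r x = 0" if "x \<notin> units G" for x using that by (simp add: restrict_units_def)
    show "continuous_map (subtopology (gtop G) (units G)) euclidean ?r"
      using C0_continuous[OF \<phi>] by (simp add: continuous_map_atin tendsto_of_real tendsto_real_sqrt tendsto_Re)
    fix e :: real assume e: "0 < e"
    have "{x \<in> units G. e \<le> cmod (?r x)} \<subseteq> {x \<in> units G. e\<^sup>2 \<le> cmod (?\<phi> x)}"
      unfolding nr
    proof (intro subsetI CollectI conjI)
      fix x assume x: "x \<in> {x \<in> units G. e \<le> sqrt (cmod (?\<phi> x))}"
      then have "e\<^sup>2 \<le> (sqrt (cmod (?\<phi> x)))\<^sup>2" using e by (intro power_mono) auto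
      then show "e\<^sup>2 \<le> cmod (?\<phi> x)" by simp
    qed blast
    then show "\<exists>L. compactin (gtop G) L \<and> {x \<in> units G. e \<le> cmod (?r x)} \<subseteq> L"
      using C0_compact[OF \<phi>, of "e\<^sup>2"] e by (intro exI conjI) auto
  qed
  let ?b = "C0_inclusion ?r"
  note b = C0_inclusion(1)[OF r]
  have "a = amult reduced_algebra (astar reduced_algebra ?b) ?b"
  proof (rule D_eqI[OF a D_closed(4)[OF D_closed(1)[OF b] b]])
    fix x assume x: "x \<in> units G"
    have "uval (coeff (amult reduced_algebra (astar reduced_algebra ?b) ?b)) x = cnj (?r x) * ?r x"
      using coeff_mult_left[OF D_closed(1)[OF b] D_carrier[OF b], of "\<iota> (1, x)"] x
      by (simp add: coeff_star D_carrier[OF b] invol_def inv_iota C0_inclusion(2)[OF r])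
    also have "\<dots> = of_real (Re (uval (coeff a) x))"
      using pos[OF x] x by (simp add: restrict_units_def of_real_mult[symmetric] del: of_real_mult)
    finally show "uval (coeff a) x = uval (coeff (amult reduced_algebra (astar reduced_algebra ?b) ?b)) x"
      using pos[OF x] by (simp add: complex_eq_iff)
  qed
  then show ?thesis using b by blast
qed

end

section \<open>Algebras with a smaller carrier\<close>

lemma acarrier_update_simps:
  "acarrier (A\<lparr>acarrier := B\<rparr>) = B" "aadd (A\<lparr>acarrier := B\<rparr>) = aadd A"
  "azero (A\<lparr>acarrier := B\<rparr>) = azero A" "ascale (A\<lparr>acarrier := B\<rparr>) = ascale A"
  "amult (A\<lparr>acarrier := B\<rparr>) = amult A" "astar (A\<lparr>acarrier := B\<rparr>) = astar A"
  "anorm (A\<lparr>acarrier := B\<rparr>) = anorm A"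
  by simp_all

context cstar_algebra
begin

lemma adist_subalgebra:
  assumes "cstar_subalgebra A B" "a \<in> B" "b \<in> B"
  shows "adist (A\<lparr>acarrier := B\<rparr>) a b = adist A a b"
proof -
  have "a \<in> acarrier A" "b \<in> acarrier A" using assms by (auto simp: cstar_subalgebra_def)
  then show ?thesis using assms by (simp add: adist_def)
qed

text \<open>The operations are unchanged, so only closedness needs an argument: a sequence
  converging in \<open>B\<close> converges to the same limit in \<open>A\<close>.\<close>

lemma abelian_subalgebra_in_subalgebra:
  assumes B: "cstar_subalgebra A B" and D: "abelian_subalgebra A D" and "D \<subseteq> B"
  shows "abelian_subalgebra (A\<lparr>acarrier := B\<rparr>) D"
proof -
  interpret B: cstar_algebra "A\<lparr>acarrier := B\<rparr>" by (rule cstar_algebra_subalgebra[OF B])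
  have clo: "closedin metric.mtopology D"
    using D by (simp add: abelian_subalgebra_def cstar_subalgebra_def atop_def)
  have carr: "a \<in> acarrier A" if "a \<in> B" for a using B that by (auto simp: cstar_subalgebra_def)
  have "closedin B.metric.mtopology D"
    unfolding B.metric.metric_closedin_iff_sequentially_closed
  proof (intro conjI allI impI)
    show "D \<subseteq> acarrier (A\<lparr>acarrier := B\<rparr>)" using assms(3) by simp
    fix \<sigma> l assume *: "range \<sigma> \<subseteq> D \<and> limitin B.metric.mtopology \<sigma> l sequentially"
    have l: "l \<in> B" using conjunct2[OF *] unfolding B.metric.limit_metric_sequentially by simp
    have \<sigma>: "\<sigma> n \<in> B" for n using conjunct1[OF *] assms(3) by blast
    have "limitin metric.mtopology \<sigma> l sequentially"
      using conjunct2[OF *] unfolding metric.limit_metric_sequentially B.metric.limit_metric_sequentially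
      by (simp add: adist_subalgebra[OF B] \<sigma> l carr)
    then show "l \<in> D" using clo conjunct1[OF *] unfolding metric.metric_closedin_iff_sequentially_closed by metis
  qed
  then have "closedin (atop (A\<lparr>acarrier := B\<rparr>)) D" by (simp add: atop_def)
  then show ?thesis using D assms(3) by (simp add: abelian_subalgebra_def cstar_subalgebra_def)
qed

end

context twist
begin

section \<open>Conditional expectation and approximate unit\<close>

lemma star_mult_self_unit:
  assumes "a \<in> acarrier reduced_algebra" "x \<in> units G"
  shows "Im (uval (coeff (amult reduced_algebra (astar reduced_algebra a) a)) x) = 0"
    "0 \<le> Re (uval (coeff (amult reduced_algebra (astar reduced_algebra a) a)) x)"
proof -
  have "src G (q (\<iota> (1, x))) = x" using assms(2) by simp
  then show "Im (uval (coeff (amult reduced_algebra (astar reduced_algebra a) a)) x) = 0"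
    "0 \<le> Re (uval (coeff (amult reduced_algebra (astar reduced_algebra a) a)) x)"
    using coeff_star_mult_self[OF assms(1), of "\<iota> (1, x)"] assms(2)
    by (auto intro: order_trans[OF zero_le_power2])
qed

lemma apositive_D:
  assumes "D_alg \<subseteq> B" "a \<in> D_alg"
    and "\<And>x. x \<in> units G \<Longrightarrow> Im (uval (coeff a) x) = 0 \<and> 0 \<le> Re (uval (coeff a) x)"
  shows "apositive (reduced_algebra\<lparr>acarrier := B\<rparr>) a"
  using D_sqrt[OF assms(2,3)] assms(1) by (auto simp: apositive_def)

lemma conditional_expectation_D:
  assumes B: "B \<subseteq> acarrier reduced_algebra" "D_alg \<subseteq> B"
  shows "conditional_expectation (reduced_algebra\<lparr>acarrier := B\<rparr>) D_alg (multiplier unit_ind)"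
  unfolding conditional_expectation_def acarrier_update_simps
proof (intro conjI ballI allI impI)
  note E = contractive_unit_ind
  fix a assume "a \<in> B"
  then have a: "a \<in> acarrier reduced_algebra" using B by blast
  show "multiplier unit_ind a \<in> D_alg" by (rule expectation_D[OF a])
  show "multiplier unit_ind (ascale reduced_algebra c a) = ascale reduced_algebra c (multiplier unit_ind a)" for c
    by (rule multiplier_scale[OF E a])
  show "anorm reduced_algebra (multiplier unit_ind a) \<le> anorm reduced_algebra a"
    by (rule multiplier_norm_le[OF E a])
  show "multiplier unit_ind (aadd reduced_algebra a b)
      = aadd reduced_algebra (multiplier unit_ind a) (multiplier unit_ind b)" if "b \<in> B" for b
    using B that by (intro multiplier_add[OF E a]) blast
  show "apositive (reduced_algebra\<lparr>acarrier := B\<rparr>) (multiplier unit_ind a)"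
    if pos: "apositive (reduced_algebra\<lparr>acarrier := B\<rparr>) a"
  \<comment> \<open>An element of the form b* b has nonnegative real values at the units, and these
    are the values of its expectation.\<close>
  proof (rule apositive_D[OF B(2) expectation_D[OF a]])
    obtain b where "b \<in> B" and ab: "a = amult reduced_algebra (astar reduced_algebra b) b"
      using pos by (auto simp: apositive_def)
    then have b: "b \<in> acarrier reduced_algebra" using B by blast
    show "Im (uval (coeff (multiplier unit_ind a)) x) = 0 \<and> 0 \<le> Re (uval (coeff (multiplier unit_ind a)) x)"
      if "x \<in> units G" for x
      unfolding expectation_uval[OF a that] unfolding ab using star_mult_self_unit[OF b that] by simp
  qed
  fix d assume d: "d \<in> D_alg"
  note dC = D_carrier[OF d]
  show "multiplier unit_ind (amult reduced_algebra d a) = amult reduced_algebra d (multiplier unit_ind a)"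
    by (rule D_eqI[OF expectation_D[OF red.mult_closed[OF dC a]] D_closed(4)[OF d expectation_D[OF a]]])
       (simp add: expectation_uval red.mult_closed dC a coeff_mult_left[OF d] multiplier_closed E)
  show "multiplier unit_ind (amult reduced_algebra a d) = amult reduced_algebra (multiplier unit_ind a) d"
    by (rule D_eqI[OF expectation_D[OF red.mult_closed[OF a dC]] D_closed(4)[OF expectation_D[OF a] d]])
       (simp add: expectation_uval red.mult_closed dC a coeff_mult_right[OF d] multiplier_closed E)
qed (rule expectation_id)

lemma expectation_faithful:
  assumes B: "B \<subseteq> acarrier reduced_algebra"
  shows "faithful_on (reduced_algebra\<lparr>acarrier := B\<rparr>) (multiplier unit_ind)"
  unfolding faithful_on_def acarrier_update_simps
proof (intro ballI impI)
  fix a assume "a \<in> B"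
    and z: "multiplier unit_ind (amult reduced_algebra (astar reduced_algebra a) a) = azero reduced_algebra"
  then have a: "a \<in> acarrier reduced_algebra" using B by blast
  show "a = azero reduced_algebra"
  proof (rule coeff_inj[OF a red.zero_closed], unfold coeff_zero, rule ext)
    fix \<gamma> show "coeff a \<gamma> = 0"
    proof (cases "\<gamma> \<in> arrows S")
      case True
      let ?aa = "amult reduced_algebra (astar reduced_algebra a) a"
      have aa: "?aa \<in> acarrier reduced_algebra" by (intro red.mult_closed red.star_closed a)
      have "uval (coeff ?aa) (src G (q \<gamma>)) = 0"
        using expectation_uval[OF aa, of "src G (q \<gamma>)"] True by (simp add: z coeff_zero)
      then have "(cmod (coeff a \<gamma>))\<^sup>2 \<le> 0" using coeff_star_mult_self[OF a True] by simp
      then show ?thesis by simp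
    qed (rule equivariant_off[OF equivariant_coeff[OF a]])
  qed
qed

text \<open>\<open>contains_approximate_unit\<close> indexes a net by its own members, so all
  compactly supported functions with values between \<open>0\<close> and \<open>1\<close> are taken
  at once; pointwise maxima make the set directed.\<close>

definition unit_net :: "(nat \<Rightarrow> 's \<Rightarrow> complex) set set" where
  "unit_net = {emb (diag (\<lambda>x. of_real (h x))) |h :: 'g \<Rightarrow> real.
     (\<lambda>x. of_real (h x)) \<in> Cc_units \<and> (\<forall>x. 0 \<le> h x \<and> h x \<le> 1)}"

lemma unit_netI:
  "\<lbrakk>(\<lambda>x. complex_of_real (h x)) \<in> Cc_units; \<forall>x. 0 \<le> h x \<and> h x \<le> 1\<rbrakk>
    \<Longrightarrow> emb (diag (\<lambda>x. of_real (h x))) \<in> unit_net"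
  unfolding unit_net_def by (rule CollectI, rule exI[of _ h]) simp

text \<open>The order of the algebra becomes the pointwise order of functions: from left to right
  because b* b is nonnegative at the units, from right to left by the square root in
  \<open>D_alg\<close>.\<close>

lemma unit_net_less_eq_iff:
  assumes B: "B \<subseteq> acarrier reduced_algebra" "D_alg \<subseteq> B"
    and h: "(\<lambda>x. complex_of_real (h x)) \<in> Cc_units" and k: "(\<lambda>x. complex_of_real (k x)) \<in> Cc_units"
  shows "aless_eq (reduced_algebra\<lparr>acarrier := B\<rparr>) (emb (diag (\<lambda>x. of_real (h x)))) (emb (diag (\<lambda>x. of_real (k x))))
    \<longleftrightarrow> (\<forall>x\<in>units G. h x \<le> k x)"
proof -
  let ?e = "emb (diag (\<lambda>x. complex_of_real (h x)))" and ?e' = "emb (diag (\<lambda>x. complex_of_real (k x)))"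
  let ?d = "asub reduced_algebra ?e' ?e"
  have d: "?d \<in> D_alg" by (intro D_closed(5) emb_diag_D h k)
  have v: "uval (coeff ?d) x = of_real (k x - h x)" if "x \<in> units G" for x
    using that by (simp add: coeff_sub emb_closed Cc_units_diag[OF h] Cc_units_diag[OF k])
  show ?thesis
  proof
    assume "aless_eq (reduced_algebra\<lparr>acarrier := B\<rparr>) ?e ?e'"
    then obtain b where b: "b \<in> B" "?d = amult reduced_algebra (astar reduced_algebra b) b"
      by (auto simp: aless_eq_def apositive_def)
    then have "b \<in> acarrier reduced_algebra" using B by blast
    then show "\<forall>x\<in>units G. h x \<le> k x"
      using star_mult_self_unit(2)[of b] v unfolding b(2)[symmetric] by force
  next
    assume "\<forall>x\<in>units G. h x \<le> k x"
    then have "apositive (reduced_algebra\<lparr>acarrier := B\<rparr>) ?d"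
      by (intro apositive_D[OF B(2) d]) (simp add: v)
    then show "aless_eq (reduced_algebra\<lparr>acarrier := B\<rparr>) ?e ?e'" by (simp add: aless_eq_def)
  qed
qed

lemma Cc_units_max:
  assumes h: "(\<lambda>x. complex_of_real (h x)) \<in> Cc_units" and k: "(\<lambda>x. complex_of_real (k x)) \<in> Cc_units"
  shows "(\<lambda>x. complex_of_real (max (h x) (k x))) \<in> Cc_units"
proof -
  let ?U = "subtopology (gtop G) (units G)"
  obtain K where K: "compactin (gtop G) K" "K \<subseteq> units G" "\<forall>x. complex_of_real (h x) \<noteq> 0 \<longrightarrow> x \<in> K"
    using h by (rule Cc_units_support)
  obtain L where L: "compactin (gtop G) L" "L \<subseteq> units G" "\<forall>x. complex_of_real (k x) \<noteq> 0 \<longrightarrow> x \<in> L"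
    using k by (rule Cc_units_support)
  have re: "continuous_map ?U euclideanreal h" if "(\<lambda>x. complex_of_real (h x)) \<in> Cc_units" for h
  proof -
    have "continuous_map ?U euclidean (\<lambda>x. complex_of_real (h x))" using that by (simp add: Cc_units_def)
    moreover have "continuous_map euclidean euclideanreal Re"
      by (simp add: continuous_on_Re continuous_on_id)
    ultimately have "continuous_map ?U euclideanreal (Re \<circ> (\<lambda>x. complex_of_real (h x)))"
      by (rule continuous_map_compose)
    then show ?thesis by (simp add: o_def)
  qed
  show ?thesis
  proof (rule Cc_units_I)
    show "continuous_map ?U euclidean (\<lambda>x. complex_of_real (max (h x) (k x)))"
      by (intro continuous_map_of_real continuous_map_real_max re h k)
    show "compactin (gtop G) (K \<union> L)" by (intro compactin_Un K L)
    show "x \<in> K \<union> L" if "complex_of_real (max (h x) (k x)) \<noteq> 0" for x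
      using that K(3) L(3) by (auto simp: max_def split: if_splits)
  qed (use h k K L in \<open>auto simp: Cc_units_def\<close>)
qed

text \<open>Multiplication by the diagonal element scales \<open>f\<close> at an arrow by the value
  of \<open>k\<close> at its range or its source, and both are \<open>1\<close> on the support of
  \<open>f\<close>.\<close>

lemma unit_net_mult:
  assumes k: "(\<lambda>x. complex_of_real (k x)) \<in> Cc_units" and f: "f \<in> Cc"
    and L: "\<forall>\<gamma>. f \<gamma> \<noteq> 0 \<longrightarrow> \<gamma> \<in> arrows S \<and> q \<gamma> \<in> L"
    and one: "\<And>x. x \<in> rng G ` L \<union> src G ` L \<Longrightarrow> k x = 1"
  shows "amult reduced_algebra (emb (diag (\<lambda>x. of_real (k x)))) (emb f) = emb f"
    "amult reduced_algebra (emb f) (emb (diag (\<lambda>x. of_real (k x)))) = emb f"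
proof -
  let ?e = "emb (diag (\<lambda>x. complex_of_real (k x)))"
  note e = emb_diag_D[OF k] and F = emb_closed[OF f]
  note c = red.mult_closed[OF D_carrier[OF e] F] red.mult_closed[OF F D_carrier[OF e]]
  show "amult reduced_algebra ?e (emb f) = emb f"
  proof (rule coeff_inj[OF c(1) F], rule ext)
    fix \<gamma> show "coeff (amult reduced_algebra ?e (emb f)) \<gamma> = coeff (emb f) \<gamma>"
    proof (cases "\<gamma> \<in> arrows S")
      case True
      then show ?thesis
        using coeff_mult_left[OF e F True] L one[of "rng G (q \<gamma>)"] f Cc_units_diag[OF k]
        by (cases "f \<gamma> = 0") auto
    qed (simp add: equivariant_off equivariant_coeff c F)
  qed
  show "amult reduced_algebra (emb f) ?e = emb f"
  proof (rule coeff_inj[OF c(2) F], rule ext)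
    fix \<gamma> show "coeff (amult reduced_algebra (emb f) ?e) \<gamma> = coeff (emb f) \<gamma>"
    proof (cases "\<gamma> \<in> arrows S")
      case True
      then show ?thesis
        using coeff_mult_right[OF e F True] L one[of "src G (q \<gamma>)"] f Cc_units_diag[OF k]
        by (cases "f \<gamma> = 0") auto
    qed (simp add: equivariant_off equivariant_coeff c F)
  qed
qed

lemma unit_net_norm:
  assumes "(\<lambda>x. complex_of_real (h x)) \<in> Cc_units" "\<forall>x. 0 \<le> h x \<and> h x \<le> 1"
  shows "anorm reduced_algebra (emb (diag (\<lambda>x. of_real (h x)))) \<le> 1"
  using assms by (subst red_norm_le_iff) (auto intro!: bounded_by_diag emb_closed Cc_units_diag simp: Cc_units_diag)

lemma approximate_unit_D:
  assumes B: "B \<subseteq> acarrier reduced_algebra" "D_alg \<subseteq> B"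
  shows "contains_approximate_unit (reduced_algebra\<lparr>acarrier := B\<rparr>) D_alg"
  unfolding contains_approximate_unit_def
proof (intro exI[of _ unit_net] conjI ballI allI impI)
  let ?R = "reduced_algebra\<lparr>acarrier := B\<rparr>"
  show "unit_net \<subseteq> D_alg" using emb_diag_D by (auto simp: unit_net_def)
  have "(\<lambda>x. complex_of_real 0) \<in> Cc_units" by (rule Cc_units_I[of _ "{}"]) simp_all
  then have "emb (diag (\<lambda>x. complex_of_real 0)) \<in> unit_net" by (rule unit_netI) simp
  then show "unit_net \<noteq> {}" by blast
  fix e assume "e \<in> unit_net"
  then obtain h :: "'g \<Rightarrow> real" where h: "(\<lambda>x. of_real (h x)) \<in> Cc_units" "\<forall>x. 0 \<le> h x \<and> h x \<le> 1"
    "e = emb (diag (\<lambda>x. of_real (h x)))" by (auto simp: unit_net_def)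
  show "apositive ?R e"
    by (rule apositive_D[OF B(2)]) (simp_all add: h emb_diag_D Cc_units_diag)
  show "anorm ?R e \<le> 1" using unit_net_norm[OF h(1,2)] by (simp add: h(3))
  fix e' assume "e' \<in> unit_net"
  then obtain k :: "'g \<Rightarrow> real" where k: "(\<lambda>x. of_real (k x)) \<in> Cc_units" "\<forall>x. 0 \<le> k x \<and> k x \<le> 1"
    "e' = emb (diag (\<lambda>x. of_real (k x)))" by (auto simp: unit_net_def)
  let ?m = "\<lambda>x. max (h x) (k x)"
  note m = Cc_units_max[OF h(1) k(1)]
  have "\<forall>x. 0 \<le> ?m x \<and> ?m x \<le> 1" using h(2) k(2) by (auto simp: max_def)
  then have "emb (diag (\<lambda>x. of_real (?m x))) \<in> unit_net" by (rule unit_netI[OF m])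
  moreover have "aless_eq ?R e (emb (diag (\<lambda>x. of_real (?m x))))"
    unfolding h(3) unit_net_less_eq_iff[OF B h(1) m] by simp
  moreover have "aless_eq ?R e' (emb (diag (\<lambda>x. of_real (?m x))))"
    unfolding k(3) unit_net_less_eq_iff[OF B k(1) m] by simp
  ultimately show "\<exists>e''\<in>unit_net. aless_eq ?R e e'' \<and> aless_eq ?R e' e''" by blast
next
  let ?R = "reduced_algebra\<lparr>acarrier := B\<rparr>"
  fix a \<epsilon> assume "a \<in> acarrier ?R" and \<epsilon>: "0 < (\<epsilon> :: real)"
  then have a: "a \<in> acarrier reduced_algebra" using B by auto
  have "0 < \<epsilon> / 3" using \<epsilon> by simp
  then obtain f where f: "f \<in> Cc" "adist reduced_algebra (emb f) a < \<epsilon> / 3" using emb_dense[OF a] by blast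
  obtain L where L: "compactin (gtop G) L" "\<forall>\<gamma>. f \<gamma> \<noteq> 0 \<longrightarrow> \<gamma> \<in> arrows S \<and> q \<gamma> \<in> L"
    by (rule Cc_support[OF f(1)])
  \<comment> \<open>Left multiplication sees the range of an arrow and right multiplication its
    source, so both images of \<open>L\<close> are included.\<close>
  let ?K = "rng G ` L \<union> src G ` L"
  have K: "compactin (gtop G) ?K"
    by (intro compactin_Un image_compactin[OF L(1)] Base.continuous_rng Base.continuous_src)
  have "L \<subseteq> arrows G" using compactin_subset_topspace[OF L(1)] by simp
  then have Ku: "?K \<subseteq> units G" by auto
  obtain h :: "'g \<Rightarrow> real" where h: "(\<lambda>x. of_real (h x)) \<in> Cc_units" "\<forall>x. 0 \<le> h x \<and> h x \<le> 1"
    "\<forall>x\<in>?K. h x = 1" "\<forall>x. x \<notin> units G \<longrightarrow> h x = 0"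
    by (rule unit_bump[OF K openin_units Ku Ku])
  let ?e = "emb (diag (\<lambda>x. complex_of_real (h x)))"
  have "?e \<in> unit_net" by (rule unit_netI[OF h(1,2)])
  moreover have "anorm ?R (asub ?R (amult ?R e' a) a) < \<epsilon> \<and> anorm ?R (asub ?R (amult ?R a e') a) < \<epsilon>"
    if e': "e' \<in> unit_net" and le: "aless_eq ?R ?e e'" for e'
  proof -
    obtain k :: "'g \<Rightarrow> real" where k: "(\<lambda>x. of_real (k x)) \<in> Cc_units" "\<forall>x. 0 \<le> k x \<and> k x \<le> 1"
      "e' = emb (diag (\<lambda>x. of_real (k x)))" using e' by (auto simp: unit_net_def)
    have hk: "\<forall>x\<in>units G. h x \<le> k x" using le unfolding k(3) unit_net_less_eq_iff[OF B h(1) k(1)] .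
    \<comment> \<open>A later member of the net lies between \<open>h\<close> and \<open>1\<close>,
      so it is \<open>1\<close> on \<open>?K\<close> and fixes \<open>emb f\<close> exactly, not
      just approximately.\<close>
    have one: "k x = 1" if "x \<in> ?K" for x
      using bspec[OF h(3) that] bspec[OF hk subsetD[OF Ku that]] k(2)[rule_format, of x] by linarith
    let ?F = "emb f"
    note F = emb_closed[OF f(1)] and eC = D_carrier[OF emb_diag_D[OF k(1), folded k(3)]]
    have eF: "amult reduced_algebra e' ?F = ?F" "amult reduced_algebra ?F e' = ?F"
      unfolding k(3) using unit_net_mult[OF k(1) f(1) L(2) one] by blast+
    note c = red.mult_closed[OF eC a] red.mult_closed[OF a eC]
    have n1: "anorm reduced_algebra e' \<le> 1" unfolding k(3) by (rule unit_net_norm[OF k(1,2)])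
    have aF: "adist reduced_algebra a ?F < \<epsilon> / 3" using f(2) by (simp add: red.metric.commute)
    have nn: "0 \<le> anorm reduced_algebra (asub reduced_algebra a ?F)" by (rule red.norm_nonneg[OF red.asub_closed[OF a F]])
    have "adist reduced_algebra (amult reduced_algebra e' a) (amult reduced_algebra e' ?F)
        \<le> anorm reduced_algebra e' * anorm reduced_algebra (asub reduced_algebra a ?F)"
      using eC a F by (simp add: red.adist_eq red.mult_closed red.asub_mult_left red.norm_mult red.asub_closed)
    also have "\<dots> \<le> 1 * anorm reduced_algebra (asub reduced_algebra a ?F)" by (rule mult_right_mono[OF n1 nn])
    finally have 1: "adist reduced_algebra (amult reduced_algebra e' a) ?F < \<epsilon> / 3"
      using aF a F by (simp add: eF red.adist_eq)
    have "adist reduced_algebra (amult reduced_algebra a e') (amult reduced_algebra ?F e')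
        \<le> anorm reduced_algebra (asub reduced_algebra a ?F) * anorm reduced_algebra e'"
      using eC a F by (simp add: red.adist_eq red.mult_closed red.asub_mult_right red.norm_mult red.asub_closed)
    also have "\<dots> \<le> anorm reduced_algebra (asub reduced_algebra a ?F) * 1" by (rule mult_left_mono[OF n1 nn])
    finally have 2: "adist reduced_algebra (amult reduced_algebra a e') ?F < \<epsilon> / 3"
      using aF a F by (simp add: eF red.adist_eq)
    have "adist reduced_algebra (amult reduced_algebra e' a) a < \<epsilon>"
      "adist reduced_algebra (amult reduced_algebra a e') a < \<epsilon>"
      using 1 2 red.metric.triangle[OF c(1) F a] red.metric.triangle[OF c(2) F a] f(2) \<epsilon> by linarith+
    then show ?thesis using c a by (simp add: red.adist_eq)
  qed
  ultimately show "\<exists>e\<in>unit_net. \<forall>e'\<in>unit_net. aless_eq ?R e e' \<longrightarrow>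
      anorm ?R (asub ?R (amult ?R e' a) a) < \<epsilon> \<and> anorm ?R (asub ?R (amult ?R a e') a) < \<epsilon>" by blast
qed

section \<open>Normalizers\<close>

text \<open>The factor \<open>g\<close> over the units does not enlarge supports. In the first
  product a nonzero value needs composable arrows \<open>h\<close> in \<open>L\<close> and
  \<open>k\<close> with inverse in \<open>L\<close>; these have the same source in a bisection, so
  \<open>h\<close> is the inverse of \<open>k\<close> and the product is a unit. The second product
  is the same with ranges.\<close>

lemma local_conj_unit_support:
  assumes f: "f \<in> Cc" "local_support f U \<phi> L" and g: "g \<in> Cc" "\<And>\<gamma>. \<lbrakk>\<gamma> \<in> arrows S; q \<gamma> \<notin> units G\<rbrakk> \<Longrightarrow> g \<gamma> = 0"
    and \<gamma>: "\<gamma> \<in> arrows S" "q \<gamma> \<notin> units G"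
  shows "conv (conv f g) (invol f) \<gamma> = 0" "conv (conv (invol f) g) f \<gamma> = 0"
proof -
  have U: "open_bisection G U" and L: "L \<subseteq> U" "\<forall>\<gamma>. f \<gamma> \<noteq> 0 \<longrightarrow> \<gamma> \<in> arrows S \<and> q \<gamma> \<in> L"
    using f(2) unfolding local_support_def trivializes_def by blast+
  note UD = open_bisectionD[OF U]
  let ?L' = "{h \<in> arrows G. ginv G h \<in> L}"
  note ef = Cc_equivariant[OF f(1)] and eg = Cc_equivariant[OF g(1)]
  have L': "\<forall>\<gamma>. invol f \<gamma> \<noteq> 0 \<longrightarrow> \<gamma> \<in> arrows S \<and> q \<gamma> \<in> ?L'"
  proof (intro allI impI)
    fix \<gamma> assume nz: "invol f \<gamma> \<noteq> 0"
    then have "\<gamma> \<in> arrows S" by (auto simp: invol_def split: if_splits)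
    moreover from this have "f (ginv S \<gamma>) \<noteq> 0" using nz by (simp add: invol_def)
    ultimately show "\<gamma> \<in> arrows S \<and> q \<gamma> \<in> ?L'" using L(2)[rule_format, of "ginv S \<gamma>"] by simp
  qed
  have supp: "\<forall>\<gamma>. conv f' g \<gamma> \<noteq> 0 \<longrightarrow> \<gamma> \<in> arrows S \<and> q \<gamma> \<in> M"
    if f': "equivariant f'" "\<forall>\<gamma>. f' \<gamma> \<noteq> 0 \<longrightarrow> \<gamma> \<in> arrows S \<and> q \<gamma> \<in> M" for f' M
  proof (intro allI impI)
    fix \<gamma> assume nz: "conv f' g \<gamma> \<noteq> 0"
    then have \<gamma>: "\<gamma> \<in> arrows S" by (auto simp: conv_def split: if_splits)
    then have "f' \<gamma> \<noteq> 0" using nz conv_unit_support_right[OF eg g(2) f'(1) \<gamma>] by auto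
    then show "\<gamma> \<in> arrows S \<and> q \<gamma> \<in> M" using f'(2) by blast
  qed
  show "conv (conv f g) (invol f) \<gamma> = 0"
  proof (rule ccontr)
    assume "conv (conv f g) (invol f) \<gamma> \<noteq> 0"
    then obtain h k where hk: "h \<in> L" "k \<in> ?L'" "(h, k) \<in> composable G" "q \<gamma> = gmult G h k"
      by (rule conv_support[OF supp[OF ef L(2)] L'])
    note c = composableD[OF hk(3)]
    have kL: "ginv G k \<in> L" using hk(2) by simp
    have "h = ginv G k"
      by (rule inj_onD[OF UD(3)]) (use L(1) hk(1) kL c in auto)
    then have "q \<gamma> = src G k" using hk(4) c by simp
    then show False using \<gamma>(2) c by simp
  qed
  show "conv (conv (invol f) g) f \<gamma> = 0"
  proof (rule ccontr)
    assume "conv (conv (invol f) g) f \<gamma> \<noteq> 0"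
    then obtain h k where hk: "h \<in> ?L'" "k \<in> L" "(h, k) \<in> composable G" "q \<gamma> = gmult G h k"
      by (rule conv_support[OF supp[OF equivariant_invol[OF ef] L'] L(2)])
    note c = composableD[OF hk(3)]
    have hL: "ginv G h \<in> L" using hk(1) by simp
    have "k = ginv G h"
      by (rule inj_onD[OF UD(4)]) (use L(1) hk(2) hL c in auto)
    then have "q \<gamma> = rng G h" using hk(4) c by simp
    then show False using \<gamma>(2) c by simp
  qed
qed

lemma local_conj_D:
  assumes f: "f \<in> Cc" "local_support f U \<phi> L" and d: "d \<in> D_alg"
  shows "amult reduced_algebra (amult reduced_algebra (emb f) d) (astar reduced_algebra (emb f)) \<in> D_alg"
    "amult reduced_algebra (amult reduced_algebra (astar reduced_algebra (emb f)) d) (emb f) \<in> D_alg"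
proof -
  obtain v where v: "Cc.cauchy v" "d = Cc.cls v" "\<forall>n. v n \<in> Cc"
    "\<forall>n. \<forall>\<gamma>\<in>arrows S. q \<gamma> \<notin> units G \<longrightarrow> v n \<gamma> = 0" using d by (rule D_cauchyE)
  note F = Cc_cauchy_const[OF f(1)] and F' = Cc_cauchy_const[OF Cc_invol[OF f(1)]]
  have st: "astar reduced_algebra (emb f) = emb (invol f)"
    unfolding emb_eq_cls by (rule red_cls_ops(4)[OF F F])
  note dC = D_carrier[OF d] and fC = emb_closed[OF f(1)] and sC = emb_closed[OF Cc_invol[OF f(1)]]
  show "amult reduced_algebra (amult reduced_algebra (emb f) d) (astar reduced_algebra (emb f)) \<in> D_alg"
    unfolding st
  proof (rule D_I[OF red.mult_closed[OF red.mult_closed[OF fC dC] sC]])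
    fix \<gamma> assume \<gamma>: "\<gamma> \<in> arrows S" "q \<gamma> \<notin> units G"
    have "(\<lambda>n. conv (conv f (v n)) (invol f) \<gamma>)
        \<longlonglongrightarrow> coeff (amult reduced_algebra (amult reduced_algebra (emb f) d) (emb (invol f))) \<gamma>"
      unfolding emb_eq_cls v(2) red_cls_ops(2)[OF F v(1)] red_cls_ops(2)[OF red_cauchy_ops(2)[OF F v(1)] F']
      by (rule coeff_LIMSEQ[OF red_cauchy_ops(2)[OF red_cauchy_ops(2)[OF F v(1)] F']])
    moreover have "conv (conv f (v n)) (invol f) \<gamma> = 0" for n
      using v(3,4) by (intro local_conj_unit_support(1)[OF f _ _ \<gamma>]) auto
    ultimately show "coeff (amult reduced_algebra (amult reduced_algebra (emb f) d) (emb (invol f))) \<gamma> = 0"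
      using LIMSEQ_unique[OF _ tendsto_const] by simp
  qed
  show "amult reduced_algebra (amult reduced_algebra (astar reduced_algebra (emb f)) d) (emb f) \<in> D_alg"
    unfolding st
  proof (rule D_I[OF red.mult_closed[OF red.mult_closed[OF sC dC] fC]])
    fix \<gamma> assume \<gamma>: "\<gamma> \<in> arrows S" "q \<gamma> \<notin> units G"
    have "(\<lambda>n. conv (conv (invol f) (v n)) f \<gamma>)
        \<longlonglongrightarrow> coeff (amult reduced_algebra (amult reduced_algebra (emb (invol f)) d) (emb f)) \<gamma>"
      unfolding emb_eq_cls v(2) red_cls_ops(2)[OF F' v(1)] red_cls_ops(2)[OF red_cauchy_ops(2)[OF F' v(1)] F]
      by (rule coeff_LIMSEQ[OF red_cauchy_ops(2)[OF red_cauchy_ops(2)[OF F' v(1)] F]])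
    moreover have "conv (conv (invol f) (v n)) f \<gamma> = 0" for n
      using v(3,4) by (intro local_conj_unit_support(2)[OF f _ _ \<gamma>]) auto
    ultimately show "coeff (amult reduced_algebra (amult reduced_algebra (emb (invol f)) d) (emb f)) \<gamma> = 0"
      using LIMSEQ_unique[OF _ tendsto_const] by simp
  qed
qed

lemma emb_add: "\<lbrakk>f \<in> Cc; g \<in> Cc\<rbrakk> \<Longrightarrow> emb (\<lambda>\<gamma>. f \<gamma> + g \<gamma>) = aadd reduced_algebra (emb f) (emb g)"
  unfolding emb_eq_cls by (rule red_cls_ops(1)[symmetric]) (rule Cc_cauchy_const; assumption)+

lemma emb_zero: "emb (\<lambda>\<gamma>. 0) = azero reduced_algebra"
  by (simp add: reduced_algebra_def completion_def completion_emb_def)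

lemma normalizers_dense:
  "atop reduced_algebra closure_of aspan reduced_algebra (normalizers reduced_algebra D_alg)
    = acarrier reduced_algebra"
proof (rule red.closure_of_eq_carrier)
  fix a and e :: real assume "a \<in> acarrier reduced_algebra" "0 < e"
  then obtain f where f: "f \<in> Cc" "adist reduced_algebra (emb f) a < e" using emb_dense by blast
  have "emb f \<in> aspan reduced_algebra (normalizers reduced_algebra D_alg)"
    using f(1)
  proof (induction f rule: Cc_induct)
    case zero
    show ?case unfolding emb_zero by (rule aspan_zero)
  next
    case (add f g)
    then show ?case by (simp add: emb_add aspan_add)
  next
    case (local f U \<phi> L)
    have "emb f \<in> normalizers reduced_algebra D_alg"
      using local_conj_D[OF local] emb_closed[OF local(1)] by (simp add: normalizers_def)
    then show ?case by (rule aspan_base)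
  qed
  then show "\<exists>b\<in>aspan reduced_algebra (normalizers reduced_algebra D_alg).
      b \<in> acarrier reduced_algebra \<and> adist reduced_algebra b a < e"
    using f emb_closed by blast
qed

section \<open>Open supports\<close>

text \<open>\<open>lift\<close> is an arbitrary choice and not continuous. Whether a coefficient
  vanishes depends only on the image in \<open>G\<close>, so near a given arrow \<open>lift\<close>
  may be replaced by a continuous section \<open>\<phi>\<close>.\<close>

lemma openin_support:
  assumes a: "a \<in> acarrier reduced_algebra"
  shows "openin (gtop G) {h \<in> arrows G. coeff a (lift h) \<noteq> 0}"
proof (subst openin_subopen, intro ballI)
  let ?O = "{h \<in> arrows G. coeff a (lift h) \<noteq> 0}"
  fix h0 assume h0: "h0 \<in> ?O"
  obtain U \<phi> p where tr: "trivializes U \<phi> p" "h0 \<in> U" using trivialization[of h0] h0 by blast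
  have U: "openin (gtop G) U" using tr(1) by (simp add: trivializes_def open_bisectionD)
  have Ua: "U \<subseteq> arrows G" using openin_subset[OF U] by simp
  have \<phi>c: "continuous_map (subtopology (gtop G) U) (gtop S) \<phi>"
    and \<phi>: "\<And>h. h \<in> U \<Longrightarrow> \<phi> h \<in> arrows S \<and> q (\<phi> h) = h" using tr(1) unfolding trivializes_def by blast+
  have iff: "coeff a (\<phi> h) = 0 \<longleftrightarrow> coeff a (lift h) = 0" if "h \<in> U" for h
    using that \<phi>[OF that] Ua by (intro equivariant_zero_iff[OF equivariant_coeff[OF a]]) auto
  have top: "topspace (subtopology (gtop G) U) = U" using Ua by auto
  have "open (- {0 :: complex})" by (intro open_Compl closed_singleton)
  then have "openin euclidean (- {0 :: complex})" by simp
  from openin_continuous_map_preimage[OF continuous_map_compose[OF \<phi>c coeff_continuous[OF a]] this]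
  have "openin (subtopology (gtop G) U) {h \<in> U. coeff a (\<phi> h) \<in> - {0}}" unfolding top o_def .
  then have "openin (gtop G) {h \<in> U. coeff a (\<phi> h) \<in> - {0}}" by (rule openin_trans_full[OF _ U])
  moreover have "{h \<in> U. coeff a (\<phi> h) \<in> - {0}} \<subseteq> ?O" using iff Ua by auto
  moreover have "h0 \<in> {h \<in> U. coeff a (\<phi> h) \<in> - {0}}" using iff[OF tr(2)] h0 tr(2) by auto
  ultimately show "\<exists>T. openin (gtop G) T \<and> h0 \<in> T \<and> T \<subseteq> ?O" by blast
qed

text \<open>Commuting with a bump function that separates the range from the source of \<open>h\<close>
  forces the coefficient at \<open>h\<close> to vanish.\<close>

lemma commutant_support_isotropy:
  assumes a: "a \<in> acarrier reduced_algebra"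
    and comm: "\<And>d. d \<in> D_alg \<Longrightarrow> amult reduced_algebra a d = amult reduced_algebra d a"
    and h: "h \<in> arrows G" "coeff a (lift h) \<noteq> 0"
  shows "rng G h = src G h"
proof (rule ccontr)
  assume ne: "rng G h \<noteq> src G h"
  have K: "compactin (gtop G) {rng G h}" using h(1) by simp
  have "closedin (gtop G) {src G h}"
    using h(1) by (intro compactin_imp_closedin[OF Base.Hausdorff]) simp
  then have U: "openin (gtop G) (topspace (gtop G) - {src G h})" by blast
  have KU: "{rng G h} \<subseteq> topspace (gtop G) - {src G h}" "{rng G h} \<subseteq> units G" using ne h(1) by auto
  obtain k :: "'g \<Rightarrow> real" where k: "(\<lambda>x. of_real (k x)) \<in> Cc_units" "\<forall>x. 0 \<le> k x \<and> k x \<le> 1"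
    "\<forall>x\<in>{rng G h}. k x = 1" "\<forall>x. x \<notin> topspace (gtop G) - {src G h} \<longrightarrow> k x = 0"
    by (rule unit_bump[OF K U KU])
  let ?d = "emb (diag (\<lambda>x. complex_of_real (k x)))"
  note d = emb_diag_D[OF k(1)]
  have v: "uval (coeff ?d) x = of_real (k x)" if "x \<in> units G" for x
    using that by (simp add: Cc_units_diag[OF k(1)])
  have "coeff (amult reduced_algebra ?d a) (lift h) = coeff a (lift h)"
    using coeff_mult_left[OF d a, of "lift h"] h(1) k(3) by (simp add: v)
  moreover have "coeff (amult reduced_algebra a ?d) (lift h) = 0"
    using coeff_mult_right[OF d a, of "lift h"] h(1) k(4) by (simp add: v)
  ultimately show False using comm[OF d] h(2) by simp
qed

end

section \<open>Gradings\<close>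

lemma dual_groupD:
  assumes "\<omega> \<in> dual_group"
  shows "cmod (\<omega> t) = 1" "\<omega> (s + t) = \<omega> s * \<omega> t" "\<omega> 0 = 1" "\<omega> (- t) = cnj (\<omega> t)"
proof -
  show n: "cmod (\<omega> t) = 1" and m: "\<omega> (s + t) = \<omega> s * \<omega> t" for s t
    using assms by (simp_all add: dual_group_def)
  show z: "\<omega> 0 = 1" using m[of 0 0] n[of 0] by auto
  have "\<omega> t * \<omega> (- t) = 1" using m[of t "- t"] z by simp
  then have "cnj (\<omega> t) * \<omega> t * \<omega> (- t) = cnj (\<omega> t)" by (simp add: mult.assoc)
  then show "\<omega> (- t) = cnj (\<omega> t)" using circle_cnj_mult[of "\<omega> t"] n by simp
qed

lemma dual_group_cnj: "\<omega> \<in> dual_group \<Longrightarrow> (\<lambda>t. cnj (\<omega> t)) \<in> dual_group"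
  by (simp add: dual_group_def)

lemma dual_group_mult: "\<lbrakk>\<omega> \<in> dual_group; \<omega>' \<in> dual_group\<rbrakk> \<Longrightarrow> (\<lambda>t. \<omega> t * \<omega>' t) \<in> dual_group"
  by (simp add: dual_group_def norm_mult)

lemma dual_group_one: "(\<lambda>t. 1) \<in> dual_group"
  by (simp add: dual_group_def)

lemma openin_dual_group_nbhd:
  fixes \<omega>0 :: "'t::ab_group_add \<Rightarrow> complex"
  assumes "finite T" shows "openin (top_of_set dual_group) {\<omega> \<in> dual_group. \<forall>t\<in>T. cmod (\<omega> t - \<omega>0 t) < (d :: real)}"
proof -
  have "open (\<Inter>t\<in>T. {\<omega> :: 't \<Rightarrow> complex. cmod (\<omega> t - \<omega>0 t) < d})"
    using assms by (intro open_INT ballI open_Collect_less continuous_intros) auto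
  then have "openin (top_of_set dual_group) (dual_group \<inter> (\<Inter>t\<in>T. {\<omega>. cmod (\<omega> t - \<omega>0 t) < d}))" by (rule openin_open_Int)
  moreover have "dual_group \<inter> (\<Inter>t\<in>T. {\<omega>. cmod (\<omega> t - \<omega>0 t) < d})
      = {\<omega> \<in> dual_group. \<forall>t\<in>T. cmod (\<omega> t - \<omega>0 t) < d}" by auto
  ultimately show ?thesis by simp
qed

context graded_twist
begin

section \<open>The dual action\<close>

lemma cG_unit: assumes "x \<in> units G" shows "cG x = 0"
proof -
  have "(x, x) \<in> composable G" "gmult G x x = x"
    using assms Base.mult_unit[of x x] by (simp_all add: composable_def)
  then show ?thesis using cG_hom[of x x] by simp
qed

lemma cG_inv: assumes "g \<in> arrows G" shows "cG (ginv G g) = - cG g"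
  using cG_hom[of "ginv G g" g] cG_unit[of "src G g"] assms by (simp add: eq_neg_iff_add_eq_0)

abbreviation chi :: "('t \<Rightarrow> complex) \<Rightarrow> 'g \<Rightarrow> complex" where
  "chi \<omega> g \<equiv> \<omega> (cG g)"

lemma chi_continuous: "continuous_map (gtop G) euclidean (chi \<omega>)"
proof -
  have "continuous_map (discrete_topology UNIV) euclidean \<omega>" by simp
  from continuous_map_compose[OF cG_continuous this] show ?thesis by (simp only: o_def)
qed

text \<open>The degree of the product of \<open>h\<close> with the inverse of \<open>k\<close> is
  \<open>cG h - cG k\<close>, so the multiplier conjugates the matrix by the diagonal unitary with
  entries \<open>chi \<omega> h\<close>.\<close>

lemma contractive_chi: assumes "\<omega> \<in> dual_group" shows "contractive (chi \<omega>)"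
proof (rule contractiveI[OF chi_continuous])
  fix x f C assume C: "kernel_bound (base_fibre x) (kernel f) C"
  have eq: "chi \<omega> (gmult G h (ginv G k)) = chi \<omega> h * cnj (chi \<omega> k)" if "h \<in> base_fibre x" "k \<in> base_fibre x" for h k
    using that base_fibre_composable[OF that]
    by (simp add: cG_hom cG_inv dual_groupD(4)[OF assms, symmetric] dual_groupD(2)[OF assms, symmetric])
  have "kernel_bound (base_fibre x) (\<lambda>h k. chi \<omega> h * cnj (chi \<omega> k) * kernel f h k) C"
    by (rule kernel_bound_conjugate[OF C dual_groupD(1)[OF assms]])
  then show "kernel_bound (base_fibre x) (\<lambda>h k. chi \<omega> (gmult G h (ginv G k)) * kernel f h k) C"
    by (subst kernel_bound_cong[where L = "\<lambda>h k. chi \<omega> h * cnj (chi \<omega> k) * kernel f h k"]) (simp_all only: eq)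
qed

definition zero_ind :: "'g \<Rightarrow> complex" where
  "zero_ind g = (if cG g = 0 then 1 else 0)"

lemma contractive_zero_ind: "contractive zero_ind"
proof (rule contractiveI)
  show "continuous_map (gtop G) euclidean zero_ind"
    unfolding zero_ind_def[abs_def] by (rule chi_continuous[of "\<lambda>t. if t = 0 then 1 else 0"])
  fix x f C assume C: "0 \<le> C" "kernel_bound (base_fibre x) (kernel f) C"
  have eq: "zero_ind (gmult G h (ginv G k)) * kernel f h k = (if cG h = cG k then kernel f h k else 0)"
    if "h \<in> base_fibre x" "k \<in> base_fibre x" for h k
    using that base_fibre_composable[OF that] by (simp add: zero_ind_def cG_hom cG_inv)
  show "kernel_bound (base_fibre x) (\<lambda>h k. zero_ind (gmult G h (ginv G k)) * kernel f h k) C"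
    by (subst kernel_bound_cong[where L = "\<lambda>h k. if cG h = cG k then kernel f h k else 0"])
       (simp_all only: eq kernel_bound_block[OF C(2,1)])
qed

text \<open>The multiplier is contractive and agrees with the defining map on every
  \<open>emb f\<close>, so it is the continuous extension.\<close>

lemma dual_action_eq:
  assumes \<omega>: "\<omega> \<in> dual_group" and a: "a \<in> acarrier reduced_algebra"
  shows "dual_action \<omega> a = multiplier (chi \<omega>) a"
  unfolding dual_action_def atop_def
proof (rule continuous_extension_metric_eqI[OF red.metric.Metric_space_axioms red.metric.Metric_space_axioms a])
  note m = contractive_chi[OF \<omega>]
  \<comment> \<open>The two gradings are related only on arrows of \<open>S\<close>; elsewhere both
    sides vanish because \<open>f\<close> does.\<close>
  have eq: "(\<lambda>\<gamma>. \<omega> (cS \<gamma>) * f \<gamma>) = (\<lambda>\<gamma>. chi \<omega> (q \<gamma>) * f \<gamma>)" if "f \<in> Cc" for f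
    using equivariant_off[OF Cc_equivariant[OF that]] cS_eq by (intro ext) (metis mult_zero_right)
  show "multiplier (chi \<omega>) a \<in> acarrier reduced_algebra" by (rule multiplier_closed[OF m a])
  show "emb f \<in> acarrier reduced_algebra" if "f \<in> Cc" for f by (rule emb_closed[OF that])
  show "emb (\<lambda>\<gamma>. \<omega> (cS \<gamma>) * f \<gamma>) \<in> acarrier reduced_algebra" if "f \<in> Cc" for f
    unfolding eq[OF that] by (rule emb_closed[OF contractive_Cc[OF m that]])
  fix e :: real assume e: "0 < e"
  show "\<exists>f\<in>Cc. adist reduced_algebra (emb f) a < e" by (rule emb_dense[OF a e])
  show "\<exists>d>0. \<forall>f\<in>Cc. adist reduced_algebra (emb f) a < d \<longrightarrow>
      adist reduced_algebra (emb (\<lambda>\<gamma>. \<omega> (cS \<gamma>) * f \<gamma>)) (multiplier (chi \<omega>) a) < e"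
  proof (intro exI[of _ e] conjI e ballI impI)
    fix f assume f: "f \<in> Cc" "adist reduced_algebra (emb f) a < e"
    then show "adist reduced_algebra (emb (\<lambda>\<gamma>. \<omega> (cS \<gamma>) * f \<gamma>)) (multiplier (chi \<omega>) a) < e"
      unfolding eq[OF f(1)] multiplier_emb[OF m f(1), symmetric]
      using multiplier_adist_le[OF m emb_closed[OF f(1)] a] by linarith
  qed
qed

lemma coeff_dual_action:
  "\<lbrakk>\<omega> \<in> dual_group; a \<in> acarrier reduced_algebra\<rbrakk>
    \<Longrightarrow> coeff (dual_action \<omega> a) = (\<lambda>\<gamma>. chi \<omega> (q \<gamma>) * coeff a \<gamma>)"
  by (simp add: dual_action_eq coeff_multiplier contractive_chi)

lemma dual_action_closed:
  "\<lbrakk>\<omega> \<in> dual_group; a \<in> acarrier reduced_algebra\<rbrakk> \<Longrightarrow> dual_action \<omega> a \<in> acarrier reduced_algebra"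
  by (simp add: dual_action_eq multiplier_closed contractive_chi)

text \<open>In each term the degrees of the two factors add up to the degree of
  \<open>\<gamma>\<close>, so the character comes out of the sum.\<close>

lemma conv_chi:
  assumes "\<omega> \<in> dual_group"
  shows "conv (\<lambda>\<gamma>. chi \<omega> (q \<gamma>) * f \<gamma>) (\<lambda>\<gamma>. chi \<omega> (q \<gamma>) * g \<gamma>) = (\<lambda>\<gamma>. chi \<omega> (q \<gamma>) * conv f g \<gamma>)"
proof
  fix \<gamma> show "conv (\<lambda>\<gamma>. chi \<omega> (q \<gamma>) * f \<gamma>) (\<lambda>\<gamma>. chi \<omega> (q \<gamma>) * g \<gamma>) \<gamma> = chi \<omega> (q \<gamma>) * conv f g \<gamma>"
  proof (cases "\<gamma> \<in> arrows S")
    case True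
    let ?H = "{h \<in> arrows G. rng G h = rng G (q \<gamma>)}"
    have t: "chi \<omega> (q (lift h)) * f (lift h) * (chi \<omega> (q (gmult S (ginv S (lift h)) \<gamma>)) * g (gmult S (ginv S (lift h)) \<gamma>))
        = chi \<omega> (q \<gamma>) * (f (lift h) * g (gmult S (ginv S (lift h)) \<gamma>))" if "h \<in> ?H" for h
    proof -
      have c: "(ginv S (lift h), \<gamma>) \<in> composable S" using that True by (simp add: composable_iff_q)
      have cG': "(ginv G h, q \<gamma>) \<in> composable G" using that True by (simp add: composable_def)
      have "chi \<omega> (q \<gamma>) = \<omega> (cG h + (- cG h + cG (q \<gamma>)))" by simp
      also have "\<dots> = chi \<omega> h * chi \<omega> (q (gmult S (ginv S (lift h)) \<gamma>))"
        unfolding dual_groupD(2)[OF assms, of "cG h"] using that c cG' by (simp add: q.map_mult cG_hom cG_inv)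
      finally show ?thesis using that by simp
    qed
    have "conv (\<lambda>\<gamma>. chi \<omega> (q \<gamma>) * f \<gamma>) (\<lambda>\<gamma>. chi \<omega> (q \<gamma>) * g \<gamma>) \<gamma>
        = (\<Sum>\<^sub>\<infinity>h\<in>?H. chi \<omega> (q \<gamma>) * (f (lift h) * g (gmult S (ginv S (lift h)) \<gamma>)))"
      unfolding conv_def if_P[OF True] by (rule infsum_cong) (rule t)
    also have "\<dots> = chi \<omega> (q \<gamma>) * conv f g \<gamma>"
      unfolding conv_def if_P[OF True] by (rule infsum_cmult_right')
    finally show ?thesis .
  qed (simp add: conv_def)
qed

lemma dual_action_mult:
  assumes \<omega>: "\<omega> \<in> dual_group" and a: "a \<in> acarrier reduced_algebra" and b: "b \<in> acarrier reduced_algebra"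
  shows "dual_action \<omega> (amult reduced_algebra a b)
    = amult reduced_algebra (dual_action \<omega> a) (dual_action \<omega> b)"
proof -
  note m = contractive_chi[OF \<omega>]
  obtain u where u: "Cc.cauchy u" "a = Cc.cls u" using a by (rule red_carrierE)
  obtain v where v: "Cc.cauchy v" "b = Cc.cls v" using b by (rule red_carrierE)
  note mu = multiplier_cls[OF m u(1)] and mv = multiplier_cls[OF m v(1)]
  show ?thesis
    unfolding dual_action_eq[OF \<omega> a] dual_action_eq[OF \<omega> b] dual_action_eq[OF \<omega> red.mult_closed[OF a b]]
    unfolding u(2) v(2) mu(2) mv(2) red_cls_ops(2)[OF u(1) v(1)] red_cls_ops(2)[OF mu(1) mv(1)]
      multiplier_cls(2)[OF m red_cauchy_ops(2)[OF u(1) v(1)]] conv_chi[OF \<omega>] ..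
qed

lemma dual_action_star:
  assumes \<omega>: "\<omega> \<in> dual_group" and a: "a \<in> acarrier reduced_algebra"
  shows "dual_action \<omega> (astar reduced_algebra a) = astar reduced_algebra (dual_action \<omega> a)"
proof (rule coeff_inj)
  have "chi \<omega> (q \<gamma>) * invol (coeff a) \<gamma> = invol (\<lambda>\<gamma>. chi \<omega> (q \<gamma>) * coeff a \<gamma>) \<gamma>" for \<gamma>
    by (simp add: invol_def cG_inv dual_groupD(4)[OF \<omega>])
  then show "coeff (dual_action \<omega> (astar reduced_algebra a)) = coeff (astar reduced_algebra (dual_action \<omega> a))"
    using \<omega> a by (simp add: coeff_dual_action coeff_star red.star_closed dual_action_closed)
qed (use \<omega> a in \<open>simp_all add: red.star_closed dual_action_closed\<close>)

lemma dual_action_dual_action: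
  assumes "\<omega> \<in> dual_group" "\<omega>' \<in> dual_group" "a \<in> acarrier reduced_algebra"
  shows "dual_action (\<lambda>t. \<omega> t * \<omega>' t) a = dual_action \<omega> (dual_action \<omega>' a)"
  by (rule coeff_inj)
     (use assms in \<open>simp_all add: coeff_dual_action dual_action_closed dual_group_mult mult.assoc\<close>)

lemma dual_action_one: "a \<in> acarrier reduced_algebra \<Longrightarrow> dual_action (\<lambda>t. 1) a = a"
  by (rule coeff_inj) (simp_all add: coeff_dual_action dual_action_closed dual_group_one)

lemma dual_action_automorphism:
  assumes \<omega>: "\<omega> \<in> dual_group" shows "star_automorphism reduced_algebra (dual_action \<omega>)"
proof -
  have 1: "(\<lambda>t. \<omega> t * cnj (\<omega> t)) = (\<lambda>t. 1)" "(\<lambda>t. cnj (\<omega> t) * \<omega> t) = (\<lambda>t. 1)"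
    using circle_cnj_mult[of "\<omega> _"] dual_groupD(1)[OF \<omega>] by (auto simp: mult.commute)
  have "bij_betw (dual_action \<omega>) (acarrier reduced_algebra) (acarrier reduced_algebra)"
  proof (rule bij_betw_byWitness[where f' = "dual_action (\<lambda>t. cnj (\<omega> t))"])
    show "\<forall>a\<in>acarrier reduced_algebra. dual_action (\<lambda>t. cnj (\<omega> t)) (dual_action \<omega> a) = a"
      using dual_action_dual_action[OF dual_group_cnj[OF \<omega>] \<omega>] dual_action_one by (simp add: 1)
    show "\<forall>a\<in>acarrier reduced_algebra. dual_action \<omega> (dual_action (\<lambda>t. cnj (\<omega> t)) a) = a"
      using dual_action_dual_action[OF \<omega> dual_group_cnj[OF \<omega>]] dual_action_one by (simp add: 1)
  qed (use \<omega> dual_group_cnj[OF \<omega>] dual_action_closed in auto)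
  then show ?thesis
    unfolding star_automorphism_def
    using \<omega> contractive_chi[OF \<omega>]
    by (simp add: dual_action_mult dual_action_star)
       (simp add: dual_action_eq red.add_closed red.scale_closed multiplier_add multiplier_scale)
qed

text \<open>The degree is locally constant, so a compact support meets only finitely many degrees
  and finitely many values of \<open>\<omega>\<close> control the multiplier on it. The induction
  reduces to functions on a bisection because there a uniform estimate bounds the norm.\<close>

lemma dual_action_continuous_Cc:
  assumes f: "f \<in> Cc" and \<omega>0: "\<omega>0 \<in> dual_group" and e: "0 < (e :: real)"
  shows "\<exists>T d. finite T \<and> 0 < d \<and> (\<forall>\<omega>\<in>dual_group. (\<forall>t\<in>T. cmod (\<omega> t - \<omega>0 t) < d) \<longrightarrow>
    adist reduced_algebra (dual_action \<omega> (emb f)) (dual_action \<omega>0 (emb f)) < e)"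
  using f e
proof (induction f arbitrary: e rule: Cc_induct)
  case zero
  have z: "dual_action \<omega> (azero reduced_algebra) = azero reduced_algebra" if "\<omega> \<in> dual_group" for \<omega>
    by (rule coeff_inj) (simp_all add: that dual_action_closed coeff_dual_action red.zero_closed coeff_zero)
  show ?case using zero by (intro exI[of _ "{}"] exI[of _ 1]) (simp add: emb_zero z \<omega>0 red.zero_closed)
next
  case (add f g)
  have "0 < e / 2" using add.prems by simp
  from add.IH(1)[OF this] obtain T d where T: "finite T" "0 < d"
    "\<And>\<omega>. \<omega> \<in> dual_group \<Longrightarrow> (\<forall>t\<in>T. cmod (\<omega> t - \<omega>0 t) < d) \<Longrightarrow>
      adist reduced_algebra (dual_action \<omega> (emb f)) (dual_action \<omega>0 (emb f)) < e / 2" by blast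
  from add.IH(2)[OF \<open>0 < e / 2\<close>] obtain T' d' where T': "finite T'" "0 < d'"
    "\<And>\<omega>. \<omega> \<in> dual_group \<Longrightarrow> (\<forall>t\<in>T'. cmod (\<omega> t - \<omega>0 t) < d') \<Longrightarrow>
      adist reduced_algebra (dual_action \<omega> (emb g)) (dual_action \<omega>0 (emb g)) < e / 2" by blast
  note c = emb_closed[OF add.hyps(1)] emb_closed[OF add.hyps(2)]
  have "adist reduced_algebra (dual_action \<omega> (emb (\<lambda>\<gamma>. f \<gamma> + g \<gamma>))) (dual_action \<omega>0 (emb (\<lambda>\<gamma>. f \<gamma> + g \<gamma>))) < e"
    if \<omega>: "\<omega> \<in> dual_group" and small: "\<forall>t\<in>T \<union> T'. cmod (\<omega> t - \<omega>0 t) < min d d'" for \<omega>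
  proof -
    note c1 = dual_action_closed[OF \<omega> c(1)] dual_action_closed[OF \<omega> c(2)]
      dual_action_closed[OF \<omega>0 c(1)] dual_action_closed[OF \<omega>0 c(2)]
    have add': "dual_action \<omega> (emb (\<lambda>\<gamma>. f \<gamma> + g \<gamma>)) = aadd reduced_algebra (dual_action \<omega> (emb f)) (dual_action \<omega> (emb g))"
      if "\<omega> \<in> dual_group" for \<omega>
      using that c add.hyps by (simp add: emb_add dual_action_eq red.add_closed multiplier_add contractive_chi)
    have "adist reduced_algebra (dual_action \<omega> (emb (\<lambda>\<gamma>. f \<gamma> + g \<gamma>))) (dual_action \<omega>0 (emb (\<lambda>\<gamma>. f \<gamma> + g \<gamma>)))
      \<le> adist reduced_algebra (dual_action \<omega> (emb f)) (dual_action \<omega>0 (emb f))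
       + adist reduced_algebra (dual_action \<omega> (emb g)) (dual_action \<omega>0 (emb g))"
      using c1 red.norm_triangle by (simp add: add' \<omega> \<omega>0 red.adist_eq red.add_closed red.asub_add red.asub_closed)
    also have "\<dots> < e / 2 + e / 2" using small by (intro add_strict_mono T(3) T'(3) \<omega>) auto
    finally show ?thesis by simp
  qed
  then show ?case using T(1,2) T'(1,2) by (intro exI[of _ "T \<union> T'"] exI[of _ "min d d'"]) auto
next
  case (local f U \<phi> L)
  obtain B where B: "0 \<le> B" "\<And>\<gamma>. cmod (f \<gamma>) \<le> B" using Cc_bounded[OF local(1)] by blast
  have L: "compactin (gtop G) L" "\<forall>\<gamma>. f \<gamma> \<noteq> 0 \<longrightarrow> \<gamma> \<in> arrows S \<and> q \<gamma> \<in> L"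
    using local(2) unfolding local_support_def by blast+
  have "compactin (discrete_topology UNIV) (cG ` L)" by (rule image_compactin[OF L(1) cG_continuous])
  then have T: "finite (cG ` L)" by (simp add: compactin_discrete_topology)
  \<comment> \<open>The bound \<open>B\<close> may be \<open>0\<close>, hence \<open>B + 1\<close>;
    the factor \<open>2\<close> leaves \<open>e / 2\<close>, so that a weak bound on the norm still
    gives a strict one.\<close>
  let ?d = "e / (2 * (B + 1))"
  have d: "0 < ?d" using local.prems B(1) by simp
  note c = emb_closed[OF local(1)]
  have "adist reduced_algebra (dual_action \<omega> (emb f)) (dual_action \<omega>0 (emb f)) < e"
    if \<omega>: "\<omega> \<in> dual_group" and small: "\<forall>t\<in>cG ` L. cmod (\<omega> t - \<omega>0 t) < ?d" for \<omega>
  proof -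
    let ?g = "\<lambda>\<gamma>. (chi \<omega> (q \<gamma>) - chi \<omega>0 (q \<gamma>)) * f \<gamma>"
    have gC: "?g \<in> Cc" by (rule Cc_multiplier[OF local(1) continuous_map_diff[OF chi_continuous chi_continuous]])
    have "local_support ?g U \<phi> L" using local(2) by (auto simp: local_support_def)
    moreover have "cmod (?g \<gamma>) \<le> e / 2" for \<gamma>
    proof (cases "f \<gamma> = 0")
      case False
      then have "cmod (chi \<omega> (q \<gamma>) - chi \<omega>0 (q \<gamma>)) \<le> ?d" using L(2) small by (auto intro: less_imp_le)
      then have "cmod (?g \<gamma>) \<le> ?d * (B + 1)"
        unfolding norm_mult using B(2)[of \<gamma>] d by (intro mult_mono) auto
      also have "\<dots> = e / 2" using B(1) by (simp add: field_simps)
      finally show ?thesis .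
    qed (use local.prems in simp)
    ultimately have "bounded_by ?g (e / 2)" using local.prems by (intro bounded_by_local[OF gC]) auto
    moreover have "coeff (asub reduced_algebra (dual_action \<omega> (emb f)) (dual_action \<omega>0 (emb f))) = ?g"
      using local(1) by (simp add: coeff_sub coeff_dual_action dual_action_closed \<omega> \<omega>0 c left_diff_distrib)
    ultimately have "anorm reduced_algebra (asub reduced_algebra (dual_action \<omega> (emb f)) (dual_action \<omega>0 (emb f))) \<le> e / 2"
      using local.prems by (subst red_norm_le_iff) (simp_all add: red.asub_closed dual_action_closed \<omega> \<omega>0 c)
    then show ?thesis using local.prems by (simp add: red.adist_eq dual_action_closed \<omega> \<omega>0 c)
  qed
  then show ?case using T d by blast
qed

lemma dual_action_continuous:
  assumes a: "a \<in> acarrier reduced_algebra"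
  shows "continuous_map (top_of_set dual_group) (atop reduced_algebra) (\<lambda>\<omega>. dual_action \<omega> a)"
  unfolding atop_def red.metric.continuous_map_to_metric
proof (intro ballI allI impI)
  fix \<omega>0 :: "'t \<Rightarrow> complex" and e :: real assume "\<omega>0 \<in> topspace (top_of_set dual_group)" and e: "0 < e"
  then have \<omega>0: "\<omega>0 \<in> dual_group" by simp
  have e3: "0 < e / 3" using e by simp
  obtain f where f: "f \<in> Cc" "adist reduced_algebra (emb f) a < e / 3" using emb_dense[OF a e3] by blast
  obtain T d where T: "finite T" "0 < d" "\<And>\<omega>. \<omega> \<in> dual_group \<Longrightarrow> (\<forall>t\<in>T. cmod (\<omega> t - \<omega>0 t) < d) \<Longrightarrow>
      adist reduced_algebra (dual_action \<omega> (emb f)) (dual_action \<omega>0 (emb f)) < e / 3"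
    using dual_action_continuous_Cc[OF f(1) \<omega>0 e3] by blast
  let ?U = "{\<omega> \<in> dual_group. \<forall>t\<in>T. cmod (\<omega> t - \<omega>0 t) < d}"
  note F = emb_closed[OF f(1)]
  have "dual_action \<omega> a \<in> red.metric.mball (dual_action \<omega>0 a) e" if \<omega>: "\<omega> \<in> ?U" for \<omega>
  proof -
    have \<omega>d: "\<omega> \<in> dual_group" using \<omega> by blast
    note c = dual_action_closed[OF \<omega>d a] dual_action_closed[OF \<omega>d F] dual_action_closed[OF \<omega>0 a] dual_action_closed[OF \<omega>0 F]
    have near: "adist reduced_algebra (dual_action \<theta> (emb f)) (dual_action \<theta> a) < e / 3" if "\<theta> \<in> dual_group" for \<theta>
      using multiplier_adist_le[OF contractive_chi[OF that] F a] f(2) by (simp add: dual_action_eq that F a)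
    have mid: "adist reduced_algebra (dual_action \<omega> (emb f)) (dual_action \<omega>0 (emb f)) < e / 3"
      using \<omega> by (intro T(3)) auto
    have "adist reduced_algebra (dual_action \<omega>0 a) (dual_action \<omega> a) < e"
      using red.metric.triangle[OF c(3,4,1)] red.metric.triangle[OF c(4,2,1)] near[OF \<omega>d] near[OF \<omega>0] mid
        red.metric.commute[of "dual_action \<omega>0 a" "dual_action \<omega>0 (emb f)"]
        red.metric.commute[of "dual_action \<omega>0 (emb f)" "dual_action \<omega> (emb f)"] by linarith
    then show ?thesis using c by simp
  qed
  moreover have "\<omega>0 \<in> ?U" using \<omega>0 T(2) by simp
  ultimately show "\<exists>U. openin (top_of_set dual_group) U \<and> \<omega>0 \<in> U \<and>
      (\<forall>\<omega>\<in>U. dual_action \<omega> a \<in> red.metric.mball (dual_action \<omega>0 a) e)"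
    using openin_dual_group_nbhd[OF T(1)] by blast
qed

lemma dual_action_strongly_continuous: "strongly_continuous_action reduced_algebra dual_action"
  unfolding strongly_continuous_action_def
  by (intro conjI ballI dual_action_automorphism dual_action_one dual_action_dual_action
      dual_action_continuous)

section \<open>The subalgebra of degree zero\<close>

abbreviation A0 :: "(nat \<Rightarrow> 's \<Rightarrow> complex) set set" where
  "A0 \<equiv> graded_subspace reduced_algebra dual_action 0"

lemma A0_eq: "A0 = {a \<in> acarrier reduced_algebra. \<forall>\<gamma>\<in>{\<gamma> \<in> arrows S. cG (q \<gamma>) \<noteq> 0}. coeff a \<gamma> = 0}"
proof (intro set_eqI iffI)
  fix a assume "a \<in> A0"
  then have a: "a \<in> acarrier reduced_algebra"
    and inv: "\<And>\<omega>. \<omega> \<in> dual_group \<Longrightarrow> dual_action \<omega> a = ascale reduced_algebra (\<omega> 0) a"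
    by (auto simp: graded_subspace_def)
  have "coeff a \<gamma> = 0" if \<gamma>: "cG (q \<gamma>) \<noteq> 0" for \<gamma>
  proof -
    obtain \<omega> where \<omega>: "\<omega> \<in> dual_group" "chi \<omega> (q \<gamma>) \<noteq> 1" using characters_separate_points[OF \<gamma>] by blast
    have "dual_action \<omega> a = a" using inv[OF \<omega>(1)] a by (simp add: dual_groupD(3)[OF \<omega>(1)] red.scale_one)
    then have "chi \<omega> (q \<gamma>) * coeff a \<gamma> = coeff a \<gamma>" using fun_cong[OF coeff_dual_action[OF \<omega>(1) a], of \<gamma>] by simp
    then show ?thesis using \<omega>(2) by simp
  qed
  then show "a \<in> {a \<in> acarrier reduced_algebra. \<forall>\<gamma>\<in>{\<gamma> \<in> arrows S. cG (q \<gamma>) \<noteq> 0}. coeff a \<gamma> = 0}" using a by blast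
next
  fix a assume a0: "a \<in> {a \<in> acarrier reduced_algebra. \<forall>\<gamma>\<in>{\<gamma> \<in> arrows S. cG (q \<gamma>) \<noteq> 0}. coeff a \<gamma> = 0}"
  then have a: "a \<in> acarrier reduced_algebra" by blast
  have "dual_action \<omega> a = a" if \<omega>: "\<omega> \<in> dual_group" for \<omega>
  proof (rule coeff_inj[OF dual_action_closed[OF \<omega> a] a], unfold coeff_dual_action[OF \<omega> a], rule ext)
    fix \<gamma> show "chi \<omega> (q \<gamma>) * coeff a \<gamma> = coeff a \<gamma>"
      using a0 dual_groupD(3)[OF \<omega>] equivariant_off[OF equivariant_coeff[OF a], of \<gamma>]
      by (cases "\<gamma> \<in> arrows S"; cases "cG (q \<gamma>) = 0") auto
  qed
  then show "a \<in> A0" using a by (simp add: graded_subspace_def dual_groupD(3) red.scale_one)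
qed

lemma A0_carrier: "a \<in> A0 \<Longrightarrow> a \<in> acarrier reduced_algebra"
  by (simp add: graded_subspace_def)

text \<open>The description by fixed points makes products and adjoints immediate, whereas
  \<open>A0_eq\<close> serves sums, scalars and closedness.\<close>

lemma A0_iff: "a \<in> A0 \<longleftrightarrow> a \<in> acarrier reduced_algebra \<and> (\<forall>\<omega>\<in>dual_group. dual_action \<omega> a = a)"
  by (auto simp: graded_subspace_def dual_groupD(3) red.scale_one)

lemma cstar_subalgebra_A0: "cstar_subalgebra reduced_algebra A0"
  unfolding cstar_subalgebra_def
proof (intro conjI ballI allI)
  show "closedin (atop reduced_algebra) A0" unfolding A0_eq by (rule closedin_vanishing)
  show "A0 \<subseteq> acarrier reduced_algebra" using A0_carrier by blast
  show "azero reduced_algebra \<in> A0" unfolding A0_eq by (simp add: red.zero_closed coeff_zero)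
  fix a assume a: "a \<in> A0"
  show "astar reduced_algebra a \<in> A0" using a unfolding A0_iff by (auto simp: red.star_closed dual_action_star)
  show "ascale reduced_algebra c a \<in> A0" for c
    using a unfolding A0_eq by (auto simp: red.scale_closed coeff_scale)
  fix b assume b: "b \<in> A0"
  show "aadd reduced_algebra a b \<in> A0" using a b unfolding A0_eq by (auto simp: red.add_closed coeff_add)
  show "amult reduced_algebra a b \<in> A0"
    using a b unfolding A0_iff by (auto simp: red.mult_closed dual_action_mult)
qed

lemma D_subset_A0: "D_alg \<subseteq> A0"
  unfolding A0_eq using D_carrier D_off cG_unit by auto

lemma emb_A0:
  assumes "f \<in> Cc" shows "emb (\<lambda>\<gamma>. zero_ind (q \<gamma>) * f \<gamma>) \<in> A0"
  unfolding A0_eq using contractive_Cc[OF contractive_zero_ind assms] by (simp add: emb_closed zero_ind_def)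

text \<open>Normalizers must now be found inside \<open>A0\<close>. Truncation to degree zero keeps
  a function on its bisection, so \<open>local_conj_D\<close> still applies. Truncation is also
  contractive and fixes \<open>A0\<close>, so approximants in \<open>Cc\<close> can be truncated
  without loss.\<close>

lemma normalizers_generate_A0:
  "generates (reduced_algebra\<lparr>acarrier := A0\<rparr>) (normalizers (reduced_algebra\<lparr>acarrier := A0\<rparr>) D_alg)"
  unfolding generates_def
proof (intro allI impI)
  let ?R = "reduced_algebra\<lparr>acarrier := A0\<rparr>"
  interpret R: cstar_algebra ?R by (rule red.cstar_algebra_subalgebra[OF cstar_subalgebra_A0])
  fix B assume "cstar_subalgebra ?R B \<and> normalizers ?R D_alg \<subseteq> B"
  then have sub: "cstar_subalgebra ?R B" and nB: "normalizers ?R D_alg \<subseteq> B" by blast+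
  have BA: "B \<subseteq> A0" and zB: "azero reduced_algebra \<in> B" and clo: "closedin (atop ?R) B"
    and addB: "\<And>a b. a \<in> B \<Longrightarrow> b \<in> B \<Longrightarrow> aadd reduced_algebra a b \<in> B"
    using sub unfolding cstar_subalgebra_def by simp_all
  have emb_B: "emb (\<lambda>\<gamma>. zero_ind (q \<gamma>) * f \<gamma>) \<in> B" if "f \<in> Cc" for f
    using that
  proof (induction f rule: Cc_induct)
    case zero
    then show ?case using zB by (simp add: emb_zero)
  next
    case (add f g)
    have "emb (\<lambda>\<gamma>. zero_ind (q \<gamma>) * (f \<gamma> + g \<gamma>))
        = aadd reduced_algebra (emb (\<lambda>\<gamma>. zero_ind (q \<gamma>) * f \<gamma>)) (emb (\<lambda>\<gamma>. zero_ind (q \<gamma>) * g \<gamma>))"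
      unfolding distrib_left by (intro emb_add contractive_Cc[OF contractive_zero_ind] add.hyps)
    then show ?case using addB add.IH by simp
  next
    case (local f U \<phi> L)
    have "local_support (\<lambda>\<gamma>. zero_ind (q \<gamma>) * f \<gamma>) U \<phi> L" using local(2) by (auto simp: local_support_def)
    from local_conj_D[OF contractive_Cc[OF contractive_zero_ind local(1)] this]
    have "emb (\<lambda>\<gamma>. zero_ind (q \<gamma>) * f \<gamma>) \<in> normalizers ?R D_alg"
      using emb_A0[OF local(1)] by (simp add: normalizers_def)
    then show ?case using nB by blast
  qed
  have "a \<in> B" if a0: "a \<in> A0" for a
  proof (rule R.closedin_approx[OF clo])
    note a = A0_carrier[OF a0]
    show "a \<in> acarrier ?R" using a0 by simp
    have za: "multiplier zero_ind a = a"
    proof (rule coeff_inj[OF multiplier_closed[OF contractive_zero_ind a] a],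
        unfold coeff_multiplier[OF contractive_zero_ind a], rule ext)
      fix \<gamma> show "zero_ind (q \<gamma>) * coeff a \<gamma> = coeff a \<gamma>"
        using a0 equivariant_off[OF equivariant_coeff[OF a], of \<gamma>] unfolding A0_eq
        by (cases "\<gamma> \<in> arrows S") (auto simp: zero_ind_def)
    qed
    fix e :: real assume "0 < e"
    then obtain f where f: "f \<in> Cc" "adist reduced_algebra (emb f) a < e" using emb_dense[OF a] by blast
    let ?b = "emb (\<lambda>\<gamma>. zero_ind (q \<gamma>) * f \<gamma>)"
    have "adist reduced_algebra ?b a \<le> adist reduced_algebra (emb f) a"
      using multiplier_adist_le[OF contractive_zero_ind emb_closed[OF f(1)] a]
      by (simp add: multiplier_emb contractive_zero_ind f(1) za)
    then have "adist ?R ?b a < e"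
      using f(2) red.adist_subalgebra[OF cstar_subalgebra_A0 emb_A0[OF f(1)] a0] by simp
    then show "\<exists>b\<in>B. adist ?R b a < e" using emb_B[OF f(1)] by blast
  qed
  then show "B = acarrier ?R" using BA by auto
qed

section \<open>The commutant of the diagonal and the Cartan property\<close>

lemma commutant_in_D:
  assumes eff: "effective (subgroupoid G {g \<in> arrows G. cG g = 0})"
    and a0: "a \<in> A0" and comm: "\<And>d. d \<in> D_alg \<Longrightarrow> amult reduced_algebra a d = amult reduced_algebra d a"
  shows "a \<in> D_alg"
proof -
  let ?H = "{g \<in> arrows G. cG g = 0}"
  let ?G0 = "subgroupoid G ?H"
  let ?O = "{h \<in> arrows G. coeff a (lift h) \<noteq> 0}"
  note a = A0_carrier[OF a0]
  have top: "gtop ?G0 = subtopology (gtop G) ?H" by (simp add: subgroupoid_def)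
  have arr: "arrows ?G0 = ?H" unfolding arrows_def[of ?G0] top topspace_subtopology topspace_G by blast
  \<comment> \<open>Passing to the subgroupoid changes the topology, and with it the set of arrows,
    but none of the operations.\<close>
  have sr: "src ?G0 = src G" "rng ?G0 = rng G"
    by (simp_all add: fun_eq_iff src_def rng_def subgroupoid_def)
  have z: "\<forall>\<gamma>\<in>{\<gamma> \<in> arrows S. cG (q \<gamma>) \<noteq> 0}. coeff a \<gamma> = 0" using a0 unfolding A0_eq by blast
  have OH: "?O \<subseteq> ?H"
  proof
    fix h assume "h \<in> ?O"
    then show "h \<in> ?H" using bspec[OF z, of "lift h"] by auto
  qed
  have "?O \<subseteq> isotropy ?G0"
  proof
    fix h assume h: "h \<in> ?O"
    then have "rng G h = src G h" by (intro commutant_support_isotropy[OF a comm]) auto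
    then show "h \<in> isotropy ?G0" unfolding isotropy_def arr sr using h OH by blast
  qed
  moreover have "openin (gtop ?G0) ?O"
    unfolding top openin_subtopology using openin_support[OF a] OH by blast
  ultimately have "?O \<subseteq> gtop ?G0 interior_of isotropy ?G0" by (rule interior_of_maximal)
  also have "\<dots> = units ?G0" using eff by (simp add: effective_def)
  also have "\<dots> \<subseteq> units G" unfolding units_def arr sr by blast
  finally have O: "?O \<subseteq> units G" .
  show ?thesis
  proof (rule D_I[OF a], rule ccontr)
    fix \<gamma> assume \<gamma>: "\<gamma> \<in> arrows S" "q \<gamma> \<notin> units G" and nz: "coeff a \<gamma> \<noteq> 0"
    have "coeff a (lift (q \<gamma>)) \<noteq> 0"
      using equivariant_zero_iff[OF equivariant_coeff[OF a] \<gamma>(1), of "lift (q \<gamma>)"] \<gamma>(1) nz by simp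
    then have "q \<gamma> \<in> ?O" using \<gamma>(1) by simp
    then show False using O \<gamma>(2) by blast
  qed
qed

theorem Gamma_Cartan_pair_reduced:
  assumes eff: "effective (subgroupoid G {g \<in> arrows G. cG g = 0})"
  shows "Gamma_Cartan_pair reduced_algebra C0_subalgebra dual_action"
proof -
  let ?R = "reduced_algebra\<lparr>acarrier := A0\<rparr>"
  have AR: "A0 \<subseteq> acarrier reduced_algebra" using A0_carrier by blast
  have ab: "abelian_subalgebra ?R D_alg"
    by (rule red.abelian_subalgebra_in_subalgebra[OF cstar_subalgebra_A0 abelian_D D_subset_A0])
  have "D' = D_alg" if D': "abelian_subalgebra ?R D'" "D_alg \<subseteq> D'" for D'
  proof -
    \<comment> \<open>Members of an abelian subalgebra that contains \<open>D_alg\<close> commute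
      with \<open>D_alg\<close>, so its commutant in \<open>A0\<close> decides maximality.\<close>
    have "a \<in> D_alg" if "a \<in> D'" for a
      using D' that by (intro commutant_in_D[OF eff]) (auto simp: abelian_subalgebra_def cstar_subalgebra_def)
    then show ?thesis using D'(2) by blast
  qed
  then have "maximal_abelian ?R D_alg" using ab by (simp add: maximal_abelian_def)
  then have "cartan_subalgebra ?R D_alg"
    unfolding cartan_subalgebra_def
    using red.cstar_algebra_subalgebra[OF cstar_subalgebra_A0] conditional_expectation_D[OF AR D_subset_A0]
      expectation_faithful[OF AR] approximate_unit_D[OF AR D_subset_A0] normalizers_generate_A0 by blast
  then show ?thesis
    unfolding Gamma_Cartan_pair_def C0_subalgebra_eq
    using red.cstar_algebra_axioms dual_action_strongly_continuous abelian_D D_subset_A0 normalizers_dense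
    by blast
qed

end

theorem proposition5p5:
  fixes S :: "'s groupoid_data" and G :: "'g groupoid_data"
    and \<iota> :: "complex \<times> 'g \<Rightarrow> 's" and q :: "'s \<Rightarrow> 'g"
    and cS :: "'s \<Rightarrow> 't::ab_group_add" and cG :: "'g \<Rightarrow> 't"
  assumes "graded_twist S G \<iota> q cS cG"
    and "effective (subgroupoid G {g \<in> arrows G. cG g = 0})"
  shows "Gamma_Cartan_pair
           (twist.reduced_algebra S G \<iota> q)
           (twist.C0_subalgebra S G \<iota> q)
           (graded_twist.dual_action S G \<iota> q cS)"
  by (rule graded_twist.Gamma_Cartan_pair_reduced[OF assms])

end
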